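(* Let $\Omega=\mathbb{T}^d$ be the flat torus, let $\Psi\in C^{1,1}(\mathbb{T}^d)$, and let $G$ satisfy both of the following assumptions: (superlinearity) $\lim_{s\to\infty}G(s)/s=+\infty$; (polynomial-type growth) there exist $C_0,a_0>0$ such that $G((1+a)s)\le (1+C_0a)G(s)+C_0$ for all $s>0$ and all $0<a<a_0$. Suppose that $J,J_*:\mathbb{R}\to\mathbb{R}$ and $c>0$ are such that $$G(s)+G^*(q)\ \ge\ sq+c\,|J(s)-J_*(q)|^2\qquad\text{for all } s,q\in\mathbb{R}.$$ If $(m,v)\in\mathcal{H}$ is a solution of the problem $\min_{\mathcal{H}}\mathcal{B}$, then $J(m)\in H^1_{loc}((0,T]\times\mathbb{T}^d)$, i.e. $J(m)\in H^1((t_1,T)\times\mathbb{T}^d)$ for every $t_1\in(0,T)$.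
   Context: Let $T>0$ and $d\ge1$. The function $G:[0,\infty)\to[0,+\infty]$ is $G(s)=\int_0^s g(r)\,dr$ with $g:[0,\infty)\to[0,+\infty]$ increasing; thus $G$ is convex and $G(0)=0$. It is extended by $G(s)=+\infty$ for $s<0$, and $G^*(q)=\sup_{s\in\mathbb{R}}\{sq-G(s)\}$. The initial datum $\overline{m_0}$ is a given probability density on $\mathbb{T}^d$, and $\Psi:\mathbb{T}^d\to\mathbb{R}$ is a given final cost. $\mathcal{H}$ is the set of pairs $(m,v)$ where $m\in L^1((0,T)\times\mathbb{T}^d)$, $m\ge0$ a.e., $\int_{\mathbb{T}^d}m(t,x)\,dx=1$ for a.e. $t$, $v$ is a measurable vector field on $(0,T)\times\mathbb{T}^d$ with $mv\in L^1$, and $\partial_tm+\nabla\cdot(mv)=0$ with $m_0=\overline{m_0}$ in the weak sense: for all $\phi\in C^1_c([0,T)\times\mathbb{T}^d)$, $$\int_0^T\!\!\int_{\mathbb{T}^d}(m\,\partial_t\phi+mv\cdot\nabla\phi)\,dx\,dt+\int_{\mathbb{T}^d}\phi(0,x)\overline{m_0}(x)\,dx=0.$$ For $(m,v)\in\mathcal{H}$, $$\mathcal{B}(m,v)=\int_0^T\!\!\int_{\mathbb{T}^d}\Big(\tfrac12m|v|^2+G(m)\Big)dx\,dt+\int_{\mathbb{T}^d}\Psi\,dm_T.$$ When $\int_0^T\int m|v|^2<\infty$, $m$ has a representative that is a continuous curve $t\mapsto m_t$ on $[0,T]$ with values in the probability measures on $\mathbb{T}^d$ with the Wasserstein distance $W_2$,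 and $m_T$ is its value at $t=T$; if the first integral is $+\infty$, one sets $\mathcal{B}(m,v)=+\infty$. A solution of $\min_{\mathcal{H}}\mathcal{B}$ is a pair attaining the infimum, with $\mathcal{B}(m,v)<+\infty$. *)

theory Defs
  imports "HOL-Probability.Probability"
begin

text \<open>
  The flat torus is \<open>\<real>\<^sup>d / \<int>\<^sup>d\<close> with \<open>d = CARD('n)\<close>. Continuous or differentiable functions on it
  are \<open>\<int>\<^sup>d\<close>-periodic functions on \<open>\<real>\<^sup>d\<close>. Measurable functions and measures are taken on the
  half-open unit cell, which meets every class exactly once. The quotient map restricted to the cell
  is a Borel isomorphism carrying Lebesgue measure to the Haar probability measure, so the values
  of such functions outside the cell play no role.
\<close>

definition lattice :: "(real ^ 'n) set" where
  "lattice = {k. \<forall>i. k $ i \<in> \<int>}"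

definition periodic :: "(real ^ 'n \<Rightarrow> 'b) \<Rightarrow> bool" where
  "periodic f \<longleftrightarrow> (\<forall>x. \<forall>k\<in>lattice. f (x + k) = f x)"

definition cell :: "(real ^ 'n) set" where
  "cell = {x. \<forall>i. 0 \<le> x $ i \<and> x $ i < 1}"

abbreviation torus_borel :: "(real ^ 'n) measure" where
  "torus_borel \<equiv> restrict_space borel cell"

definition torus_dist :: "real ^ 'n \<Rightarrow> real ^ 'n \<Rightarrow> real" where
  "torus_dist x y = (INF k\<in>lattice. norm (x - y + k))"

definition torus_C11 :: "(real ^ 'n \<Rightarrow> real) \<Rightarrow> bool" where
  "torus_C11 \<Psi> \<longleftrightarrow> periodic \<Psi> \<and>
     (\<exists>D L. (\<forall>x. GDERIV \<Psi> x :> D x) \<and> L-lipschitz_on UNIV D)"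


subsection \<open>Probability measures on the torus and the Wasserstein distance\<close>

definition torus_prob :: "(real ^ 'n) measure \<Rightarrow> bool" where
  "torus_prob \<mu> \<longleftrightarrow> prob_space \<mu> \<and> sets \<mu> = sets torus_borel"

definition couplings ::
    "(real ^ 'n) measure \<Rightarrow> (real ^ 'n) measure \<Rightarrow> ((real ^ 'n) \<times> (real ^ 'n)) measure set" where
  "couplings \<mu> \<nu> = {\<pi>. sets \<pi> = sets (torus_borel \<Otimes>\<^sub>M torus_borel) \<and>
     distr \<pi> torus_borel fst = \<mu> \<and> distr \<pi> torus_borel snd = \<nu>}"

definition W2 :: "(real ^ 'n) measure \<Rightarrow> (real ^ 'n) measure \<Rightarrow> real" where
  "W2 \<mu> \<nu> = sqrt (enn2real
     (INF \<pi>\<in>couplings \<mu> \<nu>. \<integral>\<^sup>+ p. ennreal ((torus_dist (fst p) (snd p))\<^sup>2) \<partial>\<pi>))"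


subsection \<open>Function spaces on time intervals times the torus\<close>

text \<open>
  Derivatives are one-sided at boundary points of \<open>S\<close>. They are unique for the sets
  \<open>I \<times> UNIV\<close>, with \<open>I\<close> a nondegenerate interval, for which the notion is used.
\<close>

primrec Ck_on :: "nat \<Rightarrow> 'a::euclidean_space set \<Rightarrow> ('a \<Rightarrow> real) \<Rightarrow> bool" where
  "Ck_on 0 S f \<longleftrightarrow> continuous_on S f"
| "Ck_on (Suc k) S f \<longleftrightarrow>
     (\<exists>D. (\<forall>z\<in>S. (f has_derivative D z) (at z within S)) \<and>
          (\<forall>e\<in>Basis. Ck_on k S (\<lambda>z. D z e)))"

text \<open>
  The space of compactly supported \<open>C\<^sup>k\<close> functions on \<open>I \<times> \<real>\<^sup>d/\<int>\<^sup>d\<close>. Since the torus is compact,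
  compactness of the support only concerns the time variable; for \<open>I = {0..<T}\<close> the
  functions need not vanish at time \<open>0\<close>.
\<close>

definition test_fun :: "nat \<Rightarrow> real set \<Rightarrow> (real \<times> (real ^ 'n) \<Rightarrow> real) \<Rightarrow> bool" where
  "test_fun k I \<phi> \<longleftrightarrow> Ck_on k (I \<times> UNIV) \<phi> \<and>
     (\<forall>t\<in>I. periodic (\<lambda>x. \<phi> (t, x))) \<and>
     (\<exists>K. compact K \<and> K \<subseteq> I \<and> (\<forall>t\<in>I - K. \<forall>x. \<phi> (t, x) = 0))"

definition time_deriv :: "(real \<times> (real ^ 'n) \<Rightarrow> real) \<Rightarrow> real \<times> (real ^ 'n) \<Rightarrow> real" where
  "time_deriv \<phi> z = frechet_derivative \<phi> (at z) (1, 0)"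

definition space_grad :: "(real \<times> (real ^ 'n) \<Rightarrow> real) \<Rightarrow> real \<times> (real ^ 'n) \<Rightarrow> real ^ 'n" where
  "space_grad \<phi> z = (\<chi> i. frechet_derivative \<phi> (at z) (0, axis i 1))"

abbreviation cylinder :: "real \<Rightarrow> real \<Rightarrow> (real \<times> (real ^ 'n)) measure" where
  "cylinder a b \<equiv> lebesgue_on ({a<..<b} \<times> cell)"

definition L2_fun :: "'a measure \<Rightarrow> ('a \<Rightarrow> real) \<Rightarrow> bool" where
  "L2_fun M f \<longleftrightarrow> f \<in> borel_measurable M \<and> integrable M (\<lambda>z. (f z)\<^sup>2)"

text \<open>
  The basis directions of \<open>real \<times> real ^ 'n\<close> are the time direction and the \<open>d\<close> space directions.
\<close>

definition H1_cylinder :: "real \<Rightarrow> real \<Rightarrow> (real \<times> (real ^ 'n) \<Rightarrow> real) \<Rightarrow> bool" where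
  "H1_cylinder a b u \<longleftrightarrow> L2_fun (cylinder a b) u \<and>
     (\<forall>e\<in>Basis. \<exists>w. L2_fun (cylinder a b) w \<and>
        (\<forall>\<phi>. (\<forall>k. test_fun k {a<..<b} \<phi>) \<longrightarrow>
           (\<integral>z. u z * frechet_derivative \<phi> (at z) e \<partial>cylinder a b)
             = - (\<integral>z. w z * \<phi> z \<partial>cylinder a b)))"


subsection \<open>The variational problem\<close>

definition torus_density :: "(real ^ 'n \<Rightarrow> real) \<Rightarrow> bool" where
  "torus_density \<rho> \<longleftrightarrow> integrable (lebesgue_on cell) \<rho> \<and>
     (AE x in lebesgue_on cell. 0 \<le> \<rho> x) \<and> (\<integral>x. \<rho> x \<partial>lebesgue_on cell) = 1"

definition admissible :: "real \<Rightarrow> (real ^ 'n \<Rightarrow> real) \<Rightarrow>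
    ((real \<times> (real ^ 'n) \<Rightarrow> real) \<times> (real \<times> (real ^ 'n) \<Rightarrow> real ^ 'n)) set" where
  "admissible T \<rho>0 = {(m, v).
     integrable (cylinder 0 T) m \<and>
     (AE z in cylinder 0 T. 0 \<le> m z) \<and>
     (AE t in lebesgue_on {0<..<T}. (\<integral>x. m (t, x) \<partial>lebesgue_on cell) = 1) \<and>
     v \<in> borel_measurable (cylinder 0 T) \<and>
     integrable (cylinder 0 T) (\<lambda>z. m z *\<^sub>R v z) \<and>
     (\<forall>\<phi>. test_fun 1 {0..<T} \<phi> \<longrightarrow>
        (\<integral>z. m z * time_deriv \<phi> z + (m z *\<^sub>R v z) \<bullet> space_grad \<phi> z \<partial>cylinder 0 T)
        + (\<integral>x. \<phi> (0, x) * \<rho>0 x \<partial>lebesgue_on cell) = 0)}"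

definition W2_representative ::
    "real \<Rightarrow> (real \<times> (real ^ 'n) \<Rightarrow> real) \<Rightarrow> (real \<Rightarrow> (real ^ 'n) measure) \<Rightarrow> bool" where
  "W2_representative T m \<mu> \<longleftrightarrow>
     (\<forall>t\<in>{0..T}. torus_prob (\<mu> t)) \<and>
     (\<forall>t\<in>{0..T}. ((\<lambda>s. W2 (\<mu> s) (\<mu> t)) \<longlongrightarrow> 0) (at t within {0..T})) \<and>
     (AE t in lebesgue_on {0<..<T}. \<forall>A\<in>sets torus_borel.
        emeasure (\<mu> t) A = (\<integral>\<^sup>+x\<in>A. ennreal (m (t, x)) \<partial>lebesgue_on cell))"

text \<open>
  Two \<open>W2\<close>-continuous representatives agree at every time in \<open>{0..T}\<close>, and one exists for
  admissible pairs of finite kinetic energy; this is the only case in which the value is used.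
\<close>

definition final_measure :: "real \<Rightarrow> (real \<times> (real ^ 'n) \<Rightarrow> real) \<Rightarrow> (real ^ 'n) measure" where
  "final_measure T m = (THE \<nu>. \<exists>\<mu>. W2_representative T m \<mu> \<and> \<mu> T = \<nu>)"

definition energy :: "real \<Rightarrow> (real \<Rightarrow> ennreal) \<Rightarrow> (real ^ 'n \<Rightarrow> real) \<Rightarrow>
    (real \<times> (real ^ 'n) \<Rightarrow> real) \<Rightarrow> (real \<times> (real ^ 'n) \<Rightarrow> real ^ 'n) \<Rightarrow> ereal" where
  "energy T G \<Psi> m v =
     (if (\<integral>\<^sup>+z. ennreal (m z * (norm (v z))\<^sup>2) \<partial>cylinder 0 T) = \<infinity> then \<infinity>
      else enn2ereal (\<integral>\<^sup>+z. ennreal (1/2 * m z * (norm (v z))\<^sup>2) + G (m z) \<partial>cylinder 0 T)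
           + ereal (\<integral>x. \<Psi> x \<partial>final_measure T m))"

definition is_solution :: "real \<Rightarrow> (real \<Rightarrow> ennreal) \<Rightarrow> (real ^ 'n \<Rightarrow> real) \<Rightarrow>
    (real ^ 'n \<Rightarrow> real) \<Rightarrow>
    (real \<times> (real ^ 'n) \<Rightarrow> real) \<Rightarrow> (real \<times> (real ^ 'n) \<Rightarrow> real ^ 'n) \<Rightarrow> bool" where
  "is_solution T G \<Psi> \<rho>0 m v \<longleftrightarrow>
     (m, v) \<in> admissible T \<rho>0 \<and> energy T G \<Psi> m v < \<infinity> \<and>
     (\<forall>(m', v')\<in>admissible T \<rho>0. energy T G \<Psi> m v \<le> energy T G \<Psi> m' v')"

definition conjugate_fun :: "(real \<Rightarrow> ennreal) \<Rightarrow> real \<Rightarrow> ereal" where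
  "conjugate_fun G q = (SUP s. ereal (s * q) - enn2ereal (G s))"

end

theory Submission
 imports Defs
begin

text \<open>
 No duality is used. By the hypothesis on \<open>J\<close>, taken at \<open>q = g ((s + t) / 2)\<close>, the function \<open>G\<close> is
 convex with midpoint gap at least \<open>c / 4 * (J s - J t)\<^sup>2\<close>. Averaging a solution \<open>(m, v)\<close> with a competitor
 \<open>(m', v')\<close> in the density and momentum variables therefore bounds \<open>c / 2\<close> times the squared \<open>L\<^sup>2\<close> distance of
 \<open>J m\<close> and \<open>J m'\<close> by the excess energy of the competitor. The competitors are push-forwards of \<open>(m, v)\<close> that
 shift it by \<open>h\<close> in one direction for times beyond \<open>t1\<close>, and the point is that their excess is \<open>O(h\<^sup>2)\<close>.

 For space shifts the energy is twice differentiable in \<open>h\<close>, up to \<open>O(h\<^sup>2)\<close>, with a minimum at \<open>h = 0\<close>. For time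
 shifts the flow is stretched on \<open>{0<..t1}\<close> and cut off at \<open>T\<close>. Conservation in time of the
 integral of \<open>G m - 1/2 * m * (norm v)\<^sup>2\<close> cancels the first-order terms, except for an integral of \<open>m v \<bullet> (v + p)\<close> over
 the last \<open>h\<close> time units, where \<open>p\<close> is the gradient of \<open>\<Psi>\<close>. It is \<open>O(h\<^sup>2)\<close> because \<open>v + p\<close> vanishes at time
 \<open>T\<close> in a weak sense: one tests minimality with displacements in direction \<open>p\<close> supported near \<open>T\<close>. This
 replaces \<open>p\<close> by difference quotients of \<open>\<Psi>\<close>, as \<open>p\<close> is only Lipschitz, and it is where the growth
 condition on \<open>G\<close> enters.

 The final cost becomes a bulk integral through \<open>\<integral> \<Psi> d m_T = \<integral> \<Psi> d m_0 + \<integral>\<integral> m v \<bullet> p\<close>. This requires the existence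
 and uniqueness of the \<open>W2\<close>-continuous representative.
\<close>

text \<open>\<open>J\<close> sees \<open>m\<close> only through convexity, so competitors need an
  excess of second order although neither \<open>G\<close> nor the gradient of \<open>\<Psi>\<close>
  need be differentiable. A shift depending on time alone has space Jacobian 1 and merely relocates
  the values of \<open>m\<close>, so \<open>G\<close> is not differentiated; only the displacements
  near \<open>T\<close> compress the density. There minimality gives a first-order condition with an
  error, which has to be small only relative to the square of \<open>h\<close>. Cost terms are
  estimated after integration along the flow: the rate of change of a function \<open>r\<close>
  integrates to at most the size of \<open>r\<close>, so a second difference of
  \<open>\<Psi>\<close> counts as O(h^2), although its gradient is merely O(h). One \<open>h\<close>
  serves as time shift, as length of the final time layer and as step of the difference quotient of
  \<open>\<Psi>\<close>: the layer has mass \<open>h\<close> and energy O(h), and each replacement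
  of the gradient by the quotient costs a further factor \<open>h\<close>. The energy bound for the
  layer comes from the time-shifted competitor itself, whose excess cannot be negative.\<close>

abbreviation borel_fun :: "('a::topological_space \<Rightarrow> 'b::topological_space) set" where
 "borel_fun \<equiv> borel_measurable borel"

section \<open>Integration over the unit cell\<close>

lemma lborel_nn_integral_translate:
 fixes f :: "'a::euclidean_space => ennreal"
 assumes [measurable]: "f \<in> borel_fun"
 shows "(\<integral>\<^sup>+x. f (x + a) \<partial>lborel) = (\<integral>\<^sup>+x. f x \<partial>lborel)"
proof -
 have "(\<integral>\<^sup>+x. f x \<partial>lborel) = (\<integral>\<^sup>+x. f x \<partial>distr lborel borel ((+) a))"
  by (simp add: lborel_distr_plus)
 also have "... = (\<integral>\<^sup>+x. f (a + x) \<partial>lborel)"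
  by (subst nn_integral_distr) auto
 finally show ?thesis by (simp add: add.commute)
qed

lemma nn_integral_unit_interval_periodic:
 fixes F :: "real => ennreal"
 assumes [measurable]: "F \<in> borel_fun" and per: "!!u. F (u + 1) = F u"
 shows "(\<integral>\<^sup>+u. F u * indicator {a..a+1} u \<partial>lborel) = (\<integral>\<^sup>+u. F u * indicator {0..1} u \<partial>lborel)"
proof -
 have perz: "F (u + of_int k) = F u" for u k
 proof (induction k rule: int_induct[where k=0])
  case (step1 i) then show ?case using per[of "u + of_int i"] by (simp add: algebra_simps)
 next
  case (step2 i) then show ?case using per[of "u + of_int (i - 1)"] by (simp add: algebra_simps)
 qed simp
 \<comment> \<open>Shifting by \<open>floor a\<close> moves the window to start at \<open>b\<close>
   in [0,1); the part of it beyond 1 then returns by one period to fill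
   \<open>{0<..b}\<close>.\<close>
 define b where "b = frac a"
 have b: "0 <= b" "b < 1" "a = b + of_int (floor a)"
  using frac_lt_1[of a] by (auto simp: b_def frac_def)
 have "(\<integral>\<^sup>+u. F u * indicator {a..a+1} u \<partial>lborel)
   = (\<integral>\<^sup>+u. F (u + of_int (floor a)) * indicator {a..a+1} (u + of_int (floor a)) \<partial>lborel)"
  by (rule lborel_nn_integral_translate[symmetric]) measurable
 also have "... = (\<integral>\<^sup>+u. F u * indicator {b..b+1} u \<partial>lborel)"
  by (intro nn_integral_cong) (use b in \<open>auto simp: perz indicator_def\<close>)
 also have "... = (\<integral>\<^sup>+u. F u * indicator {b<..1} u + F u * indicator {1<..b+1} u \<partial>lborel)"
  by (rule nn_integral_cong_AE, rule AE_mp[OF AE_lborel_singleton[of b]])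
    (use b in \<open>auto simp: indicator_def\<close>)
 also have "... = (\<integral>\<^sup>+u. F u * indicator {b<..1} u \<partial>lborel) + (\<integral>\<^sup>+u. F u * indicator {1<..b+1} u \<partial>lborel)"
  by (rule nn_integral_add) measurable
 also have "(\<integral>\<^sup>+u. F u * indicator {1<..b+1} u \<partial>lborel) = (\<integral>\<^sup>+u. F (u + 1) * indicator {1<..b+1} (u + 1) \<partial>lborel)"
  by (rule lborel_nn_integral_translate[symmetric]) measurable
 also have "... = (\<integral>\<^sup>+u. F u * indicator {0<..b} u \<partial>lborel)"
  by (intro nn_integral_cong) (auto simp: per indicator_def)
 also have "(\<integral>\<^sup>+u. F u * indicator {b<..1} u \<partial>lborel) + ...
   = (\<integral>\<^sup>+u. F u * indicator {b<..1} u + F u * indicator {0<..b} u \<partial>lborel)"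
  by (rule nn_integral_add[symmetric]) measurable
 also have "... = (\<integral>\<^sup>+u. F u * indicator {0..1} u \<partial>lborel)"
  by (rule nn_integral_cong_AE, rule AE_mp[OF AE_lborel_singleton[of "0::real"]])
    (use b in \<open>auto simp: indicator_def\<close>)
 finally show ?thesis .
qed

section \<open>Representatives modulo the lattice\<close>

lemma axis_in_lattice: "axis i 1 \<in> lattice"
 by (auto simp: lattice_def axis_def)

lemma sets_cell [measurable, simp]: "cell \<in> sets (borel :: (real^'n) measure)"
proof -
 have "cell = {x::real^'n. \<forall>i\<in>UNIV. 0 <= x $ i \<and> x $ i < 1}" by (auto simp: cell_def)
 also have "... \<in> sets borel" by measurable
 finally show ?thesis .
qed

definition wrap :: "real^'n => real^'n" where
 "wrap x = (\<chi> i. frac (x $ i))"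

lemma wrap_cell [simp]: "wrap x \<in> cell"
 by (simp add: wrap_def cell_def frac_lt_1)

lemma wrap_id: "x \<in> cell ==> wrap x = x"
 by (auto simp: wrap_def cell_def vec_eq_iff frac_eq)

lemma wrap_diff_lattice: "wrap x - x \<in> lattice"
 by (auto simp: lattice_def wrap_def frac_def)

lemma periodic_wrap: "periodic f ==> f (wrap x) = f x"
 using wrap_diff_lattice[of x] unfolding periodic_def
 by (metis add.commute diff_add_cancel)

lemma wrap_add_lattice: "k \<in> lattice ==> wrap (x + k) = wrap x"
proof -
 assume "k \<in> lattice"
 then have "!!i. k $ i \<in> \<int>" by (simp add: lattice_def)
 then have "frac (x $ i + k $ i) = frac (x $ i)" for i
  by (rule Ints_cases[of "k $ i"]) (auto simp: frac_def)
 then show ?thesis by (simp add: wrap_def)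
qed

lemma measurable_vec_lambda [measurable (raw)]:
 fixes f :: "'a => 'n::finite => real"
 assumes "!!i. (%x. f x i) \<in> borel_measurable M"
 shows "(%x. (\<chi> i. f x i) :: real^'n) \<in> borel_measurable M"
 by (subst borel_measurable_euclidean_space)
   (use assms in \<open>auto simp: Basis_vec_def inner_axis\<close>)

lemma measurable_wrap [measurable]: "wrap \<in> borel_fun"
 unfolding wrap_def frac_def by measurable

lemma emeasure_cell: "emeasure lborel (cell :: (real^'n) set) = 1"
proof -
 have 1: "box 0 1 \<subseteq> (cell :: (real^'n) set)" "cell \<subseteq> (cbox 0 1 :: (real^'n) set)"
  by (auto simp: cell_def mem_box_cart less_imp_le)
 have e: "emeasure lborel (box 0 (1::real^'n)) = 1" "emeasure lborel (cbox 0 (1::real^'n)) = 1"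
 proof -
  have "!!b::real^'n. b \<in> Basis ==> 1 \<bullet> b = 1" by (auto simp: Basis_vec_def inner_axis)
  then show "emeasure lborel (box 0 (1::real^'n)) = 1" "emeasure lborel (cbox 0 (1::real^'n)) = 1"
   by (simp_all add: emeasure_lborel_box_eq emeasure_lborel_cbox_eq)
 qed
 have "emeasure lborel (cell :: (real^'n) set) <= emeasure lborel (cbox 0 (1::real^'n))"
  by (rule emeasure_mono) (use 1 in auto)
 moreover have "emeasure lborel (box 0 (1::real^'n)) <= emeasure lborel (cell :: (real^'n) set)"
  by (rule emeasure_mono) (use 1 in auto)
 ultimately show ?thesis using e by simp
qed

text \<open>A translation by \<open>s\<close> pushes a slab of \<open>cell\<close> across the face
  at 1; one period back, that slab fills the gap left at the face at 0.\<close>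

lemma nn_integral_cell_translate:
 fixes f :: "real^'n => ennreal"
 assumes [measurable]: "f \<in> borel_fun" and per: "!!x. f (x + axis i 1) = f x"
  and s: "0 <= s" "s <= 1"
 shows "(\<integral>\<^sup>+x. f (x + s *\<^sub>R axis i 1) * indicator cell x \<partial>lborel) = (\<integral>\<^sup>+x. f x * indicator cell x \<partial>lborel)"
proof -
 let ?e = "axis i 1 :: real^'n"
 define R where "R = {x::real^'n. \<forall>j\<in>UNIV. j \<noteq> i --> 0 <= x $ j \<and> x $ j < 1}"
 define A where "A = {x\<in>R. s <= x $ i \<and> x $ i < 1}"
 define B where "B = {x\<in>R. 0 <= x $ i \<and> x $ i < s}"
 define B' where "B' = {x\<in>R. 1 <= x $ i \<and> x $ i < 1 + s}"
 have [measurable]: "R \<in> sets borel" unfolding R_def by measurable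
 have [measurable]: "A \<in> sets borel" "B \<in> sets borel" "B' \<in> sets borel"
  unfolding A_def B_def B'_def by measurable
 have cellR: "x \<in> cell \<longleftrightarrow> x \<in> R \<and> 0 <= x $ i \<and> x $ i < 1" for x
  unfolding cell_def R_def by auto
 have Rt: "x + r *\<^sub>R ?e \<in> R \<longleftrightarrow> x \<in> R" for x r
  unfolding R_def by (auto simp: axis_def)
 have Rt': "x - r *\<^sub>R ?e \<in> R \<longleftrightarrow> x \<in> R" for x r
  using Rt[of x "-r"] by simp
 have c1: "x - s *\<^sub>R ?e \<in> cell \<longleftrightarrow> x \<in> A \<or> x \<in> B'" for x
  using s by (auto simp: cellR A_def B'_def Rt')
 have d1: "A \<inter> B' = {}" by (auto simp: A_def B'_def)
 have c2: "x \<in> cell \<longleftrightarrow> x \<in> A \<or> x \<in> B" for x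
  using s by (auto simp: cellR A_def B_def)
 have d2: "A \<inter> B = {}" by (auto simp: A_def B_def)
 have c3: "x + ?e \<in> B' \<longleftrightarrow> x \<in> B" for x
  using Rt[of x 1] by (auto simp: B_def B'_def)
 have "(\<integral>\<^sup>+x. f (x + s *\<^sub>R ?e) * indicator cell x \<partial>lborel)
   = (\<integral>\<^sup>+x. (%y. f y * indicator cell (y - s *\<^sub>R ?e)) (x + s *\<^sub>R ?e) \<partial>lborel)"
  by simp
 also have "... = (\<integral>\<^sup>+x. f x * indicator cell (x - s *\<^sub>R ?e) \<partial>lborel)"
  by (rule lborel_nn_integral_translate) measurable
 also have "... = (\<integral>\<^sup>+x. f x * indicator A x + f x * indicator B' x \<partial>lborel)"
  by (intro nn_integral_cong) (use c1 d1 in \<open>auto simp: indicator_def\<close>)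
 also have "... = (\<integral>\<^sup>+x. f x * indicator A x \<partial>lborel) + (\<integral>\<^sup>+x. f x * indicator B' x \<partial>lborel)"
  by (rule nn_integral_add) measurable
 also have "(\<integral>\<^sup>+x. f x * indicator B' x \<partial>lborel) = (\<integral>\<^sup>+x. f (x + ?e) * indicator B' (x + ?e) \<partial>lborel)"
  by (rule lborel_nn_integral_translate[symmetric]) measurable
 also have "... = (\<integral>\<^sup>+x. f x * indicator B x \<partial>lborel)"
  by (intro nn_integral_cong) (auto simp: per indicator_def c3)
 also have "(\<integral>\<^sup>+x. f x * indicator A x \<partial>lborel) + ... = (\<integral>\<^sup>+x. f x * indicator A x + f x * indicator B x \<partial>lborel)"
  by (rule nn_integral_add[symmetric]) measurable
 also have "... = (\<integral>\<^sup>+x. f x * indicator cell x \<partial>lborel)"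
  by (intro nn_integral_cong) (use c2 d2 in \<open>auto simp: indicator_def\<close>)
 finally show ?thesis .
qed

text \<open>Fubini combined with the translation invariance just shown. It exhibits a full period of
  every line in direction \<open>i\<close>, on which a one-dimensional substitution can act, without
  splitting \<open>real^'n\<close> into coordinates.\<close>

lemma nn_integral_cell_average:
 fixes f :: "real^'n => ennreal"
 assumes [measurable]: "f \<in> borel_fun" and per: "!!x. f (x + axis i 1) = f x"
 shows "(\<integral>\<^sup>+x. f x * indicator cell x \<partial>lborel)
  = (\<integral>\<^sup>+x. (\<integral>\<^sup>+s. f (x + s *\<^sub>R axis i 1) * indicator {0..1} s \<partial>lborel) * indicator cell x \<partial>lborel)"
proof -
 have "(\<integral>\<^sup>+x. (\<integral>\<^sup>+s. f (x + s *\<^sub>R axis i 1) * indicator {0..1} s \<partial>lborel) * indicator cell x \<partial>lborel)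
   = (\<integral>\<^sup>+x. (\<integral>\<^sup>+s. f (x + s *\<^sub>R axis i 1) * indicator {0..1} s * indicator cell x \<partial>lborel) \<partial>lborel)"
  by (intro nn_integral_cong nn_integral_multc[symmetric]) measurable
 also have "... = (\<integral>\<^sup>+s. (\<integral>\<^sup>+x. f (x + s *\<^sub>R axis i 1) * indicator {0..1} s * indicator cell x \<partial>lborel) \<partial>lborel)"
  by (rule lborel_pair.Fubini') measurable
 also have "... = (\<integral>\<^sup>+s. (\<integral>\<^sup>+x. f x * indicator cell x \<partial>lborel) * indicator {0..1} (s::real) \<partial>lborel)"
 proof (intro nn_integral_cong)
  fix s :: real
  have "(\<integral>\<^sup>+x. f (x + s *\<^sub>R axis i 1) * indicator {0..1} s * indicator cell x \<partial>lborel)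
   = (\<integral>\<^sup>+x. f (x + s *\<^sub>R axis i 1) * indicator cell x * indicator {0..1} s \<partial>lborel)"
   by (intro nn_integral_cong) (simp add: ac_simps)
  also have "... = (\<integral>\<^sup>+x. f (x + s *\<^sub>R axis i 1) * indicator cell x \<partial>lborel) * indicator {0..1} s"
   by (rule nn_integral_multc) measurable
  also have "... = (\<integral>\<^sup>+x. f x * indicator cell x \<partial>lborel) * indicator {0..1} s"
   using nn_integral_cell_translate[OF assms(1) per, of s] by (auto simp: indicator_def)
  finally show "(\<integral>\<^sup>+x. f (x + s *\<^sub>R axis i 1) * indicator {0..1} s * indicator cell x \<partial>lborel)
   = (\<integral>\<^sup>+x. f x * indicator cell x \<partial>lborel) * indicator {0..1} s" .
 qed
 also have "... = (\<integral>\<^sup>+x. f x * indicator cell x \<partial>lborel)"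
  by (subst nn_integral_cmult) auto
 finally show ?thesis by simp
qed

text \<open>On a line in direction \<open>i\<close> the map \<open>s + Y\<close> is nondecreasing
  and gains exactly 1 over a period, so the substitution turns a window of length one into another
  one, and periodicity of \<open>f\<close> absorbs the offset.\<close>

lemma nn_integral_cell_shear:
 fixes f :: "real^'n => ennreal" and Y Y' :: "real^'n => real"
 assumes [measurable]: "f \<in> borel_fun" "Y \<in> borel_fun" "Y' \<in> borel_fun"
  and per: "!!x. f (x + axis i 1) = f x" "!!x. Y (x + axis i 1) = Y x" "!!x. Y' (x + axis i 1) = Y' x"
  and der: "!!x s. ((%s. Y (x + s *\<^sub>R axis i 1)) has_real_derivative Y' (x + s *\<^sub>R axis i 1)) (at s)"
  and cont: "!!x. continuous_on UNIV (%s. Y' (x + s *\<^sub>R axis i 1))"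
  and pos: "!!x. 0 <= 1 + Y' x"
 shows "(\<integral>\<^sup>+x. f (x + Y x *\<^sub>R axis i 1) * ennreal (1 + Y' x) * indicator cell x \<partial>lborel)
   = (\<integral>\<^sup>+x. f x * indicator cell x \<partial>lborel)"
proof -
 let ?e = "axis i 1 :: real^'n"
 have swp: "x + ?e + r *\<^sub>R ?e = x + r *\<^sub>R ?e + ?e" for x r by simp
 have "(\<integral>\<^sup>+x. f (x + Y x *\<^sub>R ?e) * ennreal (1 + Y' x) * indicator cell x \<partial>lborel)
  = (\<integral>\<^sup>+x. (\<integral>\<^sup>+s. f (x + s *\<^sub>R ?e + Y (x + s *\<^sub>R ?e) *\<^sub>R ?e) * ennreal (1 + Y' (x + s *\<^sub>R ?e)) * indicator {0..1} s \<partial>lborel) * indicator cell x \<partial>lborel)"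
  by (rule nn_integral_cell_average, measurable, simp only: per swp)
 also have "... = (\<integral>\<^sup>+x. (\<integral>\<^sup>+s. f (x + s *\<^sub>R ?e) * indicator {0..1} s \<partial>lborel) * indicator cell x \<partial>lborel)"
 proof -
  have "(\<integral>\<^sup>+s. f (x + s *\<^sub>R ?e + Y (x + s *\<^sub>R ?e) *\<^sub>R ?e) * ennreal (1 + Y' (x + s *\<^sub>R ?e)) * indicator {0..1} s \<partial>lborel)
   = (\<integral>\<^sup>+s. f (x + s *\<^sub>R ?e) * indicator {0..1} s \<partial>lborel)" for x
  proof -
   define g where "g s = s + Y (x + s *\<^sub>R ?e)" for s
   have g1: "g 1 = g 0 + 1" using per(2)[of x] by (simp add: g_def)
   have "(\<integral>\<^sup>+s. f (x + s *\<^sub>R ?e + Y (x + s *\<^sub>R ?e) *\<^sub>R ?e) * ennreal (1 + Y' (x + s *\<^sub>R ?e)) * indicator {0..1} s \<partial>lborel)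
    = (\<integral>\<^sup>+s. (%u. f (x + u *\<^sub>R ?e)) (g s) * ennreal (1 + Y' (x + s *\<^sub>R ?e)) * indicator {0..1} s \<partial>lborel)"
    by (simp add: g_def algebra_simps)
   also have "... = (\<integral>\<^sup>+u. f (x + u *\<^sub>R ?e) * indicator {g 0..g 1} u \<partial>lborel)"
    by (rule nn_integral_substitution_aux[symmetric])
      (auto simp: g_def intro!: derivative_eq_intros der continuous_intros continuous_on_subset[OF cont] pos)
   also have "... = (\<integral>\<^sup>+u. f (x + u *\<^sub>R ?e) * indicator {0..1} u \<partial>lborel)"
    unfolding g1 by (rule nn_integral_unit_interval_periodic)
     (use per(1) in \<open>auto simp: scaleR_add_left add.assoc[symmetric]\<close>)
   finally show ?thesis .
  qed
  then show ?thesis by simp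
 qed
 also have "... = (\<integral>\<^sup>+x. f x * indicator cell x \<partial>lborel)"
  by (rule nn_integral_cell_average[symmetric]) (auto simp: per)
 finally show ?thesis .
qed

section \<open>Changes of variables on the cylinder\<close>

text \<open>A Borel version of \<open>cylinder\<close>, for which products and Fubini apply
  directly; \<open>cylinder_AE_eq\<close> leads back to Lebesgue measure at the end.\<close>

definition cyl :: "real => real => (real \<times> (real^'n)) measure" where
 "cyl a b = restrict_space lborel ({a<..<b} \<times> cell)"

lemma sets_cylinder_set [measurable, simp]: "{a<..<b::real} \<times> (cell :: (real^'n) set) \<in> sets borel"
 by (simp add: borel_prod[symmetric])

lemma space_cyl [simp]: "space (cyl a b) = {a<..<b} \<times> cell"
 by (simp add: cyl_def space_restrict_space)

lemma borel_measurable_cyl [measurable (raw)]: "f \<in> borel_fun ==> f \<in> borel_measurable (cyl a b)"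
 unfolding cyl_def by (rule measurable_restrict_space1) simp

lemma nn_integral_cyl_indicator:
 "(\<integral>\<^sup>+z. f z \<partial>cyl a b) = (\<integral>\<^sup>+z. f z * indicator ({a<..<b} \<times> cell) z \<partial>lborel)"
 unfolding cyl_def by (subst nn_integral_restrict_space) auto

lemma nn_integral_cyl:
 fixes f :: "real \<times> (real^'n) => ennreal"
 assumes [measurable]: "f \<in> borel_fun"
 shows "(\<integral>\<^sup>+z. f z \<partial>cyl a b)
  = (\<integral>\<^sup>+t. (\<integral>\<^sup>+x. f (t, x) * indicator cell x \<partial>lborel) * indicator {a<..<b} t \<partial>lborel)"
proof -
 have m: "(%z. f z * indicator ({a<..<b} \<times> cell) z) \<in> borel_measurable (lborel \<Otimes>\<^sub>M lborel)"
  by (simp add: lborel_prod)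
 have "(\<integral>\<^sup>+z. f z \<partial>cyl a b) = (\<integral>\<^sup>+z. f z * indicator ({a<..<b} \<times> cell) z \<partial>(lborel \<Otimes>\<^sub>M lborel))"
  by (simp add: nn_integral_cyl_indicator lborel_prod)
 also have "... = (\<integral>\<^sup>+t. (\<integral>\<^sup>+x. f (t, x) * indicator ({a<..<b} \<times> cell) (t, x) \<partial>lborel) \<partial>lborel)"
  by (rule lborel.nn_integral_fst[symmetric, OF m])
 also have "... = (\<integral>\<^sup>+t. (\<integral>\<^sup>+x. f (t, x) * indicator cell x \<partial>lborel) * indicator {a<..<b} t \<partial>lborel)"
  by (intro nn_integral_cong) (auto simp: indicator_def)
 finally show ?thesis .
qed

lemma measurable_Pair_slice [measurable (raw)]:
 "f \<in> borel_measurable (borel :: ('a::second_countable_topology \<times> 'b::second_countable_topology) measure)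
  ==> (%x. f (t, x)) \<in> borel_fun"
 by (rule measurable_compose[of "%x. (t, x)" _ borel]) (simp_all add: borel_prod[symmetric])

lemma borel_measurable_fst_snd [measurable]:
 "fst \<in> (borel :: ('a::second_countable_topology \<times> 'b::second_countable_topology) measure) \<rightarrow>\<^sub>M borel"
 "snd \<in> (borel :: ('a::second_countable_topology \<times> 'b::second_countable_topology) measure) \<rightarrow>\<^sub>M borel"
 by (simp_all add: borel_prod[symmetric])

lemma finite_measure_cyl: "finite_measure (cyl a b :: (real \<times> (real^'n)) measure)"
proof
 have "emeasure (cyl a b) (space (cyl a b :: (real \<times> (real^'n)) measure)) = (\<integral>\<^sup>+z. 1 \<partial>(cyl a b :: (real \<times> (real^'n)) measure))"
  by (rule trans[OF _ nn_integral_const[symmetric]]) simp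
 also have "... = (\<integral>\<^sup>+t. (\<integral>\<^sup>+x. indicator cell (x::real^'n) \<partial>lborel) * indicator {a<..<b} t \<partial>lborel)"
  by (subst nn_integral_cyl) auto
 also have "... = emeasure lborel {a<..<b}"
  by (simp add: emeasure_cell)
 finally show "emeasure (cyl a b :: (real \<times> (real^'n)) measure) (space (cyl a b)) \<noteq> \<infinity>"
  by (cases "a <= b") auto
qed

section \<open>Functions periodic in space\<close>

definition tperiodic :: "(real \<times> (real^'n) => 'b) => bool" where
 "tperiodic f \<longleftrightarrow> (\<forall>t x k. k \<in> lattice --> f (t, x + k) = f (t, x))"

lemma tperiodicD: "tperiodic f ==> k \<in> lattice ==> f (t, x + k) = f (t, x)"
 by (simp add: tperiodic_def)

lemma tperiodic_comp: "tperiodic f ==> tperiodic (%z. h (f z))"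
 by (simp add: tperiodic_def)

lemma tperiodic_comp2: "tperiodic f ==> tperiodic g ==> tperiodic (%z. h (f z) (g z))"
 by (simp add: tperiodic_def)

lemma continuous_cbox_bound:
 fixes f :: "real \<times> (real^'n) => real"
 assumes "continuous_on UNIV f" "tperiodic f"
 shows "\<exists>B. \<forall>t\<in>{a..b}. \<forall>x. \<bar>f (t, x)\<bar> <= B"
proof -
 have "compact (f ` ({a..b} \<times> cbox 0 1))"
  by (intro compact_continuous_image compact_Times continuous_on_subset[OF assms(1)]) auto
 then obtain B where B: "!!z. z \<in> {a..b} \<times> cbox 0 1 ==> \<bar>f z\<bar> <= B"
  using compact_imp_bounded bounded_iff by (metis (no_types, lifting) image_eqI real_norm_def)
 have "\<bar>f (t, x)\<bar> <= B" if "t \<in> {a..b}" for t x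
 proof -
  have "wrap x \<in> cell" by simp
  then have "wrap x \<in> cbox 0 1" by (auto simp: cell_def mem_box_cart less_imp_le)
  moreover have "f (t, wrap x) = f (t, x)"
   using tperiodicD[OF assms(2) wrap_diff_lattice[of x], of t x] by simp
  ultimately show ?thesis using B[of "(t, wrap x)"] that by auto
 qed
 then show ?thesis by blast
qed

text \<open>
 The map \<open>\<Phi> (s, x) = (\<tau> s, x + Y (s, x) e)\<close> displaces points only along one axis, so that its change of
 variables formula follows from the one-dimensional one.
\<close>

locale transport =
 fixes S T :: real and \<tau> \<tau>' :: "real => real" and Y :: "real \<times> (real^'n) => real"
  and DY :: "real \<times> (real^'n) => real \<times> (real^'n) => real" and i :: 'n
 assumes S_pos: "0 < S" and S_le: "S <= T"
  and \<tau>_der: "!!s. (\<tau> has_real_derivative \<tau>' s) (at s)"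
  and \<tau>'_cont: "continuous_on UNIV \<tau>'"
  and \<tau>'_ge: "!!s. 1/2 <= \<tau>' s"
  and \<tau>_0: "\<tau> 0 = 0" and \<tau>_S: "\<tau> S = T"
  and Y_der: "!!z. (Y has_derivative DY z) (at z)"
  and DY_cont: "!!e. continuous_on UNIV (%z. DY z e)"
  and Y_per: "tperiodic Y"
  and Y_0: "!!x. Y (0, x) = 0"
  and J_pos: "!!z. 0 < 1 + DY z (0, axis i 1)"
begin

abbreviation "e \<equiv> axis i (1::real)"

text \<open>The Jacobian in space only. As the first component of \<open>\<Phi>\<close> depends on
  time alone, the full Jacobian is \<open>\<tau>' * J\<close>.\<close>

definition "J z = 1 + DY z (0, e)"

definition "\<Phi> z = (\<tau> (fst z), snd z + Y z *\<^sub>R e)"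

definition "\<sigma> = inv \<tau>"

lemma \<tau>'_pos: "0 < \<tau>' s" using \<tau>'_ge[of s] by simp

lemma \<tau>_less: "s < t ==> \<tau> s < \<tau> t"
 by (rule DERIV_pos_imp_increasing) (use \<tau>_der \<tau>'_pos in blast)+

lemma \<tau>_less_iff: "\<tau> s < \<tau> t \<longleftrightarrow> s < t"
 by (metis \<tau>_less linorder_neqE_linordered_idom order_less_asym)

lemma \<tau>_cont: "continuous_on A \<tau>"
 using \<tau>_der by (meson DERIV_isCont continuous_at_imp_continuous_on)

lemma \<tau>_ge: "0 <= s ==> s / 2 <= \<tau> s"
proof (cases "s = 0")
 case False
 assume "0 <= s"
 with False have "0 < s" by simp
 then obtain r where "\<tau> s - \<tau> 0 = (s - 0) * \<tau>' r" using MVT2[of 0 s \<tau> \<tau>'] \<tau>_der by blast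
 then show ?thesis using \<tau>'_ge[of r] \<open>0 < s\<close> mult_left_mono[OF \<tau>'_ge[of r], of s] by (simp add: \<tau>_0)
qed (simp add: \<tau>_0)

lemma \<tau>_le: "s <= 0 ==> \<tau> s <= s / 2"
proof (cases "s = 0")
 case False
 assume "s <= 0"
 with False have "s < 0" by simp
 then obtain r where "\<tau> 0 - \<tau> s = (0 - s) * \<tau>' r" using MVT2[of s 0 \<tau> \<tau>'] \<tau>_der by blast
 then show ?thesis using \<tau>'_ge[of r] \<open>s < 0\<close> mult_left_mono[OF \<tau>'_ge[of r], of "-s"] by (simp add: \<tau>_0)
qed (simp add: \<tau>_0)

lemma \<tau>_surj: "\<exists>s. \<tau> s = t"
proof -
 have "\<exists>s. - 2 * \<bar>t\<bar> <= s \<and> s <= 2 * \<bar>t\<bar> \<and> \<tau> s = t"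
  by (rule IVT') (use \<tau>_ge[of "2 * \<bar>t\<bar>"] \<tau>_le[of "- 2 * \<bar>t\<bar>"] in \<open>auto intro: \<tau>_cont\<close>)
 then show ?thesis by blast
qed

lemma \<tau>_inj: "inj \<tau>" by (rule injI) (metis \<tau>_less less_irrefl linorder_neqE_linordered_idom)

lemma \<sigma>_\<tau> [simp]: "\<sigma> (\<tau> s) = s" unfolding \<sigma>_def by (simp add: \<tau>_inj)
lemma \<tau>_\<sigma> [simp]: "\<tau> (\<sigma> t) = t" unfolding \<sigma>_def by (rule surj_f_inv_f) (metis \<tau>_surj surjI)

lemma \<sigma>_measurable [measurable]: "\<sigma> \<in> borel_fun"
proof (rule borel_measurable_mono)
 show "mono \<sigma>" by (rule monoI) (metis \<tau>_\<sigma> \<tau>_less_iff linorder_not_less)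
qed

lemma \<tau>_measurable [measurable]: "\<tau> \<in> borel_fun"
 by (rule borel_measurable_continuous_onI[OF \<tau>_cont])

lemma \<tau>'_measurable [measurable]: "\<tau>' \<in> borel_fun"
 by (rule borel_measurable_continuous_onI[OF \<tau>'_cont])

lemma Y_cont: "continuous_on A Y"
 using Y_der by (meson has_derivative_continuous continuous_at_imp_continuous_on)

lemma Y_measurable [measurable]: "Y \<in> borel_fun"
 by (rule borel_measurable_continuous_onI[OF Y_cont])

lemma DY_measurable [measurable]: "(%z. DY z w) \<in> borel_fun"
 by (rule borel_measurable_continuous_onI[OF DY_cont])

lemma J_measurable [measurable]: "J \<in> borel_fun"
 unfolding J_def[abs_def] by measurable

lemma J_pos': "0 < J z" using J_pos by (simp add: J_def)

lemma DY_linear: "linear (DY z)" using Y_der has_derivative_linear by blast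

lemma DY_per: "tperiodic DY"
 unfolding tperiodic_def
proof (intro allI impI)
 fix t x k assume k: "(k::real^'n) \<in> lattice"
 have "((%z. Y (z + (0, k))) has_derivative DY ((t, x) + (0, k))) (at (t, x))"
  by (rule derivative_eq_intros has_derivative_compose[OF _ Y_der])+ auto
 moreover have "(%z. Y (z + (0, k))) = Y" using tperiodicD[OF Y_per k] by (auto simp: fun_eq_iff)
 ultimately show "DY (t, x + k) = DY (t, x)"
  using has_derivative_unique[OF _ Y_der[of "(t, x)"]] by simp
qed

lemma J_per: "tperiodic J"
 unfolding J_def[abs_def] by (rule tperiodic_comp[OF DY_per])

lemma \<Phi>_measurable [measurable]: "\<Phi> \<in> borel_fun"
 unfolding \<Phi>_def[abs_def]
 by (intro borel_measurable_continuous_onI continuous_intros continuous_on_compose2[OF \<tau>_cont[of UNIV]] Y_cont) auto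

lemma \<Phi>_add_lattice: "k \<in> lattice ==> \<Phi> (t, x + k) = \<Phi> (t, x) + (0, k)"
 by (simp add: \<Phi>_def tperiodicD[OF Y_per])

text \<open>Fubini separates the time substitution \<open>\<tau>\<close> from the shear at fixed
  time. Strict monotonicity of \<open>\<tau>\<close> matches the open intervals
  \<open>{0<..<S}\<close> and \<open>{0<..<T}\<close>.\<close>

lemma nn_integral_transport:
 fixes f :: "real \<times> (real^'n) => ennreal"
 assumes [measurable]: "f \<in> borel_fun" and per: "tperiodic f"
 shows "(\<integral>\<^sup>+z. f z \<partial>cyl 0 T) = (\<integral>\<^sup>+z. f (\<Phi> z) * ennreal (\<tau>' (fst z) * J z) \<partial>cyl 0 S)"
proof -
 define A where "A t = (\<integral>\<^sup>+x. f (t, x) * indicator cell x \<partial>lborel)" for t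
 have [measurable]: "A \<in> borel_fun"
  unfolding A_def[abs_def] by measurable
 have "(\<integral>\<^sup>+z. f z \<partial>cyl 0 T) = (\<integral>\<^sup>+t. A t * indicator {0<..<T} t \<partial>lborel)"
  unfolding A_def by (rule nn_integral_cyl) measurable
 also have "... = (\<integral>\<^sup>+t. (A t * indicator {0<..<T} t) * indicator {\<tau> 0..\<tau> S} t \<partial>lborel)"
  by (intro nn_integral_cong) (auto simp: \<tau>_0 \<tau>_S indicator_def)
 also have "... = (\<integral>\<^sup>+s. (A (\<tau> s) * indicator {0<..<T} (\<tau> s)) * ennreal (\<tau>' s) * indicator {0..S} s \<partial>lborel)"
  by (rule nn_integral_substitution_aux)
    (use \<tau>_der \<tau>'_pos S_pos in \<open>auto intro: continuous_on_subset[OF \<tau>'_cont] less_imp_le\<close>)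
 also have "... = (\<integral>\<^sup>+s. (A (\<tau> s) * ennreal (\<tau>' s)) * indicator {0<..<S} s \<partial>lborel)"
  by (intro nn_integral_cong)
    (use \<tau>_less_iff[of 0] \<tau>_less_iff[of _ S] in \<open>auto simp: \<tau>_0 \<tau>_S indicator_def\<close>)
 also have "... = (\<integral>\<^sup>+s. (\<integral>\<^sup>+x. (f (\<Phi> (s, x)) * ennreal (\<tau>' s * J (s, x))) * indicator cell x \<partial>lborel) * indicator {0<..<S} s \<partial>lborel)"
 proof -
  have "A (\<tau> s) * ennreal (\<tau>' s) = (\<integral>\<^sup>+x. (f (\<Phi> (s, x)) * ennreal (\<tau>' s * J (s, x))) * indicator cell x \<partial>lborel)" for s
  proof -
   have "A (\<tau> s) = (\<integral>\<^sup>+x. f (\<tau> s, x + Y (s, x) *\<^sub>R axis i 1) * ennreal (1 + DY (s, x) (0, e)) * indicator cell x \<partial>lborel)"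
    unfolding A_def
   proof (rule nn_integral_cell_shear[symmetric])
    show "((%r. Y (s, x + r *\<^sub>R e)) has_real_derivative DY (s, x + r *\<^sub>R e) (0, e)) (at r)" for x r
    proof -
     have "((%r. Y (s, x + r *\<^sub>R e)) has_derivative (%h. DY (s, x + r *\<^sub>R e) (0, h *\<^sub>R e))) (at r)"
      by (rule has_derivative_compose[OF _ Y_der]) (auto intro!: derivative_eq_intros)
     moreover have "DY (s, x + r *\<^sub>R e) (0, h *\<^sub>R e) = DY (s, x + r *\<^sub>R e) (0, e) * h" for h
      using linear_scale[OF DY_linear, of "(s, x + r *\<^sub>R e)" h "(0, e)"] by (simp add: mult.commute)
     ultimately show ?thesis by (simp add: has_field_derivative_def)
    qed
    show "continuous_on UNIV (%r. DY (s, x + r *\<^sub>R e) (0, e))" for x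
     by (rule continuous_on_compose2[OF DY_cont]) (auto intro!: continuous_intros)
   qed (use J_pos per in \<open>auto simp: tperiodicD[OF per axis_in_lattice] tperiodicD[OF Y_per axis_in_lattice] tperiodicD[OF DY_per axis_in_lattice] less_imp_le\<close>)
   then have "A (\<tau> s) * ennreal (\<tau>' s) = (\<integral>\<^sup>+x. (f (\<tau> s, x + Y (s, x) *\<^sub>R axis i 1) * ennreal (1 + DY (s, x) (0, e)) * indicator cell x) * ennreal (\<tau>' s) \<partial>lborel)"
    by (subst nn_integral_multc) auto
   also have "... = (\<integral>\<^sup>+x. (f (\<Phi> (s, x)) * ennreal (\<tau>' s * J (s, x))) * indicator cell x \<partial>lborel)"
    by (intro nn_integral_cong)
      (use \<tau>'_pos[of s] J_pos in \<open>auto simp: \<Phi>_def J_def ennreal_mult less_imp_le ac_simps\<close>)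
   finally show ?thesis .
  qed
  then show ?thesis by simp
 qed
 also have "... = (\<integral>\<^sup>+z. f (\<Phi> z) * ennreal (\<tau>' (fst z) * J z) \<partial>cyl 0 S)"
  by (subst nn_integral_cyl) auto
 finally show ?thesis .
qed

text \<open>Positive and negative parts are transported separately. The equality of integrals covers
  the nonintegrable case too, where both sides default to 0.\<close>

lemma real_transport:
 fixes f :: "real \<times> (real^'n) => real"
 assumes [measurable]: "f \<in> borel_fun" and per: "tperiodic f"
 shows "integrable (cyl 0 T) f \<longleftrightarrow> integrable (cyl 0 S) (%z. \<tau>' (fst z) * J z * f (\<Phi> z))"
  and "(LINT z|cyl 0 T. f z) = (LINT z|cyl 0 S. \<tau>' (fst z) * J z * f (\<Phi> z))"
proof -
 have w: "0 <= \<tau>' (fst z) * J z" for z using \<tau>'_pos J_pos' by (simp add: less_imp_le)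
 have eq: "(\<integral>\<^sup>+z. ennreal (g z) \<partial>cyl 0 T) = (\<integral>\<^sup>+z. ennreal (\<tau>' (fst z) * J z * g (\<Phi> z)) \<partial>cyl 0 S)"
  if [measurable]: "g \<in> borel_fun" and "tperiodic g" for g :: "real \<times> (real^'n) => real"
 proof -
  have "(\<integral>\<^sup>+z. ennreal (g z) \<partial>cyl 0 T) = (\<integral>\<^sup>+z. ennreal (g (\<Phi> z)) * ennreal (\<tau>' (fst z) * J z) \<partial>cyl 0 S)"
   by (rule nn_integral_transport) (use that tperiodic_comp in auto)
  also have "... = (\<integral>\<^sup>+z. ennreal (\<tau>' (fst z) * J z * g (\<Phi> z)) \<partial>cyl 0 S)"
   by (intro nn_integral_cong) (simp add: ennreal_mult'' w mult.commute)
  finally show ?thesis .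
 qed
 have 1: "(\<integral>\<^sup>+z. ennreal (f z) \<partial>cyl 0 T) = (\<integral>\<^sup>+z. ennreal (\<tau>' (fst z) * J z * f (\<Phi> z)) \<partial>cyl 0 S)"
  by (rule eq) (use per in auto)
 have 2: "(\<integral>\<^sup>+z. ennreal (- f z) \<partial>cyl 0 T) = (\<integral>\<^sup>+z. ennreal (- (\<tau>' (fst z) * J z * f (\<Phi> z))) \<partial>cyl 0 S)"
  using eq[of "%z. - f z"] tperiodic_comp[OF per, of uminus] by simp
 show I: "integrable (cyl 0 T) f \<longleftrightarrow> integrable (cyl 0 S) (%z. \<tau>' (fst z) * J z * f (\<Phi> z))"
  unfolding real_integrable_def 1 2 by simp
 show "(LINT z|cyl 0 T. f z) = (LINT z|cyl 0 S. \<tau>' (fst z) * J z * f (\<Phi> z))"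
 proof (cases "integrable (cyl 0 T) f")
  case True
  then show ?thesis using I unfolding real_lebesgue_integral_def[OF True] by (simp add: real_lebesgue_integral_def 1 2)
 next
  case False
  then show ?thesis using I by (simp add: not_integrable_integral_eq)
 qed
qed

section \<open>The inverse of the space-time map\<close>

lemma Y_line_bounded: "\<exists>B. \<forall>x. \<bar>Y (s, x)\<bar> <= B"
 using continuous_cbox_bound[OF Y_cont Y_per, of s s] by auto

text \<open>\<open>u + Y\<close> is strictly increasing along each line since \<open>J\<close> is
  positive, and \<open>Y\<close> is bounded at a fixed time; the intermediate value theorem then
  gives a global inverse.\<close>

lemma disp_ex1: "\<exists>!u. u + Y (s, y + u *\<^sub>R e) = 0"
 and disp_mono: "a < b ==> a + Y (s, y + a *\<^sub>R e) < b + Y (s, y + b *\<^sub>R e)"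
proof -
 have d: "((%u. u + Y (s, y + u *\<^sub>R e)) has_real_derivative J (s, y + r *\<^sub>R e)) (at r)" for r
 proof -
  have "((%r. Y (s, y + r *\<^sub>R e)) has_derivative (%h. DY (s, y + r *\<^sub>R e) (0, h *\<^sub>R e))) (at r)"
   by (rule has_derivative_compose[OF _ Y_der]) (auto intro!: derivative_eq_intros)
  moreover have "DY (s, y + r *\<^sub>R e) (0, h *\<^sub>R e) = DY (s, y + r *\<^sub>R e) (0, e) * h" for h
   using linear_scale[OF DY_linear, of "(s, y + r *\<^sub>R e)" h "(0, e)"] by (simp add: mult.commute)
  ultimately have "((%r. Y (s, y + r *\<^sub>R e)) has_real_derivative DY (s, y + r *\<^sub>R e) (0, e)) (at r)"
   by (simp add: has_field_derivative_def)
  from DERIV_add[OF DERIV_ident this] show ?thesis by (simp add: J_def)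
 qed
 have mono: "a + Y (s, y + a *\<^sub>R e) < b + Y (s, y + b *\<^sub>R e)" if "a < b" for a b
  by (rule DERIV_pos_imp_increasing[OF that]) (use d J_pos' in blast)
 then show "a < b ==> a + Y (s, y + a *\<^sub>R e) < b + Y (s, y + b *\<^sub>R e)" .
 obtain B where B: "\<bar>Y (s, x)\<bar> <= B" for x using Y_line_bounded by blast
 have B0: "0 <= B" using B[of 0] by linarith
 have "\<exists>u. - B <= u \<and> u <= B \<and> u + Y (s, y + u *\<^sub>R e) = 0"
 proof (rule IVT')
  show "- B + Y (s, y + - B *\<^sub>R e) <= 0" using B[of "y + - B *\<^sub>R e"] by linarith
  show "0 <= B + Y (s, y + B *\<^sub>R e)" using B[of "y + B *\<^sub>R e"] by linarith
  show "continuous_on {- B..B} (%u. u + Y (s, y + u *\<^sub>R e))"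
   using d by (meson DERIV_isCont continuous_at_imp_continuous_on)
 qed (use B0 in auto)
 then obtain u where "u + Y (s, y + u *\<^sub>R e) = 0" by blast
 then show "\<exists>!u. u + Y (s, y + u *\<^sub>R e) = 0"
  by (rule ex1I) (metis mono \<open>u + Y (s, y + u *\<^sub>R e) = 0\<close> less_irrefl linorder_neqE_linordered_idom)
qed

definition "disp s y = (THE u. u + Y (s, y + u *\<^sub>R e) = 0)"

definition "\<Phi>i w = (\<sigma> (fst w), snd w + disp (\<sigma> (fst w)) (snd w) *\<^sub>R e)"

lemma disp_eq: "disp s y + Y (s, y + disp s y *\<^sub>R e) = 0"
 unfolding disp_def by (rule theI'[OF disp_ex1])

lemma disp_unique: "u + Y (s, y + u *\<^sub>R e) = 0 ==> disp s y = u"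
 using disp_ex1 disp_eq by blast

lemma \<Phi>_\<Phi>i [simp]: "\<Phi> (\<Phi>i w) = w"
proof -
 have "snd w + (disp (\<sigma> (fst w)) (snd w) + Y (\<Phi>i w)) *\<^sub>R e = snd w"
  using disp_eq[of "\<sigma> (fst w)" "snd w"] by (simp add: \<Phi>i_def)
 then show ?thesis by (simp add: \<Phi>_def \<Phi>i_def scaleR_add_left prod_eq_iff add.assoc)
qed

lemma \<Phi>i_\<Phi> [simp]: "\<Phi>i (\<Phi> z) = z"
proof -
 have "disp (fst z) (snd z + Y z *\<^sub>R e) = - Y z"
  by (rule disp_unique) simp
 then show ?thesis by (simp add: \<Phi>_def \<Phi>i_def prod_eq_iff)
qed

text \<open>Monotonicity along the line turns \<open>disp <= a\<close> into a sign condition on a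
  continuous function, so no regularity of the inverse has to be proved.\<close>

lemma \<Phi>i_measurable [measurable]: "\<Phi>i \<in> borel_fun"
proof -
 have "(%w. disp (fst w) (snd w)) \<in> borel_fun"
 proof (rule borel_measurableI_le)
  fix a
  have "disp (fst w) (snd w) <= a \<longleftrightarrow> 0 <= a + Y (fst w, snd w + a *\<^sub>R e)" for w
   using disp_mono[of a "disp (fst w) (snd w)" "fst w" "snd w"] disp_mono[of "disp (fst w) (snd w)" a "fst w" "snd w"] disp_eq[of "fst w" "snd w"]
   by (cases "disp (fst w) (snd w)" a rule: linorder_cases) auto
  then have "{w \<in> space borel. disp (fst w) (snd w) <= a} = {w \<in> space borel. 0 <= a + Y (fst w, snd w + a *\<^sub>R e)}"
   by (simp only:)
  moreover have "(%w. a + Y (fst w, snd w + a *\<^sub>R e)) \<in> borel_fun"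
   by (intro borel_measurable_continuous_onI continuous_intros continuous_on_compose2[OF Y_cont[of UNIV]]) auto
  ultimately show "{w \<in> space borel. disp (fst w) (snd w) <= a} \<in> sets borel"
   using borel_measurable_le[OF borel_measurable_const[of 0]] by (simp only:)
 qed
 then have [measurable]: "(%w. disp (fst w) (snd w)) \<in> borel_measurable (borel \<Otimes>\<^sub>M borel)" by (simp add: borel_prod)
 have "(%w. disp (fst (\<sigma> (fst w), snd w)) (snd (\<sigma> (fst w), snd w))) \<in> borel_measurable (borel \<Otimes>\<^sub>M borel)"
  by (rule measurable_compose[of "%w. (\<sigma> (fst w), snd w)" _ "borel \<Otimes>\<^sub>M borel"]) measurable
 then have [measurable]: "(%w. disp (\<sigma> (fst w)) (snd w)) \<in> borel_measurable (borel \<Otimes>\<^sub>M borel)" by simp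
 show ?thesis unfolding \<Phi>i_def[abs_def] borel_prod[symmetric] by measurable
qed

lemma \<Phi>i_add_lattice: "k \<in> lattice ==> \<Phi>i (t, x + k) = \<Phi>i (t, x) + (0, k)"
proof -
 assume k: "k \<in> lattice"
 have "\<Phi> (\<Phi>i (t, x) + (0, k)) = (t, x + k)"
  using \<Phi>_add_lattice[OF k, of "fst (\<Phi>i (t, x))" "snd (\<Phi>i (t, x))"] by (simp add: plus_prod_def)
 then show ?thesis by (metis \<Phi>i_\<Phi>)
qed

lemma tperiodic_\<Phi>i: "tperiodic f ==> tperiodic (%w. f (\<Phi>i w))"
 unfolding tperiodic_def using \<Phi>i_add_lattice by (metis (no_types, lifting) add_Pair add.right_neutral prod.collapse)

end

section \<open>Weak solutions of the continuity equation\<close>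

lemma integrable_cyl_iff:
 fixes f :: "real \<times> (real^'n) => 'b::{banach, second_countable_topology}"
 shows "integrable (cyl a b) f \<longleftrightarrow> integrable lborel (%z. indicator ({a<..<b} \<times> cell) z *\<^sub>R f z)"
 unfolding cyl_def by (subst integrable_restrict_space) (auto simp: set_integrable_def)

lemma integral_cyl_indicator:
 fixes f :: "real \<times> (real^'n) => 'b::{banach, second_countable_topology}"
 shows "(LINT z|cyl a b. f z) = (LINT z|lborel. indicator ({a<..<b} \<times> cell) z *\<^sub>R f z)"
 unfolding cyl_def by (subst integral_restrict_space) (auto simp: set_lebesgue_integral_def)

lemma integrable_cyl_subset:
 fixes f :: "real \<times> (real^'n) => real"
 assumes "integrable (cyl a b) f" "a <= c" "d <= b"
 shows "integrable (cyl c d) f"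
proof -
 have "integrable lborel (%z. indicator ({c<..<d} \<times> cell) z *\<^sub>R (indicator ({a<..<b} \<times> cell) z *\<^sub>R f z))"
  using assms(1) unfolding integrable_cyl_iff[of a b f]
  by (rule integrable_mult_indicator[rotated]) simp
 also have "(%z. indicator ({c<..<d} \<times> cell) z *\<^sub>R (indicator ({a<..<b} \<times> cell) z *\<^sub>R f z))
   = (%z. indicator ({c<..<d} \<times> cell) z *\<^sub>R f z)"
  using assms(2,3) by (auto simp: indicator_def fun_eq_iff)
 finally show ?thesis unfolding integrable_cyl_iff .
qed

lemma integral_cyl_subset:
 fixes f :: "real \<times> (real^'n) => real"
 assumes "a <= c" "d <= b"
 shows "(LINT z|cyl c d. f z) = (LINT z|cyl a b. indicator {c<..<d} (fst z) * f z)"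
 unfolding integral_cyl_indicator
 by (intro Bochner_Integration.integral_cong) (use assms in \<open>auto simp: indicator_def\<close>)

lemma integrable_cyl_bounded_mult:
 fixes f g :: "real \<times> (real^'n) => real"
 assumes "integrable (cyl a b) f" "g \<in> borel_fun"
  and "!!z. z \<in> {a<..<b} \<times> cell ==> \<bar>g z\<bar> <= B"
 shows "integrable (cyl a b) (%z. g z * f z)"
proof (rule Bochner_Integration.integrable_bound[OF integrable_mult_right[OF integrable_norm[OF assms(1)], of "\<bar>B\<bar>"]])
 show "(%z. g z * f z) \<in> borel_measurable (cyl a b)"
  by (rule borel_measurable_times[OF borel_measurable_cyl[OF assms(2)] borel_measurable_integrable[OF assms(1)]])
 show "AE z in cyl a b. norm (g z * f z) <= norm (\<bar>B\<bar> * norm (f z))"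
 proof (rule AE_I2)
  fix z assume "z \<in> space (cyl a b :: (real \<times> (real^'n)) measure)"
  then have "\<bar>g z\<bar> <= \<bar>B\<bar>" using assms(3)[of z] by auto
  then show "norm (g z * f z) <= norm (\<bar>B\<bar> * norm (f z))" by (simp add: abs_mult mult_right_mono)
 qed
qed

text \<open>The C1 test functions of \<open>admissible\<close>, paired with their derivative so that
  chain rules can be applied to \<open>D\<close> directly. Compact support in time is recorded as
  vanishing after some \<open>a < T\<close>.\<close>

definition test_pair :: "real => (real \<times> (real^'n) => real) => (real \<times> (real^'n) => real \<times> (real^'n) => real) => bool" where
 "test_pair T \<phi> D \<longleftrightarrow>
  (\<forall>z\<in>{0..<T} \<times> UNIV. (\<phi> has_derivative D z) (at z within {0..<T} \<times> UNIV)) \<and>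
  (\<forall>e. continuous_on ({0..<T} \<times> UNIV) (%z. D z e)) \<and>
  (\<forall>t\<in>{0..<T}. periodic (%x. \<phi> (t, x))) \<and>
  (\<exists>a<T. \<forall>t\<in>{0..<T}. a < t --> (\<forall>x. \<phi> (t, x) = 0))"

text \<open>
 Borel, periodic, everywhere nonnegative representatives of admissible pairs of finite kinetic energy.
 The initial datum enters only through the weak equation.
\<close>

definition weak_sol :: "real => (real^'n => real) => (real \<times> (real^'n) => real) => (real \<times> (real^'n) => real^'n) => bool" where
 "weak_sol T \<rho> m v \<longleftrightarrow>
  m \<in> borel_fun \<and> v \<in> borel_fun \<and> tperiodic m \<and> tperiodic v \<and>
  (\<forall>z. 0 <= m z) \<and> integrable (cyl 0 T) m \<and> integrable (cyl 0 T) (%z. m z * (norm (v z))\<^sup>2) \<and>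
  (\<forall>\<phi> D. test_pair T \<phi> D -->
    (LINT z|cyl 0 T. m z * D z (1, v z)) + (LINT x|lebesgue_on cell. \<phi> (0, x) * \<rho> x) = 0)"

text \<open>The energy density, with the final cost turned into the bulk term \<open>m * (v \<bullet> p)\<close>.\<close>

definition lagr :: "(real => real) => (real^'n => real^'n) => (real \<times> (real^'n) => real) => (real \<times> (real^'n) => real^'n) => real \<times> (real^'n) => real" where
 "lagr G p m v z = 1/2 * m z * (norm (v z))\<^sup>2 + G (m z) + m z * (v z \<bullet> p (snd z))"

lemma borel_measurable_vec_nth [measurable (raw)]:
 "f \<in> borel_measurable M ==> (%x. (f x :: real^'n) $ j) \<in> borel_measurable M"
 using borel_measurable_inner[of f M "%_. axis j 1"] by (simp add: inner_axis)

lemma weak_solD: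
 assumes "weak_sol T \<rho> m v"
 shows "m \<in> borel_fun" "v \<in> borel_fun" "tperiodic m" "tperiodic v"
  "!!z. 0 <= m z" "integrable (cyl 0 T) m" "integrable (cyl 0 T) (%z. m z * (norm (v z))\<^sup>2)"
  "!!\<phi> D. test_pair T \<phi> D ==> (LINT z|cyl 0 T. m z * D z (1, v z)) + (LINT x|lebesgue_on cell. \<phi> (0, x) * \<rho> x) = 0"
 using assms unfolding weak_sol_def by blast+

lemma test_pairD:
 assumes "test_pair T \<phi> D"
 shows "!!z. z \<in> {0..<T} \<times> UNIV ==> (\<phi> has_derivative D z) (at z within {0..<T} \<times> UNIV)"
  "!!e. continuous_on ({0..<T} \<times> UNIV) (%z. D z e)"
  "!!t x k. t \<in> {0..<T} ==> k \<in> lattice ==> \<phi> (t, x + k) = \<phi> (t, x)"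
  "\<exists>a<T. \<forall>t\<in>{0..<T}. a < t --> (\<forall>x. \<phi> (t, x) = 0)"
 using assms unfolding test_pair_def periodic_def by blast+

lemma vec_axis_sum: "(u :: real^'n) = (\<Sum>j\<in>UNIV. u $ j *\<^sub>R axis j 1)"
 by (simp add: vec_eq_iff axis_def sum.delta' if_distrib cong: if_cong)

text \<open>Used to derive measurability or continuity of \<open>D z (a z, u z)\<close> in
  \<open>z\<close> from that of \<open>D z\<close> in finitely many fixed directions.\<close>

lemma linear_pair_expand:
 fixes L :: "real \<times> (real^'n) => real"
 assumes "linear L"
 shows "L (a, u) = a * L (1, 0) + (\<Sum>j\<in>UNIV. u $ j * L (0, axis j 1))"
proof -
 have s: "L (r *\<^sub>R w) = r * L w" for r w using linear_scale[OF assms] by simp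
 have s': "L (0, r *\<^sub>R w) = r * L (0, w)" for r w using s[of r "(0, w)"] by simp
 have p: "(0, \<Sum>j\<in>A. f j) = (\<Sum>j\<in>A. (0::real, f j))" for A :: "'n set" and f :: "'n => real^'n"
  by (simp add: sum_prod)
 have "L (a, u) = L (a *\<^sub>R (1, 0) + (0, u))" by simp
 also have "... = a * L (1, 0) + L (0, u)" unfolding linear_add[OF assms] s ..
 also have "L (0, u) = L (\<Sum>j\<in>UNIV. u $ j *\<^sub>R (0, axis j 1))"
  by (subst vec_axis_sum[of u], subst p) (simp add: scaleR_Pair)
 also have "... = (\<Sum>j\<in>UNIV. u $ j * L (0, axis j 1))"
  by (subst linear_sum[OF assms]) (simp add: s')
 finally show ?thesis .
qed

lemma test_pair_interior:
 assumes "test_pair T \<phi> D" "0 < fst z" "fst z < T"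
 shows "(\<phi> has_derivative D z) (at z)"
proof -
 have "z \<in> {0..<T} \<times> UNIV" using assms by (cases z) auto
 then have "(\<phi> has_derivative D z) (at z within {0..<T} \<times> UNIV)" using assms(1) by (auto simp: test_pair_def)
 moreover have "at z within {0..<T} \<times> UNIV = at z"
  by (rule at_within_open_subset[of _ "{0<..<T} \<times> UNIV"]) (use assms(2,3) in \<open>auto intro!: open_Times simp: mem_Times_iff\<close>)
 ultimately show ?thesis by simp
qed

lemma test_pair_linear:
 assumes "test_pair T \<phi> D" "0 <= fst z" "fst z < T"
 shows "linear (D z)"
proof -
 have "z \<in> {0..<T} \<times> UNIV" using assms by (cases z) auto
 from has_derivative_linear[OF test_pairD(1)[OF assms(1) this]] show ?thesis .
qed

lemma test_pair_per:
 assumes "test_pair T \<phi> D" "0 < t" "t < T" "k \<in> lattice"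
 shows "D (t, x + k) = D (t, x)"
proof -
 have 1: "(\<phi> has_derivative D (t, x + k)) (at (t, x + k))" by (rule test_pair_interior[OF assms(1)]) (use assms in auto)
 have 2: "(\<phi> has_derivative D (t, x)) (at (t, x))" by (rule test_pair_interior[OF assms(1)]) (use assms in auto)
 have "((%z. \<phi> (z + (0, k))) has_derivative D (t, x + k)) (at (t, x))"
  by (rule has_derivative_compose[where g=\<phi> and f="%z. z + (0, k)", THEN has_derivative_eq_rhs])
    (use 1 in \<open>auto intro!: derivative_eq_intros\<close>)
 then have "(\<phi> has_derivative D (t, x + k)) (at (t, x))"
 proof (rule has_derivative_transform_within_open[of _ _ _ _ "{0<..<T} \<times> UNIV"])
  show "\<phi> (z + (0, k)) = \<phi> z" if "z \<in> {0<..<T} \<times> UNIV" for z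
   using that assms(1,4) by (cases z) (auto simp: test_pair_def periodic_def)
 qed (use assms in \<open>auto intro: open_Times\<close>)
 then show ?thesis using has_derivative_unique[OF _ 2] by blast
qed

text \<open>Outside the open strip the derivative of a test function may be junk, so it is replaced by zero.\<close>

definition strip_ext :: "real => (real \<times> (real^'n) => real \<times> (real^'n) => real) => real \<times> (real^'n) => real \<times> (real^'n) => real" where
 "strip_ext T D z w = (if z \<in> {0<..<T} \<times> UNIV then D z w else 0)"

lemma strip_ext_cont_measurable:
 assumes "continuous_on ({0<..<T} \<times> UNIV) (%z. D z w)"
 shows "(%z. strip_ext T D z w) \<in> borel_fun"
 unfolding strip_ext_def
 by (rule borel_measurable_continuous_on_if[OF _ assms]) (auto intro!: borel_open open_Times)

lemma strip_ext_measurable: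
 assumes "!!w. continuous_on ({0<..<T} \<times> UNIV) (%z. D z w)" "!!z. z \<in> {0<..<T} \<times> UNIV ==> linear (D z)"
  and [measurable]: "a \<in> borel_fun" "u \<in> borel_fun"
 shows "(%z. strip_ext T D z (a z, u z)) \<in> borel_fun"
proof -
 have [measurable]: "(%z. strip_ext T D z w) \<in> borel_fun" for w
  by (rule strip_ext_cont_measurable[OF assms(1)])
 have "(%z. strip_ext T D z (a z, u z)) = (%z. a z * strip_ext T D z (1, 0) + (\<Sum>j\<in>UNIV. u z $ j * strip_ext T D z (0, axis j 1)))"
 proof (rule ext)
  fix z show "strip_ext T D z (a z, u z) = a z * strip_ext T D z (1, 0) + (\<Sum>j\<in>UNIV. u z $ j * strip_ext T D z (0, axis j 1))"
  proof (cases "z \<in> {0<..<T} \<times> UNIV")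
   case True
   then show ?thesis
    using linear_pair_expand[OF assms(2)[OF True], of "a z" "u z"] by (simp add: strip_ext_def)
  qed (simp only: strip_ext_def if_False mult_zero_right sum.neutral_const add_0)
 qed
 also have "... \<in> borel_fun" by measurable
 finally show ?thesis .
qed

section \<open>Push-forward of density, velocity and energy\<close>

context transport begin

text \<open>A trajectory of \<open>v\<close> is carried by \<open>\<Phi>\<close> to a path with
  space velocity \<open>V v\<close> in the old time and \<open>tv v\<close> in the new one. For the
  density only the space Jacobian divides, as a change of clock does not alter the mass of a time
  slice.\<close>

definition "V v z = v z + DY z (1, v z) *\<^sub>R e"
definition "tm m w = m (\<Phi>i w) / J (\<Phi>i w)"
definition "tv v w = (1 / \<tau>' (fst (\<Phi>i w))) *\<^sub>R V v (\<Phi>i w)"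
definition "D\<Phi> z w = (\<tau>' (fst z) * fst w, snd w + DY z w *\<^sub>R e)"

lemma tm_\<Phi>: "tm m (\<Phi> z) = m z / J z" by (simp add: tm_def)
lemma tv_\<Phi>: "tv v (\<Phi> z) = (1 / \<tau>' (fst z)) *\<^sub>R V v z" by (simp add: tv_def)

lemma DY_expand: "DY z (a, u) = a * DY z (1, 0) + (\<Sum>j\<in>UNIV. u $ j * DY z (0, axis j 1))"
 by (rule linear_pair_expand[OF DY_linear])

lemma DY_comp_measurable [measurable (raw)]:
 assumes [measurable]: "u \<in> borel_fun" "a \<in> borel_fun"
 shows "(%z. DY z (a z, u z)) \<in> borel_fun"
 by (subst DY_expand) measurable

lemma V_measurable [measurable]: "v \<in> borel_fun ==> V v \<in> borel_fun"
 unfolding V_def[abs_def]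
 by (intro borel_measurable_add borel_measurable_scaleR DY_comp_measurable borel_measurable_const)

lemma V_per: "tperiodic v ==> tperiodic (V v)"
 by (auto simp: tperiodic_def V_def tperiodicD[OF DY_per])

lemma \<Phi>_der: "(\<Phi> has_derivative D\<Phi> z) (at z)"
proof -
 have "((%z. \<tau> (fst z)) has_derivative (%w. \<tau>' (fst z) * fst w)) (at z)"
  by (rule has_derivative_compose[OF has_derivative_fst[OF has_derivative_ident]])
    (use \<tau>_der[of "fst z"] in \<open>simp add: has_field_derivative_def\<close>)
 then show ?thesis
  unfolding \<Phi>_def[abs_def] D\<Phi>_def
  by (intro has_derivative_Pair has_derivative_add has_derivative_scaleR_left Y_der) (auto intro: derivative_intros)
qed

lemma \<Phi>_cont: "continuous_on A \<Phi>"
 using \<Phi>_der by (meson has_derivative_continuous continuous_at_imp_continuous_on)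

lemma DY_bound: "\<exists>B\<ge>0. \<forall>t\<in>{0..S}. \<forall>x a u. \<bar>DY (t, x) (a, u)\<bar> <= B * (\<bar>a\<bar> + norm u)"
proof -
 have "\<forall>w. \<exists>B. \<forall>t\<in>{0..S}. \<forall>x. \<bar>DY (t, x) w\<bar> <= B"
  using continuous_cbox_bound[OF DY_cont tperiodic_comp[OF DY_per]] by blast
 then obtain B where B: "!!w t x. t \<in> {0..S} ==> \<bar>DY (t, x) w\<bar> <= B w" by metis
 define C where "C = \<bar>B (1, 0)\<bar> + (\<Sum>j\<in>UNIV. \<bar>B (0, axis j 1)\<bar>)"
 have "\<bar>DY (t, x) (a, u)\<bar> <= C * (\<bar>a\<bar> + norm u)" if t: "t \<in> {0..S}" for t x a u
 proof -
  have "\<bar>DY (t, x) (a, u)\<bar> <= \<bar>a\<bar> * \<bar>DY (t, x) (1, 0)\<bar> + (\<Sum>j\<in>UNIV. \<bar>u $ j\<bar> * \<bar>DY (t, x) (0, axis j 1)\<bar>)"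
   unfolding DY_expand[of _ a u]
   by (rule order_trans[OF abs_triangle_ineq]) (auto simp: abs_mult intro!: order_trans[OF sum_abs])
  also have "... <= (\<bar>a\<bar> + norm u) * \<bar>B (1, 0)\<bar> + (\<Sum>j\<in>UNIV. (\<bar>a\<bar> + norm u) * \<bar>B (0, axis j 1)\<bar>)"
  proof (intro add_mono sum_mono mult_mono)
   show "\<bar>DY (t, x) w\<bar> <= \<bar>B w\<bar>" for w using B[OF t, of x w] by linarith
   show "\<bar>DY (t, x) w\<bar> <= \<bar>B w\<bar>" for w using B[OF t, of x w] by linarith
   show "\<bar>u $ j\<bar> <= \<bar>a\<bar> + norm u" for j using component_le_norm_cart[of u j] by linarith
  qed auto
  also have "... = C * (\<bar>a\<bar> + norm u)" by (simp add: C_def sum_distrib_left sum_distrib_right algebra_simps)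
  finally show ?thesis .
 qed
 moreover have "0 <= C" by (simp add: C_def sum_nonneg)
 ultimately show ?thesis by blast
qed

lemma V_sq_bound: "\<exists>C\<ge>0. \<forall>v z. fst z \<in> {0..S} --> (norm (V v z))\<^sup>2 <= C * (1 + (norm (v z))\<^sup>2)"
proof -
 obtain B where B: "0 <= B" "!!t x a u. t \<in> {0..S} ==> \<bar>DY (t, x) (a, u)\<bar> <= B * (\<bar>a\<bar> + norm u)"
  using DY_bound by blast
 have "(norm (V v z))\<^sup>2 <= 2 * (1 + B)\<^sup>2 * (1 + (norm (v z))\<^sup>2)" if "fst z \<in> {0..S}" for v z
 proof -
  have "norm (V v z) <= norm (v z) + \<bar>DY z (1, v z)\<bar>"
   unfolding V_def by (rule order_trans[OF norm_triangle_ineq]) (simp add: norm_axis_1)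
  also have "... <= norm (v z) + B * (1 + norm (v z))"
   using B(2)[OF that, of "snd z" 1 "v z"] by simp
  also have "... <= (1 + B) * (1 + norm (v z))" using B(1) by (simp add: algebra_simps)
  finally have "(norm (V v z))\<^sup>2 <= ((1 + B) * (1 + norm (v z)))\<^sup>2" by (rule power_mono) simp
  also have "... = (1 + B)\<^sup>2 * (1 + norm (v z))\<^sup>2" by (simp add: power_mult_distrib)
  also have "... <= (1 + B)\<^sup>2 * (2 * (1 + (norm (v z))\<^sup>2))"
   by (intro mult_left_mono zero_le_power2)
     (use zero_le_power2[of "1 - norm (v z)"] in \<open>simp add: power2_eq_square algebra_simps\<close>)
  finally show ?thesis by (simp add: field_simps)
 qed
 then show ?thesis by (intro exI[of _ "2 * (1 + B)\<^sup>2"]) auto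
qed

lemma integrable_V:
 assumes "weak_sol T \<rho> m v"
 shows "integrable (cyl 0 S) (%z. m z * (norm (V v z))\<^sup>2)"
proof -
 obtain C where C: "0 <= C" "!!z. fst z \<in> {0..S} ==> (norm (V v z))\<^sup>2 <= C * (1 + (norm (v z))\<^sup>2)"
  using V_sq_bound by blast
 have [measurable]: "m \<in> borel_fun" "v \<in> borel_fun" and m0: "!!z. 0 <= m z"
  using weak_solD[OF assms] by auto
 have "integrable (cyl 0 S) m" "integrable (cyl 0 S) (%z. m z * (norm (v z))\<^sup>2)"
  using assms S_le by (auto simp: weak_sol_def intro: integrable_cyl_subset)
 then have "integrable (cyl 0 S) (%z. C * (m z + m z * (norm (v z))\<^sup>2))" by auto
 then show ?thesis
 proof (rule Bochner_Integration.integrable_bound)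
  show "AE z in cyl 0 S. norm (m z * (norm (V v z))\<^sup>2) <= norm (C * (m z + m z * (norm (v z))\<^sup>2))"
  proof (rule AE_I2)
   fix z assume "z \<in> space (cyl 0 S :: (real \<times> (real^'n)) measure)"
   then have "fst z \<in> {0..S}" by auto
   from mult_left_mono[OF C(2)[OF this] m0[of z]]
   show "norm (m z * (norm (V v z))\<^sup>2) <= norm (C * (m z + m z * (norm (v z))\<^sup>2))"
    using C(1) m0[of z] by (simp add: algebra_simps)
  qed
 qed measurable
qed

text \<open>\<open>\<Phi>\<close> is used only before time \<open>S\<close>, which it sends to
  \<open>T\<close>. As \<open>\<phi>\<close> vanishes near \<open>T\<close>, its pull-back vanishes
  for times between some \<open>s0\<close> and \<open>S\<close>, and the extension by 0 is still C1
  up to \<open>T\<close>.\<close>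

lemma test_pair_pullback:
 assumes tp: "test_pair T \<phi> D"
 shows "test_pair T (%z. if fst z < S then \<phi> (\<Phi> z) else 0)
   (%z w. if fst z < S then D (\<Phi> z) (D\<Phi> z w) else 0)" (is "test_pair T ?\<psi> ?E")
proof -
 let ?A = "{0..<T} \<times> (UNIV :: (real^'n) set)"
 obtain a' where a': "a' < T" "!!t x. t \<in> {0..<T} ==> a' < t ==> \<phi> (t, x) = 0"
  using tp by (auto simp: test_pair_def)
 define a where "a = max a' 0"
 have a: "a < T" "0 <= a" "!!t x. a < t ==> t < T ==> \<phi> (t, x) = 0"
  using a' S_pos S_le by (auto simp: a_def)
 define s0 where "s0 = \<sigma> a"
 have s0: "s0 < S" "\<tau> s0 = a" using a(1) \<tau>_less_iff[of s0 S] by (auto simp: s0_def \<tau>_S)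
 have s0': "0 <= s0" using \<tau>_less_iff[of s0 0] a(2) s0(2) \<tau>_0 by (metis linorder_not_less)
 have \<Phi>A: "\<Phi> z \<in> ?A" if "0 <= fst z" "fst z < S" for z
  using that \<tau>_less_iff[of "fst z" 0] \<tau>_less_iff[of "fst z" S] \<tau>_0 \<tau>_S by (auto simp: \<Phi>_def)
 have zero: "\<phi> (\<Phi> z) = 0" if "s0 < fst z" "fst z < S" for z
  using a(3)[of "\<tau> (fst z)"] that \<tau>_less_iff[of s0 "fst z"] \<tau>_less_iff[of "fst z" S] s0 \<tau>_S by (auto simp: \<Phi>_def)
 have \<psi>0: "?\<psi> z = 0" if "s0 < fst z" for z using zero that by auto
 have opn: "open {z :: real \<times> (real^'n). s0 < fst z}" "open {z :: real \<times> (real^'n). fst z < S}"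
  by (auto intro!: open_Collect_less continuous_intros)
 have D0: "D w = (%_. 0)" if "a < fst w" "fst w < T" for w
 proof -
  have 1: "(\<phi> has_derivative D w) (at w)" by (rule test_pair_interior[OF tp]) (use that a in auto)
  have "(\<phi> has_derivative (%_. 0)) (at w)"
   by (rule has_derivative_transform_within_open[of "%_. 0" _ _ _ "{a<..<T} \<times> UNIV"])
     (use that a(2) a(3)[of "fst _" "snd _"] in \<open>auto intro!: open_Times simp: mem_Times_iff\<close>)
  then show ?thesis using has_derivative_unique[OF 1] by blast
 qed
 have E0: "?E z w = 0" if "s0 < fst z" for z w
  using that D0[of "\<Phi> z"] \<tau>_less_iff[of s0 "fst z"] \<tau>_less_iff[of "fst z" S] s0 \<tau>_S by (auto simp: \<Phi>_def)
 show ?thesis unfolding test_pair_def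
 proof (intro conjI ballI allI)
  fix z assume z: "z \<in> ?A"
  show "(?\<psi> has_derivative ?E z) (at z within ?A)"
  proof (cases "fst z < S")
   case True
   have "((%z. \<phi> (\<Phi> z)) has_derivative (%w. D (\<Phi> z) (D\<Phi> z w))) (at z within {0..<S} \<times> UNIV)"
   proof (rule has_derivative_in_compose2[where t="?A" and g=\<phi> and g'=D])
    show "(\<phi> has_derivative D w) (at w within ?A)" if "w \<in> ?A" for w
     by (rule test_pairD(1)[OF tp that])
    show "\<Phi> ` ({0..<S} \<times> UNIV) \<subseteq> ?A" by (intro image_subsetI \<Phi>A) (auto simp: mem_Times_iff)
    show "z \<in> {0..<S} \<times> UNIV" using True z by (cases z) auto
    show "(\<Phi> has_derivative D\<Phi> z) (at z within {0..<S} \<times> UNIV)" by (rule has_derivative_at_withinI[OF \<Phi>_der])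
   qed
   also have "at z within {0..<S} \<times> UNIV = at z within ?A"
    by (rule at_within_nhd[of _ "{z. fst z < S}"]) (use True opn S_le in auto)
   finally have "((%z. \<phi> (\<Phi> z)) has_derivative ?E z) (at z within ?A)" using True by simp
   then show ?thesis
    by (rule has_derivative_transform_within_open[of _ _ _ _ "{z. fst z < S}"]) (use True opn z in auto)
  next
   case False
   then have E: "?E z = (%_. 0)" by auto
   show ?thesis unfolding E
    by (rule has_derivative_transform_within_open[of "%_. 0" _ _ _ "{z. s0 < fst z}"])
      (use False opn z s0 \<psi>0 in \<open>auto simp del: if_splits\<close>)
  qed
 next
  fix w
  let ?U1 = "{z. fst z < S} \<inter> ?A" and ?U2 = "{z. s0 < fst z} \<inter> ?A"
  \<comment> \<open>The relatively open sets \<open>?U1\<close> and \<open>?U2\<close> overlap in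
    the times between \<open>s0\<close> and \<open>S\<close>, where the derivative is zero on both
    accounts.\<close>
  have A: "?A = ?U1 \<union> ?U2" using s0 by auto
  have "continuous_on (?U1 \<union> ?U2) (%z. ?E z w)"
  proof (rule continuous_on_Un_local_open)
   show "openin (top_of_set (?U1 \<union> ?U2)) ?U1" unfolding A[symmetric]
    using opn(2) by (auto simp: openin_open intro!: exI[of _ "{z. fst z < S}"])
   show "openin (top_of_set (?U1 \<union> ?U2)) ?U2" unfolding A[symmetric]
    using opn(1) by (auto simp: openin_open intro!: exI[of _ "{z. s0 < fst z}"])
   show "continuous_on ?U2 (%z. ?E z w)"
    by (rule continuous_on_eq[of _ "%_. 0"]) (use E0 in auto)
   have Dc: "continuous_on ?U1 (%z. D (\<Phi> z) u)" for u
    by (rule continuous_on_compose2[of ?A "%z. D z u"]) (use test_pairD(2)[OF tp] \<Phi>A \<Phi>_cont in \<open>auto simp: mem_Times_iff image_subset_iff\<close>)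
   have "continuous_on ?U1 (%z. D (\<Phi> z) (D\<Phi> z w))"
   proof (rule continuous_on_eq)
    show "continuous_on ?U1 (%z. fst (D\<Phi> z w) * D (\<Phi> z) (1, 0) + (\<Sum>j\<in>UNIV. snd (D\<Phi> z w) $ j * D (\<Phi> z) (0, axis j 1)))"
     unfolding D\<Phi>_def
     by (intro continuous_intros Dc) (auto intro!: continuous_intros continuous_on_compose2[OF \<tau>'_cont] continuous_on_subset[OF DY_cont])
    show "fst (D\<Phi> z w) * D (\<Phi> z) (1, 0) + (\<Sum>j\<in>UNIV. snd (D\<Phi> z w) $ j * D (\<Phi> z) (0, axis j 1)) = D (\<Phi> z) (D\<Phi> z w)" if "z \<in> ?U1" for z
     using linear_pair_expand[OF test_pair_linear[OF tp, of "\<Phi> z"], of "fst (D\<Phi> z w)" "snd (D\<Phi> z w)"] \<Phi>A[of z] that by auto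
   qed
   then show "continuous_on ?U1 (%z. ?E z w)" by (rule continuous_on_eq) auto
  qed
  then show "continuous_on ?A (%z. ?E z w)" using A by simp
 next
  fix t assume t: "t \<in> {0..<T}"
  show "periodic (%x. ?\<psi> (t, x))" unfolding periodic_def
  proof (intro allI ballI)
   fix x k assume k: "(k :: real^'n) \<in> lattice"
   show "?\<psi> (t, x + k) = ?\<psi> (t, x)"
   proof (cases "t < S")
    case True
    have "fst (\<Phi> (t, x)) \<in> {0..<T}" using \<Phi>A[of "(t, x)"] True t by auto
    then have "\<phi> (fst (\<Phi> (t, x)), snd (\<Phi> (t, x)) + k) = \<phi> (fst (\<Phi> (t, x)), snd (\<Phi> (t, x)))"
     using tp k unfolding test_pair_def periodic_def by blast
    then have "\<phi> (\<Phi> (t, x) + (0, k)) = \<phi> (\<Phi> (t, x))" by (simp add: plus_prod_def)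
    then show ?thesis by (simp add: \<Phi>_add_lattice[OF k])
   qed simp
  qed
 next
  show "\<exists>a<T. \<forall>t\<in>{0..<T}. a < t --> (\<forall>x. ?\<psi> (t, x) = 0)"
   using zero s0(1) S_le by (intro exI[of _ s0]) auto
 qed
qed

text \<open>Substituting \<open>\<Phi>\<close> into the weak equation turns it into the equation for
  \<open>(m, v)\<close> with the pulled-back test function; the part of the flow after time
  \<open>S\<close> is thereby discarded. The initial datum is kept because \<open>\<Phi>\<close>
  fixes time 0 pointwise.\<close>

lemma weak_sol_transport:
 assumes ws: "weak_sol T \<rho> m v"
 shows "weak_sol T \<rho> (tm m) (tv v)"
proof -
 have [measurable]: "m \<in> borel_fun" "v \<in> borel_fun" and m0: "!!z. 0 <= m z"
  and per: "tperiodic m" "tperiodic v" and im: "integrable (cyl 0 T) m"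
  using weak_solD[OF ws] by auto
 have tp': "tperiodic (tm m)" "tperiodic (tv v)"
 proof -
  show "tperiodic (tm m)" unfolding tm_def[abs_def]
   by (rule tperiodic_\<Phi>i[OF tperiodic_comp2[OF per(1) J_per]])
  have "tperiodic (%z. (1 / \<tau>' (fst z)) *\<^sub>R V v z)" using V_per[OF per(2)] by (simp add: tperiodic_def)
  from tperiodic_\<Phi>i[OF this] show "tperiodic (tv v)" unfolding tv_def[abs_def] .
 qed
 have [measurable]: "tm m \<in> borel_fun" "tv v \<in> borel_fun"
  unfolding tm_def[abs_def] tv_def[abs_def] by measurable
 have nz: "\<tau>' s \<noteq> 0" "J z \<noteq> 0" for s z using \<tau>'_pos[of s] J_pos'[of z] by auto
 show ?thesis unfolding weak_sol_def
 proof (intro conjI allI impI tp')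
  show "0 <= tm m z" for z using m0 J_pos' by (simp add: tm_def less_imp_le)
  have "integrable (cyl 0 S) (%z. \<tau>' (fst z) * m z)"
  proof -
   have "compact (\<tau>' ` {0..S})" by (intro compact_continuous_image continuous_on_subset[OF \<tau>'_cont]) auto
   then obtain B where B: "!!s. s \<in> {0..S} ==> \<bar>\<tau>' s\<bar> <= B"
    using compact_imp_bounded bounded_iff by (metis (no_types, lifting) image_eqI real_norm_def)
   show ?thesis
    by (rule integrable_cyl_bounded_mult[where B=B]) (use B integrable_cyl_subset[OF im] S_le in auto)
  qed
  then show "integrable (cyl 0 T) (tm m)"
   by (subst real_transport(1)) (auto simp: tp' tm_\<Phi> nz)
  have "integrable (cyl 0 S) (%z. (1 / \<tau>' (fst z)) * (m z * (norm (V v z))\<^sup>2))"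
  proof (rule integrable_cyl_bounded_mult[OF integrable_V[OF ws], where B=2])
   show "\<bar>1 / \<tau>' (fst z)\<bar> <= 2" for z using \<tau>'_ge[of "fst z"] by (simp add: divide_simps)
  qed measurable
  also have "(%z. (1 / \<tau>' (fst z)) * (m z * (norm (V v z))\<^sup>2)) = (%z. \<tau>' (fst z) * J z * (tm m (\<Phi> z) * (norm (tv v (\<Phi> z)))\<^sup>2))"
   by (auto simp: tm_\<Phi> tv_\<Phi> fun_eq_iff nz power_mult_distrib power2_eq_square divide_simps)
  finally show "integrable (cyl 0 T) (%z. tm m z * (norm (tv v z))\<^sup>2)"
   by (subst real_transport(1)) (auto intro!: tperiodic_comp2[OF tp', of "%a b. a * (norm b)\<^sup>2"])
 next
  fix \<phi> :: "real \<times> (real^'n) => real" and D assume tp: "test_pair T \<phi> D"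
  let ?E = "%z w. if fst z < S then D (\<Phi> z) (D\<Phi> z w) else 0"
  let ?D = "strip_ext T D"
  have Dm: "(%z. ?D z (1, tv v z)) \<in> borel_fun"
   by (rule strip_ext_measurable) (use test_pair_linear[OF tp] in \<open>auto intro!: continuous_on_subset[OF test_pairD(2)[OF tp]] simp: mem_Times_iff\<close>)
  have Dper: "tperiodic (%z. tm m z * ?D z (1, tv v z))"
   using tperiodicD[OF tp'(1)] tperiodicD[OF tp'(2)] test_pair_per[OF tp] by (auto simp: tperiodic_def strip_ext_def)
  have "(LINT z|cyl 0 T. tm m z * D z (1, tv v z)) = (LINT z|cyl 0 T. tm m z * ?D z (1, tv v z))"
   by (intro Bochner_Integration.integral_cong) (auto simp: strip_ext_def)
  also have "... = (LINT z|cyl 0 S. \<tau>' (fst z) * J z * (tm m (\<Phi> z) * ?D (\<Phi> z) (1, tv v (\<Phi> z))))"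
   by (rule real_transport(2)) (use Dm Dper in auto)
  also have "... = (LINT z|cyl 0 S. m z * ?E z (1, v z))"
  proof (intro Bochner_Integration.integral_cong refl)
   fix z assume "z \<in> space (cyl 0 S :: (real \<times> (real^'n)) measure)"
   then have z: "0 < fst z" "fst z < S" by auto
   then have f: "0 < fst (\<Phi> z)" "fst (\<Phi> z) < T"
    using \<tau>_less_iff[of 0 "fst z"] \<tau>_less_iff[of "fst z" S] by (auto simp: \<Phi>_def \<tau>_0 \<tau>_S)
   \<comment> \<open>\<open>D\<Phi>\<close> maps the old flow direction to \<open>\<tau>'\<close>
     times the new one, and this factor is exactly the time part of the Jacobian.\<close>
   have "D\<Phi> z (1, v z) = \<tau>' (fst z) *\<^sub>R (1, tv v (\<Phi> z))"
    by (simp add: D\<Phi>_def tv_\<Phi> V_def nz)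
   then have "D (\<Phi> z) (D\<Phi> z (1, v z)) = \<tau>' (fst z) * D (\<Phi> z) (1, tv v (\<Phi> z))"
    using linear_scale[OF test_pair_linear[OF tp, of "\<Phi> z"], of "\<tau>' (fst z)" "(1, tv v (\<Phi> z))"] f by simp
   then show "\<tau>' (fst z) * J z * (tm m (\<Phi> z) * ?D (\<Phi> z) (1, tv v (\<Phi> z))) = m z * ?E z (1, v z)"
    using z f by (simp add: strip_ext_def tm_\<Phi> nz mem_Times_iff)
  qed
  also have "... = (LINT z|cyl 0 T. indicator {0<..<S} (fst z) * (m z * ?E z (1, v z)))"
   by (rule integral_cyl_subset) (use S_le in auto)
  also have "... = (LINT z|cyl 0 T. m z * ?E z (1, v z))"
   by (intro Bochner_Integration.integral_cong) (auto simp: indicator_def)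
  finally have 1: "(LINT z|cyl 0 T. tm m z * D z (1, tv v z)) = (LINT z|cyl 0 T. m z * ?E z (1, v z))" .
  have 2: "(if fst (0, x) < S then \<phi> (\<Phi> (0, x)) else 0) = \<phi> (0, x)" for x
   using S_pos by (simp add: \<Phi>_def \<tau>_0 Y_0)
  have "(LINT z|cyl 0 T. m z * ?E z (1, v z)) + (LINT x|lebesgue_on cell. (if fst (0, x) < S then \<phi> (\<Phi> (0, x)) else 0) * \<rho> x) = 0"
   using ws test_pair_pullback[OF tp] unfolding weak_sol_def by blast
  then show "(LINT z|cyl 0 T. tm m z * D z (1, tv v z)) + (LINT x|lebesgue_on cell. \<phi> (0, x) * \<rho> x) = 0"
   unfolding 1 2 .
 qed measurable
qed

text \<open>Kinetic energy is quadratic in the velocity and the Jacobian contains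
  \<open>\<tau>'\<close> once, so one power stays in the denominator; the cost term is linear in the
  velocity and keeps none.\<close>

lemma lagr_transport:
 assumes ws: "weak_sol T \<rho> m v" and [measurable]: "G \<in> borel_fun" "p \<in> borel_fun"
  and p: "periodic p"
 defines "L \<equiv> %z. 1/2 * m z * (norm (V v z))\<^sup>2 / \<tau>' (fst z) + \<tau>' (fst z) * J z * G (m z / J z) + m z * (V v z \<bullet> p (snd (\<Phi> z)))"
 shows "integrable (cyl 0 T) (lagr G p (tm m) (tv v)) \<longleftrightarrow> integrable (cyl 0 S) L"
  and "(LINT z|cyl 0 T. lagr G p (tm m) (tv v) z) = (LINT z|cyl 0 S. L z)"
  and "integrable (cyl 0 T) (%z. G (tm m z)) \<longleftrightarrow> integrable (cyl 0 S) (%z. \<tau>' (fst z) * J z * G (m z / J z))"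
proof -
 have nz: "\<tau>' s \<noteq> 0" "J z \<noteq> 0" for s z using \<tau>'_pos[of s] J_pos'[of z] by auto
 have ws': "weak_sol T \<rho> (tm m) (tv v)" by (rule weak_sol_transport[OF ws])
 have [measurable]: "tm m \<in> borel_fun" "tv v \<in> borel_fun" using ws' by (auto simp: weak_sol_def)
 have M: "lagr G p (tm m) (tv v) \<in> borel_fun" unfolding lagr_def[abs_def] by measurable
 have P: "tperiodic (lagr G p (tm m) (tv v))"
  using ws' p by (auto simp: weak_sol_def tperiodic_def lagr_def periodic_def)
 have L: "(%z. \<tau>' (fst z) * J z * lagr G p (tm m) (tv v) (\<Phi> z)) = L"
  unfolding L_def lagr_def tm_\<Phi> tv_\<Phi>
  by (auto simp: fun_eq_iff nz power_mult_distrib power2_eq_square field_simps)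
 show "integrable (cyl 0 T) (lagr G p (tm m) (tv v)) \<longleftrightarrow> integrable (cyl 0 S) L"
  unfolding real_transport(1)[OF M P] L ..
 show "(LINT z|cyl 0 T. lagr G p (tm m) (tv v) z) = (LINT z|cyl 0 S. L z)"
  unfolding real_transport(2)[OF M P] L ..
 show "integrable (cyl 0 T) (%z. G (tm m z)) \<longleftrightarrow> integrable (cyl 0 S) (%z. \<tau>' (fst z) * J z * G (m z / J z))"
  by (subst real_transport(1)) (use ws' in \<open>auto simp: tm_\<Phi> weak_sol_def tperiodic_def\<close>)
qed

end

section \<open>Evolution of averages\<close>

lemma integral_cong_except_two:
 fixes f g :: "real => real"
 assumes "f \<in> borel_fun" "g \<in> borel_fun" "!!s. s \<noteq> a ==> s \<noteq> b ==> f s = g s"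
 shows "(LINT s|lborel. f s) = (LINT s|lborel. g s)" "integrable lborel f ==> integrable lborel g"
proof -
 have "AE s in lborel. f s = g s"
  using AE_lborel_singleton[of a] AE_lborel_singleton[of b] by eventually_elim (use assms(3) in blast)
 then show "(LINT s|lborel. f s) = (LINT s|lborel. g s)" "integrable lborel f ==> integrable lborel g"
  using assms(1,2) by (auto intro: integral_cong_AE integrable_cong_AE_imp)
qed

text \<open>A set of full measure meets every nonempty open interval. The endpoints are included so
  that values at 0 and \<open>T\<close> can be reached as limits.\<close>

lemma AE_dense_sequence:
 fixes T :: real
 assumes "AE t in lborel. t \<in> {0<..<T} --> P t" "0 < T" "t \<in> {0..T}"
 shows "\<exists>s. (\<forall>n::nat. s n \<in> {0<..<T} \<and> P (s n)) \<and> s \<longlonglongrightarrow> t"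
proof -
 have "\<exists>s. s \<in> {0<..<T} \<and> P s \<and> \<bar>s - t\<bar> < inverse (real (Suc n))" for n
 proof (rule ccontr)
  let ?e = "inverse (real (Suc n))"
  define lo hi where "lo = max 0 (t - ?e)" and "hi = min T (t + ?e)"
  let ?I = "{lo<..<hi}"
  assume "\<not> ?thesis"
  then have "s \<notin> ?I" if "s \<in> {0<..<T} --> P s" for s using that by (auto simp: abs_less_iff not_less lo_def hi_def)
  then have "AE s in lborel. s \<notin> ?I" using assms(1) by (auto elim: eventually_mono)
  then have "emeasure lborel ?I = 0" using AE_iff_null_sets[of ?I lborel] by (auto dest: null_setsD1)
  moreover have "lo < hi" proof -
   have "0 < ?e" by simp
   with assms(2,3) show ?thesis unfolding lo_def hi_def max_def min_def atLeastAtMost_iff by (smt (verit))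
  qed
  ultimately show False by simp
 qed
 then obtain s where s: "!!n. s n \<in> {0<..<T} \<and> P (s n)" "!!n. \<bar>s n - t\<bar> < inverse (real (Suc n))" by metis
 have "s \<longlonglongrightarrow> t"
 proof (rule LIM_zero_cancel, rule tendsto_rabs_zero_cancel)
  show "(%n. \<bar>s n - t\<bar>) \<longlonglongrightarrow> 0"
   by (rule tendsto_sandwich[OF _ _ tendsto_const LIMSEQ_inverse_real_of_nat])
     (use s(2) in \<open>auto simp: less_imp_le\<close>)
 qed
 then show ?thesis using s(1) by blast
qed

text \<open>The fundamental lemma of the calculus of variations. Trapezoids converging to the
  indicator of \<open>{0<..<x}\<close> show that the integrals of \<open>h\<close> over all initial
  intervals vanish.\<close>

lemma AE_zero_of_continuous_tests:
 fixes h :: "real => real"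
 assumes int: "integrable lborel (%t. indicator {0<..<T} t * h t)" and T: "0 < T"
  and test: "!!\<kappa> a b. continuous_on UNIV \<kappa> ==> 0 < a ==> b < T ==> (!!t. t \<notin> {a..b} ==> \<kappa> t = 0) ==>
   (LINT t|lborel. indicator {0<..<T} t * (\<kappa> t * h t)) = 0"
 shows "AE t in lborel. t \<in> {0<..<T} --> h t = 0"
proof -
 define h0 where "h0 t = indicator {0<..<T} t * h t" for t
 have ih0: "integrable lborel h0" using int by (simp add: h0_def[abs_def])
 then have [measurable]: "h0 \<in> borel_fun" by auto
 have key0: "(LINT t|lborel. indicator {0<..<x} t * h0 t) = 0" if x: "x <= T" for x
 proof -
  \<comment> \<open>The trapezoid is zero up to distance \<open>1 / Suc n\<close> from 0 and
    \<open>x\<close> and rises to 1 over the same length again, so its support stays inside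
    \<open>{0<..<T}\<close>.\<close>
  define \<kappa> where "\<kappa> n t = max 0 (min 1 (real (Suc n) * min (t - 1 / real (Suc n)) (x - 1 / real (Suc n) - t)))" for n :: nat and t :: real
  have \<kappa>b: "\<bar>\<kappa> n t\<bar> <= 1" for n t by (auto simp: \<kappa>_def max_def min_def)
  have \<kappa>c: "continuous_on UNIV (\<kappa> n)" for n unfolding \<kappa>_def by (intro continuous_intros)
  have "(%n. \<integral>t. \<kappa> n t * h0 t \<partial>lborel) \<longlonglongrightarrow> (LINT t|lborel. indicator {0<..<x} t * h0 t)"
  proof (rule integral_dominated_convergence[where w="%t. \<bar>h0 t\<bar>"])
   show "AE t in lborel. (%n. \<kappa> n t * h0 t) \<longlonglongrightarrow> indicator {0<..<x} t * h0 t"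
   proof (rule AE_I2, intro tendsto_mult tendsto_const)
    fix t
    show "(%n. \<kappa> n t) \<longlonglongrightarrow> indicator {0<..<x} t"
    proof (cases "t \<in> {0<..<x}")
     case True
     define d where "d = min t (x - t)"
     have d: "0 < d" using True by (auto simp: d_def)
     obtain N :: nat where N: "2 / d < real N" using reals_Archimedean2 by blast
     have "\<kappa> n t = 1" if "N <= n" for n
     proof -
      have "2 / d < real (Suc n)" using N that by simp
      then have "2 < real (Suc n) * d" using d by (simp add: pos_divide_less_eq)
      moreover have "real (Suc n) * (t - 1 / real (Suc n)) = real (Suc n) * t - 1"
       "real (Suc n) * (x - 1 / real (Suc n) - t) = real (Suc n) * (x - t) - 1" by (auto simp: field_simps)
      moreover have "real (Suc n) * d <= real (Suc n) * t" "real (Suc n) * d <= real (Suc n) * (x - t)"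
       by (auto simp: d_def intro!: mult_left_mono)
      ultimately have "1 <= real (Suc n) * (t - 1 / real (Suc n))" "1 <= real (Suc n) * (x - 1 / real (Suc n) - t)" by linarith+
      then show ?thesis by (auto simp: \<kappa>_def min_def max_def)
     qed
     then have "eventually (%n. \<kappa> n t = 1) sequentially" by (auto simp: eventually_sequentially)
     then show ?thesis using True by (auto intro: tendsto_eventually)
    next
     case False
     have "\<kappa> n t = 0" for n
     proof -
      have "0 <= 1 / real (Suc n)" by simp
      moreover have "t <= 0 \<or> x <= t" using False by auto
      ultimately have "t - 1 / real (Suc n) <= 0 \<or> x - 1 / real (Suc n) - t <= 0" by linarith
      then have "min (t - 1 / real (Suc n)) (x - 1 / real (Suc n) - t) <= 0" by (simp only: min_le_iff_disj)
      then have "real (Suc n) * min (t - 1 / real (Suc n)) (x - 1 / real (Suc n) - t) <= 0" by (simp add: mult_nonneg_nonpos)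
      then show ?thesis by (auto simp: \<kappa>_def max_def min_def)
     qed
     then show ?thesis using False by simp
    qed
   qed
   show "AE t in lborel. norm (\<kappa> n t * h0 t) <= \<bar>h0 t\<bar>" for n
    using \<kappa>b mult_right_mono[OF \<kappa>b, of "\<bar>h0 _\<bar>"] by (auto simp: abs_mult)
  qed (use ih0 \<kappa>c borel_measurable_continuous_onI in \<open>auto intro!: borel_measurable_times\<close>)
  moreover have "(LINT t|lborel. \<kappa> n t * h0 t) = 0" for n
  proof -
   let ?d = "1 / real (Suc n)"
   have "(LINT t|lborel. indicator {0<..<T} t * (\<kappa> n t * h t)) = 0"
   proof (rule test[OF \<kappa>c, of ?d "x - ?d"])
    show "x - ?d < T" proof -
     have "0 < ?d" by simp
     with x show ?thesis by linarith
    qed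
    show "\<kappa> n t = 0" if "t \<notin> {?d..x - ?d}" for t
    proof -
     have "min (t - ?d) (x - ?d - t) <= 0" using that by (auto simp: min_def)
     then have "real (Suc n) * min (t - ?d) (x - ?d - t) <= 0" by (simp add: mult_nonneg_nonpos)
     then show ?thesis by (auto simp: \<kappa>_def max_def min_def)
    qed
   qed simp
   then show ?thesis by (simp add: h0_def ac_simps)
  qed
  ultimately show ?thesis using LIMSEQ_unique[OF _ tendsto_const[of 0]] by simp
 qed
 have key: "(LINT t|lborel. indicator {..x} t * h0 t) = 0" for x
 proof -
  have "(LINT t|lborel. indicator {..x} t * h0 t) = (LINT t|lborel. indicator {0<..<min x T} t * h0 t)"
  proof (rule integral_cong_AE)
   show "AE t in lborel. indicator {..x} t * h0 t = indicator {0<..<min x T} t * h0 t"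
    by (rule AE_mp[OF AE_lborel_singleton[of x]]) (auto simp: indicator_def h0_def)
  qed measurable
  then show ?thesis using key0[of "min x T"] by simp
 qed
 \<comment> \<open>Equal distribution functions identify the measures whose densities are the
   positive and the negative part; these parts are never both positive, so both vanish almost
   everywhere.\<close>
 define P N where "P = density lborel (%t. ennreal (max 0 (h0 t)))" and "N = density lborel (%t. ennreal (max 0 (- h0 t)))"
 have ip: "integrable lborel (%t. max 0 (h0 t))" "integrable lborel (%t. max 0 (- h0 t))"
  using ih0 by auto
 have fin: "(\<integral>\<^sup>+t. ennreal (max 0 (h0 t)) \<partial>lborel) < \<infinity>" "(\<integral>\<^sup>+t. ennreal (max 0 (- h0 t)) \<partial>lborel) < \<infinity>"
  using ip by (simp_all add: integrable_iff_bounded)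
 have "P = N"
 proof (rule cdf_unique')
  show "finite_borel_measure P" "finite_borel_measure N"
   unfolding finite_borel_measure_def finite_borel_measure_axioms_def
   using fin by (auto intro!: finite_measureI simp: P_def N_def emeasure_density less_top)
  have eq: "cdf (density lborel (%t. ennreal (g t))) x = (LINT t|lborel. indicator {..x} t * g t)"
   if "integrable lborel g" "!!t. 0 <= g t" for g x
  proof -
   have i: "integrable lborel (%t. indicator {..x} t * g t)"
    using integrable_mult_indicator[OF _ that(1), of "{..x}"] by simp
   have [measurable]: "g \<in> borel_fun" using that by auto
   have "emeasure (density lborel (%t. ennreal (g t))) {..x} = (\<integral>\<^sup>+t. ennreal (indicator {..x} t * g t) \<partial>lborel)"
    by (subst emeasure_density) (auto simp: indicator_def intro!: nn_integral_cong)
   also have "... = ennreal (LINT t|lborel. indicator {..x} t * g t)"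
    by (rule nn_integral_eq_integral[OF i]) (auto simp: that)
   finally show ?thesis by (simp add: cdf_def measure_def integral_nonneg_AE that)
  qed
  show "cdf P = cdf N"
  proof
   fix x
   have i: "integrable lborel (%t. indicator {..x} t * max 0 (h0 t))" "integrable lborel (%t. indicator {..x} t * max 0 (- h0 t))"
    using integrable_mult_indicator[OF _ ip(1), of "{..x}"] integrable_mult_indicator[OF _ ip(2), of "{..x}"] by auto
   have "cdf P x - cdf N x = (LINT t|lborel. indicator {..x} t * max 0 (h0 t) - indicator {..x} t * max 0 (- h0 t))"
   proof -
    have "cdf P x = (LINT t|lborel. indicator {..x} t * max 0 (h0 t))" unfolding P_def by (rule eq[OF ip(1)]) simp
    moreover have "cdf N x = (LINT t|lborel. indicator {..x} t * max 0 (- h0 t))" unfolding N_def by (rule eq[OF ip(2)]) simp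
    ultimately show ?thesis using Bochner_Integration.integral_diff[OF i] by simp
   qed
   also have "... = (LINT t|lborel. indicator {..x} t * h0 t)"
    by (intro Bochner_Integration.integral_cong) (auto simp: max_def)
   finally show "cdf P x = cdf N x" using key by simp
  qed
 qed
 then have "AE t in lborel. ennreal (max 0 (h0 t)) = ennreal (max 0 (- h0 t))"
  unfolding P_def N_def by (intro sigma_finite_measure.density_unique[OF lborel.sigma_finite_measure_axioms]) auto
 then show ?thesis
  by eventually_elim (auto simp: h0_def max_def split: if_splits)
qed

definition slice :: "(real \<times> (real^'n) => real) => real => real" where
 "slice h t = (LINT x|lborel. indicator cell x * h (t, x))"

lemma integrable_slice:
 assumes "integrable (cyl a b) h"
 shows "integrable lborel (%t. indicator {a<..<b} t * slice h t)"
  and "(LINT z|cyl a b. h z) = (LINT t|lborel. indicator {a<..<b} t * slice h t)"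
  and "AE t in lborel. t \<in> {a<..<b} --> integrable lborel (%x. indicator cell x * h (t, x))"
proof -
 have i: "integrable (lborel \<Otimes>\<^sub>M lborel) (%z. indicator ({a<..<b} \<times> cell) z *\<^sub>R h z)"
  using assms unfolding integrable_cyl_iff lborel_prod .
 have ind: "indicator ({a<..<b} \<times> cell) (t, x) = (indicator {a<..<b} t * indicator cell x :: real)" for t and x :: "real^'n"
  by (auto simp: indicator_def)
 have eq: "(LINT x|lborel. indicator ({a<..<b} \<times> cell) (t, x) *\<^sub>R h (t, x)) = indicator {a<..<b} t * slice h t" for t
  unfolding ind by (simp add: slice_def mult.assoc)
 show "integrable lborel (%t. indicator {a<..<b} t * slice h t)"
  using lborel_pair.integrable_fst'[OF i] unfolding eq .
 show "(LINT z|cyl a b. h z) = (LINT t|lborel. indicator {a<..<b} t * slice h t)"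
  using lborel_pair.integral_fst'[OF i] unfolding eq integral_cyl_indicator lborel_prod by simp
 have "AE t in lborel. integrable lborel (%x. indicator ({a<..<b} \<times> cell) (t, x) *\<^sub>R h (t, x))"
  by (rule lborel_pair.AE_integrable_fst'[OF i])
 then show "AE t in lborel. t \<in> {a<..<b} --> integrable lborel (%x. indicator cell x * h (t, x))"
  by eventually_elim (auto simp: ind)
qed

section \<open>Continuously differentiable periodic functions and their averages\<close>

definition C1per :: "(real \<times> (real^'n) => real) => (real \<times> (real^'n) => real \<times> (real^'n) => real) => bool" where
 "C1per r D \<longleftrightarrow> (\<forall>z. (r has_derivative D z) (at z)) \<and> (\<forall>e. continuous_on UNIV (%z. D z e)) \<and> tperiodic r"

lemma C1perD:
 assumes "C1per r D"
 shows "(r has_derivative D z) (at z)" "continuous_on A (%z. D z e)" "tperiodic r" "continuous_on A r" "linear (D z)"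
proof -
 show d: "(r has_derivative D z) (at z)" for z using assms unfolding C1per_def by blast
 show "continuous_on A (%z. D z e)" using assms continuous_on_subset[OF _ subset_UNIV] unfolding C1per_def by blast
 show "tperiodic r" using assms unfolding C1per_def by blast
 show "continuous_on A r" using d by (meson has_derivative_continuous continuous_at_imp_continuous_on)
 show "linear (D z)" using has_derivative_linear[OF d] .
qed

lemma C1per_per:
 fixes r :: "real \<times> (real^'n) => real"
 assumes "C1per r D" shows "tperiodic D"
 unfolding tperiodic_def
proof (intro allI impI)
 fix t x k assume k: "(k::real^'n) \<in> lattice"
 have "((%z. r (z + (0, k))) has_derivative D ((t, x) + (0, k))) (at (t, x))"
  by (rule has_derivative_compose[where g=r and f="%z. z + (0, k)", THEN has_derivative_eq_rhs])
    (auto intro!: derivative_eq_intros C1perD[OF assms])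
 moreover have "(%z. r (z + (0, k))) = r" using tperiodicD[OF C1perD(3)[OF assms] k] by (auto simp: fun_eq_iff)
 ultimately show "D (t, x + k) = D (t, x)"
  using has_derivative_unique[OF _ C1perD(1)[OF assms, of "(t, x)"]] by simp
qed

lemma C1per_borel: "C1per r D ==> r \<in> borel_fun"
 by (rule borel_measurable_continuous_onI[OF C1perD(4)])

lemma C1per_measurable:
 assumes "C1per r D" and [measurable]: "u \<in> borel_fun" "a \<in> borel_fun"
 shows "(%z. D z (a z, u z)) \<in> borel_fun"
proof -
 have [measurable]: "(%z. D z w) \<in> borel_fun" for w
  by (rule borel_measurable_continuous_onI[OF C1perD(2)[OF assms(1)]])
 show "(%z. D z (a z, u z)) \<in> borel_fun"
  by (subst linear_pair_expand[OF C1perD(5)[OF assms(1)]]) measurable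
qed

lemma C1per_bound:
 assumes "C1per r D"
 shows "\<exists>B\<ge>0. \<forall>t\<in>{a..b}. \<forall>x c u. \<bar>D (t, x) (c, u)\<bar> <= B * (\<bar>c\<bar> + norm u)"
proof -
 have "\<forall>w. \<exists>B. \<forall>t\<in>{a..b}. \<forall>x. \<bar>D (t, x) w\<bar> <= B"
  using continuous_cbox_bound[OF C1perD(2)[OF assms] tperiodic_comp[OF C1per_per[OF assms]]] by blast
 then obtain B where B: "!!w t x. t \<in> {a..b} ==> \<bar>D (t, x) w\<bar> <= B w" by metis
 define C where "C = \<bar>B (1, 0)\<bar> + (\<Sum>j\<in>UNIV. \<bar>B (0, axis j 1)\<bar>)"
 have "\<bar>D (t, x) (c, u)\<bar> <= C * (\<bar>c\<bar> + norm u)" if t: "t \<in> {a..b}" for t x c u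
 proof -
  have "\<bar>D (t, x) (c, u)\<bar> <= \<bar>c\<bar> * \<bar>D (t, x) (1, 0)\<bar> + (\<Sum>j\<in>UNIV. \<bar>u $ j\<bar> * \<bar>D (t, x) (0, axis j 1)\<bar>)"
   unfolding linear_pair_expand[OF C1perD(5)[OF assms], of _ c u]
   by (rule order_trans[OF abs_triangle_ineq]) (auto simp: abs_mult intro!: order_trans[OF sum_abs])
  also have "... <= (\<bar>c\<bar> + norm u) * \<bar>B (1, 0)\<bar> + (\<Sum>j\<in>UNIV. (\<bar>c\<bar> + norm u) * \<bar>B (0, axis j 1)\<bar>)"
  proof (intro add_mono sum_mono mult_mono)
   show "\<bar>D (t, x) w\<bar> <= \<bar>B w\<bar>" for w using B[OF t, of x w] by linarith
   show "\<bar>D (t, x) w\<bar> <= \<bar>B w\<bar>" for w using B[OF t, of x w] by linarith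
   show "\<bar>u $ j\<bar> <= \<bar>c\<bar> + norm u" for j using component_le_norm_cart[of u j] by linarith
  qed auto
  also have "... = C * (\<bar>c\<bar> + norm u)" by (simp add: C_def sum_distrib_left sum_distrib_right algebra_simps)
  finally show ?thesis .
 qed
 moreover have "0 <= C" by (simp add: C_def sum_nonneg)
 ultimately show ?thesis by blast
qed

lemma weak_sol_integrable_v:
 assumes "weak_sol T \<rho> m v"
 shows "integrable (cyl 0 T) (%z. m z * norm (v z))"
proof -
 note ws[measurable] = weak_solD(1,2)[OF assms]
 have "integrable (cyl 0 T) (%z. m z + m z * (norm (v z))\<^sup>2)" using weak_solD[OF assms] by auto
 then show ?thesis
 proof (rule Bochner_Integration.integrable_bound)
  show "AE z in cyl 0 T. norm (m z * norm (v z)) <= norm (m z + m z * (norm (v z))\<^sup>2)"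
  proof (rule AE_I2)
   fix z
   have "norm (v z) <= 1 + (norm (v z))\<^sup>2" using zero_le_power2[of "norm (v z) - 1/2"] by (simp add: power2_eq_square algebra_simps)
   from mult_left_mono[OF this weak_solD(5)[OF assms, of z]]
   show "norm (m z * norm (v z)) <= norm (m z + m z * (norm (v z))\<^sup>2)"
    using weak_solD(5)[OF assms, of z] by (simp add: algebra_simps)
  qed
 qed measurable
qed

lemma weak_sol_integrable_D:
 assumes "weak_sol T \<rho> m v" "C1per r D"
 shows "integrable (cyl 0 T) (%z. m z * D z (1, v z))" "integrable (cyl 0 T) (%z. r z * m z)"
proof -
 note [measurable] = weak_solD(1,2)[OF assms(1)] C1per_borel[OF assms(2)] C1per_measurable[OF assms(2)]
 obtain B where B: "0 <= B" "!!t x c u. t \<in> {0..T} ==> \<bar>D (t, x) (c, u)\<bar> <= B * (\<bar>c\<bar> + norm u)"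
  using C1per_bound[OF assms(2)] by blast
 have "integrable (cyl 0 T) (%z. B * (m z + m z * norm (v z)))"
  using weak_solD(6)[OF assms(1)] weak_sol_integrable_v[OF assms(1)] by auto
 then show "integrable (cyl 0 T) (%z. m z * D z (1, v z))"
 proof (rule Bochner_Integration.integrable_bound)
  show "AE z in cyl 0 T. norm (m z * D z (1, v z)) <= norm (B * (m z + m z * norm (v z)))"
  proof (rule AE_I2)
   fix z assume "z \<in> space (cyl 0 T :: (real \<times> (real^'a)) measure)"
   then have "fst z \<in> {0..T}" by auto
   from mult_left_mono[OF B(2)[OF this, of "snd z" 1 "v z"] weak_solD(5)[OF assms(1), of z]]
   show "norm (m z * D z (1, v z)) <= norm (B * (m z + m z * norm (v z)))"
    using weak_solD(5)[OF assms(1), of z] B(1) by (simp add: algebra_simps abs_mult)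
  qed
 qed measurable
 obtain B' where "!!t x. t \<in> {0..T} ==> \<bar>r (t, x)\<bar> <= B'"
  using continuous_cbox_bound[OF C1perD(4,3)[OF assms(2)], of 0 T] by blast
 then show "integrable (cyl 0 T) (%z. r z * m z)"
  by (intro integrable_cyl_bounded_mult[OF weak_solD(6)[OF assms(1)], where B=B'] C1per_borel[OF assms(2)]) auto
qed

lemma test_pair_cutoff:
 assumes r: "C1per r D" and \<theta>: "!!t. (\<theta> has_real_derivative \<theta>' t) (at t)" "continuous_on UNIV \<theta>'"
  and "a < T" "!!t. a < t ==> \<theta> t = 0"
 shows "test_pair T (%z. \<theta> (fst z) * r z) (%z w. \<theta>' (fst z) * fst w * r z + \<theta> (fst z) * D z w)"
 unfolding test_pair_def
proof (intro conjI ballI allI)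
 fix z :: "real \<times> (real^'a)"
 have "((%z. \<theta> (fst z)) has_derivative (%w. \<theta>' (fst z) * fst w)) (at z)"
  by (rule has_derivative_compose[OF has_derivative_fst[OF has_derivative_ident]])
    (use \<theta>(1)[of "fst z"] in \<open>simp add: has_field_derivative_def\<close>)
 from has_derivative_mult[OF this C1perD(1)[OF r, of z]]
 have "((%z. \<theta> (fst z) * r z) has_derivative (%w. \<theta>' (fst z) * fst w * r z + \<theta> (fst z) * D z w)) (at z)"
  by (simp add: add.commute)
 then show "((%z. \<theta> (fst z) * r z) has_derivative (%w. \<theta>' (fst z) * fst w * r z + \<theta> (fst z) * D z w)) (at z within {0..<T} \<times> UNIV)"
  by (rule has_derivative_at_withinI)
next
 fix w
 have "continuous_on UNIV \<theta>" using \<theta>(1) by (meson DERIV_isCont continuous_at_imp_continuous_on)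
 then have "continuous_on ({0..<T} \<times> UNIV) (%z :: real \<times> (real^'a). \<theta> (fst z))"
  "continuous_on ({0..<T} \<times> UNIV) (%z :: real \<times> (real^'a). \<theta>' (fst z))"
  by (auto intro!: continuous_on_compose2[OF \<theta>(2)] continuous_on_compose2[of UNIV \<theta>] continuous_on_fst continuous_on_id)
 then show "continuous_on ({0..<T} \<times> UNIV) (%z. \<theta>' (fst z) * fst w * r z + \<theta> (fst z) * D z w)"
  by (intro continuous_on_add continuous_on_mult continuous_on_const C1perD(2,4)[OF r])
next
 fix t show "periodic (%x. \<theta> (fst (t, x)) * r (t, x))"
  using C1perD(3)[OF r] by (simp add: periodic_def tperiodic_def)
next
 show "\<exists>a<T. \<forall>t\<in>{0..<T}. a < t --> (\<forall>x. \<theta> (fst (t, x)) * r (t, x) = 0)"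
  using assms(4,5) by auto
qed

text \<open>The average of \<open>r\<close> against the solution at time \<open>t\<close>, written
  as the initial average plus the accumulated rate of change. For a solution it makes sense and is
  continuous at every \<open>t\<close> of \<open>{0..T}\<close>, including \<open>T\<close>, whereas
  \<open>slice\<close> carries information for almost every \<open>t\<close> only.\<close>

definition evol :: "(real^'n => real) => (real \<times> (real^'n) => real) => (real \<times> (real^'n) => real^'n) =>
  (real \<times> (real^'n) => real) => (real \<times> (real^'n) => real \<times> (real^'n) => real) => real => real" where
 "evol \<rho> m v r D t = (LINT x|lebesgue_on cell. r (0, x) * \<rho> x) + (LINT z|cyl 0 t. m z * D z (1, v z))"

lemma antiderivative_real:
 fixes \<kappa> :: "real => real"
 assumes "continuous_on UNIV \<kappa>"
 obtains K where "!!t. (K has_real_derivative \<kappa> t) (at t)"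
proof -
 have "\<exists>F. \<forall>x::real. - \<infinity> < ereal x --> ereal x < \<infinity> --> (F has_vector_derivative \<kappa> x) (at x)"
  by (rule einterval_antiderivative) (use assms in \<open>auto simp: continuous_on_eq_continuous_at\<close>)
 then show ?thesis using that by (auto simp: has_real_derivative_iff_has_vector_derivative)
qed

text \<open>Testing with \<open>(K (fst z) - K T) * r z\<close>, where \<open>K\<close> is a
  primitive of an arbitrary continuous \<open>\<kappa>\<close> supported inside
  \<open>{0<..<T}\<close>, gives the integrated balance law against every such
  \<open>\<kappa>\<close>.\<close>

lemma weak_sol_slice:
 fixes m :: "real \<times> (real^'n) => real"
 assumes ws: "weak_sol T \<rho> m v" and r: "C1per r D" and T: "0 < T"
 shows "AE t in lborel. t \<in> {0<..<T} --> slice (%z. r z * m z) t = evol \<rho> m v r D t"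
proof -
 define f g where "f = slice (%z. r z * m z)" and "g = slice (%z. m z * D z (1, v z))"
 define R0 where "R0 = (LINT x|lebesgue_on cell. r (0, x) * \<rho> x)"
 note im = weak_sol_integrable_D[OF ws r]
 have if': "integrable lborel (%t. indicator {0<..<T} t * f t)" and ig: "integrable lborel (%t. indicator {0<..<T} t * g t)"
  unfolding f_def g_def by (rule integrable_slice im)+
 define \<Lambda> where "\<Lambda> s = (LINT t|lborel. indicator {0<..<s} t * (indicator {0<..<T} t * g t))" for s
 have \<Lambda>: "evol \<rho> m v r D s = R0 + \<Lambda> s" if "s <= T" for s
 proof -
  have "(LINT z|cyl 0 s. m z * D z (1, v z)) = (LINT t|lborel. indicator {0<..<s} t * g t)"
   unfolding g_def by (rule integrable_slice(2)) (use integrable_cyl_subset[OF im(1)] that in auto)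
  also have "... = \<Lambda> s" unfolding \<Lambda>_def
   by (intro Bochner_Integration.integral_cong) (use that in \<open>auto simp: indicator_def\<close>)
  finally show ?thesis by (simp add: evol_def R0_def)
 qed
 have [measurable]: "(%t. indicator {0<..<T} t * f t) \<in> borel_fun" "(%t. indicator {0<..<T} t * g t) \<in> borel_fun"
  using if' ig by auto
 have \<Lambda>m [measurable]: "\<Lambda> \<in> borel_fun"
 proof -
  have "(%(s, t). indicator {0<..<s} t * (indicator {0<..<T} t * g t)) = (%(s, t). indicator {z. 0 < snd z \<and> snd z < fst z} (s, t) * (indicator {0<..<T} t * g t))"
   by (auto simp: indicator_def fun_eq_iff)
  also have "... \<in> borel_measurable (borel \<Otimes>\<^sub>M lborel)" by measurable
  finally show ?thesis unfolding \<Lambda>_def[abs_def] by (rule lborel.borel_measurable_lebesgue_integral)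
 qed
 have \<Lambda>b: "\<bar>\<Lambda> s\<bar> <= (LINT t|lborel. \<bar>indicator {0<..<T} t * g t\<bar>)" for s
  unfolding \<Lambda>_def
  by (rule order_trans[OF integral_abs_bound], rule integral_mono)
    (use integrable_mult_indicator[OF _ ig, of "{0<..<s}"] ig in \<open>auto simp: indicator_def\<close>)
 define h where "h t = f t - R0 - \<Lambda> t" for t
 have indint: "integrable lborel (%t. indicator {0<..<T} t :: real)" by (simp add: T less_imp_le)
 have i\<Lambda>: "integrable lborel (%t. indicator {0<..<T} t * (c t * \<Lambda> t))" if [measurable]: "c \<in> borel_fun" and c: "!!t. \<bar>c t\<bar> <= B" for c B
 proof (rule Bochner_Integration.integrable_bound[OF integrable_mult_left[OF indint, of "B * (LINT t|lborel. \<bar>indicator {0<..<T} t * g t\<bar>)"]])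
  have B0: "0 <= B" using c[of 0] by linarith
  have "\<bar>c t\<bar> * \<bar>\<Lambda> t\<bar> <= B * (LINT t|lborel. \<bar>indicator {0<..<T} t * g t\<bar>)" for t
   by (rule mult_mono[OF c \<Lambda>b B0]) auto
  then show "AE t in lborel. norm (indicator {0<..<T} t * (c t * \<Lambda> t)) <= norm (indicator {0<..<T} t * (B * (LINT t|lborel. \<bar>indicator {0<..<T} t * g t\<bar>)))"
   using B0 by (auto simp: indicator_def abs_mult intro!: AE_I2)
 qed measurable
 have "AE t in lborel. t \<in> {0<..<T} --> h t = 0"
 proof (rule AE_zero_of_continuous_tests[OF _ T])
  have "integrable lborel (%t. indicator {0<..<T} t * f t - indicator {0<..<T} t * R0 - indicator {0<..<T} t * (1 * \<Lambda> t))"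
   by (intro Bochner_Integration.integrable_diff if' integrable_mult_left indint i\<Lambda>[where B=1]) auto
  then show "integrable lborel (%t. indicator {0<..<T} t * h t)" by (simp add: h_def algebra_simps)
  fix \<kappa> :: "real => real" and a b :: real assume \<kappa>: "continuous_on UNIV \<kappa>" "0 < a" "b < T" "!!t. t \<notin> {a..b} ==> \<kappa> t = 0"
  have [measurable]: "\<kappa> \<in> borel_fun" by (rule borel_measurable_continuous_onI[OF \<kappa>(1)])
  obtain B where B: "!!t. \<bar>\<kappa> t\<bar> <= B"
  proof -
   have "compact (\<kappa> ` {a..b})" by (intro compact_continuous_image continuous_on_subset[OF \<kappa>(1)]) auto
   then obtain B where "!!t. t \<in> {a..b} ==> \<bar>\<kappa> t\<bar> <= B"
    using compact_imp_bounded bounded_iff by (metis (no_types, lifting) image_eqI real_norm_def)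
   then have "\<bar>\<kappa> t\<bar> <= max B 0" for t using \<kappa>(4)[of t] by (cases "t \<in> {a..b}") (auto simp: max_def, fastforce)
   then show ?thesis using that by blast
  qed
  obtain K where K: "!!t. (K has_real_derivative \<kappa> t) (at t)" using antiderivative_real[OF \<kappa>(1)] by blast
  have KT: "K t = K T" if "b < t" for t
  proof -
   define c where "c = (b + min t T) / 2"
   have c: "b < c" "c < t" "c < T" using that \<kappa>(3) by (auto simp: c_def min_def)
   have *: "K s = K c" if cs: "c < s" for s
   proof -
    obtain \<xi> where "c < \<xi>" "\<xi> < s" "K s - K c = (s - c) * \<kappa> \<xi>" using MVT2[OF cs, of K \<kappa>] K by blast
    then show ?thesis using \<kappa>(4)[of \<xi>] c by auto
   qed
   show ?thesis using *[OF c(2)] *[OF c(3)] by simp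
  qed
  have KI: "K s - K t = (LINT x|lborel. \<kappa> x * indicator {t..s} x)" if "t <= s" for s t
   by (rule integral_FTC_Icc_real[symmetric, OF that]) (use K \<kappa>(1) in \<open>auto simp: continuous_on_eq_continuous_at\<close>)
  \<comment> \<open>Past \<open>b\<close> the primitive is constant; subtracting \<open>K T\<close>
    makes the test function vanish there, while at time 0 it leaves minus the total weight of
    \<open>\<kappa>\<close>.\<close>
  have tp: "test_pair T (%z. (K (fst z) - K T) * r z) (%z w. \<kappa> (fst z) * fst w * r z + (K (fst z) - K T) * D z w)"
   by (rule test_pair_cutoff[OF r _ \<kappa>(1) \<kappa>(3)]) (use KT K in \<open>auto intro!: derivative_eq_intros\<close>)
  have Kc: "continuous_on UNIV K" using K by (meson DERIV_isCont continuous_at_imp_continuous_on)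
  have [measurable]: "K \<in> borel_fun" by (rule borel_measurable_continuous_onI[OF Kc])
  obtain B2 where B2: "!!t. t \<in> {0..T} ==> \<bar>K t - K T\<bar> <= B2"
  proof -
   have "compact ((%t. K t - K T) ` {0..T})" by (intro compact_continuous_image continuous_intros continuous_on_subset[OF Kc]) auto
   then show ?thesis
    using that compact_imp_bounded bounded_iff by (metis (no_types, lifting) image_eqI real_norm_def)
  qed
  have i1: "integrable (cyl 0 T) (%z. \<kappa> (fst z) * (r z * m z))"
   by (rule integrable_cyl_bounded_mult[OF im(2), where B=B]) (use B in auto)
  have i2: "integrable (cyl 0 T) (%z. (K (fst z) - K T) * (m z * D z (1, v z)))"
   by (rule integrable_cyl_bounded_mult[OF im(1), where B=B2]) (use B2 in auto)
  have "0 = (LINT z|cyl 0 T. m z * (\<kappa> (fst z) * fst (1::real, v z) * r z + (K (fst z) - K T) * D z (1, v z))) + (LINT x|lebesgue_on cell. (K (fst (0::real, x)) - K T) * r (0, x) * \<rho> x)"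
   using weak_solD(8)[OF ws tp] by simp
  also have "(LINT x|lebesgue_on cell. (K (fst (0::real, x)) - K T) * r (0, x) * \<rho> x) = (K 0 - K T) * R0"
   by (simp add: R0_def mult.assoc)
  also have "(LINT z|cyl 0 T. m z * (\<kappa> (fst z) * fst (1::real, v z) * r z + (K (fst z) - K T) * D z (1, v z)))
   = (LINT z|cyl 0 T. \<kappa> (fst z) * (r z * m z) + (K (fst z) - K T) * (m z * D z (1, v z)))"
   by (intro Bochner_Integration.integral_cong) (auto simp: algebra_simps)
  also have "... = (LINT z|cyl 0 T. \<kappa> (fst z) * (r z * m z)) + (LINT z|cyl 0 T. (K (fst z) - K T) * (m z * D z (1, v z)))"
   by (rule Bochner_Integration.integral_add[OF i1 i2])
  also have "(LINT z|cyl 0 T. \<kappa> (fst z) * (r z * m z)) = (LINT t|lborel. indicator {0<..<T} t * (\<kappa> t * f t))"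
   unfolding integrable_slice(2)[OF i1] by (simp add: f_def slice_def mult.left_commute[of _ "\<kappa> _"])
  also have "(LINT z|cyl 0 T. (K (fst z) - K T) * (m z * D z (1, v z))) = (LINT t|lborel. indicator {0<..<T} t * ((K t - K T) * g t))"
   unfolding integrable_slice(2)[OF i2] by (simp add: g_def slice_def mult.left_commute[of _ "K _ - K T"])
  \<comment> \<open>\<open>K t - K T\<close> is minus the integral of \<open>\<kappa>\<close> over
    \<open>{t..T}\<close>; exchanging the integrals is an integration by parts that produces the
    primitive \<open>\<Lambda>\<close>.\<close>
  also have "... = (LINT t|lborel. (LINT s|lborel. - (indicator {0<..<T} s * \<kappa> s) * (indicator {0<..<s} t * (indicator {0<..<T} t * g t))))"
  proof (intro Bochner_Integration.integral_cong refl)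
   fix t
   show "indicator {0<..<T} t * ((K t - K T) * g t) = (LINT s|lborel. - (indicator {0<..<T} s * \<kappa> s) * (indicator {0<..<s} t * (indicator {0<..<T} t * g t)))"
   proof (cases "t \<in> {0<..<T}")
    case True
    have "(LINT s|lborel. - (indicator {0<..<T} s * \<kappa> s) * (indicator {0<..<s} t * (indicator {0<..<T} t * g t)))
     = (LINT s|lborel. - (\<kappa> s * indicator {t<..<T} s) * g t)"
     by (intro Bochner_Integration.integral_cong) (use True in \<open>auto simp: indicator_def\<close>)
    also have "... = (LINT s|lborel. - (\<kappa> s * indicator {t..T} s) * g t)"
     by (rule integral_cong_except_two[of _ _ t T]) (auto simp: indicator_def)
    also have "... = - (K T - K t) * g t" using KI[of t T] True by simp
    finally show ?thesis using True by simp
   qed simp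
  qed
  also have "... = (LINT s|lborel. (LINT t|lborel. - (indicator {0<..<T} s * \<kappa> s) * (indicator {0<..<s} t * (indicator {0<..<T} t * g t))))"
  proof (rule lborel_pair.Fubini_integral)
   let ?F = "%s t. - (indicator {0<..<T} s * \<kappa> s) * (indicator {0<..<s} t * (indicator {0<..<T} t * g t))"
   have "case_prod ?F = (%(s, t). - (indicator {0<..<T} s * \<kappa> s) * (indicator {z. 0 < snd z \<and> snd z < fst z} (s, t) * (indicator {0<..<T} t * g t)))"
    by (auto simp: indicator_def fun_eq_iff)
   also have "... \<in> borel_measurable (lborel \<Otimes>\<^sub>M lborel)" by measurable
   finally have M: "case_prod ?F \<in> borel_measurable (lborel \<Otimes>\<^sub>M lborel)" .
   have B0: "0 <= B" using B[of 0] by linarith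
   have "(\<integral>\<^sup>+z. norm (case_prod ?F z) \<partial>(lborel \<Otimes>\<^sub>M lborel)) <= (\<integral>\<^sup>+z. ennreal (indicator {0<..<T} (fst z) * B) * ennreal \<bar>indicator {0<..<T} (snd z) * g (snd z)\<bar> \<partial>(lborel \<Otimes>\<^sub>M lborel))"
   proof (intro nn_integral_mono)
    fix z :: "real \<times> real"
    have "\<bar>case_prod ?F z\<bar> <= (indicator {0<..<T} (fst z) * B) * \<bar>indicator {0<..<T} (snd z) * g (snd z)\<bar>"
     using B[of "fst z"] B0 by (cases z) (auto simp: indicator_def abs_mult intro!: mult_right_mono)
    then show "ennreal (norm (case_prod ?F z)) <= ennreal (indicator {0<..<T} (fst z) * B) * ennreal \<bar>indicator {0<..<T} (snd z) * g (snd z)\<bar>"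
     using B0 by (simp add: ennreal_mult[symmetric] ennreal_leI)
   qed
   also have "... = (\<integral>\<^sup>+s. (\<integral>\<^sup>+t. ennreal (indicator {0<..<T} s * B) * ennreal \<bar>indicator {0<..<T} t * g t\<bar> \<partial>lborel) \<partial>lborel)"
    by (subst lborel.nn_integral_fst[symmetric]) auto
   also have "... = (\<integral>\<^sup>+s. ennreal (indicator {0<..<T} s * B) \<partial>lborel) * (\<integral>\<^sup>+t. ennreal \<bar>indicator {0<..<T} t * g t\<bar> \<partial>lborel)"
    by (simp add: nn_integral_cmult nn_integral_multc)
   also have "... < \<infinity>"
   proof -
    have "(\<integral>\<^sup>+s. ennreal (indicator {0<..<T} s * B) \<partial>lborel) < \<infinity>"
    proof -
     have "(\<integral>\<^sup>+s. ennreal (indicator {0<..<T} s * B) \<partial>lborel) = (\<integral>\<^sup>+s. ennreal (norm (indicator {0<..<T} s * B)) \<partial>lborel)"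
      by (intro nn_integral_cong) (use B0 in auto)
     then show ?thesis using integrable_mult_left[OF indint, of B] unfolding integrable_iff_bounded by simp
    qed
    moreover have "(\<integral>\<^sup>+t. ennreal \<bar>indicator {0<..<T} t * g t\<bar> \<partial>lborel) < \<infinity>"
     using ig by (simp add: integrable_iff_bounded)
    ultimately show ?thesis by (simp add: ennreal_mult_less_top)
   qed
   finally show "integrable (lborel \<Otimes>\<^sub>M lborel) (case_prod ?F)"
    using M by (simp add: integrable_iff_bounded)
  qed
  also have "... = (LINT s|lborel. - (indicator {0<..<T} s * (\<kappa> s * \<Lambda> s)))"
   by (simp add: \<Lambda>_def mult.assoc)
  also have "(K 0 - K T) * R0 = - (LINT s|lborel. indicator {0<..<T} s * (\<kappa> s * R0))"
  proof -
   have "K T - K 0 = (LINT s|lborel. \<kappa> s * indicator {0..T} s)" using KI[of 0 T] T by simp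
   also have "... = (LINT s|lborel. indicator {0<..<T} s * \<kappa> s)"
    by (rule integral_cong_except_two[of _ _ 0 T]) (auto simp: indicator_def)
   finally have "(K T - K 0) * R0 = (LINT s|lborel. indicator {0<..<T} s * \<kappa> s * R0)" by simp
   then show ?thesis by (simp add: mult.assoc algebra_simps)
  qed
  finally have 0: "0 = (LINT t|lborel. indicator {0<..<T} t * (\<kappa> t * f t)) - (LINT s|lborel. indicator {0<..<T} s * (\<kappa> s * \<Lambda> s)) - (LINT s|lborel. indicator {0<..<T} s * (\<kappa> s * R0))"
   by simp
  have j1: "integrable lborel (%t. indicator {0<..<T} t * (\<kappa> t * f t))"
  proof -
   have "integrable lborel (%t. indicator {0<..<T} t * slice (%z. \<kappa> (fst z) * (r z * m z)) t)" by (rule integrable_slice(1)[OF i1])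
   then show ?thesis by (simp add: f_def slice_def mult.left_commute[of _ "\<kappa> _"])
  qed
  have j3: "integrable lborel (%t. indicator {0<..<T} t * (\<kappa> t * R0))"
  proof -
   have "integrable lborel (%t. \<kappa> t * indicator {0..T} t * R0)"
    by (intro integrable_mult_left) (use borel_integrable_atLeastAtMost[of 0 T \<kappa>] \<kappa>(1) in \<open>auto simp: continuous_on_eq_continuous_at\<close>)
   then show ?thesis by (rule integral_cong_except_two(2)[of _ _ 0 T, rotated -1]) (auto simp: indicator_def)
  qed
  have "(LINT t|lborel. indicator {0<..<T} t * (\<kappa> t * h t)) = (LINT t|lborel. indicator {0<..<T} t * (\<kappa> t * f t) - indicator {0<..<T} t * (\<kappa> t * \<Lambda> t) - indicator {0<..<T} t * (\<kappa> t * R0))"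
   by (intro Bochner_Integration.integral_cong) (auto simp: h_def algebra_simps)
  also have "... = 0" using j1 i\<Lambda>[of \<kappa> B] j3 B 0 by (simp)
  finally show "(LINT t|lborel. indicator {0<..<T} t * (\<kappa> t * h t)) = 0" .
 qed
 then show ?thesis by eventually_elim (auto simp: h_def f_def \<Lambda>)
qed

lemma evol_tendsto:
 fixes m :: "real \<times> (real^'n) => real"
 assumes ws: "weak_sol T \<rho> m v" and r: "C1per r D" and s: "!!n. s n \<in> {0..T}" "s \<longlonglongrightarrow> t" "t \<in> {0..T}"
 shows "(%n. evol \<rho> m v r D (s n)) \<longlonglongrightarrow> evol \<rho> m v r D t"
proof -
 have e: "evol \<rho> m v r D u = (LINT x|lebesgue_on cell. r (0, x) * \<rho> x) + (LINT z|cyl 0 T. indicator {0<..<u} (fst z) * (m z * D z (1, v z)))" if "u \<in> {0..T}" for u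
  unfolding evol_def by (subst integral_cyl_subset[of 0 0 u T]) (use that in auto)
 note im = weak_sol_integrable_D(1)[OF ws r]
 have [measurable]: "(%z. m z * D z (1, v z)) \<in> borel_fun"
  using weak_solD(1,2)[OF ws] by (intro borel_measurable_times C1per_measurable[OF r]) auto
 have "(%n. \<integral>z. indicator {0<..<s n} (fst z) * (m z * D z (1, v z)) \<partial>cyl 0 T) \<longlonglongrightarrow> (LINT z|cyl 0 T. indicator {0<..<t} (fst z) * (m z * D z (1, v z)))"
 proof (rule integral_dominated_convergence[where w="%z. \<bar>m z * D z (1, v z)\<bar>"])
  have "AE x in lborel. AE y in (lborel :: (real^'n) measure). fst (x, y) \<noteq> t"
   using AE_lborel_singleton[of t] by eventually_elim auto
  then have "AE z in lborel \<Otimes>\<^sub>M (lborel :: (real^'n) measure). fst z \<noteq> t"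
   by (intro lborel_pair.AE_pair_measure) measurable
  then have "AE z in (lborel :: (real \<times> (real^'n)) measure). fst z \<noteq> t" unfolding lborel_prod .
  then have "AE z in cyl 0 T. fst (z :: real \<times> (real^'n)) \<noteq> t"
   unfolding cyl_def by (subst AE_restrict_space_iff) auto
  then show "AE z in cyl 0 T. (%n. indicator {0<..<s n} (fst z) * (m z * D z (1, v z))) \<longlonglongrightarrow> indicator {0<..<t} (fst z) * (m z * D z (1, v z))"
  proof eventually_elim
   case (elim z)
   have "eventually (%n. indicator {0<..<s n} (fst z) = (indicator {0<..<t} (fst z) :: real)) sequentially"
   proof (cases "fst z < t")
    case True
    from order_tendstoD(1)[OF s(2) this] show ?thesis by eventually_elim (use True in \<open>auto simp: indicator_def\<close>)
   next
    case False
    with elim have "t < fst z" by simp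
    from order_tendstoD(2)[OF s(2) this] show ?thesis by eventually_elim (use False in \<open>auto simp: indicator_def\<close>)
   qed
   then show ?case by (intro tendsto_mult tendsto_const) (rule tendsto_eventually)
  qed
 qed (use im in \<open>auto simp: indicator_def\<close>)
 then show ?thesis unfolding e[OF s(1)] e[OF s(3)] by (intro tendsto_intros)
qed

lemma C1per_const: "C1per (%_. c) (%_ _. 0)"
 by (auto simp: C1per_def tperiodic_def)

lemma weak_sol_mass:
 assumes ws: "weak_sol T \<rho> m v" and T: "0 < T" and \<rho>: "(LINT x|lebesgue_on cell. \<rho> x) = 1"
 shows "AE t in lborel. t \<in> {0<..<T} --> slice m t = 1"
 using weak_sol_slice[OF ws C1per_const[of 1] T] \<rho> by (simp add: evol_def)

text \<open>At almost every time the average of \<open>r\<close> is at most \<open>B\<close> in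
  absolute value because the mass is 1; continuity of \<open>evol\<close> carries this to
  \<open>T\<close>.\<close>

lemma weak_sol_bound:
 fixes m :: "real \<times> (real^'n) => real"
 assumes ws: "weak_sol T \<rho> m v" and T: "0 < T" and \<rho>: "(LINT x|lebesgue_on cell. \<rho> x) = 1"
  and r: "C1per r D" and B: "!!t x. t \<in> {0<..<T} ==> \<bar>r (t, x)\<bar> <= B"
 shows "\<bar>evol \<rho> m v r D T\<bar> <= B"
proof -
 have "AE t in lborel. t \<in> {0<..<T} --> \<bar>evol \<rho> m v r D t\<bar> <= B"
  using weak_sol_slice[OF ws r T] weak_sol_mass[OF ws T \<rho>] integrable_slice(3)[OF weak_solD(6)[OF ws]]
   integrable_slice(3)[OF weak_sol_integrable_D(2)[OF ws r]]
 proof eventually_elim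
  case (elim t)
  show ?case
  proof
   assume t: "t \<in> {0<..<T}"
   have "\<bar>evol \<rho> m v r D t\<bar> = \<bar>slice (%z. r z * m z) t\<bar>" using elim t by simp
   also have "... <= (LINT x|lborel. \<bar>indicator cell x * (r (t, x) * m (t, x))\<bar>)"
    unfolding slice_def by (rule integral_abs_bound)
   also have "... <= (LINT x|lborel. B * (indicator cell x * m (t, x)))"
   proof (rule integral_mono)
    show "\<bar>indicator cell x * (r (t, x) * m (t, x))\<bar> <= B * (indicator cell x * m (t, x))" for x
     using B[OF t, of x] weak_solD(5)[OF ws, of "(t, x)"] by (auto simp: indicator_def abs_mult intro!: mult_right_mono)
   qed (use elim t in auto)
   also have "... = B * slice m t" by (simp add: slice_def)
   finally show "\<bar>evol \<rho> m v r D t\<bar> <= B" using elim t by simp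
  qed
 qed
 from AE_dense_sequence[OF this T, of T] T obtain s where s: "!!n. s n \<in> {0<..<T} \<and> \<bar>evol \<rho> m v r D (s n)\<bar> <= B" "s \<longlonglongrightarrow> T" by auto
 have "(%n. evol \<rho> m v r D (s n)) \<longlonglongrightarrow> evol \<rho> m v r D T"
  by (rule evol_tendsto[OF ws r _ s(2)]) (use s(1) T in \<open>auto simp: less_imp_le\<close>)
 then have "(%n. \<bar>evol \<rho> m v r D (s n)\<bar>) \<longlonglongrightarrow> \<bar>evol \<rho> m v r D T\<bar>" by (rule tendsto_rabs)
 then show ?thesis by (rule LIMSEQ_le_const2) (use s in auto)
qed

section \<open>Convexity at a minimizer\<close>

text \<open>\<open>E\<close> is the size of a contribution to the energy that is Lipschitz at 0 but
  not differentiable in \<epsilon>, so that a minimum yields only approximate stationarity. Divide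
  by \<epsilon> and let it tend to 0 from either side.\<close>

lemma abs_le_of_first_order:
 fixes A B E \<epsilon>0 :: real
 assumes \<epsilon>0: "0 < \<epsilon>0" and le: "!!\<epsilon>. \<bar>\<epsilon>\<bar> < \<epsilon>0 ==> 0 <= \<epsilon> * A + \<bar>\<epsilon>\<bar> * E + \<epsilon>\<^sup>2 * B"
 shows "\<bar>A\<bar> <= E"
proof -
 have *: "0 <= s * A + E" if s: "\<bar>s\<bar> = 1" for s
 proof -
  have "eventually (%\<epsilon>. 0 <= s * A + E + \<epsilon> * B) (at_right 0)"
   unfolding eventually_at_right_field
  proof (intro exI conjI allI impI)
   fix \<epsilon> assume "0 < \<epsilon>" "\<epsilon> < \<epsilon>0"
   have ss: "s * s = 1" using s by (metis abs_mult_self_eq mult_1)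
   have "\<bar>s * \<epsilon>\<bar> = \<epsilon>" using s \<open>0 < \<epsilon>\<close> by (simp add: abs_mult)
   then have "0 <= s * \<epsilon> * A + \<epsilon> * E + (s * \<epsilon>)\<^sup>2 * B" using le[of "s * \<epsilon>"] \<open>\<epsilon> < \<epsilon>0\<close> by (simp only:)
   also have "(s * \<epsilon>)\<^sup>2 = (s * s) * (\<epsilon> * \<epsilon>)" by (simp add: power2_eq_square)
   finally have "0 <= \<epsilon> * (s * A + E + \<epsilon> * B)" unfolding ss by (simp add: algebra_simps)
   then show "0 <= s * A + E + \<epsilon> * B" using \<open>0 < \<epsilon>\<close> by (simp add: zero_le_mult_iff)
  qed (rule \<epsilon>0)
  moreover have "((%\<epsilon>. s * A + E + \<epsilon> * B) \<longlongrightarrow> s * A + E + 0 * B) (at_right 0)"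
   by (intro tendsto_intros)
  ultimately show ?thesis
   using tendsto_lowerbound[of "%\<epsilon>. s * A + E + \<epsilon> * B" "s * A + E + 0 * B" "at_right 0" 0] by simp
 qed
 from *[of 1] *[of "-1"] show ?thesis by auto
qed

section \<open>Quadratic splines as cutoffs in time\<close>

definition possq :: "real => real" where "possq s = (max 0 s)\<^sup>2"

lemma possq_der: "(possq has_real_derivative 2 * max 0 s) (at s)"
proof (cases s "0::real" rule: linorder_cases)
 case less
 have "((%_. 0) has_real_derivative 2 * max 0 s) (at s)" using less by simp
 then show ?thesis
  by (rule has_field_derivative_transform_within_open[of _ _ _ "{..<0}"]) (use less in \<open>auto simp: possq_def max_def\<close>)
next
 case greater
 have "((%s. s\<^sup>2) has_real_derivative 2 * max 0 s) (at s)" using greater by (auto intro!: derivative_eq_intros)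
 then show ?thesis
  by (rule has_field_derivative_transform_within_open[of _ _ _ "{0<..}"]) (use greater in \<open>auto simp: possq_def max_def\<close>)
next
 case equal
 have "((%h. max 0 (h::real) * (max 0 h / h)) \<longlongrightarrow> 0) (at 0)"
 proof (rule Lim_null_comparison)
  show "eventually (%h. norm (max 0 (h::real) * (max 0 h / h)) <= \<bar>h\<bar>) (at 0)"
   by (rule always_eventually) (auto simp: max_def)
  show "((%h. \<bar>h::real\<bar>) \<longlongrightarrow> 0) (at 0)" by (rule tendsto_rabs_zero) (rule tendsto_ident_at)
 qed
 then have "((%h. (possq (0 + h) - possq 0) / h) \<longlongrightarrow> 0) (at 0)"
  by (simp add: possq_def power2_eq_square)
 then show ?thesis using equal by (simp add: DERIV_def)
qed

text \<open>A C1 version of \<open>max 0 (s - a)\<close>: its slope \<open>clamp01 a k\<close>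
  climbs linearly from 0 to 1 on an interval of length \<open>1 / k\<close>. The sharp corner is
  recovered as \<open>k\<close> grows.\<close>

definition ramp :: "real => real => real => real" where
 "ramp a k s = k / 2 * (possq (s - a) - possq (s - a - 1 / k))"

definition clamp01 :: "real => real => real => real" where
 "clamp01 a k s = k * (max 0 (s - a) - max 0 (s - a - 1 / k))"

lemma possq_shift_der: "((%s. possq (s - a)) has_real_derivative 2 * max 0 (s - a)) (at s)"
proof -
 have "((%s. s - a) has_real_derivative 1) (at s)" by (auto intro!: derivative_eq_intros)
 from DERIV_chain2[of possq "2 * max 0 (s - a)" "%s. s - a" s 1, OF possq_der this] show ?thesis by simp
qed

lemma ramp_der: "(ramp a k has_real_derivative clamp01 a k s) (at s)"
proof -
 have "((%s. possq (s - a) - possq (s - (a + 1 / k))) has_real_derivative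
   2 * max 0 (s - a) - 2 * max 0 (s - (a + 1 / k))) (at s)"
  by (intro DERIV_diff possq_shift_der)
 from DERIV_cmult[OF this, of "k / 2"]
 have "(ramp a k has_real_derivative k / 2 * (2 * max 0 (s - a) - 2 * max 0 (s - (a + 1 / k)))) (at s)"
  unfolding ramp_def[abs_def] by (simp only: diff_diff_eq)
 also have "k / 2 * (2 * max 0 (s - a) - 2 * max 0 (s - (a + 1 / k))) = clamp01 a k s"
  unfolding clamp01_def diff_diff_eq by (simp add: right_diff_distrib)
 finally show ?thesis .
qed

lemma clamp01_cont: "continuous_on A (clamp01 a k)"
 unfolding clamp01_def[abs_def] by (intro continuous_intros)

lemma clamp01_alt: "0 < k ==> clamp01 a k s = (if s <= a then 0 else if s - a <= 1 / k then k * (s - a) else 1)"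
proof -
 assume k: "0 < k"
 then have "0 < 1 / k" by simp
 have "k * (s - a) - k * (s - a - 1 / k) = 1" using k by (simp add: right_diff_distrib)
 moreover from \<open>0 < 1 / k\<close> have "s <= a ==> s - a <= 1 / k" by linarith
 ultimately show ?thesis using k by (auto simp: clamp01_def max_def right_diff_distrib)
qed

lemma clamp01_range:
 assumes k: "0 < k" shows "0 <= clamp01 a k s" "clamp01 a k s <= 1"
proof -
 have "k * (s - a) <= 1" if "s - a <= 1 / k" using mult_left_mono[OF that, of k] k by simp
 then show "0 <= clamp01 a k s" "clamp01 a k s <= 1" using k by (auto simp: clamp01_alt)
qed

lemma ramp_zero: "0 < k ==> s <= a ==> ramp a k s = 0"
proof -
 assume "s <= a" "0 < k"
 moreover from this have "0 <= 1 / k" by simp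
 ultimately have "max 0 (s - a) = 0" "max 0 (s - a - 1 / k) = 0" by linarith+
 then show ?thesis by (simp add: ramp_def possq_def)
qed

lemma ramp_lip:
 assumes k: "0 < k" and "s <= t"
 shows "0 <= ramp a k t - ramp a k s" "ramp a k t - ramp a k s <= t - s"
proof -
 consider "s = t" | "s < t" using assms by linarith
 then have "0 <= ramp a k t - ramp a k s \<and> ramp a k t - ramp a k s <= t - s"
 proof cases
  case 2
  then obtain r where "ramp a k t - ramp a k s = (t - s) * clamp01 a k r"
   using MVT2[OF 2, of "ramp a k" "clamp01 a k"] ramp_der by blast
  then show ?thesis using clamp01_range[OF k, of a r] 2 by (auto simp: mult_left_le)
 qed simp
 then show "0 <= ramp a k t - ramp a k s" "ramp a k t - ramp a k s <= t - s" by auto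
qed

lemma clamp01_tendsto: "(%n. clamp01 a (real (Suc n)) s) \<longlonglongrightarrow> indicator {a<..} s"
proof (cases "a < s")
 case True
 obtain N :: nat where N: "1 / (s - a) < real N" using reals_Archimedean2 by blast
 have "clamp01 a (real (Suc n)) s = 1" if "N <= n" for n
 proof -
  define k where "k = real (Suc n)"
  have "1 / (s - a) < k" "0 < k" using N that by (auto simp: k_def)
  then have "1 / k < s - a" using True by (simp add: field_simps)
  then show ?thesis using True \<open>0 < k\<close> unfolding k_def[symmetric] by (auto simp: clamp01_alt)
 qed
 then have "eventually (%n. clamp01 a (real (Suc n)) s = 1) sequentially" by (auto simp: eventually_sequentially)
 then show ?thesis using True by (auto intro: tendsto_eventually)
next
 case False
 then show ?thesis by (simp add: clamp01_alt)
qed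

lemma ramp_top_tendsto: "a < b ==> (%n. ramp a (real (Suc n)) b) \<longlonglongrightarrow> b - a"
proof -
 assume ab: "a < b"
 have "eventually (%n. ramp a (real (Suc n)) b = b - a - 1 / 2 * (1 / real (Suc n))) sequentially"
 proof -
  obtain N :: nat where N: "1 / (b - a) < real N" using reals_Archimedean2 by blast
  have "ramp a (real (Suc n)) b = b - a - 1 / 2 * (1 / real (Suc n))" if "N <= n" for n
  proof -
   define k where "k = real (Suc n)"
   have k: "1 / (b - a) < k" "0 < k" using N that by (auto simp: k_def)
   then have "1 / k < b - a" using ab by (simp add: field_simps)
   then have "possq (b - a) - possq (b - a - 1 / k) = (b - a)\<^sup>2 - (b - a - 1 / k)\<^sup>2"
    using ab by (simp add: possq_def max_def)
   also have "... = (2 / k) * (b - a - 1 / 2 * (1 / k))"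
   proof -
    have "x\<^sup>2 - (x - y)\<^sup>2 = 2 * y * (x - 1 / 2 * y)" for x y :: real by (simp add: power2_eq_square algebra_simps)
    from this[of "b - a" "1 / k"] show ?thesis by simp
   qed
   finally show ?thesis using k unfolding k_def[symmetric] by (simp add: ramp_def)
  qed
  then show ?thesis by (auto simp: eventually_sequentially)
 qed
 moreover have "(%n. b - a - 1 / 2 * (1 / real (Suc n))) \<longlonglongrightarrow> b - a - 1 / 2 * 0"
  by (intro tendsto_intros) (use LIMSEQ_inverse_real_of_nat in \<open>simp add: inverse_eq_divide\<close>)
 ultimately show ?thesis by (simp add: tendsto_cong)
qed

text \<open>The derivative is the tent of height \<open>2 / t1\<close> over \<open>{0..t1}\<close>,
  whose area is 1; hence the rise from 0 to 1 and the slope bound \<open>2 / t1\<close>.\<close>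

definition cutoff :: "real => real => real" where
 "cutoff t1 s = 2 / t1\<^sup>2 * (possq s - 2 * possq (s - t1/2) + possq (s - t1))"

definition cutoff' :: "real => real => real" where
 "cutoff' t1 s = 4 / t1\<^sup>2 * (max 0 s - 2 * max 0 (s - t1/2) + max 0 (s - t1))"

lemma cutoff_der: "(cutoff t1 has_real_derivative cutoff' t1 s) (at s)"
proof -
 have "((%s. possq (s - 0) - 2 * possq (s - t1/2) + possq (s - t1)) has_real_derivative
   2 * max 0 (s - 0) - 2 * (2 * max 0 (s - t1/2)) + 2 * max 0 (s - t1)) (at s)"
  by (intro DERIV_add DERIV_diff DERIV_cmult possq_shift_der)
 from DERIV_cmult[OF this, of "2 / t1\<^sup>2"]
 have "(cutoff t1 has_real_derivative 2 / t1\<^sup>2 * (2 * max 0 (s - 0) - 2 * (2 * max 0 (s - t1/2)) + 2 * max 0 (s - t1))) (at s)"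
  unfolding cutoff_def[abs_def] by simp
 also have "2 / t1\<^sup>2 * (2 * max 0 (s - 0) - 2 * (2 * max 0 (s - t1/2)) + 2 * max 0 (s - t1)) = cutoff' t1 s"
 proof -
  have "q * (2 * u - 2 * (2 * v) + 2 * w) = 2 * q * (u - 2 * v + w)" for q u v w :: real by (simp add: algebra_simps)
  from this[of "2 / t1\<^sup>2"] show ?thesis by (simp add: cutoff'_def)
 qed
 finally show ?thesis .
qed

lemma cutoff'_cont: "continuous_on A (cutoff' t1)"
 unfolding cutoff'_def[abs_def] by (intro continuous_intros)

lemma cutoff_props:
 assumes "0 < t1"
 shows "cutoff t1 0 = 0" "t1 <= s ==> cutoff t1 s = 1" "t1 <= s ==> cutoff' t1 s = 0"
  "0 <= cutoff' t1 s" "cutoff' t1 s <= 2 / t1" "\<bar>cutoff t1 s\<bar> <= 1"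
proof -
 have sq: "t1\<^sup>2 > 0" using assms by simp
 show z: "cutoff t1 0 = 0" using assms by (simp add: cutoff_def possq_def max_def)
 show "cutoff t1 s = 1" if "t1 <= s" for s
 proof -
  have "possq s - 2 * possq (s - t1/2) + possq (s - t1) = t1\<^sup>2 / 2"
   using that assms by (simp add: possq_def max_def power2_eq_square algebra_simps) (simp add: field_simps)?
  then show ?thesis using sq by (simp add: cutoff_def)
 qed
 note one = this
 show "t1 <= s ==> cutoff' t1 s = 0" using assms by (simp add: cutoff'_def max_def)
 have b: "0 <= max 0 s - 2 * max 0 (s - t1/2) + max 0 (s - t1) \<and> max 0 s - 2 * max 0 (s - t1/2) + max 0 (s - t1) <= t1 / 2" for s
  using assms by (auto simp: max_def)
 show nn: "0 <= cutoff' t1 s" for s unfolding cutoff'_def using b[of s] sq by simp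
 have "cutoff' t1 s <= 4 / t1\<^sup>2 * (t1 / 2)" unfolding cutoff'_def by (rule mult_left_mono) (use b[of s] sq in auto)
 then show "cutoff' t1 s <= 2 / t1" using assms by (simp add: power2_eq_square)
 have mono: "cutoff t1 a <= cutoff t1 b" if "a <= b" for a b
  by (rule DERIV_nonneg_imp_nondecreasing[OF that]) (use cutoff_der nn in blast)
 show "\<bar>cutoff t1 s\<bar> <= 1"
 proof -
  have n: "cutoff t1 s = 0" if "s <= 0" using that assms by (simp add: cutoff_def possq_def max_def)
  show ?thesis using n mono[of 0 s] mono[of s "max s t1"] one[of "max s t1"] z by (cases "s <= 0") auto
 qed
qed

section \<open>Integrability of the weak formulation\<close>

lemma test_pair_zero:
 assumes tp: "test_pair T \<phi> D" and "0 <= a" "!!t x. t \<in> {0..<T} ==> a < t ==> \<phi> (t, x) = 0"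
  and w: "a < fst w" "fst w < T"
 shows "D w = (%_. 0)"
proof -
 have 1: "(\<phi> has_derivative D w) (at w)" by (rule test_pair_interior[OF tp]) (use w assms(2) in auto)
 have "(\<phi> has_derivative (%_. 0)) (at w)"
  by (rule has_derivative_transform_within_open[of "%_. 0" _ _ _ "{a<..<T} \<times> UNIV"])
    (use assms(2) assms(3)[of "fst _" "snd _"] w in \<open>auto intro!: open_Times simp: mem_Times_iff\<close>)
 then show ?thesis using has_derivative_unique[OF 1] by blast
qed

lemma test_pair_integrable:
 fixes m :: "real \<times> (real^'n) => real"
 assumes ws: "weak_sol T \<rho> m v" and tp: "test_pair T \<phi> D"
 shows "integrable (cyl 0 T) (%z. m z * D z (1, v z))"
proof -
 obtain a' where a': "a' < T" "!!t x. t \<in> {0..<T} ==> a' < t ==> \<phi> (t, x) = 0"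
  using test_pairD(4)[OF tp] by blast
 define a where "a = max a' 0"
 show ?thesis
 proof (cases "0 < T")
  case False
  then have "indicator ({0<..<T} \<times> cell) z *\<^sub>R (m z * D z (1, v z)) = 0" for z
   by (cases z) (auto simp: indicator_def)
  then show ?thesis unfolding integrable_cyl_iff by (simp only: integrable_zero)
 next
  case True
  have a: "a < T" "0 <= a" "!!t x. t \<in> {0..<T} ==> a < t ==> \<phi> (t, x) = 0"
   using a' True by (auto simp: a_def)
  have "\<exists>B. \<forall>z\<in>{0<..<T} \<times> cell. \<bar>D z w\<bar> <= B" for w
  proof -
   have "compact ((%z. D z w) ` ({0..a} \<times> cbox 0 1))"
    by (intro compact_continuous_image compact_Times continuous_on_subset[OF test_pairD(2)[OF tp]]) (use a in auto)
   then obtain B where B: "!!z. z \<in> {0..a} \<times> cbox 0 1 ==> \<bar>D z w\<bar> <= B"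
    using compact_imp_bounded bounded_iff by (metis (no_types, lifting) image_eqI real_norm_def)
   have "\<bar>D z w\<bar> <= max B 0" if z: "z \<in> {0<..<T} \<times> cell" for z
   proof (cases "fst z <= a")
    case True
    then have "z \<in> {0..a} \<times> cbox 0 1" using z by (auto simp: cell_def mem_box_cart less_imp_le)
    then show ?thesis using B[of z] by linarith
   next
    case False
    then show ?thesis using test_pair_zero[OF tp a(2,3), of z] z by auto
   qed
   then show ?thesis by blast
  qed
  then obtain B where B: "!!w z. z \<in> {0<..<T} \<times> cell ==> \<bar>D z w\<bar> <= B w" by metis
  have [measurable]: "(%z. strip_ext T D z w) \<in> borel_fun" for w
   by (rule strip_ext_cont_measurable) (auto intro!: continuous_on_subset[OF test_pairD(2)[OF tp]])
  note [measurable] = weak_solD(1,2)[OF ws]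
  have eb: "\<bar>strip_ext T D z w\<bar> <= B w" if "z \<in> {0<..<T} \<times> cell" for z w
   using B[OF that] that by (auto simp: strip_ext_def mem_Times_iff)
  have 1: "integrable (cyl 0 T) (%z. strip_ext T D z (1, 0) * m z)"
   by (rule integrable_cyl_bounded_mult[OF weak_solD(6)[OF ws] _ eb]) measurable
  have 2: "integrable (cyl 0 T) (%z. strip_ext T D z (0, axis j 1) * (m z * (v z $ j)))" for j
  proof (rule integrable_cyl_bounded_mult[OF _ _ eb])
   show "integrable (cyl 0 T) (%z. m z * (v z $ j))"
    by (rule Bochner_Integration.integrable_bound[OF weak_sol_integrable_v[OF ws]])
      (use weak_solD(5)[OF ws] in \<open>auto simp: abs_mult intro!: AE_I2 mult_left_mono component_le_norm_cart\<close>)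
  qed measurable
  have "integrable (cyl 0 T) (%z. strip_ext T D z (1, 0) * m z + (\<Sum>j\<in>UNIV. strip_ext T D z (0, axis j 1) * (m z * (v z $ j))))"
   using 1 2 by auto
  then show ?thesis
  proof (rule Bochner_Integration.integrable_cong[THEN iffD1, rotated -1])
   fix z assume "z \<in> space (cyl 0 T :: (real \<times> (real^'n)) measure)"
   then have z: "0 < fst z" "fst z < T" by auto
   show "strip_ext T D z (1, 0) * m z + (\<Sum>j\<in>UNIV. strip_ext T D z (0, axis j 1) * (m z * (v z $ j))) = m z * D z (1, v z)"
    using linear_pair_expand[OF test_pair_linear[OF tp, of z], of 1 "v z"] z
    by (simp add: strip_ext_def mem_Times_iff sum_distrib_left algebra_simps)
  qed simp
 qed
qed

text \<open>\<open>G\<close> and \<open>J\<close> are real valued here; the theorem enters with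
  versions made constant on negative arguments. \<open>c / 4\<close> is the constant of
  \<open>convexity_gap\<close>, and the growth condition has the form produced by
  \<open>linear_growth\<close>, with an error proportional to \<open>a\<close>. The initial cost is
  common to all competitors, so minimality is stated for the bulk energy alone.\<close>

locale minimizer =
 fixes T c L :: real and \<rho> \<Psi> :: "real^'n => real" and p :: "real^'n => real^'n"
  and G J :: "real => real" and m :: "real \<times> (real^'n) => real" and v :: "real \<times> (real^'n) => real^'n"
  and Cg a0 :: real
 assumes T: "0 < T" and c: "0 < c" and \<rho>: "(LINT x|lebesgue_on cell. \<rho> x) = 1"
  and \<Psi>_per: "periodic \<Psi>" and \<Psi>_der: "!!x. (\<Psi> has_derivative (%h. h \<bullet> p x)) (at x)"
  and p_lip: "!!x y. norm (p x - p y) <= L * norm (x - y)" and L: "0 <= L"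
  and G_meas [measurable]: "G \<in> borel_fun" and G_nonneg: "!!s. 0 <= s ==> 0 <= G s"
  and G_mono: "!!s t. 0 <= s ==> s <= t ==> G s <= G t"
  and J_cont: "continuous_on UNIV J"
  and G_J: "!!s t. 0 <= s ==> 0 <= t ==> c / 4 * (J s - J t)\<^sup>2 <= G s / 2 + G t / 2 - G ((s + t) / 2)"
  and growth: "0 < a0" "0 <= Cg" "!!s a. 0 <= s ==> 0 <= a ==> a <= a0 ==> G ((1 + a) * s) <= G s + Cg * a * (G s + 1)"
  and ws: "weak_sol T \<rho> m v" and int_G: "integrable (cyl 0 T) (%z. G (m z))"
  and minimal: "!!m' v'. weak_sol T \<rho> m' v' ==> integrable (cyl 0 T) (%z. G (m' z)) ==>
   (LINT z|cyl 0 T. lagr G p m v z) <= (LINT z|cyl 0 T. lagr G p m' v' z)"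
begin

definition "F m' v' = (LINT z|cyl 0 T. lagr G p m' v' z)"

lemma J_meas [measurable]: "J \<in> borel_fun"
 by (rule borel_measurable_continuous_onI[OF J_cont])

lemma p_cont: "continuous_on A p"
proof (rule continuous_on_subset[OF lipschitz_on_continuous_on subset_UNIV])
 show "L-lipschitz_on UNIV p" using p_lip L by (intro lipschitz_onI) (auto simp: dist_norm)
qed

lemma p_meas [measurable]: "p \<in> borel_fun"
 by (rule borel_measurable_continuous_onI[OF p_cont])

lemma p_per: "periodic p"
 unfolding periodic_def
proof (intro allI ballI)
 fix x k :: "real^'n" assume k: "k \<in> lattice"
 have "((%x. \<Psi> (x + k)) has_derivative (%h. h \<bullet> p (x + k))) (at x)"
  by (rule has_derivative_compose[where g=\<Psi> and f="%x. x + k", THEN has_derivative_eq_rhs])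
    (auto intro!: derivative_eq_intros \<Psi>_der)
 moreover have "(%x. \<Psi> (x + k)) = \<Psi>" using \<Psi>_per k by (auto simp: periodic_def fun_eq_iff)
 ultimately have "(%h. h \<bullet> p (x + k)) = (%h. h \<bullet> p x)"
  using has_derivative_unique[OF _ \<Psi>_der[of x]] by simp
 then have "h \<bullet> p (x + k) = h \<bullet> p x" for h by (rule fun_cong)
 then show "p (x + k) = p x" using vector_eq_ldot by blast
qed

definition "P = L * real CARD('n) + norm (p 0)"

lemma P_bound: "norm (p x) <= P"
proof -
 have "norm (p x) = norm (p (wrap x))" using periodic_wrap[OF p_per] by simp
 also have "... <= norm (p (wrap x) - p 0) + norm (p 0)" by norm
 also have "norm (p (wrap x) - p 0) <= L * norm (wrap x - 0)" by (rule p_lip)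
 also have "norm (wrap x - 0) <= real CARD('n)"
 proof -
  have "norm (wrap x) <= (\<Sum>i\<in>UNIV. \<bar>wrap x $ i\<bar>)" by (rule norm_le_l1_cart)
  also have "... <= (\<Sum>i\<in>(UNIV :: 'n set). 1)"
   using wrap_cell[of x] by (intro sum_mono) (auto simp: cell_def less_imp_le)
  finally show ?thesis by simp
 qed
 finally show ?thesis unfolding P_def using L by (simp add: mult_left_mono)
qed

lemma P_nonneg: "0 <= P" using P_bound[of 0] norm_ge_zero order_trans by blast

lemma \<Psi>_taylor: "\<bar>\<Psi> (x + w) - \<Psi> x - p x \<bullet> w\<bar> <= L * (norm w)\<^sup>2"
proof -
 have "\<exists>s\<in>{0<..<1}. (%s::real. \<Psi> (x + s *\<^sub>R w)) 1 - (%s. \<Psi> (x + s *\<^sub>R w)) 0 = (%h. (h *\<^sub>R w) \<bullet> p (x + s *\<^sub>R w)) (1 - 0)"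
 proof (rule mvt_simple)
  show "((%s. \<Psi> (x + s *\<^sub>R w)) has_derivative (%h. (h *\<^sub>R w) \<bullet> p (x + s *\<^sub>R w))) (at s within {0..1})" for s
   by (rule has_derivative_compose[where g=\<Psi> and f="%s. x + s *\<^sub>R w", THEN has_derivative_eq_rhs])
     (auto intro!: derivative_eq_intros \<Psi>_der)
 qed simp
 then obtain s where s: "0 < s" "s < 1" "\<Psi> (x + w) - \<Psi> x = w \<bullet> p (x + s *\<^sub>R w)" by auto
 have "\<Psi> (x + w) - \<Psi> x - p x \<bullet> w = w \<bullet> (p (x + s *\<^sub>R w) - p x)"
  using s(3) by (simp add: inner_diff_right inner_commute)
 also have "\<bar>...\<bar> <= norm w * norm (p (x + s *\<^sub>R w) - p x)" by (rule Cauchy_Schwarz_ineq2)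
 also have "... <= norm w * (L * norm w)"
 proof (rule mult_left_mono)
  have "norm (p (x + s *\<^sub>R w) - p x) <= L * norm (s *\<^sub>R w)" using p_lip[of "x + s *\<^sub>R w" x] by simp
  also have "... <= L * norm w" using s L by (intro mult_left_mono) (auto simp: mult_left_le_one_le)
  finally show "norm (p (x + s *\<^sub>R w) - p x) <= L * norm w" .
 qed simp
 finally show ?thesis by (simp add: power2_eq_square ac_simps)
qed

lemmas wsD = weak_solD[OF ws]
lemmas [measurable] = weak_solD(1,2)[OF ws]

lemma lagr_integrable:
 assumes ws': "weak_sol T \<rho> m' v'" and "integrable (cyl 0 T) (%z. G (m' z))"
 shows "integrable (cyl 0 T) (lagr G p m' v')" "integrable (cyl 0 T) (%z. m' z * (v' z \<bullet> p (snd z)))"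
proof -
 note [measurable] = weak_solD(1,2)[OF ws']
 have "integrable (cyl 0 T) (%z. P * (m' z * norm (v' z)))" using weak_sol_integrable_v[OF ws'] by auto
 then show 1: "integrable (cyl 0 T) (%z. m' z * (v' z \<bullet> p (snd z)))"
 proof (rule Bochner_Integration.integrable_bound)
  show "AE z in cyl 0 T. norm (m' z * (v' z \<bullet> p (snd z))) <= norm (P * (m' z * norm (v' z)))"
  proof (rule AE_I2)
   fix z
   have "\<bar>v' z \<bullet> p (snd z)\<bar> <= norm (v' z) * P"
    by (rule order_trans[OF Cauchy_Schwarz_ineq2 mult_left_mono[OF P_bound]]) simp
   from mult_left_mono[OF this weak_solD(5)[OF ws', of z]]
   show "norm (m' z * (v' z \<bullet> p (snd z))) <= norm (P * (m' z * norm (v' z)))"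
    using P_nonneg weak_solD(5)[OF ws', of z] by (simp add: abs_mult ac_simps)
  qed
 qed measurable
 have "integrable (cyl 0 T) (%z. 1/2 * (m' z * (norm (v' z))\<^sup>2) + G (m' z) + m' z * (v' z \<bullet> p (snd z)))"
  using 1 assms(2) weak_solD(7)[OF ws'] by auto
 then show "integrable (cyl 0 T) (lagr G p m' v')" by (simp add: lagr_def[abs_def] mult.assoc)
qed

lemma midpoint_estimate:
 assumes ws': "weak_sol T \<rho> m' v'" and G': "integrable (cyl 0 T) (%z. G (m' z))"
 shows "integrable (cyl 0 T) (%z. (J (m z) - J (m' z))\<^sup>2)"
  and "c / 2 * (LINT z|cyl 0 T. (J (m z) - J (m' z))\<^sup>2) <= F m' v' - F m v"
proof -
 note ws'D = weak_solD[OF ws']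
 note [measurable] = ws'D(1,2)
 define mm where "mm z = (m z + m' z) / 2" for z
 \<comment> \<open>Where \<open>mm\<close> vanishes so do \<open>m\<close> and \<open>m'\<close>,
   and division by zero gives velocity 0; the identity \<open>mv\<close> for the momentum holds
   there as well.\<close>
 define vv where "vv z = (1 / (2 * mm z)) *\<^sub>R (m z *\<^sub>R v z + m' z *\<^sub>R v' z)" for z
 have [measurable]: "mm \<in> borel_fun" unfolding mm_def[abs_def] by measurable
 have [measurable]: "vv \<in> borel_fun" unfolding vv_def[abs_def] by measurable
 have mm0: "0 <= mm z" for z using wsD(5)[of z] ws'D(5)[of z] by (simp add: mm_def)
 have mv: "mm z *\<^sub>R vv z = (1/2) *\<^sub>R (m z *\<^sub>R v z + m' z *\<^sub>R v' z)" for z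
 proof (cases "mm z = 0")
  case True
  then have "m z = 0" "m' z = 0" using wsD(5)[of z] ws'D(5)[of z] by (auto simp: mm_def)
  then show ?thesis using True by simp
 qed (simp add: vv_def)
 have kin: "mm z * (norm (vv z))\<^sup>2 <= 1/2 * (m z * (norm (v z))\<^sup>2) + 1/2 * (m' z * (norm (v' z))\<^sup>2)" for z
 proof (cases "mm z = 0")
  case True
  then show ?thesis using wsD(5)[of z] ws'D(5)[of z] by simp
 next
  case False
  then have mp: "0 < mm z" using mm0[of z] by simp
  define a b where "a = m z" and "b = m' z"
  have ab: "0 <= a" "0 <= b" "mm z = (a + b) / 2" using wsD(5)[of z] ws'D(5)[of z] by (auto simp: a_def b_def mm_def)
  have "norm (mm z *\<^sub>R vv z) <= (a * norm (v z) + b * norm (v' z)) / 2"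
   unfolding mv using ab norm_triangle_ineq[of "m z *\<^sub>R v z" "m' z *\<^sub>R v' z"] by (simp add: a_def b_def)
  then have "(mm z * norm (vv z))\<^sup>2 <= ((a * norm (v z) + b * norm (v' z)) / 2)\<^sup>2"
   using mp by (intro power_mono) auto
  \<comment> \<open>Cauchy-Schwarz with weights \<open>a\<close> and \<open>b\<close>; the defect is
    a quarter of \<open>a * b\<close> times the squared difference of the norms.\<close>
  also have "... <= mm z * (1/2 * (a * (norm (v z))\<^sup>2) + 1/2 * (b * (norm (v' z))\<^sup>2))"
  proof -
   have "0 <= a * b * (norm (v z) - norm (v' z))\<^sup>2" using ab by simp
   then show ?thesis unfolding ab(3) by (simp add: power2_eq_square field_simps)
  qed
  finally have "mm z * (mm z * (norm (vv z))\<^sup>2) <= mm z * (1/2 * (a * (norm (v z))\<^sup>2) + 1/2 * (b * (norm (v' z))\<^sup>2))"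
   by (simp add: power2_eq_square ac_simps)
  then show ?thesis using mp by (simp add: a_def b_def)
 qed
 have ikin: "integrable (cyl 0 T) (%z. 1/2 * (m z * (norm (v z))\<^sup>2) + 1/2 * (m' z * (norm (v' z))\<^sup>2))"
  using wsD(7) ws'D(7) by auto
 have wsm: "weak_sol T \<rho> mm vv" unfolding weak_sol_def
 proof (intro conjI allI impI)
  show "tperiodic mm" using wsD(3) ws'D(3) by (simp add: tperiodic_def mm_def)
  then show "tperiodic vv" using wsD(3,4) ws'D(3,4) by (simp add: tperiodic_def vv_def)
  show "integrable (cyl 0 T) mm" unfolding mm_def[abs_def] using wsD(6) ws'D(6) by auto
  show "integrable (cyl 0 T) (%z. mm z * (norm (vv z))\<^sup>2)"
  proof (rule Bochner_Integration.integrable_bound[OF ikin])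
   show "AE z in cyl 0 T. norm (mm z * (norm (vv z))\<^sup>2) <= norm (1/2 * (m z * (norm (v z))\<^sup>2) + 1/2 * (m' z * (norm (v' z))\<^sup>2))"
   proof (rule AE_I2)
    fix z
    show "norm (mm z * (norm (vv z))\<^sup>2) <= norm (1/2 * (m z * (norm (v z))\<^sup>2) + 1/2 * (m' z * (norm (v' z))\<^sup>2))"
     using kin[of z] mult_nonneg_nonneg[OF mm0[of z] zero_le_power2[of "norm (vv z)"]] unfolding real_norm_def by linarith
   qed
  qed measurable
  fix \<phi> :: "real \<times> (real^'n) => real" and D assume tp: "test_pair T \<phi> D"
  \<comment> \<open>The weak equation is linear in density and momentum, and these are the
    quantities that are averaged.\<close>
  have "(LINT z|cyl 0 T. mm z * D z (1, vv z)) = (LINT z|cyl 0 T. 1/2 * (m z * D z (1, v z)) + 1/2 * (m' z * D z (1, v' z)))"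
  proof (intro Bochner_Integration.integral_cong refl)
   fix z assume "z \<in> space (cyl 0 T :: (real \<times> (real^'n)) measure)"
   then have lin: "linear (D z)" using test_pair_linear[OF tp, of z] by auto
   have "mm z * D z (1, vv z) = D z (mm z *\<^sub>R (1, vv z))" using linear_scale[OF lin, of "mm z" "(1, vv z)"] by simp
   also have "mm z *\<^sub>R (1::real, vv z) = (m z / 2) *\<^sub>R (1, v z) + (m' z / 2) *\<^sub>R (1, v' z)"
    using mv[of z] by (simp add: mm_def scaleR_add_right prod_eq_iff field_simps)
   also have "D z ... = 1/2 * (m z * D z (1, v z)) + 1/2 * (m' z * D z (1, v' z))"
    unfolding linear_add[OF lin] linear_scale[OF lin] by simp
   finally show "mm z * D z (1, vv z) = 1/2 * (m z * D z (1, v z)) + 1/2 * (m' z * D z (1, v' z))" .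
  qed
  also have "... = 1/2 * (LINT z|cyl 0 T. m z * D z (1, v z)) + 1/2 * (LINT z|cyl 0 T. m' z * D z (1, v' z))"
   using test_pair_integrable[OF ws tp] test_pair_integrable[OF ws' tp] by simp
  finally show "(LINT z|cyl 0 T. mm z * D z (1, vv z)) + (LINT x|lebesgue_on cell. \<phi> (0, x) * \<rho> x) = 0"
   using wsD(8)[OF tp] ws'D(8)[OF tp] by simp
 qed (use mm0 in measurable)
 have GJ: "c / 4 * (J (m z) - J (m' z))\<^sup>2 <= 1/2 * G (m z) + 1/2 * G (m' z) - G (mm z)" for z
  using G_J[OF wsD(5)[of z] ws'D(5)[of z]] by (simp add: mm_def)
 have iGG: "integrable (cyl 0 T) (%z. 1/2 * G (m z) + 1/2 * G (m' z))" using int_G G' by auto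
 have iG: "integrable (cyl 0 T) (%z. G (mm z))"
 proof (rule Bochner_Integration.integrable_bound[OF iGG])
  show "AE z in cyl 0 T. norm (G (mm z)) <= norm (1/2 * G (m z) + 1/2 * G (m' z))"
  proof (rule AE_I2)
   fix z
   have "0 <= c / 4 * (J (m z) - J (m' z))\<^sup>2" using c by simp
   then show "norm (G (mm z)) <= norm (1/2 * G (m z) + 1/2 * G (m' z))"
    using GJ[of z] G_nonneg[OF mm0[of z]] by auto
  qed
 qed measurable
 have "integrable (cyl 0 T) (%z. c / 4 * (J (m z) - J (m' z))\<^sup>2)"
 proof (rule Bochner_Integration.integrable_bound[OF iGG])
  show "AE z in cyl 0 T. norm (c / 4 * (J (m z) - J (m' z))\<^sup>2) <= norm (1/2 * G (m z) + 1/2 * G (m' z))"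
  proof (rule AE_I2)
   fix z
   have "0 <= c / 4 * (J (m z) - J (m' z))\<^sup>2" using c by simp
   then show "norm (c / 4 * (J (m z) - J (m' z))\<^sup>2) <= norm (1/2 * G (m z) + 1/2 * G (m' z))"
    using GJ[of z] G_nonneg[OF mm0[of z]] unfolding real_norm_def by linarith
  qed
 qed measurable
 from integrable_mult_right[OF this, of "4 / c"]
 show iJ: "integrable (cyl 0 T) (%z. (J (m z) - J (m' z))\<^sup>2)" using c by simp
 note il = lagr_integrable(1)[OF ws int_G] lagr_integrable(1)[OF ws' G'] lagr_integrable(1)[OF wsm iG]
 \<comment> \<open>The cost term is linear in the momentum and is averaged exactly; the kinetic term
   can only decrease, and the gain comes from \<open>G\<close>.\<close>
 have pt: "lagr G p mm vv z + c / 4 * (J (m z) - J (m' z))\<^sup>2 <= 1/2 * lagr G p m v z + 1/2 * lagr G p m' v' z" for z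
 proof -
  have "mm z * (vv z \<bullet> p (snd z)) = (mm z *\<^sub>R vv z) \<bullet> p (snd z)" by simp
  also have "... = 1/2 * (m z * (v z \<bullet> p (snd z))) + 1/2 * (m' z * (v' z \<bullet> p (snd z)))"
   unfolding mv by (simp add: inner_add_left)
  finally show ?thesis unfolding lagr_def using kin[of z] GJ[of z] by (simp add: algebra_simps)
 qed
 have "F mm vv + c / 4 * (LINT z|cyl 0 T. (J (m z) - J (m' z))\<^sup>2) = (LINT z|cyl 0 T. lagr G p mm vv z + c / 4 * (J (m z) - J (m' z))\<^sup>2)"
  unfolding F_def using il iJ by simp
 also have "... <= (LINT z|cyl 0 T. 1/2 * lagr G p m v z + 1/2 * lagr G p m' v' z)"
  by (rule integral_mono) (use il iJ pt in auto)
 also have "... = 1/2 * F m v + 1/2 * F m' v'" unfolding F_def using il by simp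
 finally show "c / 2 * (LINT z|cyl 0 T. (J (m z) - J (m' z))\<^sup>2) <= F m' v' - F m v"
  using minimal[OF wsm iG] by (simp add: F_def[symmetric])
qed

end

section \<open>Variations in space and in time\<close>

lemma C1per_add: "C1per r D ==> C1per r' D' ==> C1per (%z. r z + r' z) (%z w. D z w + D' z w)"
 unfolding C1per_def by (auto simp: tperiodic_def intro!: has_derivative_add continuous_on_add)

lemma C1per_diff: "C1per r D ==> C1per r' D' ==> C1per (%z. r z - r' z) (%z w. D z w - D' z w)"
 unfolding C1per_def by (auto simp: tperiodic_def intro!: has_derivative_diff continuous_on_diff)

lemma C1per_mult:
 assumes "C1per r D" "C1per r' D'"
 shows "C1per (%z. r z * r' z) (%z w. r z * D' z w + D z w * r' z)"
 using assms C1perD(4)[OF assms(1), of UNIV] C1perD(4)[OF assms(2), of UNIV] unfolding C1per_def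
 by (auto simp: tperiodic_def intro!: has_derivative_mult continuous_on_add continuous_on_mult)

lemma C1per_time:
 assumes "!!t. (f has_real_derivative f' t) (at t)" "continuous_on UNIV f'"
 shows "C1per (%z. f (fst z)) (%z w. f' (fst z) * fst w)"
 unfolding C1per_def
proof (intro conjI allI)
 show "((%z. f (fst z)) has_derivative (%w. f' (fst z) * fst w)) (at z)" for z
  by (rule has_derivative_compose[OF has_derivative_fst[OF has_derivative_ident]])
    (use assms(1)[of "fst z"] in \<open>simp add: has_field_derivative_def\<close>)
 show "continuous_on UNIV (%z :: real \<times> (real^'a). f' (fst z) * fst w)" for w :: "real \<times> (real^'a)"
  by (intro continuous_on_mult continuous_on_const continuous_on_compose2[OF assms(2)] continuous_on_fst continuous_on_id) auto
qed (auto simp: tperiodic_def)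

lemma cyl_mono_integral:
 fixes f :: "real \<times> (real^'n) => real"
 assumes "integrable (cyl a b) f" "integrable (cyl a b) g" "!!z. z \<in> {a<..<b} \<times> cell ==> f z <= g z"
 shows "(LINT z|cyl a b. f z) <= (LINT z|cyl a b. g z)"
 by (rule integral_mono[OF assms(1,2)]) (use assms(3) in auto)

context minimizer begin

lemma mass_cyl: "0 <= a ==> a <= T ==> (LINT z|cyl a T. m z) = T - a"
proof -
 assume a: "0 <= a" "a <= T"
 have i: "integrable (cyl a T) m" by (rule integrable_cyl_subset[OF wsD(6)]) (use a in auto)
 note [measurable] = borel_measurable_integrable[OF integrable_slice(1)[OF i]]
 have "(LINT z|cyl a T. m z) = (LINT t|lborel. indicator {a<..<T} t * slice m t)"
  by (rule integrable_slice(2)[OF i])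
 also have "... = (LINT t|lborel. indicator {a<..<T} t)"
 proof (rule integral_cong_AE)
  show "AE t in lborel. indicator {a<..<T} t * slice m t = indicator {a<..<T} t"
   using weak_sol_mass[OF ws T \<rho>] by eventually_elim (use a in \<open>auto simp: indicator_def\<close>)
  show "(%t. indicator {a<..<T} t * slice m t) \<in> borel_measurable lborel"
   using integrable_slice(1)[OF i] by auto
 qed auto
 also have "... = T - a" using a by simp
 finally show ?thesis .
qed

text \<open>The integral on the left is the total change of the average of \<open>r\<close> along
  the flow, so the size of \<open>r\<close> bounds it, whatever its derivatives. Second-order
  remainders of \<open>\<Psi>\<close> are estimated in this way, although their gradients are of
  first order only.\<close>

lemma D_bound:
 assumes r: "C1per r D" and z: "!!x. r (0, x) = 0" and B: "!!t x. t \<in> {0<..<T} ==> \<bar>r (t, x)\<bar> <= B"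
 shows "\<bar>\<integral>z. m z * D z (1, v z) \<partial>cyl 0 T\<bar> <= B"
 using weak_sol_bound[OF ws T \<rho> r B] by (simp add: evol_def z)

lemma C1per_\<Psi>:
 assumes Y: "C1per Y DY"
 shows "C1per (%z. \<Psi> (snd z + Y z *\<^sub>R axis i 1)) (%z w. (snd w + DY z w *\<^sub>R axis i 1) \<bullet> p (snd z + Y z *\<^sub>R axis i 1))"
 unfolding C1per_def
proof (intro conjI allI)
 fix z w
 have "((%z. snd z + Y z *\<^sub>R axis i 1) has_derivative (%w. snd w + DY z w *\<^sub>R axis i 1)) (at z)"
  by (intro has_derivative_add has_derivative_scaleR_left C1perD(1)[OF Y] has_derivative_snd has_derivative_ident)
 from has_derivative_compose[OF this \<Psi>_der]
 show "((%z. \<Psi> (snd z + Y z *\<^sub>R axis i 1)) has_derivative (%w. (snd w + DY z w *\<^sub>R axis i 1) \<bullet> p (snd z + Y z *\<^sub>R axis i 1))) (at z)" .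
 show "continuous_on UNIV (%z. (snd w + DY z w *\<^sub>R axis i 1) \<bullet> p (snd z + Y z *\<^sub>R axis i 1))"
  by (intro continuous_intros C1perD[OF Y] continuous_on_compose2[OF p_cont[of UNIV]]) auto
next
 show "tperiodic (%z. \<Psi> (snd z + Y z *\<^sub>R axis i 1))"
  unfolding tperiodic_def
 proof (intro allI impI)
  fix t x k assume k: "(k::real^'n) \<in> lattice"
  have "\<Psi> (x + Y (t, x) *\<^sub>R axis i 1 + k) = \<Psi> (x + Y (t, x) *\<^sub>R axis i 1)"
   using \<Psi>_per k by (simp add: periodic_def)
  then show "\<Psi> (snd (t, x + k) + Y (t, x + k) *\<^sub>R axis i 1) = \<Psi> (snd (t, x) + Y (t, x) *\<^sub>R axis i 1)"
   by (simp add: tperiodicD[OF C1perD(3)[OF Y] k]) (simp add: ac_simps)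
 qed
qed

text \<open>\<open>e0\<close> is twice the kinetic energy density. The space integral of
  \<open>g\<close> is the quantity conserved in time, and \<open>q\<close>, which is
  \<open>m\<close> times \<open>v \<bullet> (v + p)\<close>, is the density of the boundary term
  left over by a time shift.\<close>

definition "e0 z = m z * (norm (v z))\<^sup>2"
definition "g z = G (m z) - 1/2 * e0 z"
definition "q z = e0 z + m z * (v z \<bullet> p (snd z))"

lemma e0_nonneg: "0 <= e0 z" by (simp add: e0_def wsD(5))
lemma Gm_nonneg: "0 <= G (m z)" by (rule G_nonneg[OF wsD(5)])

lemma e0_meas [measurable]: "e0 \<in> borel_fun" unfolding e0_def[abs_def] by measurable
lemma g_meas [measurable]: "g \<in> borel_fun" unfolding g_def[abs_def] by measurable

lemma int_e0: "integrable (cyl 0 T) e0" unfolding e0_def[abs_def] by (rule wsD(7))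
lemma int_vp: "integrable (cyl 0 T) (%z. m z * (v z \<bullet> p (snd z)))" by (rule lagr_integrable(2)[OF ws int_G])
lemma int_g: "integrable (cyl 0 T) g" unfolding g_def[abs_def] using int_e0 int_G by auto
lemma int_q: "integrable (cyl 0 T) q" unfolding q_def[abs_def] using int_e0 int_vp by auto
lemma int_lagr: "integrable (cyl 0 T) (lagr G p m v)" by (rule lagr_integrable(1)[OF ws int_G])

lemma lagr_eq: "lagr G p m v z = 1/2 * e0 z + G (m z) + m z * (v z \<bullet> p (snd z))"
 by (simp add: lagr_def e0_def)

lemma F_min: "weak_sol T \<rho> m' v' ==> integrable (cyl 0 T) (%z. G (m' z)) ==> F m v <= F m' v'"
 unfolding F_def by (rule minimal)

text \<open>The displacement depends on time only, so densities are moved without compression and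
  \<open>G\<close> does not contribute to the excess. The rest is estimated by a symmetric second
  difference in \<delta>, in which all first-order terms cancel.\<close>

lemma space_estimate:
 assumes t1: "0 < t1" "t1 < T"
 shows "\<exists>C. \<forall>\<delta>. integrable (cyl t1 T) (%z. (J (m z) - J (m (z - (0, \<delta> *\<^sub>R axis i 1))))\<^sup>2) \<and>
  (LINT z|cyl t1 T. (J (m z) - J (m (z - (0, \<delta> *\<^sub>R axis i 1))))\<^sup>2) <= C * \<delta>\<^sup>2"
proof -
 let ?e = "axis i 1 :: real^'n"
 let ?\<zeta> = "cutoff t1" and ?\<zeta>' = "cutoff' t1"
 note cp = cutoff_props[OF t1(1)]
 define Ld where "Ld \<delta> z = 1/2 * m z * (norm (v z + (\<delta> * ?\<zeta>' (fst z)) *\<^sub>R ?e))\<^sup>2 + G (m z)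
   + m z * ((v z + (\<delta> * ?\<zeta>' (fst z)) *\<^sub>R ?e) \<bullet> p (snd z + (\<delta> * ?\<zeta> (fst z)) *\<^sub>R ?e))" for \<delta> and z :: "real \<times> (real^'n)"
 have comp: "\<exists>m' v'. weak_sol T \<rho> m' v' \<and> integrable (cyl 0 T) (%z. G (m' z)) \<and> integrable (cyl 0 T) (Ld \<delta>)
   \<and> F m' v' = (LINT z|cyl 0 T. Ld \<delta> z) \<and> (\<forall>z. t1 <= fst z --> m' z = m (z - (0, \<delta> *\<^sub>R ?e)))" for \<delta>
 proof -
  have Y: "C1per (%z :: real \<times> (real^'n). \<delta> * ?\<zeta> (fst z)) (%z w. \<delta> * ?\<zeta>' (fst z) * fst w)"
   by (rule C1per_time) (auto intro!: DERIV_cmult cutoff_der continuous_intros cutoff'_cont)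
  interpret tr: transport T T "%s. s" "%_. 1" "%z :: real \<times> (real^'n). \<delta> * ?\<zeta> (fst z)" "%z w. \<delta> * ?\<zeta>' (fst z) * fst w" i
   by (unfold_locales) (use T cp(1) C1perD[OF Y] in \<open>auto simp: cutoff_def\<close>)
  have J1: "tr.J z = 1" for z by (simp add: tr.J_def)
  have V: "tr.V v z = v z + (\<delta> * ?\<zeta>' (fst z)) *\<^sub>R ?e" for z by (simp add: tr.V_def)
  have Phi: "tr.\<Phi> z = (fst z, snd z + (\<delta> * ?\<zeta> (fst z)) *\<^sub>R ?e)" for z by (simp add: tr.\<Phi>_def)
  note w = tr.weak_sol_transport[OF ws]
  note l = tr.lagr_transport[OF ws G_meas p_meas p_per]
  have Gi: "integrable (cyl 0 T) (%z. G (tr.tm m z))"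
   unfolding l(3) using int_G by (simp add: J1)
  have "integrable (cyl 0 T) (Ld \<delta>)"
   using lagr_integrable(1)[OF w Gi] unfolding l(1) by (simp add: J1 V Phi Ld_def[abs_def])
  moreover have "F (tr.tm m) (tr.tv v) = (LINT z|cyl 0 T. Ld \<delta> z)"
   unfolding F_def l(2) by (simp add: J1 V Phi Ld_def)
  moreover have "tr.tm m z = m (z - (0, \<delta> *\<^sub>R ?e))" if "t1 <= fst z" for z
  proof -
   have "tr.\<Phi> (z - (0, \<delta> *\<^sub>R ?e)) = z" using cp(2)[OF that] by (simp add: Phi prod_eq_iff)
   then have "tr.\<Phi>i z = z - (0, \<delta> *\<^sub>R ?e)" by (metis tr.\<Phi>i_\<Phi>)
   then show ?thesis by (simp add: tr.tm_def J1)
  qed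
  ultimately show ?thesis using w Gi by blast
 qed
 define Z where "Z = (2 / t1)\<^sup>2"
 \<comment> \<open>By minimality the competitor for \<open>-\<delta>\<close> has nonnegative excess
   as well; adding it bounds the excess for \<delta> by the second difference, and nothing has to be
   differentiated in \<delta>.\<close>
 have Fd: "(LINT z|cyl 0 T. Ld \<delta> z) - F m v <= (Z * T + 2 * L) * \<delta>\<^sup>2" for \<delta>
 proof -
  have iL: "integrable (cyl 0 T) (Ld \<delta>)" for \<delta> using comp by blast
  have Fm: "F m v <= (LINT z|cyl 0 T. Ld \<delta> z)" for \<delta>
  proof -
   obtain m' v' where "weak_sol T \<rho> m' v'" "integrable (cyl 0 T) (%z. G (m' z))" "F m' v' = (LINT z|cyl 0 T. Ld \<delta> z)"
    using comp[of \<delta>] by blast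
   then show ?thesis using F_min[of m' v'] by simp
  qed
  define r where "r \<delta> z = \<Psi> (snd z + (\<delta> * ?\<zeta> (fst z)) *\<^sub>R ?e)" for \<delta> and z :: "real \<times> (real^'n)"
  define D where "D \<delta> z w = (snd w + (\<delta> * ?\<zeta>' (fst z) * fst w) *\<^sub>R ?e) \<bullet> p (snd z + (\<delta> * ?\<zeta> (fst z)) *\<^sub>R ?e)" for \<delta> and z w :: "real \<times> (real^'n)"
  have rD: "C1per (r \<delta>) (D \<delta>)" for \<delta>
   unfolding r_def[abs_def] D_def[abs_def]
   by (rule C1per_\<Psi>, rule C1per_time) (auto intro!: DERIV_cmult cutoff_der continuous_intros cutoff'_cont)
  \<comment> \<open>The second difference of \<open>\<Psi>\<close> along the displacement: of size
    \<open>2 * L * \<delta>^2\<close>, and zero at time 0, as \<open>D_bound\<close>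
    demands.\<close>
  let ?r = "%z. (r \<delta> z - r 0 z) + (r (-\<delta>) z - r 0 z)" and ?D = "%z w. (D \<delta> z w - D 0 z w) + (D (-\<delta>) z w - D 0 z w)"
  have RD: "C1per ?r ?D" by (intro C1per_add C1per_diff rD)
  have b: "\<bar>\<integral>z. m z * ?D z (1, v z) \<partial>cyl 0 T\<bar> <= 2 * L * \<delta>\<^sup>2"
  proof (rule D_bound[OF RD])
   show "(r \<delta> (0, x) - r 0 (0, x)) + (r (-\<delta>) (0, x) - r 0 (0, x)) = 0" for x by (simp add: r_def cp(1))
   fix t x
   define w where "w = (\<delta> * ?\<zeta> t) *\<^sub>R ?e"
   have "norm w <= \<bar>\<delta>\<bar> * 1" using mult_left_mono[OF cp(6)[of t], of "\<bar>\<delta>\<bar>"] by (simp add: w_def abs_mult norm_axis_1)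
   then have w2: "L * (norm w)\<^sup>2 <= L * \<delta>\<^sup>2" using L power_mono[of "norm w" "\<bar>\<delta>\<bar>" 2] by (intro mult_left_mono) auto
   have "\<bar>(\<Psi> (x + w) - \<Psi> x) + (\<Psi> (x + - w) - \<Psi> x)\<bar> <= 2 * (L * \<delta>\<^sup>2)"
    using \<Psi>_taylor[of x w] \<Psi>_taylor[of x "-w"] w2 by simp
   then show "\<bar>(r \<delta> (t, x) - r 0 (t, x)) + (r (-\<delta>) (t, x) - r 0 (t, x))\<bar> <= 2 * L * \<delta>\<^sup>2"
    by (simp add: r_def w_def)
  qed
  have sq: "(norm (u + a *\<^sub>R ?e))\<^sup>2 + (norm (u - a *\<^sub>R ?e))\<^sup>2 - 2 * (norm u)\<^sup>2 = 2 * a\<^sup>2" for u :: "real^'n" and a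
   unfolding power2_norm_eq_inner
   by (simp add: inner_add_left inner_add_right inner_diff_left inner_diff_right inner_axis_axis inner_commute) (simp add: power2_eq_square)
  have pt: "Ld \<delta> z + Ld (-\<delta>) z - 2 * lagr G p m v z = (\<delta>\<^sup>2 * (?\<zeta>' (fst z))\<^sup>2) * m z + m z * ?D z (1, v z)" for z
  proof -
   define w where "w = \<delta> * ?\<zeta>' (fst z)"
   define n0 n1 n2 where "n0 = (norm (v z))\<^sup>2" and "n1 = (norm (v z + w *\<^sub>R ?e))\<^sup>2" and "n2 = (norm (v z - w *\<^sub>R ?e))\<^sup>2"
   define A B C where "A = (v z + w *\<^sub>R ?e) \<bullet> p (snd z + (\<delta> * ?\<zeta> (fst z)) *\<^sub>R ?e)"
    and "B = (v z - w *\<^sub>R ?e) \<bullet> p (snd z - (\<delta> * ?\<zeta> (fst z)) *\<^sub>R ?e)" and "C = v z \<bullet> p (snd z)"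
   have e1: "Ld \<delta> z = 1/2 * m z * n1 + G (m z) + m z * A" by (simp add: Ld_def n1_def A_def w_def)
   have e2: "Ld (-\<delta>) z = 1/2 * m z * n2 + G (m z) + m z * B" by (simp add: Ld_def n2_def B_def w_def)
   have e3: "lagr G p m v z = 1/2 * m z * n0 + G (m z) + m z * C" by (simp add: lagr_def n0_def C_def)
   have e4: "?D z (1, v z) = (A - C) + (B - C)" by (simp add: D_def A_def B_def C_def w_def)
   have e5: "n1 = 2 * w\<^sup>2 + 2 * n0 - n2" using sq[of "v z" w] by (simp add: n0_def n1_def n2_def)
   show ?thesis unfolding e1 e2 e3 e4 e5 power_mult_distrib[symmetric] w_def[symmetric] by (simp add: algebra_simps)
  qed
  have i1: "integrable (cyl 0 T) (%z. (\<delta>\<^sup>2 * (?\<zeta>' (fst z))\<^sup>2) * m z)"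
  proof (rule integrable_cyl_bounded_mult[OF wsD(6), where B="\<delta>\<^sup>2 * Z"])
   show "(%z :: real \<times> (real^'n). \<delta>\<^sup>2 * (?\<zeta>' (fst z))\<^sup>2) \<in> borel_fun"
    by (intro borel_measurable_continuous_onI continuous_intros continuous_on_compose2[OF cutoff'_cont[of UNIV]]) auto
   show "\<bar>\<delta>\<^sup>2 * (?\<zeta>' (fst z))\<^sup>2\<bar> <= \<delta>\<^sup>2 * Z" for z :: "real \<times> (real^'n)"
    using power_mono[OF cp(5,4), of "fst z" 2] by (simp add: Z_def mult_left_mono)
  qed
  have "2 * ((LINT z|cyl 0 T. Ld \<delta> z) - F m v) <= 2 * ((LINT z|cyl 0 T. Ld \<delta> z) - F m v) + 0" by simp
  have "(LINT z|cyl 0 T. Ld \<delta> z) - F m v <= (LINT z|cyl 0 T. Ld \<delta> z) + (LINT z|cyl 0 T. Ld (-\<delta>) z) - 2 * F m v"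
   using Fm[of "-\<delta>"] by simp
  also have "... = (LINT z|cyl 0 T. Ld \<delta> z + Ld (-\<delta>) z - 2 * lagr G p m v z)"
   unfolding F_def using iL int_lagr by simp
  also have "... = (LINT z|cyl 0 T. (\<delta>\<^sup>2 * (?\<zeta>' (fst z))\<^sup>2) * m z + m z * ?D z (1, v z))" unfolding pt ..
  also have "... = (LINT z|cyl 0 T. (\<delta>\<^sup>2 * (?\<zeta>' (fst z))\<^sup>2) * m z) + (LINT z|cyl 0 T. m z * ?D z (1, v z))"
   by (rule Bochner_Integration.integral_add[OF i1 weak_sol_integrable_D(1)[OF ws RD]])
  also have "(LINT z|cyl 0 T. (\<delta>\<^sup>2 * (?\<zeta>' (fst z))\<^sup>2) * m z) <= (LINT z|cyl 0 T. (\<delta>\<^sup>2 * Z) * m z)"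
  proof (rule cyl_mono_integral[OF i1])
   show "(\<delta>\<^sup>2 * (?\<zeta>' (fst z))\<^sup>2) * m z <= (\<delta>\<^sup>2 * Z) * m z" for z
    using power_mono[OF cp(5,4), of "fst z" 2] wsD(5)[of z] by (intro mult_right_mono mult_left_mono) (auto simp: Z_def)
  qed (use wsD(6) in auto)
  also have "(LINT z|cyl 0 T. (\<delta>\<^sup>2 * Z) * m z) = \<delta>\<^sup>2 * Z * T" using mass_cyl[of 0] T by simp
  finally show ?thesis using b by (simp add: algebra_simps abs_le_iff)
 qed
 have "integrable (cyl t1 T) (%z. (J (m z) - J (m (z - (0, \<delta> *\<^sub>R ?e))))\<^sup>2) \<and>
  (LINT z|cyl t1 T. (J (m z) - J (m (z - (0, \<delta> *\<^sub>R ?e))))\<^sup>2) <= 2 / c * (Z * T + 2 * L) * \<delta>\<^sup>2" for \<delta>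
 proof -
  obtain m' v' where mv: "weak_sol T \<rho> m' v'" "integrable (cyl 0 T) (%z. G (m' z))"
   "F m' v' = (LINT z|cyl 0 T. Ld \<delta> z)" "!!z. t1 <= fst z ==> m' z = m (z - (0, \<delta> *\<^sub>R ?e))"
   using comp[of \<delta>] by blast
  note me = midpoint_estimate[OF mv(1,2)]
  have i: "integrable (cyl t1 T) (%z. (J (m z) - J (m' z))\<^sup>2)" by (rule integrable_cyl_subset[OF me(1)]) (use t1 in auto)
  have "integrable (cyl t1 T) (%z. (J (m z) - J (m (z - (0, \<delta> *\<^sub>R ?e))))\<^sup>2) \<longleftrightarrow> integrable (cyl t1 T) (%z. (J (m z) - J (m' z))\<^sup>2)"
   by (rule Bochner_Integration.integrable_cong) (use mv(4) in auto)
  moreover have "(LINT z|cyl t1 T. (J (m z) - J (m (z - (0, \<delta> *\<^sub>R ?e))))\<^sup>2) <= 2 / c * (Z * T + 2 * L) * \<delta>\<^sup>2"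
  proof -
   have "(LINT z|cyl t1 T. (J (m z) - J (m (z - (0, \<delta> *\<^sub>R ?e))))\<^sup>2) = (LINT z|cyl t1 T. (J (m z) - J (m' z))\<^sup>2)"
    by (rule Bochner_Integration.integral_cong) (use mv(4) in auto)
   also have "... = (LINT z|cyl 0 T. indicator {t1<..<T} (fst z) * (J (m z) - J (m' z))\<^sup>2)"
    by (rule integral_cyl_subset) (use t1 in auto)
   also have "... <= (LINT z|cyl 0 T. (J (m z) - J (m' z))\<^sup>2)"
    by (rule cyl_mono_integral[OF integrable_cyl_bounded_mult[OF me(1), where B=1] me(1)]) (auto simp: indicator_def)
   finally have "c / 2 * (LINT z|cyl t1 T. (J (m z) - J (m (z - (0, \<delta> *\<^sub>R ?e))))\<^sup>2) <= (Z * T + 2 * L) * \<delta>\<^sup>2"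
    using me(2) Fd[of \<delta>] c unfolding mv(3) by (smt (verit) mult_left_mono divide_pos_pos)
   then show ?thesis using c by (simp add: field_simps)
  qed
  ultimately show ?thesis using i by blast
 qed
 then show ?thesis by blast
qed

text \<open>Inner variations \<open>s + \<epsilon> * \<eta> s\<close> of the clock keep each slice
  and change only the speed. Their first-order effect on the energy is the integral of
  \<open>\<eta>' * g\<close>; its vanishing is the conservation law in weak form.\<close>

lemma inner_time_variation:
 assumes \<eta>: "!!s. (\<eta> has_real_derivative \<eta>' s) (at s)" "continuous_on UNIV \<eta>'" "!!s. \<bar>\<eta>' s\<bar> <= N" "\<eta> 0 = 0" "\<eta> T = 0"
 shows "(LINT z|cyl 0 T. \<eta>' (fst z) * g z) = 0"
proof -
 have N0: "0 <= N" using \<eta>(3)[of 0] by linarith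
 have [measurable]: "\<eta>' \<in> borel_fun" by (rule borel_measurable_continuous_onI[OF \<eta>(2)])
 define A B where "A = (LINT z|cyl 0 T. \<eta>' (fst z) * g z)" and "B = N\<^sup>2 * (LINT z|cyl 0 T. e0 z)"
 have iA: "integrable (cyl 0 T) (%z. \<eta>' (fst z) * g z)"
  by (rule integrable_cyl_bounded_mult[OF int_g, where B=N]) (use \<eta>(3) in auto)
 have "\<bar>A\<bar> <= 0"
 \<comment> \<open>This range of \<epsilon> keeps the speed of the clock at least 1/2, as
   \<open>transport\<close> requires.\<close>
 proof (rule abs_le_of_first_order[of "1 / (2 * (N + 1))" _ _ B])
  show "0 < 1 / (2 * (N + 1))" using N0 by simp
  fix \<epsilon> :: real assume \<epsilon>: "\<bar>\<epsilon>\<bar> < 1 / (2 * (N + 1))"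
  have small: "\<bar>\<epsilon> * \<eta>' s\<bar> <= 1/2" for s
  proof -
   have "\<bar>\<epsilon> * \<eta>' s\<bar> <= (1 / (2 * (N + 1))) * N" unfolding abs_mult using \<epsilon> \<eta>(3) N0 by (intro mult_mono) auto
   also have "... <= 1/2" using N0 by (simp add: field_simps)
   finally show ?thesis .
  qed
  have sm: "- (1/2) <= \<epsilon> * \<eta>' s" for s using small[of s] by linarith
  interpret tr: transport T T "%s. s + \<epsilon> * \<eta> s" "%s. 1 + \<epsilon> * \<eta>' s" "%z :: real \<times> (real^'n). 0" "%z w. 0" undefined
  proof
   show "((%s. s + \<epsilon> * \<eta> s) has_real_derivative 1 + \<epsilon> * \<eta>' s) (at s)" for s
    by (intro DERIV_add DERIV_ident DERIV_cmult \<eta>)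
   show "continuous_on UNIV (%s. 1 + \<epsilon> * \<eta>' s)" by (intro continuous_intros \<eta>)
   show "1/2 <= 1 + \<epsilon> * \<eta>' s" for s using sm[of s] by linarith
  qed (use T \<eta> in \<open>auto simp: tperiodic_def\<close>)
  have J1: "tr.J z = 1" for z by (simp add: tr.J_def)
  have V: "tr.V v z = v z" for z by (simp add: tr.V_def)
  have Phi: "snd (tr.\<Phi> z) = snd z" for z by (simp add: tr.\<Phi>_def)
  note w = tr.weak_sol_transport[OF ws]
  note l = tr.lagr_transport[OF ws G_meas p_meas p_per]
  have iG': "integrable (cyl 0 T) (%z. (1 + \<epsilon> * \<eta>' (fst z)) * G (m z))"
  proof (rule integrable_cyl_bounded_mult[OF int_G, where B=2])
   show "\<bar>1 + \<epsilon> * \<eta>' (fst z)\<bar> <= 2" for z :: "real \<times> (real^'n)" using small[of "fst z"] by linarith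
  qed measurable
  then have Gi: "integrable (cyl 0 T) (%z. G (tr.tm m z))" unfolding l(3) by (simp add: J1)
  let ?L = "%z. 1/2 * m z * (norm (v z))\<^sup>2 / (1 + \<epsilon> * \<eta>' (fst z)) + (1 + \<epsilon> * \<eta>' (fst z)) * G (m z) + m z * (v z \<bullet> p (snd z))"
  have iL: "integrable (cyl 0 T) ?L"
   using lagr_integrable(1)[OF w Gi] unfolding l(1) by (simp add: J1 V Phi)
  have "F m v <= (LINT z|cyl 0 T. ?L z)"
   using F_min[OF w Gi] unfolding F_def l(2) by (simp add: J1 V Phi)
  also have "... <= (LINT z|cyl 0 T. lagr G p m v z + \<epsilon> * (\<eta>' (fst z) * g z) + (\<epsilon>\<^sup>2 * N\<^sup>2) * e0 z)"
  proof (rule cyl_mono_integral[OF iL])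
   show "integrable (cyl 0 T) (%z. lagr G p m v z + \<epsilon> * (\<eta>' (fst z) * g z) + (\<epsilon>\<^sup>2 * N\<^sup>2) * e0 z)"
    using int_lagr iA int_e0 by auto
   fix z :: "real \<times> (real^'n)"
   define x where "x = \<epsilon> * \<eta>' (fst z)"
   have x: "- (1/2) <= x" using sm by (simp add: x_def)
   have "1 <= (1 - x + 2 * x\<^sup>2) * (1 + x)"
   proof -
    have "(1 - x + 2 * x\<^sup>2) * (1 + x) = 1 + x\<^sup>2 * (1 + 2 * x)" by (simp add: power2_eq_square algebra_simps)
    then show ?thesis using x by simp
   qed
   then have "1 / (1 + x) <= 1 - x + 2 * x\<^sup>2" using x by (simp add: pos_divide_le_eq)
   also have "x\<^sup>2 <= \<epsilon>\<^sup>2 * N\<^sup>2"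
    unfolding x_def power_mult_distrib using \<eta>(3)[of "fst z"] by (intro mult_left_mono) (auto simp: abs_le_square_iff[symmetric] N0)
   finally have "1 / (1 + x) <= 1 - x + 2 * (\<epsilon>\<^sup>2 * N\<^sup>2)" by simp
   from mult_left_mono[OF this, of "1/2 * e0 z"] e0_nonneg[of z]
   have "1/2 * e0 z / (1 + x) <= 1/2 * e0 z * (1 - x + 2 * (\<epsilon>\<^sup>2 * N\<^sup>2))" by simp
   then show "?L z <= lagr G p m v z + \<epsilon> * (\<eta>' (fst z) * g z) + (\<epsilon>\<^sup>2 * N\<^sup>2) * e0 z"
    unfolding lagr_eq g_def x_def[symmetric] mult.assoc[symmetric] by (simp add: e0_def[symmetric] mult.assoc algebra_simps)
  qed
  also have "... = F m v + \<epsilon> * A + \<epsilon>\<^sup>2 * B"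
   unfolding F_def A_def B_def using int_lagr iA int_e0 by simp
  finally show "0 <= \<epsilon> * A + \<bar>\<epsilon>\<bar> * 0 + \<epsilon>\<^sup>2 * B" by simp
 qed
 then show ?thesis by (simp add: A_def)
qed

lemma clamp_integral_tendsto:
 fixes f :: "real \<times> (real^'n) => real"
 assumes "integrable (cyl 0 T) f" and [measurable]: "f \<in> borel_fun" and "0 <= a"
 shows "(%n. \<integral>z. clamp01 a (real (Suc n)) (fst z) * f z \<partial>cyl 0 T) \<longlonglongrightarrow> (LINT z|cyl a T. f z)"
proof -
 have m: "(%z :: real \<times> (real^'n). clamp01 a k (fst z)) \<in> borel_fun" for k
  by (intro borel_measurable_continuous_onI continuous_on_compose2[OF clamp01_cont[of UNIV]]) (auto intro!: continuous_intros)
 have "(%n. \<integral>z. clamp01 a (real (Suc n)) (fst z) * f z \<partial>cyl 0 T) \<longlonglongrightarrow> (LINT z|cyl 0 T. indicator {a<..} (fst z) * f z)"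
 proof (rule integral_dominated_convergence[where w="%z. \<bar>f z\<bar>"])
  show "AE z in cyl 0 T. (%n. clamp01 a (real (Suc n)) (fst z) * f z) \<longlonglongrightarrow> indicator {a<..} (fst z) * f z"
   by (intro AE_I2 tendsto_mult tendsto_const clamp01_tendsto)
  show "AE z in cyl 0 T. norm (clamp01 a (real (Suc n)) (fst z) * f z) <= \<bar>f z\<bar>" for n
   using clamp01_range[of "real (Suc n)" a] by (intro AE_I2) (auto simp: abs_mult mult_left_le_one_le)
 qed (use assms(1) m in \<open>auto intro!: borel_measurable_times borel_measurable_cyl simp del: of_nat_Suc\<close>)
 also have "(LINT z|cyl 0 T. indicator {a<..} (fst z) * f z) = (LINT z|cyl 0 T. indicator {a<..<T} (fst z) * f z)"
  by (intro Bochner_Integration.integral_cong) (auto simp: indicator_def)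
 also have "... = (LINT z|cyl a T. f z)" by (rule integral_cyl_subset[symmetric]) (use assms(3) in auto)
 finally show ?thesis .
qed

text \<open>Both weights, \<open>h * cutoff' t1\<close> and the indicator of the last
  \<open>h\<close> time units, have total mass \<open>h\<close>. The difference of their primitives
  vanishes at 0 and \<open>T\<close> and so is a clock variation, once the indicator is smoothed to
  \<open>clamp01\<close> and the factor \<open>h\<close> is adjusted to the final value of
  \<open>ramp\<close>.\<close>

lemma time_balance:
 assumes t1: "0 < t1" "t1 < T" and h: "0 < h" "h < T"
 shows "h * (LINT z|cyl 0 T. cutoff' t1 (fst z) * g z) = (LINT z|cyl (T - h) T. g z)"
proof -
 let ?a = "T - h"
 note cp = cutoff_props[OF t1(1)]
 have c'm: "(%z :: real \<times> (real^'n). cutoff' t1 (fst z)) \<in> borel_fun"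
  by (intro borel_measurable_continuous_onI continuous_on_compose2[OF cutoff'_cont[of UNIV]]) (auto intro!: continuous_intros)
 have clm: "(%z :: real \<times> (real^'n). clamp01 ?a k (fst z)) \<in> borel_fun" for k
  by (intro borel_measurable_continuous_onI continuous_on_compose2[OF clamp01_cont[of UNIV]]) (auto intro!: continuous_intros)
 have i1: "integrable (cyl 0 T) (%z. cutoff' t1 (fst z) * g z)"
  by (rule integrable_cyl_bounded_mult[OF int_g c'm, where B="2 / t1"]) (use cp(4,5) in auto)
 have i2: "0 < k ==> integrable (cyl 0 T) (%z. clamp01 ?a k (fst z) * g z)" for k
  by (rule integrable_cyl_bounded_mult[OF int_g clm, where B=1]) (use clamp01_range in auto)
 have "ramp ?a k T * (LINT z|cyl 0 T. cutoff' t1 (fst z) * g z) = (LINT z|cyl 0 T. clamp01 ?a k (fst z) * g z)" if k: "0 < k" for k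
 proof -
  have "(LINT z|cyl 0 T. (ramp ?a k T * cutoff' t1 (fst z) - clamp01 ?a k (fst z)) * g z) = 0"
  proof (rule inner_time_variation[of "%s. ramp ?a k T * cutoff t1 s - ramp ?a k s" _ "\<bar>ramp ?a k T\<bar> * (2 / t1) + 1"])
   show "((%s. ramp ?a k T * cutoff t1 s - ramp ?a k s) has_real_derivative ramp ?a k T * cutoff' t1 s - clamp01 ?a k s) (at s)" for s
    by (intro DERIV_diff DERIV_cmult cutoff_der ramp_der)
   show "continuous_on UNIV (%s. ramp ?a k T * cutoff' t1 s - clamp01 ?a k s)"
    by (intro continuous_intros cutoff'_cont clamp01_cont)
   show "\<bar>ramp ?a k T * cutoff' t1 s - clamp01 ?a k s\<bar> <= \<bar>ramp ?a k T\<bar> * (2 / t1) + 1" for s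
   proof -
    have "\<bar>ramp ?a k T * cutoff' t1 s\<bar> <= \<bar>ramp ?a k T\<bar> * (2 / t1)"
     unfolding abs_mult using cp(4,5)[of s] by (intro mult_left_mono) auto
    then show ?thesis using clamp01_range[OF k, of ?a s] by linarith
   qed
  qed (use cp(1,2) t1 h ramp_zero[OF k] in auto)
  also have "(LINT z|cyl 0 T. (ramp ?a k T * cutoff' t1 (fst z) - clamp01 ?a k (fst z)) * g z)
   = (LINT z|cyl 0 T. ramp ?a k T * (cutoff' t1 (fst z) * g z) - clamp01 ?a k (fst z) * g z)"
   by (simp add: left_diff_distrib mult.assoc)
  also have "... = ramp ?a k T * (LINT z|cyl 0 T. cutoff' t1 (fst z) * g z) - (LINT z|cyl 0 T. clamp01 ?a k (fst z) * g z)"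
   using i1 i2[OF k] by simp
  finally show ?thesis by simp
 qed
 then have eq: "(%n. ramp ?a (real (Suc n)) T * (LINT z|cyl 0 T. cutoff' t1 (fst z) * g z)) = (%n. \<integral>z. clamp01 ?a (real (Suc n)) (fst z) * g z \<partial>cyl 0 T)"
  by (intro ext) (simp del: of_nat_Suc)
 have "(%n. ramp ?a (real (Suc n)) T * (LINT z|cyl 0 T. cutoff' t1 (fst z) * g z)) \<longlonglongrightarrow> (T - ?a) * (LINT z|cyl 0 T. cutoff' t1 (fst z) * g z)"
  by (intro tendsto_mult tendsto_const ramp_top_tendsto) (use h in auto)
 moreover have "(%n. ramp ?a (real (Suc n)) T * (LINT z|cyl 0 T. cutoff' t1 (fst z) * g z)) \<longlonglongrightarrow> (LINT z|cyl ?a T. g z)"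
  unfolding eq by (rule clamp_integral_tendsto[OF int_g]) (use h in auto)
 ultimately show ?thesis using LIMSEQ_unique by fastforce
qed

end

section \<open>Time shifts up to the final time\<close>

lemma AE_cyl_fst_neq: "AE z in cyl a b. fst (z :: real \<times> (real^'n)) \<noteq> t"
proof -
 have "AE x in lborel. AE y in (lborel :: (real^'n) measure). fst (x, y) \<noteq> t"
  using AE_lborel_singleton[of t] by eventually_elim auto
 then have "AE z in lborel \<Otimes>\<^sub>M (lborel :: (real^'n) measure). fst z \<noteq> t"
  by (intro lborel_pair.AE_pair_measure) measurable
 then have "AE z in (lborel :: (real \<times> (real^'n)) measure). fst z \<noteq> t" unfolding lborel_prod .
 then show ?thesis unfolding cyl_def by (subst AE_restrict_space_iff) auto
qed

lemma integral_cyl_split: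
 fixes f :: "real \<times> (real^'n) => real"
 assumes "integrable (cyl a b) f" "a <= t" "t <= b"
 shows "(LINT z|cyl a b. f z) = (LINT z|cyl a t. f z) + (LINT z|cyl t b. f z)"
proof -
 have i: "integrable (cyl a b) (%z. indicator {c<..<d} (fst z) * f z)" for c d
  by (rule integrable_cyl_bounded_mult[OF assms(1), where B=1]) (auto simp: indicator_def)
 have "(LINT z|cyl a t. f z) + (LINT z|cyl t b. f z)
   = (LINT z|cyl a b. indicator {a<..<t} (fst z) * f z + indicator {t<..<b} (fst z) * f z)"
  using assms(2,3) i by (simp add: integral_cyl_subset[of a a t b f] integral_cyl_subset[of a t b b f])
 also have "... = (LINT z|cyl a b. f z)"
 proof (rule integral_cong_AE)
  have "AE z in cyl a b. z \<in> space (cyl a b :: (real \<times> (real^'n)) measure)" by (rule AE_space)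
  with AE_cyl_fst_neq[of t a b] show "AE z in cyl a b. indicator {a<..<t} (fst z) * f z + indicator {t<..<b} (fst z) * f z = f z"
   by eventually_elim (auto simp: indicator_def)
 qed (use assms(1) i in \<open>auto intro!: borel_measurable_add borel_measurable_integrable\<close>)
 finally show ?thesis by simp
qed

lemma volume_cyl: "a <= b ==> (LINT z|(cyl a b :: (real \<times> (real^'n)) measure). 1) = b - a"
 and integrable_cyl_one: "integrable (cyl a b :: (real \<times> (real^'n)) measure) (%_. c :: real)"
proof -
 interpret finite_measure "cyl a b :: (real \<times> (real^'n)) measure" by (rule finite_measure_cyl)
 show "integrable (cyl a b :: (real \<times> (real^'n)) measure) (%_. c :: real)" by (rule integrable_const)
 assume ab: "a <= b"
 have "integrable (cyl a b :: (real \<times> (real^'n)) measure) (%_. 1 :: real)" by (rule integrable_const)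
 from integrable_slice(2)[OF this]
 have "(LINT z|(cyl a b :: (real \<times> (real^'n)) measure). 1) = (LINT t|lborel. indicator {a<..<b} t * slice (%_ :: real \<times> (real^'n). 1) t)" .
 also have "... = b - a" using ab by (simp add: slice_def measure_def emeasure_cell)
 finally show "(LINT z|(cyl a b :: (real \<times> (real^'n)) measure). 1) = b - a" .
qed

context minimizer begin

text \<open>Expansion of the speed factor: \<open>1 / (1 + x)\<close> is at most
  \<open>1 - x + 2 * x^2\<close> as long as \<open>x >= -1/2\<close>. The linear term in
  \<open>x\<close> multiplies exactly \<open>g\<close>.\<close>

lemma scaled_lagr_le:
 assumes x: "- (1/2) <= x" "x\<^sup>2 <= B"
 shows "1/2 * m z * (norm (v z))\<^sup>2 / (1 + x) + (1 + x) * G (m z) + m z * (v z \<bullet> p (snd z))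
  <= lagr G p m v z + x * g z + B * e0 z"
proof -
 have "1 <= (1 - x + 2 * x\<^sup>2) * (1 + x)"
 proof -
  have "(1 - x + 2 * x\<^sup>2) * (1 + x) = 1 + x\<^sup>2 * (1 + 2 * x)" by (simp add: power2_eq_square algebra_simps)
  then show ?thesis using x by simp
 qed
 then have "1 / (1 + x) <= 1 - x + 2 * x\<^sup>2" using x by (simp add: pos_divide_le_eq)
 also have "... <= 1 - x + 2 * B" using x(2) by simp
 finally have "1 / (1 + x) <= 1 - x + 2 * B" .
 from mult_left_mono[OF this, of "1/2 * e0 z"] e0_nonneg[of z]
 have "1/2 * e0 z / (1 + x) <= 1/2 * e0 z * (1 - x + 2 * B)" by simp
 then show ?thesis
  unfolding lagr_eq g_def mult.assoc[symmetric] by (simp add: e0_def[symmetric] mult.assoc algebra_simps)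
qed

text \<open>The clock \<open>s + h * cutoff t1 s\<close> delays the flow by \<open>h\<close> after
  \<open>t1\<close>, and what happened in the last \<open>h\<close> time units is lost. Stretching
  costs \<open>h\<close> times the integral of \<open>cutoff' t1\<close> against \<open>g\<close>,
  which by \<open>time_balance\<close> is the integral of \<open>g\<close> over the lost layer;
  subtracting the energy of that layer leaves \<open>- q\<close>. The bound
  \<open>h <= t1 / 4\<close> controls the speed, and \<open>h <= T - t1\<close> makes the delay
  complete at \<open>T - h\<close>.\<close>

lemma time_shift_energy:
 assumes t1: "0 < t1" "t1 < T" and h: "0 < h" "h <= t1 / 4" "h <= T - t1"
 shows "\<exists>m' v'. weak_sol T \<rho> m' v' \<and> integrable (cyl 0 T) (%z. G (m' z)) \<and>
  (\<forall>z. t1 + h <= fst z --> m' z = m (z - (h, 0))) \<and>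
  F m' v' - F m v <= (2 / t1)\<^sup>2 * (LINT z|cyl 0 T. e0 z) * h\<^sup>2 - (LINT z|cyl (T - h) T. q z)"
proof -
 let ?\<zeta> = "cutoff t1" and ?\<zeta>' = "cutoff' t1" and ?S = "T - h"
 note cp = cutoff_props[OF t1(1)]
 have small: "0 <= h * ?\<zeta>' s \<and> h * ?\<zeta>' s <= 1/2" for s
 proof -
  have "h * ?\<zeta>' s <= (t1 / 4) * (2 / t1)" using h cp(4,5)[of s] by (intro mult_mono) auto
  then show ?thesis using t1 h cp(4)[of s] by simp
 qed
 have c'm: "(%z :: real \<times> (real^'n). ?\<zeta>' (fst z)) \<in> borel_fun"
  by (intro borel_measurable_continuous_onI continuous_on_compose2[OF cutoff'_cont[of UNIV]]) (auto intro!: continuous_intros)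
 note [measurable] = this
 interpret tr: transport ?S T "%s. s + h * ?\<zeta> s" "%s. 1 + h * ?\<zeta>' s" "%z :: real \<times> (real^'n). 0" "%z w. 0" undefined
 proof
  show "((%s. s + h * ?\<zeta> s) has_real_derivative 1 + h * ?\<zeta>' s) (at s)" for s
   by (intro DERIV_add DERIV_ident DERIV_cmult cutoff_der)
  show "continuous_on UNIV (%s. 1 + h * ?\<zeta>' s)" by (intro continuous_intros cutoff'_cont)
  show "1/2 <= 1 + h * ?\<zeta>' s" for s using small[of s] by linarith
  show "T - h + h * ?\<zeta> (T - h) = T" using cp(2)[of "T - h"] h by simp
 qed (use t1 h cp(1) in \<open>auto simp: tperiodic_def\<close>)
 have J1: "tr.J z = 1" for z by (simp add: tr.J_def)
 have V: "tr.V v z = v z" for z by (simp add: tr.V_def)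
 have Phi: "tr.\<Phi> z = (fst z + h * ?\<zeta> (fst z), snd z)" for z by (simp add: tr.\<Phi>_def)
 note w = tr.weak_sol_transport[OF ws]
 note l = tr.lagr_transport[OF ws G_meas p_meas p_per]
 have sub: "integrable (cyl 0 T) f ==> integrable (cyl 0 ?S) f" for f :: "real \<times> (real^'n) => real"
  by (rule integrable_cyl_subset) (use h in auto)
 have iG': "integrable (cyl 0 ?S) (%z. (1 + h * ?\<zeta>' (fst z)) * G (m z))"
 proof (rule integrable_cyl_bounded_mult[OF sub[OF int_G], where B=2])
  show "\<bar>1 + h * ?\<zeta>' (fst z)\<bar> <= 2" for z :: "real \<times> (real^'n)" using small[of "fst z"] by linarith
 qed measurable
 then have Gi: "integrable (cyl 0 T) (%z. G (tr.tm m z))" unfolding l(3) by (simp add: J1)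
 let ?L = "%z. 1/2 * m z * (norm (v z))\<^sup>2 / (1 + h * ?\<zeta>' (fst z)) + (1 + h * ?\<zeta>' (fst z)) * G (m z) + m z * (v z \<bullet> p (snd z))"
 have iL: "integrable (cyl 0 ?S) ?L"
  using lagr_integrable(1)[OF w Gi] unfolding l(1) by (simp add: J1 V Phi)
 have ig: "integrable (cyl 0 T) (%z. ?\<zeta>' (fst z) * g z)"
  by (rule integrable_cyl_bounded_mult[OF int_g c'm, where B="2 / t1"]) (use cp(4,5) in auto)
 define B where "B = (h * (2 / t1))\<^sup>2"
 let ?U = "%z. lagr G p m v z + h * (?\<zeta>' (fst z) * g z) + B * e0 z"
 have iU: "integrable (cyl 0 T) ?U" using int_lagr ig int_e0 by auto
 have "F (tr.tm m) (tr.tv v) = (LINT z|cyl 0 ?S. ?L z)"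
  unfolding F_def l(2) by (simp add: J1 V Phi)
 also have "... <= (LINT z|cyl 0 ?S. ?U z)"
 proof (rule cyl_mono_integral[OF iL sub[OF iU]])
  fix z :: "real \<times> (real^'n)"
  have "(h * ?\<zeta>' (fst z))\<^sup>2 <= B" unfolding B_def using h cp(4,5)[of "fst z"] by (intro power_mono mult_left_mono) auto
  from scaled_lagr_le[OF _ this, of z] small[of "fst z"] show "?L z <= ?U z" by (simp add: mult.assoc)
 qed
 also have "... = (LINT z|cyl 0 T. ?U z) - (LINT z|cyl ?S T. ?U z)"
  using integral_cyl_split[OF iU, of ?S] h t1 by simp
 also have "(LINT z|cyl 0 T. ?U z) = F m v + h * (LINT z|cyl 0 T. ?\<zeta>' (fst z) * g z) + B * (LINT z|cyl 0 T. e0 z)"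
  unfolding F_def using int_lagr ig int_e0 by simp
 also have "h * (LINT z|cyl 0 T. ?\<zeta>' (fst z) * g z) = (LINT z|cyl ?S T. g z)"
  by (rule time_balance[OF t1]) (use h t1 in auto)
 finally have U1: "F (tr.tm m) (tr.tv v) <= F m v + (LINT z|cyl ?S T. g z) + B * (LINT z|cyl 0 T. e0 z) - (LINT z|cyl ?S T. ?U z)" .
 \<comment> \<open>\<open>q + g\<close> is the energy density itself; on the layer the derivative of
   the cutoff is zero, and the remaining term of \<open>?U\<close> is nonnegative.\<close>
 have U2: "(LINT z|cyl ?S T. ?U z) \<ge> (LINT z|cyl ?S T. q z + g z)"
 proof (rule cyl_mono_integral)
  have s: "integrable (cyl 0 T) f ==> integrable (cyl ?S T) f" for f :: "real \<times> (real^'n) => real"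
   by (rule integrable_cyl_subset) (use h t1 in auto)
  show "integrable (cyl ?S T) ?U" by (rule s[OF iU])
  show "integrable (cyl ?S T) (%z. q z + g z)" using int_q int_g by (auto intro!: s)
  fix z :: "real \<times> (real^'n)" assume "z \<in> {?S<..<T} \<times> cell"
  then have "?\<zeta>' (fst z) = 0" using cp(3)[of "fst z"] h by auto
  moreover have "0 <= B * e0 z" using e0_nonneg[of z] by (simp add: B_def)
  ultimately show "q z + g z <= ?U z" by (simp add: lagr_eq q_def g_def)
 qed
 have U3: "(LINT z|cyl ?S T. q z + g z) = (LINT z|cyl ?S T. q z) + (LINT z|cyl ?S T. g z)"
 proof (rule Bochner_Integration.integral_add)
  show "integrable (cyl ?S T) q" "integrable (cyl ?S T) g"
   using int_q int_g h t1 by (auto intro: integrable_cyl_subset)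
 qed
 have "B * (LINT z|cyl 0 T. e0 z) = (2 / t1)\<^sup>2 * (LINT z|cyl 0 T. e0 z) * h\<^sup>2"
  by (simp add: B_def power_mult_distrib power_divide)
 with U1 U2 U3 have le: "F (tr.tm m) (tr.tv v) - F m v <= (2 / t1)\<^sup>2 * (LINT z|cyl 0 T. e0 z) * h\<^sup>2 - (LINT z|cyl (T - h) T. q z)"
  by linarith
 have "tr.tm m z = m (z - (h, 0))" if "t1 + h <= fst z" for z
 proof -
  have "tr.\<Phi> (z - (h, 0)) = z" using cp(2)[of "fst z - h"] that by (simp add: Phi prod_eq_iff)
  then have "tr.\<Phi>i z = z - (h, 0)" by (metis tr.\<Phi>i_\<Phi>)
  then show ?thesis by (simp add: tr.tm_def J1)
 qed
 then show ?thesis using w Gi le by blast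
qed

lemma end_subset: "integrable (cyl 0 T) f ==> h <= T ==> integrable (cyl (T - h) T) f" for f :: "real \<times> (real^'n) => real"
 by (rule integrable_cyl_subset) auto

text \<open>The excess of the time-shifted competitor is nonnegative, so the integral of
  \<open>q\<close> over the layer is at most of order \<open>h^2\<close>. Completing the square
  bounds \<open>q\<close> below by \<open>1/2 * e0 - P^2 / 2 * m\<close>, and the layer has mass
  \<open>h\<close>. The bound for \<open>G\<close> follows through \<open>g\<close>, whose integral
  over the layer is linear in \<open>h\<close> by \<open>time_balance\<close>.\<close>

lemma end_energy:
 "\<exists>C\<ge>0. \<exists>h0>0. \<forall>h. 0 < h \<and> h <= h0 --> (LINT z|cyl (T - h) T. e0 z) <= C * h \<and> (LINT z|cyl (T - h) T. G (m z)) <= C * h"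
proof -
 define t1 where "t1 = T / 2"
 have t1: "0 < t1" "t1 < T" using T by (auto simp: t1_def)
 define h0 where "h0 = min (t1 / 4) (T - t1)"
 have h0: "0 < h0" using t1 by (simp add: h0_def)
 define C1 where "C1 = (2 / t1)\<^sup>2 * (LINT z|cyl 0 T. e0 z)"
 have C1: "0 <= C1" unfolding C1_def by (intro mult_nonneg_nonneg integral_nonneg_AE AE_I2 e0_nonneg) auto
 define A where "A = (LINT z|cyl 0 T. cutoff' t1 (fst z) * g z)"
 define C where "C = 2 * C1 * h0 + P\<^sup>2 + \<bar>A\<bar>"
 have "(LINT z|cyl (T - h) T. e0 z) <= C * h \<and> (LINT z|cyl (T - h) T. G (m z)) <= C * h" if h: "0 < h" "h <= h0" for h
 proof -
  have hh: "h <= t1 / 4" "h <= T - t1" "h <= T" using h t1 by (auto simp: h0_def)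
  obtain m' v' where c: "weak_sol T \<rho> m' v'" "integrable (cyl 0 T) (%z. G (m' z))"
   "F m' v' - F m v <= C1 * h\<^sup>2 - (LINT z|cyl (T - h) T. q z)"
   using time_shift_energy[OF t1 h(1) hh(1,2)] unfolding C1_def by blast
  have "(LINT z|cyl (T - h) T. 1/2 * e0 z - P\<^sup>2 / 2 * m z) <= (LINT z|cyl (T - h) T. q z)"
  proof (rule cyl_mono_integral)
   show "integrable (cyl (T - h) T) q" by (rule end_subset[OF int_q hh(3)])
   show "integrable (cyl (T - h) T) (%z. 1/2 * e0 z - P\<^sup>2 / 2 * m z)"
    using end_subset[OF int_e0 hh(3)] end_subset[OF wsD(6) hh(3)] by auto
   fix z
   have "- (v z \<bullet> p (snd z)) <= norm (v z) * norm (p (snd z))"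
    using Cauchy_Schwarz_ineq2[of "v z" "p (snd z)"] by linarith
   also have "... <= norm (v z) * P" by (rule mult_left_mono[OF P_bound]) simp
   also have "... <= 1/2 * (norm (v z))\<^sup>2 + P\<^sup>2 / 2"
    using zero_le_power2[of "norm (v z) - P"] by (simp add: power2_eq_square algebra_simps)
   finally have "- (1/2 * (norm (v z))\<^sup>2 + P\<^sup>2 / 2) <= v z \<bullet> p (snd z)" by linarith
   from mult_left_mono[OF this wsD(5)[of z]]
   show "1/2 * e0 z - P\<^sup>2 / 2 * m z <= q z" by (simp add: q_def e0_def algebra_simps)
  qed
  also have "(LINT z|cyl (T - h) T. 1/2 * e0 z - P\<^sup>2 / 2 * m z) = 1/2 * (LINT z|cyl (T - h) T. e0 z) - P\<^sup>2 / 2 * h"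
   using end_subset[OF int_e0 hh(3)] end_subset[OF wsD(6) hh(3)] mass_cyl[of "T - h"] h hh by simp
  also have "(LINT z|cyl (T - h) T. q z) <= C1 * h\<^sup>2" using F_min[OF c(1,2)] c(3) by linarith
  also have "C1 * h\<^sup>2 <= C1 * (h0 * h)" using h C1 by (intro mult_left_mono) (auto simp: power2_eq_square)
  finally have e: "(LINT z|cyl (T - h) T. e0 z) <= (2 * C1 * h0 + P\<^sup>2) * h" by (simp add: algebra_simps)
  have "(LINT z|cyl (T - h) T. G (m z)) = (LINT z|cyl (T - h) T. g z + 1/2 * e0 z)" by (simp add: g_def)
  also have "... = h * A + 1/2 * (LINT z|cyl (T - h) T. e0 z)"
   unfolding A_def using time_balance[OF t1 h(1)] end_subset[OF int_g hh(3)] end_subset[OF int_e0 hh(3)] hh t1 by simp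
  also have "... <= h * \<bar>A\<bar> + (LINT z|cyl (T - h) T. e0 z)"
  proof -
   have "0 <= (LINT z|cyl (T - h) T. e0 z)" by (intro integral_nonneg_AE AE_I2 e0_nonneg)
   moreover have "h * A <= h * \<bar>A\<bar>" using h by (intro mult_left_mono) auto
   ultimately show ?thesis by linarith
  qed
  finally have G': "(LINT z|cyl (T - h) T. G (m z)) <= C * h" using e by (simp add: C_def algebra_simps)
  have "0 <= \<bar>A\<bar> * h" using h by simp
  then have "(LINT z|cyl (T - h) T. e0 z) <= C * h" using e by (simp add: C_def algebra_simps)
  then show ?thesis using G' by blast
 qed
 moreover have "0 <= C" using C1 h0 by (simp add: C_def)
 ultimately show ?thesis using h0 by blast
qed

lemma int_m_quad:
 assumes [measurable]: "f \<in> borel_fun"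
  and f: "!!z. z \<in> {0<..<T} \<times> cell ==> \<bar>f z\<bar> <= K * (1 + (norm (v z))\<^sup>2)"
 shows "integrable (cyl 0 T) (%z. m z * f z)"
proof -
 have "integrable (cyl 0 T) (%z. K * (m z + e0 z))" using wsD(6) int_e0 by auto
 then show ?thesis
 proof (rule Bochner_Integration.integrable_bound)
  show "AE z in cyl 0 T. norm (m z * f z) <= norm (K * (m z + e0 z))"
  proof (rule AE_I2)
   fix z assume "z \<in> space (cyl 0 T :: (real \<times> (real^'n)) measure)"
   then have "m z * \<bar>f z\<bar> <= m z * (K * (1 + (norm (v z))\<^sup>2))" by (intro mult_left_mono f wsD(5)) auto
   also have "... = K * (m z + e0 z)" by (simp add: e0_def algebra_simps)
   finally have "m z * \<bar>f z\<bar> <= norm (K * (m z + e0 z))" unfolding real_norm_def by linarith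
   moreover have "norm (m z * f z) = m z * \<bar>f z\<bar>" using wsD(5)[of z] by (simp add: abs_mult)
   ultimately show "norm (m z * f z) <= norm (K * (m z + e0 z))" by simp
  qed
 qed measurable
qed

text \<open>Combined with \<open>end_energy\<close>: mass and kinetic energy of the layer are both
  O(h), so an integrand quadratic in \<open>v\<close> with a coefficient of order \<open>h\<close>
  contributes O(h^2).\<close>

lemma m_quad_bound:
 assumes [measurable]: "f \<in> borel_fun" and h: "0 <= h" "h <= T"
  and f: "!!z. z \<in> {0<..<T} \<times> cell ==> \<bar>f z\<bar> <= K * (1 + (norm (v z))\<^sup>2) * indicator {T - h<..} (fst z)"
 shows "\<bar>\<integral>z. m z * f z \<partial>cyl 0 T\<bar> <= K * (h + (LINT z|cyl (T - h) T. e0 z))"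
proof -
 have "\<bar>\<integral>z. m z * f z \<partial>cyl 0 T\<bar> <= (LINT z|cyl 0 T. \<bar>m z * f z\<bar>)" by (rule integral_abs_bound)
 also have "... <= (LINT z|cyl 0 T. indicator {T - h<..<T} (fst z) * (K * (m z + e0 z)))"
 proof (rule cyl_mono_integral)
  have iK: "integrable (cyl 0 T) (%z. K * (m z + e0 z))" using wsD(6) int_e0 by auto
  show iK': "integrable (cyl 0 T) (%z. indicator {T - h<..<T} (fst z) * (K * (m z + e0 z)))"
   by (rule integrable_cyl_bounded_mult[OF iK, where B=1]) (auto simp: indicator_def)
  show pt: "\<bar>m z * f z\<bar> <= indicator {T - h<..<T} (fst z) * (K * (m z + e0 z))" if z: "z \<in> {0<..<T} \<times> cell" for z
  proof -
   have "m z * \<bar>f z\<bar> <= m z * (K * (1 + (norm (v z))\<^sup>2) * indicator {T - h<..} (fst z))" by (intro mult_left_mono f wsD(5) z)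
   also have "... = indicator {T - h<..<T} (fst z) * (K * (m z + e0 z))" using z by (auto simp: e0_def algebra_simps indicator_def)
   finally show ?thesis using wsD(5)[of z] by (simp add: abs_mult)
  qed
  show "integrable (cyl 0 T) (%z. \<bar>m z * f z\<bar>)"
  proof (rule Bochner_Integration.integrable_bound[OF iK'])
   show "AE z in cyl 0 T. norm \<bar>m z * f z\<bar> <= norm (indicator {T - h<..<T} (fst z) * (K * (m z + e0 z)))"
    by (rule AE_I2) (use pt in force)
  qed measurable
 qed
 also have "... = (LINT z|cyl (T - h) T. K * (m z + e0 z))" by (rule integral_cyl_subset[symmetric]) (use h in auto)
 also have "... = K * (h + (LINT z|cyl (T - h) T. e0 z))"
  using end_subset[OF wsD(6) h(2)] end_subset[OF int_e0 h(2)] mass_cyl[of "T - h"] h by simp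
 finally show ?thesis .
qed

text \<open>For \<open>x >= 0\<close> the density decreases and monotonicity suffices. For
  \<open>x < 0\<close> it is multiplied by \<open>1 + a\<close> with
  \<open>a = - x / (1 + x)\<close>, which is at most \<open>2 * \<bar>x\<bar>\<close>, and the
  growth condition acts. The result is a Lipschitz bound at \<open>x = 0\<close> that does not
  differentiate \<open>G\<close>.\<close>

lemma pressure_bound:
 assumes s: "0 <= s" and x: "\<bar>x\<bar> <= 1/2" "2 * \<bar>x\<bar> <= a0"
 shows "(1 + x) * G (s / (1 + x)) <= G s + (2 * Cg + 1) * \<bar>x\<bar> * (G s + 1)"
proof (cases "0 <= x")
 case True
 have "G (s / (1 + x)) <= G s" by (rule G_mono) (use s True in \<open>auto simp: divide_le_eq mult_le_cancel_left1\<close>)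
 then have "(1 + x) * G (s / (1 + x)) <= (1 + x) * G s" using True by (intro mult_left_mono) auto
 also have "... = G s + x * G s" by (simp add: algebra_simps)
 also have "x * G s <= ((2 * Cg + 1) * x) * (G s + 1)"
  using True growth(2) G_nonneg[OF s] by (intro mult_mono) (auto simp: algebra_simps)
 finally show ?thesis using True by simp
next
 case False
 define a where "a = - x / (1 + x)"
 have x1: "1/2 <= 1 + x" using x by linarith
 have a: "0 <= a" "a <= 2 * \<bar>x\<bar>" using False x1 by (auto simp: a_def divide_le_eq)
   (use mult_left_mono[of "1/2" "1 + x" "2 * (- x)"] in \<open>simp add: field_simps\<close>)?
 have e: "s / (1 + x) = (1 + a) * s" using x1 by (simp add: a_def field_simps)
 have n: "0 <= G ((1 + a) * s)" by (rule G_nonneg) (use a s in auto)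
 have "(1 + x) * G (s / (1 + x)) <= 1 * G ((1 + a) * s)" unfolding e using False n by (intro mult_right_mono) auto
 also have "... <= G s + Cg * a * (G s + 1)" using growth(3)[OF s a(1)] a(2) x(2) by simp
 also have "Cg * a * (G s + 1) <= (2 * Cg + 1) * \<bar>x\<bar> * (G s + 1)"
 proof (rule mult_right_mono)
  have "Cg * a <= Cg * (2 * \<bar>x\<bar>)" using a growth(2) by (intro mult_left_mono)
  also have "... <= (2 * Cg + 1) * \<bar>x\<bar>" by (simp add: algebra_simps)
  finally show "Cg * a <= (2 * Cg + 1) * \<bar>x\<bar>" .
 qed (use G_nonneg[OF s] in auto)
 finally show ?thesis by simp
qed

text \<open>The competitor displaces points by \<epsilon> times \<open>R * X\<close> in direction
  \<open>i\<close>, where \<open>R\<close> grows with slope at most 1 during the last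
  \<open>h\<close> time units and \<open>X\<close> is the difference quotient of
  \<open>\<Psi>\<close> with step \<open>h\<close>. The first-order terms are the wanted integral
  plus terms carrying a factor \<open>R <= h\<close>. These, the pressure and the replacement of the
  gradient by \<open>X\<close> are all O(h^2), because mass and energy of the layer are O(h) and
  \<open>X\<close> has Lipschitz constant \<open>L\<close> uniformly in \<open>h\<close>.\<close>

lemma end_momentum_component:
 "\<exists>C\<ge>0. \<exists>h0>0. \<forall>h. 0 < h \<and> h <= h0 --> \<bar>\<integral>z. m z * (p (snd z) $ i * (v z $ i + p (snd z) $ i)) \<partial>cyl (T - h) T\<bar> <= C * h\<^sup>2"
proof -
 let ?e = "axis i 1 :: real^'n"
 obtain Ce h1 where Ce: "0 <= Ce" "0 < h1" "!!h. 0 < h ==> h <= h1 ==> (LINT z|cyl (T - h) T. e0 z) <= Ce * h"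
  "!!h. 0 < h ==> h <= h1 ==> (LINT z|cyl (T - h) T. G (m z)) <= Ce * h"
  using end_energy by blast
 define h0 where "h0 = min (min h1 1) T"
 have h0: "0 < h0" using Ce T by (simp add: h0_def)
 define P1 where "P1 = P + L"
 have P1: "0 <= P1" "P <= P1" using P_nonneg L by (auto simp: P1_def)
 define K where "K = 2 * Cg + 1"
 have K: "0 <= K" using growth(2) by (simp add: K_def)
 \<comment> \<open>\<open>CA\<close> collects the pressure, the replacement of the gradient in the
   cost, and the terms with the derivative of \<open>X\<close>; \<open>CB\<close> pays for returning
   from \<open>X\<close> to the gradient in the final integral.\<close>
 define CA where "CA = K * L * (Ce + 1) + P1 * L + L * (1 + 2 * P1) * (1 + Ce)"
 define CB where "CB = L * (1 + 2 * P1) * (1 + Ce)"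
 have CA: "0 <= CA" unfolding CA_def using K L P1 Ce by (intro add_nonneg_nonneg mult_nonneg_nonneg) auto
 have "\<bar>\<integral>z. m z * (p (snd z) $ i * (v z $ i + p (snd z) $ i)) \<partial>cyl (T - h) T\<bar> <= (CA + CB) * h\<^sup>2"
  if h: "0 < h" "h <= h0" for h
 proof -
  have hh: "h <= h1" "h <= 1" "h <= T" using h by (auto simp: h0_def)
  let ?a = "T - h"
  define E where "E = (LINT z|cyl (T - h) T. e0 z)"
  have E: "E <= Ce * h" unfolding E_def by (rule Ce(3)[OF h(1) hh(1)])
  have hE: "h + E <= (1 + Ce) * h" using E by (simp add: algebra_simps)
  \<comment> \<open>\<open>X\<close> is C1 although the gradient of \<open>\<Psi>\<close> is only
    Lipschitz: it differs from component \<open>i\<close> of the gradient by at most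
    \<open>L * h\<close>, and its own derivative is bounded by \<open>L\<close> independently of
    \<open>h\<close>.\<close>
  define X where "X z = (1 / h) * (\<Psi> (snd z + h *\<^sub>R ?e) - \<Psi> (snd z))" for z :: "real \<times> (real^'n)"
  define DX where "DX z w = (1 / h) * (snd w \<bullet> p (snd z + h *\<^sub>R ?e) - snd w \<bullet> p (snd z))" for z w :: "real \<times> (real^'n)"
  have XC: "C1per X DX"
   using C1per_mult[OF C1per_const[of "1 / h"] C1per_diff[OF C1per_\<Psi>[OF C1per_const[of h], of i] C1per_\<Psi>[OF C1per_const[of 0], of i]]]
   by (simp add: X_def[abs_def] DX_def[abs_def])
  have Xp: "\<bar>X z - p (snd z) $ i\<bar> <= L * h" for z
  proof -
   have "\<bar>\<Psi> (snd z + h *\<^sub>R ?e) - \<Psi> (snd z) - p (snd z) \<bullet> (h *\<^sub>R ?e)\<bar> <= L * (norm (h *\<^sub>R ?e))\<^sup>2" by (rule \<Psi>_taylor)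
   then have "\<bar>\<Psi> (snd z + h *\<^sub>R ?e) - \<Psi> (snd z) - h * p (snd z) $ i\<bar> <= L * h\<^sup>2"
    by (simp add: norm_axis_1 inner_axis power2_eq_square)
   moreover have "\<Psi> (snd z + h *\<^sub>R ?e) - \<Psi> (snd z) - h * p (snd z) $ i = h * (X z - p (snd z) $ i)"
    using h by (simp add: X_def right_diff_distrib)
   ultimately have "h * \<bar>X z - p (snd z) $ i\<bar> <= h * (L * h)" using h by (simp add: abs_mult power2_eq_square ac_simps)
   then show ?thesis using h by simp
  qed
  have pb: "\<bar>p x $ i\<bar> <= P" for x using component_le_norm_cart[of "p x" i] P_bound[of x] by linarith
  have Xb: "\<bar>X z\<bar> <= P1" for z
  proof -
   have "L * h <= L" using mult_left_mono[OF hh(2) L] by simp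
   then show ?thesis using Xp[of z] pb[of "snd z"] unfolding P1_def by linarith
  qed
  have DXb: "\<bar>DX z w\<bar> <= L * norm (snd w)" for z w
  proof -
   have "\<bar>snd w \<bullet> p (snd z + h *\<^sub>R ?e) - snd w \<bullet> p (snd z)\<bar> <= norm (snd w) * norm (p (snd z + h *\<^sub>R ?e) - p (snd z))"
    unfolding inner_diff_right[symmetric] by (rule Cauchy_Schwarz_ineq2)
   also have "... <= norm (snd w) * (L * h)"
    using p_lip[of "snd z + h *\<^sub>R ?e" "snd z"] h by (intro mult_left_mono) (auto simp: norm_axis_1)
   finally show ?thesis using h by (simp add: DX_def abs_mult divide_le_eq ac_simps)
  qed
  note [measurable] = C1per_borel[OF XC]
  have DXm: "(%z. DX z (1, v z)) \<in> borel_fun" by (rule C1per_measurable[OF XC]) measurable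
  note [measurable] = DXm
  have tvv: "norm (v z) <= (1 + (norm (v z))\<^sup>2) / 2" for z
   using zero_le_power2[of "norm (v z) - 1"] by (simp add: power2_eq_square algebra_simps)
  have tvv1: "norm (v z) <= 1 + (norm (v z))\<^sup>2" for z
   using zero_le_power2[of "norm (v z) - 1/2"] by (simp add: power2_eq_square algebra_simps)
  have viX: "\<bar>v z $ i\<bar> <= norm (v z)" for z by (rule component_le_norm_cart)
  have key: "\<bar>\<integral>z. clamp01 ?a k (fst z) * (m z * (X z * (v z $ i + X z))) \<partial>cyl 0 T\<bar> <= CA * h\<^sup>2" if k: "0 < k" for k
  proof -
   \<comment> \<open>Before \<open>T\<close> this is \<open>ramp ?a k\<close> alone. Subtracting
     \<open>ramp T k\<close> keeps \<open>R\<close> below \<open>h\<close> at all times, so that the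
     Jacobian is positive on the whole line, as \<open>transport\<close> asks.\<close>
   define R where "R s = ramp ?a k s - ramp T k s" for s
   define \<kappa> where "\<kappa> s = clamp01 ?a k s - clamp01 T k s" for s
   have Rder: "(R has_real_derivative \<kappa> s) (at s)" for s
    unfolding R_def[abs_def] \<kappa>_def by (intro DERIV_diff ramp_der)
   have \<kappa>c: "continuous_on UNIV \<kappa>" unfolding \<kappa>_def[abs_def] by (intro continuous_intros clamp01_cont)
   have Rs: "ramp T k s = ramp ?a k (s - h)" for s by (simp add: ramp_def)
   have Rb: "0 <= R s" "R s <= h" for s
    using ramp_lip[OF k, of "s - h" s ?a] h unfolding R_def Rs by auto
   have R0: "R s = 0" if "s <= ?a" for s using ramp_zero[OF k] that h by (simp add: R_def)
   have RI: "R s <= h * indicator {?a<..} s" for s using Rb[of s] R0[of s] by (auto simp: indicator_def)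
   have \<kappa>b: "\<bar>\<kappa> s\<bar> <= 1" for s using clamp01_range[OF k, of ?a s] clamp01_range[OF k, of T s] unfolding \<kappa>_def by linarith
   have \<kappa>e: "\<kappa> s = clamp01 ?a k s" if "s < T" for s using that k by (simp add: \<kappa>_def clamp01_alt)
   have \<kappa>0: "\<kappa> s = 0" if "s <= ?a" for s using that k h by (simp add: \<kappa>_def clamp01_alt)
   have [measurable]: "\<kappa> \<in> borel_fun" "R \<in> borel_fun"
    by (auto intro!: borel_measurable_continuous_onI \<kappa>c) (use Rder in \<open>meson DERIV_isCont continuous_at_imp_continuous_on\<close>)
   define W where "W z = R (fst z) * X z" for z :: "real \<times> (real^'n)"
   define DW where "DW z w = R (fst z) * DX z w + \<kappa> (fst z) * fst w * X z" for z w :: "real \<times> (real^'n)"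
   have WC: "C1per W DW" unfolding W_def[abs_def] DW_def[abs_def]
    by (rule C1per_mult[OF C1per_time[OF Rder \<kappa>c] XC])
   define Ds where "Ds z w = W z * DX z w + DW z w * X z" for z w :: "real \<times> (real^'n)"
   have sC: "C1per (%z. W z * X z) Ds" unfolding Ds_def[abs_def] by (rule C1per_mult[OF WC XC])
   have Wb: "\<bar>W z\<bar> <= h * P1" for z unfolding W_def abs_mult using Rb[of "fst z"] Xb[of z] h P1 by (intro mult_mono) auto
   define wz where "wz z = R (fst z) * DX z (1, v z) + \<kappa> (fst z) * X z" for z
   have wzDW: "DW z (1, v z) = wz z" for z by (simp add: DW_def wz_def)
   have [measurable]: "wz \<in> borel_fun" unfolding wz_def[abs_def] by measurable
   have wzb: "\<bar>wz z\<bar> <= (L + P1) * (1 + norm (v z))" for z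
   proof -
    have "\<bar>wz z\<bar> <= \<bar>R (fst z)\<bar> * \<bar>DX z (1, v z)\<bar> + \<bar>\<kappa> (fst z)\<bar> * \<bar>X z\<bar>"
     unfolding wz_def abs_mult[symmetric] by (rule abs_triangle_ineq)
    also have "... <= 1 * (L * norm (v z)) + 1 * P1"
     using Rb[of "fst z"] hh(2) DXb[of z "(1, v z)"] \<kappa>b Xb by (intro add_mono mult_mono) auto
    also have "... <= (L + P1) * (1 + norm (v z))" using L P1 by (simp add: algebra_simps)
    finally show ?thesis .
   qed
   \<comment> \<open>\<open>A\<close> is the wanted first-order term; \<open>A2\<close> is the part
     of the first variation that contains the derivative of \<open>X\<close> and carries the factor
     \<open>R\<close>.\<close>
   define A where "A = (LINT z|cyl 0 T. m z * (\<kappa> (fst z) * (X z * (v z $ i + X z))))"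
   define A2 where "A2 = (LINT z|cyl 0 T. m z * (R (fst z) * (DX z (1, v z) * (v z $ i + 2 * X z))))"
   have b1: "\<bar>X z * (v z $ i + X z)\<bar> <= (P1 * (1 + P1)) * (1 + (norm (v z))\<^sup>2)" for z
   proof -
    have "\<bar>X z * (v z $ i + X z)\<bar> <= P1 * (norm (v z) + P1)"
     unfolding abs_mult using Xb[of z] viX[of z] P1 by (intro mult_mono) auto
    also have "... <= P1 * ((1 + P1) * (1 + (norm (v z))\<^sup>2))"
    proof (rule mult_left_mono[OF _ P1(1)])
     have "norm (v z) <= 1 + (norm (v z))\<^sup>2" by (rule tvv1)
     moreover have "P1 <= P1 * (1 + (norm (v z))\<^sup>2)" using P1 by (simp add: mult_le_cancel_left1)
     ultimately show "norm (v z) + P1 <= (1 + P1) * (1 + (norm (v z))\<^sup>2)" by (simp add: algebra_simps)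
    qed
    finally show ?thesis by (simp add: mult.assoc)
   qed
   have iA: "integrable (cyl 0 T) (%z. m z * (\<kappa> (fst z) * (X z * (v z $ i + X z))))"
   proof (rule int_m_quad[where K="P1 * (1 + P1)"])
    show "\<bar>\<kappa> (fst z) * (X z * (v z $ i + X z))\<bar> <= (P1 * (1 + P1)) * (1 + (norm (v z))\<^sup>2)" for z
     using mult_mono[OF \<kappa>b b1[of z], of "fst z"] by (simp add: abs_mult)
   qed measurable
   have b2: "\<bar>R (fst z) * (DX z (1, v z) * (v z $ i + 2 * X z))\<bar> <= (h * L * (1 + 2 * P1)) * (1 + (norm (v z))\<^sup>2) * indicator {?a<..} (fst z)" for z
   proof -
    have "\<bar>DX z (1, v z) * (v z $ i + 2 * X z)\<bar> <= (L * norm (v z)) * (norm (v z) + 2 * P1)"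
     unfolding abs_mult using DXb[of z "(1, v z)"] viX[of z] Xb[of z] L by (intro mult_mono) auto
    also have "... <= L * ((1 + 2 * P1) * (1 + (norm (v z))\<^sup>2))"
    proof -
     have "P1 * (2 * norm (v z)) <= P1 * (1 + (norm (v z))\<^sup>2)" using tvv[of z] P1 by (intro mult_left_mono) auto
     moreover have "norm (v z) * (norm (v z) + 2 * P1) = (norm (v z))\<^sup>2 + P1 * (2 * norm (v z))"
      by (simp add: power2_eq_square algebra_simps)
     moreover have "(1 + 2 * P1) * (1 + (norm (v z))\<^sup>2) = (norm (v z))\<^sup>2 + P1 * (1 + (norm (v z))\<^sup>2) + (1 + P1 * (1 + (norm (v z))\<^sup>2))"
      by (simp add: algebra_simps)
     moreover have "0 <= P1 * (1 + (norm (v z))\<^sup>2)" using P1 by simp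
     ultimately have "norm (v z) * (norm (v z) + 2 * P1) <= (1 + 2 * P1) * (1 + (norm (v z))\<^sup>2)" by linarith
     from mult_left_mono[OF this L] show ?thesis by (simp add: mult.assoc)
    qed
    finally have "R (fst z) * \<bar>DX z (1, v z) * (v z $ i + 2 * X z)\<bar> <= (h * indicator {?a<..} (fst z)) * (L * ((1 + 2 * P1) * (1 + (norm (v z))\<^sup>2)))"
     using RI[of "fst z"] Rb h by (intro mult_mono) auto
    then show ?thesis using Rb[of "fst z"] by (simp add: abs_mult ac_simps)
   qed
   have iA2: "integrable (cyl 0 T) (%z. m z * (R (fst z) * (DX z (1, v z) * (v z $ i + 2 * X z))))"
   proof (rule int_m_quad[where K="h * L * (1 + 2 * P1)"])
    show "\<bar>R (fst z) * (DX z (1, v z) * (v z $ i + 2 * X z))\<bar> <= (h * L * (1 + 2 * P1)) * (1 + (norm (v z))\<^sup>2)" for z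
    proof (rule order_trans[OF b2])
     have "0 <= (h * L * (1 + 2 * P1)) * (1 + (norm (v z))\<^sup>2)" using h L P1 by simp
     from mult_left_mono[OF _ this, of "indicator {?a<..} (fst z)" 1]
     show "(h * L * (1 + 2 * P1)) * (1 + (norm (v z))\<^sup>2) * indicator {?a<..} (fst z) <= (h * L * (1 + 2 * P1)) * (1 + (norm (v z))\<^sup>2)"
      by (simp add: indicator_def)
    qed
   qed measurable
   have A2b: "\<bar>A2\<bar> <= L * (1 + 2 * P1) * (1 + Ce) * h\<^sup>2"
   proof -
    have "\<bar>A2\<bar> <= (h * L * (1 + 2 * P1)) * (h + E)"
     unfolding A2_def E_def by (rule m_quad_bound) (use b2 h hh in auto)
    also have "... <= (h * L * (1 + 2 * P1)) * ((1 + Ce) * h)" by (rule mult_left_mono[OF hE]) (use h L P1 in auto)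
    finally show ?thesis by (simp add: power2_eq_square ac_simps)
   qed
   define B1 where "B1 = (LINT z|cyl 0 T. m z * (wz z)\<^sup>2)"
   have iB: "integrable (cyl 0 T) (%z. m z * (wz z)\<^sup>2)"
   proof (rule int_m_quad[where K="2 * (L + P1)\<^sup>2"])
    fix z
    have "(wz z)\<^sup>2 <= ((L + P1) * (1 + norm (v z)))\<^sup>2" using wzb[of z] by (metis abs_ge_zero power2_abs power_mono)
    also have "... = (L + P1)\<^sup>2 * (1 + norm (v z))\<^sup>2" by (simp add: power_mult_distrib)
    also have "... <= (L + P1)\<^sup>2 * (2 * (1 + (norm (v z))\<^sup>2))"
     by (intro mult_left_mono zero_le_power2) (use tvv[of z] in \<open>simp add: power2_eq_square algebra_simps\<close>)
    finally show "\<bar>(wz z)\<^sup>2\<bar> <= 2 * (L + P1)\<^sup>2 * (1 + (norm (v z))\<^sup>2)" by (simp add: algebra_simps)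
   qed measurable
   have iwv: "integrable (cyl 0 T) (%z. m z * (wz z * (v z $ i)))"
   proof (rule int_m_quad[where K="2 * (L + P1)"])
    fix z
    have "\<bar>wz z * (v z $ i)\<bar> <= ((L + P1) * (1 + norm (v z))) * norm (v z)"
     unfolding abs_mult using wzb[of z] viX[of z] L P1 by (intro mult_mono) auto
    also have "... = (L + P1) * ((1 + norm (v z)) * norm (v z))" by simp
    also have "... <= (L + P1) * (2 * (1 + (norm (v z))\<^sup>2))"
     using L P1 tvv1[of z] by (intro mult_left_mono) (simp_all add: power2_eq_square algebra_simps)
    finally show "\<bar>wz z * (v z $ i)\<bar> <= 2 * (L + P1) * (1 + (norm (v z))\<^sup>2)" by (simp add: algebra_simps)
   qed measurable
   define EG where "EG = (LINT z|cyl 0 T. R (fst z) * (G (m z) + 1))"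
   have iG1: "integrable (cyl 0 T) (%z. G (m z) + 1)" by (rule Bochner_Integration.integrable_add[OF int_G integrable_cyl_one])
   have iEG: "integrable (cyl 0 T) (%z. R (fst z) * (G (m z) + 1))"
    by (rule integrable_cyl_bounded_mult[OF iG1, where B=h]) (use Rb in auto)
   \<comment> \<open>\<open>R\<close> is at most \<open>h\<close> and lives on a layer of length
     \<open>h\<close>, over which \<open>end_energy\<close> bounds the integral of
     \<open>G\<close>.\<close>
   have EGb: "EG <= (Ce + 1) * h\<^sup>2"
   proof -
    have "EG <= (LINT z|cyl 0 T. indicator {?a<..<T} (fst z) * (h * (G (m z) + 1)))"
     unfolding EG_def
    proof (rule cyl_mono_integral[OF iEG])
     show "integrable (cyl 0 T) (%z. indicator {?a<..<T} (fst z) * (h * (G (m z) + 1)))"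
      by (rule integrable_cyl_bounded_mult[where B=1]) (use iG1 in \<open>auto simp: indicator_def\<close>)
     show "R (fst z) * (G (m z) + 1) <= indicator {?a<..<T} (fst z) * (h * (G (m z) + 1))" if "z \<in> {0<..<T} \<times> cell" for z
      using mult_right_mono[OF RI[of "fst z"], of "G (m z) + 1"] Gm_nonneg[of z] that by (auto simp: indicator_def split: if_splits)
    qed
    also have "... = (LINT z|cyl ?a T. h * (G (m z) + 1))" by (rule integral_cyl_subset[symmetric]) (use h hh in auto)
    also have "... = h * ((LINT z|cyl ?a T. G (m z)) + h)"
    proof -
     have "(LINT z|cyl ?a T. h * (G (m z) + 1)) = h * (LINT z|cyl ?a T. G (m z) + 1)" by simp
     also have "(LINT z|cyl ?a T. G (m z) + 1) = (LINT z|cyl ?a T. G (m z)) + (LINT z|(cyl ?a T :: (real \<times> (real^'n)) measure). 1)"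
      by (rule Bochner_Integration.integral_add[OF end_subset[OF int_G hh(3)] integrable_cyl_one])
     also have "(LINT z|(cyl ?a T :: (real \<times> (real^'n)) measure). 1) = h" using volume_cyl[of ?a T] h by simp
     finally show ?thesis .
    qed
    also have "... <= h * (Ce * h + h)" using Ce(4)[OF h(1) hh(1)] h by (intro mult_left_mono) auto
    finally show ?thesis by (simp add: power2_eq_square algebra_simps)
   qed
   \<comment> \<open>Terms quadratic in \<epsilon>. Their size may depend on \<open>h\<close> in any
     way, since \<epsilon> tends to 0 with \<open>h\<close> fixed.\<close>
   define B where "B = B1 / 2 + L * h\<^sup>2 * P1\<^sup>2"
   \<comment> \<open>Keeps the Jacobian within 1/2 of 1 and its deviation below
     \<open>a0 / 2\<close>, the range of \<open>pressure_bound\<close>; \<open>L + 1\<close> avoids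
     a division by zero.\<close>
   define \<epsilon>0 where "\<epsilon>0 = min 1 a0 / (2 * (L + 1))"
   have \<epsilon>0: "0 < \<epsilon>0" using growth(1) L by (simp add: \<epsilon>0_def)
   \<comment> \<open>The error of the stationarity condition: first the pressure, which is not
     differentiated in \<epsilon>, then the replacement of the gradient by \<open>X\<close> in the
     cost.\<close>
   define E1 where "E1 = K * L * EG + h\<^sup>2 * P1 * L"
   have "\<bar>A + A2\<bar> <= E1"
   proof (rule abs_le_of_first_order[OF \<epsilon>0, of _ _ B])
    fix \<epsilon> :: real assume \<epsilon>: "\<bar>\<epsilon>\<bar> < \<epsilon>0"
    have xb: "\<bar>\<epsilon> * DW z (0, ?e)\<bar> <= \<bar>\<epsilon>\<bar> * L * R (fst z)" for z
    proof -
     have "\<bar>DW z (0, ?e)\<bar> <= R (fst z) * L" using DXb[of z "(0, ?e)"] Rb[of "fst z"]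
      by (auto simp: DW_def abs_mult norm_axis_1 intro!: mult_left_mono)
     from mult_left_mono[OF this, of "\<bar>\<epsilon>\<bar>"] show ?thesis by (simp add: abs_mult ac_simps)
    qed
    have xs: "\<bar>\<epsilon> * DW z (0, ?e)\<bar> <= min 1 a0 / 2" for z
    proof -
     have "\<bar>\<epsilon>\<bar> * L * R (fst z) <= \<epsilon>0 * (L + 1) * 1"
      using \<epsilon> Rb[of "fst z"] hh(2) L \<epsilon>0 by (intro mult_mono) auto
     also have "... = min 1 a0 / 2"
     proof -
      have "y / (2 * (L + 1)) * (L + 1) * 1 = y / 2" for y :: real using L by (simp add: field_simps)
      then show ?thesis unfolding \<epsilon>0_def .
     qed
     finally show ?thesis using xb[of z] by linarith
    qed
    have YC: "C1per (%z. \<epsilon> * W z) (%z w. \<epsilon> * DW z w)"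
     using C1per_mult[OF C1per_const[of \<epsilon>] WC] by simp
    interpret tr: transport T T "%s. s" "%_. 1" "%z. \<epsilon> * W z" "%z w. \<epsilon> * DW z w" i
    proof
     show "0 < 1 + \<epsilon> * DW z (0, ?e)" for z using xs[of z] by linarith
     show "\<epsilon> * W (0, x) = 0" for x using R0[of 0] hh by (simp add: W_def)
    qed (use T C1perD[OF YC] in auto)
    have JJ: "tr.J z = 1 + \<epsilon> * DW z (0, ?e)" for z by (simp add: tr.J_def)
    have V: "tr.V v z = v z + (\<epsilon> * wz z) *\<^sub>R ?e" for z by (simp add: tr.V_def wzDW)
    have Phi: "snd (tr.\<Phi> z) = snd z + (\<epsilon> * W z) *\<^sub>R ?e" for z by (simp add: tr.\<Phi>_def)
    note w = tr.weak_sol_transport[OF ws]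
    note l = tr.lagr_transport[OF ws G_meas p_meas p_per]
    have pr: "tr.J z * G (m z / tr.J z) <= G (m z) + \<bar>\<epsilon>\<bar> * (K * L) * (R (fst z) * (G (m z) + 1))" for z
    proof -
     have "tr.J z * G (m z / tr.J z) <= G (m z) + (2 * Cg + 1) * \<bar>\<epsilon> * DW z (0, ?e)\<bar> * (G (m z) + 1)"
      unfolding JJ by (rule pressure_bound[OF wsD(5)]) (use xs[of z] in linarith)+
     also have "(2 * Cg + 1) * \<bar>\<epsilon> * DW z (0, ?e)\<bar> * (G (m z) + 1) <= K * (\<bar>\<epsilon>\<bar> * L * R (fst z)) * (G (m z) + 1)"
      unfolding K_def[symmetric] using xb[of z] K Gm_nonneg[of z] by (intro mult_right_mono mult_left_mono) auto
     finally show ?thesis by (simp add: ac_simps)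
    qed
    have iU: "integrable (cyl 0 T) (%z. G (m z) + \<bar>\<epsilon>\<bar> * (K * L) * (R (fst z) * (G (m z) + 1)))"
     using int_G iEG by auto
    have "integrable (cyl 0 T) (%z. tr.J z * G (m z / tr.J z))"
    proof (rule Bochner_Integration.integrable_bound[OF iU])
     show "AE z in cyl 0 T. norm (tr.J z * G (m z / tr.J z)) <= norm (G (m z) + \<bar>\<epsilon>\<bar> * (K * L) * (R (fst z) * (G (m z) + 1)))"
     proof (rule AE_I2)
      fix z
      have "0 <= tr.J z * G (m z / tr.J z)"
       using tr.J_pos'[of z] wsD(5)[of z] by (intro mult_nonneg_nonneg G_nonneg) auto
      then show "norm (tr.J z * G (m z / tr.J z)) <= norm (G (m z) + \<bar>\<epsilon>\<bar> * (K * L) * (R (fst z) * (G (m z) + 1)))"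
       using pr[of z] unfolding real_norm_def by linarith
     qed
    qed (intro borel_measurable_cyl borel_measurable_times tr.J_measurable
      measurable_compose[OF borel_measurable_divide[OF wsD(1) tr.J_measurable] G_meas])
    then have Gi: "integrable (cyl 0 T) (%z. G (tr.tm m z))" unfolding l(3) by simp
    let ?L = "%z. 1/2 * m z * (norm (v z + (\<epsilon> * wz z) *\<^sub>R ?e))\<^sup>2 + tr.J z * G (m z / tr.J z) + m z * ((v z + (\<epsilon> * wz z) *\<^sub>R ?e) \<bullet> p (snd z + (\<epsilon> * W z) *\<^sub>R ?e))"
    have iL: "integrable (cyl 0 T) ?L"
     using lagr_integrable(1)[OF w Gi] unfolding l(1) by (simp add: V Phi)
    define Dq where "Dq z w = (snd w + (\<epsilon> * DW z w) *\<^sub>R ?e) \<bullet> p (snd z + (\<epsilon> * W z) *\<^sub>R ?e) - snd w \<bullet> p (snd z)" for z w :: "real \<times> (real^'n)"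
    have qC: "C1per (%z. \<Psi> (snd z + (\<epsilon> * W z) *\<^sub>R ?e) - \<Psi> (snd z)) Dq"
     using C1per_diff[OF C1per_\<Psi>[OF YC, of i] C1per_\<Psi>[OF C1per_const[of 0], of i]] by (simp add: Dq_def[abs_def])
    have rC: "C1per (%z. (\<Psi> (snd z + (\<epsilon> * W z) *\<^sub>R ?e) - \<Psi> (snd z)) - \<epsilon> * (W z * X z)) (%z w. Dq z w - \<epsilon> * Ds z w)"
     using C1per_diff[OF qC C1per_mult[OF C1per_const[of \<epsilon>] sC]] by simp
    \<comment> \<open>The change of \<open>\<Psi>\<close> under the displacement, minus its linear
      part with slope \<open>X\<close>, is a function whose size is a multiple of
      \<open>\<epsilon>^2 * h^2\<close> plus a multiple of
      \<open>\<bar>\<epsilon>\<bar> * h^2\<close>; \<open>D_bound\<close> controls its rate of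
      change along the flow.\<close>
    have rb: "\<bar>\<integral>z. m z * (Dq z (1, v z) - \<epsilon> * Ds z (1, v z)) \<partial>cyl 0 T\<bar> <= \<epsilon>\<^sup>2 * (L * h\<^sup>2 * P1\<^sup>2) + \<bar>\<epsilon>\<bar> * (h\<^sup>2 * P1 * L)"
    proof (rule D_bound[OF rC])
     show "(\<Psi> (snd (0, x) + (\<epsilon> * W (0, x)) *\<^sub>R ?e) - \<Psi> (snd (0, x))) - \<epsilon> * (W (0, x) * X (0, x)) = 0" for x
      using R0[of 0] hh by (simp add: W_def)
     fix t x
     let ?z = "(t, x) :: real \<times> (real^'n)"
     let ?y = "\<epsilon> * W ?z"
     have y: "\<bar>?y\<bar> <= \<bar>\<epsilon>\<bar> * (h * P1)" using mult_left_mono[OF Wb[of ?z], of "\<bar>\<epsilon>\<bar>"] by (simp add: abs_mult)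
     have "\<bar>\<Psi> (x + ?y *\<^sub>R ?e) - \<Psi> x - p x \<bullet> (?y *\<^sub>R ?e)\<bar> <= L * (norm (?y *\<^sub>R ?e))\<^sup>2" by (rule \<Psi>_taylor)
     then have 1: "\<bar>\<Psi> (x + ?y *\<^sub>R ?e) - \<Psi> x - ?y * p x $ i\<bar> <= L * \<bar>?y\<bar>\<^sup>2" by (simp add: norm_axis_1 inner_axis)
     have 2: "L * \<bar>?y\<bar>\<^sup>2 <= L * (\<bar>\<epsilon>\<bar> * (h * P1))\<^sup>2" using y L by (intro mult_left_mono power_mono) auto
     have "\<bar>?y * p x $ i - ?y * X ?z\<bar> = \<bar>?y\<bar> * \<bar>X ?z - p x $ i\<bar>"
      unfolding right_diff_distrib[symmetric] abs_mult by (simp add: abs_minus_commute)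
     also have "... <= (\<bar>\<epsilon>\<bar> * (h * P1)) * (L * h)" using y Xp[of ?z] h P1 by (intro mult_mono) auto
     finally have 3: "\<bar>?y * p x $ i - ?y * X ?z\<bar> <= \<bar>\<epsilon>\<bar> * (h\<^sup>2 * P1 * L)" by (simp add: power2_eq_square ac_simps)
     have 4: "L * (\<bar>\<epsilon>\<bar> * (h * P1))\<^sup>2 = \<epsilon>\<^sup>2 * (L * h\<^sup>2 * P1\<^sup>2)" by (simp add: power_mult_distrib)
     have 5: "\<epsilon> * (W ?z * X ?z) = ?y * X ?z" by simp
     show "\<bar>(\<Psi> (snd ?z + ?y *\<^sub>R ?e) - \<Psi> (snd ?z)) - \<epsilon> * (W ?z * X ?z)\<bar> <= \<epsilon>\<^sup>2 * (L * h\<^sup>2 * P1\<^sup>2) + \<bar>\<epsilon>\<bar> * (h\<^sup>2 * P1 * L)"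
      using 1 2 3 unfolding 4 5 snd_conv by linarith
    qed
    have ir: "integrable (cyl 0 T) (%z. m z * (Dq z (1, v z) - \<epsilon> * Ds z (1, v z)))" by (rule weak_sol_integrable_D(1)[OF ws rC])
    let ?U = "%z. lagr G p m v z + \<epsilon> * (m z * (\<kappa> (fst z) * (X z * (v z $ i + X z)))) + \<epsilon> * (m z * (R (fst z) * (DX z (1, v z) * (v z $ i + 2 * X z))))
     + \<epsilon>\<^sup>2 / 2 * (m z * (wz z)\<^sup>2) + \<bar>\<epsilon>\<bar> * (K * L) * (R (fst z) * (G (m z) + 1)) + m z * (Dq z (1, v z) - \<epsilon> * Ds z (1, v z))"
    have "F m v <= (LINT z|cyl 0 T. ?L z)" using F_min[OF w Gi] unfolding F_def l(2) by (simp add: V Phi)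
    also have "... <= (LINT z|cyl 0 T. ?U z)"
    proof (rule cyl_mono_integral[OF iL])
     show "integrable (cyl 0 T) ?U" using int_lagr iA iA2 iB iEG ir by auto
     fix z
     define n0 where "n0 = (norm (v z))\<^sup>2"
     have nn: "(norm (v z + (\<epsilon> * wz z) *\<^sub>R ?e))\<^sup>2 = n0 + 2 * (\<epsilon> * wz z) * (v z $ i) + (\<epsilon> * wz z)\<^sup>2"
      unfolding n0_def power2_norm_eq_inner
      by (simp add: inner_add_left inner_add_right inner_axis inner_axis_axis inner_commute[of "axis i 1"]) (simp add: power2_eq_square algebra_simps)
     have dq: "(v z + (\<epsilon> * wz z) *\<^sub>R ?e) \<bullet> p (snd z + (\<epsilon> * W z) *\<^sub>R ?e) = v z \<bullet> p (snd z) + Dq z (1, v z)"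
      by (simp add: Dq_def wzDW)
     \<comment> \<open>The variation of the cost through \<open>W * X\<close> and of the kinetic
       energy through \<open>wz * (v $ i)\<close> regroup: terms with the slope
       \<open>\<kappa>\<close> form \<open>A\<close>, terms with \<open>R\<close> form
       \<open>A2\<close>.\<close>
     have ds: "Ds z (1, v z) + wz z * (v z $ i) = \<kappa> (fst z) * (X z * (v z $ i + X z)) + R (fst z) * (DX z (1, v z) * (v z $ i + 2 * X z))"
      by (simp add: Ds_def wzDW wz_def W_def algebra_simps)
     have "?L z <= 1/2 * m z * (n0 + 2 * (\<epsilon> * wz z) * (v z $ i) + (\<epsilon> * wz z)\<^sup>2) + (G (m z) + \<bar>\<epsilon>\<bar> * (K * L) * (R (fst z) * (G (m z) + 1))) + m z * (v z \<bullet> p (snd z) + Dq z (1, v z))"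
      unfolding nn dq using pr[of z] by linarith
     also have "... = lagr G p m v z + \<epsilon> * m z * (Ds z (1, v z) + wz z * (v z $ i)) + \<epsilon>\<^sup>2 / 2 * (m z * (wz z)\<^sup>2)
       + \<bar>\<epsilon>\<bar> * (K * L) * (R (fst z) * (G (m z) + 1)) + m z * (Dq z (1, v z) - \<epsilon> * Ds z (1, v z))"
      by (simp add: lagr_def n0_def power_mult_distrib algebra_simps)
     also have "... = ?U z" unfolding ds by (simp add: algebra_simps)
     finally show "?L z <= ?U z" .
    qed
    also have "... = F m v + \<epsilon> * A + \<epsilon> * A2 + \<epsilon>\<^sup>2 / 2 * B1 + \<bar>\<epsilon>\<bar> * (K * L) * EG + (LINT z|cyl 0 T. m z * (Dq z (1, v z) - \<epsilon> * Ds z (1, v z)))"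
     unfolding F_def A_def A2_def B1_def EG_def using int_lagr iA iA2 iB iEG ir by simp
    also have "... <= F m v + \<epsilon> * A + \<epsilon> * A2 + \<epsilon>\<^sup>2 / 2 * B1 + \<bar>\<epsilon>\<bar> * (K * L) * EG + (\<epsilon>\<^sup>2 * (L * h\<^sup>2 * P1\<^sup>2) + \<bar>\<epsilon>\<bar> * (h\<^sup>2 * P1 * L))"
     using rb by linarith
    finally show "0 <= \<epsilon> * (A + A2) + \<bar>\<epsilon>\<bar> * E1 + \<epsilon>\<^sup>2 * B"
     by (simp add: E1_def B_def algebra_simps)
   qed
   then have "\<bar>A\<bar> <= E1 + \<bar>A2\<bar>" by linarith
   also have "E1 <= K * L * ((Ce + 1) * h\<^sup>2) + h\<^sup>2 * P1 * L"
    unfolding E1_def using mult_left_mono[OF EGb, of "K * L"] K L by simp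
   also have "\<bar>A2\<bar> <= L * (1 + 2 * P1) * (1 + Ce) * h\<^sup>2" by (rule A2b)
   finally have "\<bar>A\<bar> <= CA * h\<^sup>2" by (simp add: CA_def algebra_simps)
   moreover have "A = (LINT z|cyl 0 T. clamp01 ?a k (fst z) * (m z * (X z * (v z $ i + X z))))"
    unfolding A_def by (intro Bochner_Integration.integral_cong) (auto simp: \<kappa>e)
   ultimately show ?thesis by simp
  qed
  have iX: "integrable (cyl 0 T) (%z. m z * (X z * (v z $ i + X z)))"
  proof (rule int_m_quad[where K="P1 * (1 + P1)"])
   fix z
   have "\<bar>X z * (v z $ i + X z)\<bar> <= P1 * (norm (v z) + P1)"
    unfolding abs_mult using Xb[of z] viX[of z] P1 by (intro mult_mono) auto
   also have "... <= P1 * ((1 + P1) * (1 + (norm (v z))\<^sup>2))"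
   proof (rule mult_left_mono[OF _ P1(1)])
    have "norm (v z) <= 1 + (norm (v z))\<^sup>2" by (rule tvv1)
    moreover have "P1 <= P1 * (1 + (norm (v z))\<^sup>2)" using P1 by (simp add: mult_le_cancel_left1)
    ultimately show "norm (v z) + P1 <= (1 + P1) * (1 + (norm (v z))\<^sup>2)" by (simp add: algebra_simps)
   qed
   finally show "\<bar>X z * (v z $ i + X z)\<bar> <= P1 * (1 + P1) * (1 + (norm (v z))\<^sup>2)" by (simp add: mult.assoc)
  qed measurable
  \<comment> \<open>The bound \<open>key\<close> is uniform in the sharpness \<open>k\<close>; in
    the limit the slope of the ramp becomes the indicator of the layer.\<close>
  have lim: "\<bar>\<integral>z. m z * (X z * (v z $ i + X z)) \<partial>cyl ?a T\<bar> <= CA * h\<^sup>2"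
  proof (rule LIMSEQ_le_const2)
   show "(%n. \<bar>\<integral>z. clamp01 ?a (real (Suc n)) (fst z) * (m z * (X z * (v z $ i + X z))) \<partial>cyl 0 T\<bar>) \<longlonglongrightarrow> \<bar>\<integral>z. m z * (X z * (v z $ i + X z)) \<partial>cyl ?a T\<bar>"
    by (intro tendsto_rabs clamp_integral_tendsto[OF iX]) (use hh in auto)
   show "\<exists>N. \<forall>n\<ge>N. \<bar>\<integral>z. clamp01 ?a (real (Suc n)) (fst z) * (m z * (X z * (v z $ i + X z))) \<partial>cyl 0 T\<bar> <= CA * h\<^sup>2"
    using key by (intro exI allI impI) (auto simp del: of_nat_Suc)
  qed
  let ?p = "%z :: real \<times> (real^'n). p (snd z) $ i"
  let ?d = "%z. ?p z * (v z $ i + ?p z) - X z * (v z $ i + X z)"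
  have db: "\<bar>?d z\<bar> <= (L * h * (1 + 2 * P1)) * (1 + (norm (v z))\<^sup>2)" for z
  proof -
   have "?d z = (?p z - X z) * (v z $ i + ?p z + X z)" by (simp add: algebra_simps)
   also have "\<bar>...\<bar> <= (L * h) * (norm (v z) + 2 * P1)"
    unfolding abs_mult
   proof (intro mult_mono)
    show "\<bar>?p z - X z\<bar> <= L * h" using Xp[of z] by (simp add: abs_minus_commute)
    show "\<bar>v z $ i + ?p z + X z\<bar> <= norm (v z) + 2 * P1" using viX[of z] pb[of "snd z"] Xb[of z] P1 by linarith
   qed (use L h in auto)
   also have "... <= (L * h) * ((1 + 2 * P1) * (1 + (norm (v z))\<^sup>2))"
   proof (rule mult_left_mono)
    have "norm (v z) <= 1 + (norm (v z))\<^sup>2" by (rule tvv1)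
    moreover have "2 * P1 <= 2 * P1 * (1 + (norm (v z))\<^sup>2)" using P1 by (simp add: mult_le_cancel_left1)
    ultimately show "norm (v z) + 2 * P1 <= (1 + 2 * P1) * (1 + (norm (v z))\<^sup>2)" by (simp add: algebra_simps)
   qed (use L h in auto)
   finally show ?thesis by (simp add: mult.assoc)
  qed
  have id: "integrable (cyl 0 T) (%z. m z * ?d z)" by (rule int_m_quad[where K="L * h * (1 + 2 * P1)"]) (use db in auto)
  define Id where "Id = (LINT z|cyl ?a T. m z * ?d z)"
  have "\<bar>Id\<bar> <= (L * h * (1 + 2 * P1)) * (h + E)"
  proof -
   have "Id = (LINT z|cyl 0 T. indicator {?a<..<T} (fst z) * (m z * ?d z))"
    unfolding Id_def by (rule integral_cyl_subset) (use hh h in auto)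
   also have "... = (LINT z|cyl 0 T. m z * (indicator {?a<..<T} (fst z) * ?d z))"
    by (intro Bochner_Integration.integral_cong) auto
   finally have "\<bar>Id\<bar> = \<bar>\<integral>z. m z * (indicator {?a<..<T} (fst z) * ?d z) \<partial>cyl 0 T\<bar>" by simp
   also have "... <= (L * h * (1 + 2 * P1)) * (h + E)"
    unfolding E_def
   proof (rule m_quad_bound)
    show "\<bar>indicator {?a<..<T} (fst z) * ?d z\<bar> <= (L * h * (1 + 2 * P1)) * (1 + (norm (v z))\<^sup>2) * indicator {?a<..} (fst z)" for z
     using db[of z] L h P1 by (auto simp: indicator_def)
   qed (use h hh in auto)
   finally show ?thesis .
  qed
  also have "... <= (L * h * (1 + 2 * P1)) * ((1 + Ce) * h)" by (rule mult_left_mono[OF hE]) (use h L P1 in auto)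
  also have "... = CB * h\<^sup>2" by (simp add: CB_def power2_eq_square ac_simps)
  finally have Idb: "\<bar>Id\<bar> <= CB * h\<^sup>2" .
  have "(LINT z|cyl ?a T. m z * (?p z * (v z $ i + ?p z))) = (LINT z|cyl ?a T. m z * (X z * (v z $ i + X z)) + m z * ?d z)"
   by (intro Bochner_Integration.integral_cong) (auto simp: algebra_simps)
  also have "... = (LINT z|cyl ?a T. m z * (X z * (v z $ i + X z))) + Id"
   unfolding Id_def by (rule Bochner_Integration.integral_add[OF end_subset[OF iX hh(3)] end_subset[OF id hh(3)]])
  finally show ?thesis using lim Idb by (simp add: distrib_right)
 qed
 moreover have "0 <= CA + CB" using CA L P1 Ce by (simp add: CB_def)
 ultimately show ?thesis using h0 by blast
qed

end

section \<open>Difference quotients\<close>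

context minimizer begin

text \<open>\<open>q\<close> is \<open>m\<close> times the square of \<open>norm (v + p)\<close>,
  minus \<open>m\<close> times \<open>p \<bullet> (v + p)\<close>. The square may be dropped in a
  lower bound, and the second part is a sum of the components just estimated.\<close>

lemma end_momentum:
 "\<exists>C\<ge>0. \<exists>h0>0. \<forall>h. 0 < h \<and> h <= h0 --> - (LINT z|cyl (T - h) T. q z) <= C * h\<^sup>2"
proof -
 obtain C h1 where C: "!!i. 0 <= C i" "!!i. 0 < h1 i"
  "!!i h. 0 < h ==> h <= h1 i ==> \<bar>\<integral>z. m z * (p (snd z) $ i * (v z $ i + p (snd z) $ i)) \<partial>cyl (T - h) T\<bar> <= C i * h\<^sup>2"
 proof -
  define Q where "Q i C h1 \<longleftrightarrow> 0 <= C \<and> 0 < h1 \<and> (\<forall>h. 0 < h \<and> h <= h1 -->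
   \<bar>\<integral>z. m z * (p (snd z) $ i * (v z $ i + p (snd z) $ i)) \<partial>cyl (T - h) T\<bar> <= C * h\<^sup>2)" for i and C h1 :: real
  have "\<forall>i. \<exists>C h1. Q i C h1" unfolding Q_def using end_momentum_component by blast
  then obtain C h1 where "\<forall>i. Q i (C i) (h1 i)" by metis
  then show ?thesis using that[of C h1] unfolding Q_def by blast
 qed
 define h0 where "h0 = min T (Min (range h1))"
 have h0: "0 < h0" using C(2) T by (auto simp: h0_def)
 have "- (LINT z|cyl (T - h) T. q z) <= (\<Sum>i\<in>UNIV. C i) * h\<^sup>2" if h: "0 < h" "h <= h0" for h
 proof -
  let ?f = "%i z :: real \<times> (real^'n). m z * (p (snd z) $ i * (v z $ i + p (snd z) $ i))"
  have hT: "h <= T" using h by (simp add: h0_def)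
  have hi: "h <= h1 i" for i using h by (simp add: h0_def)
  have i: "integrable (cyl (T - h) T) (?f i)" for i
  proof (rule end_subset[OF int_m_quad hT])
   fix z :: "real \<times> (real^'n)"
   have pb: "\<bar>p (snd z) $ i\<bar> <= P" using component_le_norm_cart[of "p (snd z)" i] P_bound[of "snd z"] by linarith
   have "\<bar>p (snd z) $ i * (v z $ i + p (snd z) $ i)\<bar> <= P * (norm (v z) + P)"
    unfolding abs_mult using pb component_le_norm_cart[of "v z" i] P_nonneg by (intro mult_mono) auto
   also have "... <= P * ((1 + P) * (1 + (norm (v z))\<^sup>2))"
   proof (rule mult_left_mono[OF _ P_nonneg])
    have "norm (v z) <= 1 + (norm (v z))\<^sup>2"
     using zero_le_power2[of "norm (v z) - 1/2"] by (simp add: power2_eq_square algebra_simps)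
    moreover have "P <= P * (1 + (norm (v z))\<^sup>2)" using P_nonneg by (simp add: mult_le_cancel_left1)
    ultimately show "norm (v z) + P <= (1 + P) * (1 + (norm (v z))\<^sup>2)" by (simp add: algebra_simps)
   qed
   finally show "\<bar>p (snd z) $ i * (v z $ i + p (snd z) $ i)\<bar> <= (P * (1 + P)) * (1 + (norm (v z))\<^sup>2)" by (simp add: mult.assoc)
  qed measurable
  have "(\<Sum>i\<in>UNIV. \<integral>z. ?f i z \<partial>cyl (T - h) T) <= (\<Sum>i\<in>UNIV. C i * h\<^sup>2)"
   by (rule sum_mono) (rule abs_le_D1[OF C(3)[OF h(1) hi]])
  then have "- (\<Sum>i\<in>UNIV. C i) * h\<^sup>2 <= - (\<Sum>i\<in>UNIV. \<integral>z. ?f i z \<partial>cyl (T - h) T)"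
   by (simp only: sum_distrib_right[symmetric] mult_minus_left neg_le_iff_le)
  also have "... = (LINT z|cyl (T - h) T. - (\<Sum>i\<in>UNIV. ?f i z))" using i by simp
  also have "... <= (LINT z|cyl (T - h) T. q z)"
  proof (rule cyl_mono_integral[OF _ end_subset[OF int_q hT]])
   show "integrable (cyl (T - h) T) (%z. - (\<Sum>i\<in>UNIV. ?f i z))" using i by auto
   fix z
   have "(\<Sum>i\<in>UNIV. ?f i z) = m z * (p (snd z) \<bullet> (v z + p (snd z)))"
    by (simp add: inner_vec_def sum_distrib_left)
   moreover have "q z = m z * (norm (v z + p (snd z)))\<^sup>2 - m z * (p (snd z) \<bullet> (v z + p (snd z)))"
    unfolding q_def e0_def power2_norm_eq_inner
    by (simp add: inner_add_left inner_add_right inner_commute algebra_simps)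
   moreover have "0 <= m z * (norm (v z + p (snd z)))\<^sup>2" using wsD(5)[of z] by simp
   ultimately show "- (\<Sum>i\<in>UNIV. ?f i z) <= q z" by linarith
  qed
  finally show ?thesis by simp
 qed
 then show ?thesis using h0 C(1) by (intro exI[of _ "\<Sum>i\<in>UNIV. C i"] conjI exI[of _ h0]) (auto intro: sum_nonneg)
qed

lemma time_estimate:
 assumes t2: "0 < t2" "t2 < T"
 shows "\<exists>C. \<exists>h0>0. \<forall>h. 0 < h \<and> h <= h0 --> integrable (cyl t2 T) (%z. (J (m z) - J (m (z - (h, 0))))\<^sup>2) \<and>
  (LINT z|cyl t2 T. (J (m z) - J (m (z - (h, 0))))\<^sup>2) <= C * h\<^sup>2"
proof -
 \<comment> \<open>The shifted competitor is a translate of \<open>m\<close> only from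
   \<open>t1 + h\<close> on; taking half of \<open>t2\<close> leaves room for
   \<open>h <= t1 / 4\<close>.\<close>
 define t1 where "t1 = t2 / 2"
 have t1: "0 < t1" "t1 < T" using t2 by (auto simp: t1_def)
 obtain C1 h1 where C1: "0 <= C1" "0 < h1" "!!h. 0 < h ==> h <= h1 ==> - (LINT z|cyl (T - h) T. q z) <= C1 * h\<^sup>2"
  using end_momentum by blast
 define h0 where "h0 = min h1 (min (t1 / 4) (T - t1))"
 have h0: "0 < h0" using C1 t1 by (simp add: h0_def)
 define C2 where "C2 = (2 / t1)\<^sup>2 * (LINT z|cyl 0 T. e0 z)"
 have "integrable (cyl t2 T) (%z. (J (m z) - J (m (z - (h, 0))))\<^sup>2) \<and>
  (LINT z|cyl t2 T. (J (m z) - J (m (z - (h, 0))))\<^sup>2) <= 2 / c * (C1 + C2) * h\<^sup>2" if h: "0 < h" "h <= h0" for h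
 proof -
  have hh: "h <= h1" "h <= t1 / 4" "h <= T - t1" using h by (auto simp: h0_def)
  obtain m' v' where mv: "weak_sol T \<rho> m' v'" "integrable (cyl 0 T) (%z. G (m' z))"
   "!!z. t1 + h <= fst z ==> m' z = m (z - (h, 0))" "F m' v' - F m v <= C2 * h\<^sup>2 - (LINT z|cyl (T - h) T. q z)"
   using time_shift_energy[OF t1 h(1) hh(2,3)] unfolding C2_def by blast
  note me = midpoint_estimate[OF mv(1,2)]
  have mm: "m' z = m (z - (h, 0))" if "z \<in> space (cyl t2 T)" for z
   by (rule mv(3)) (use that hh t1 t1_def in auto)
  have i: "integrable (cyl t2 T) (%z. (J (m z) - J (m' z))\<^sup>2)" by (rule integrable_cyl_subset[OF me(1)]) (use t2 in auto)
  have "integrable (cyl t2 T) (%z. (J (m z) - J (m (z - (h, 0))))\<^sup>2) \<longleftrightarrow> integrable (cyl t2 T) (%z. (J (m z) - J (m' z))\<^sup>2)"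
   by (rule Bochner_Integration.integrable_cong) (use mm in auto)
  moreover have "(LINT z|cyl t2 T. (J (m z) - J (m (z - (h, 0))))\<^sup>2) <= 2 / c * (C1 + C2) * h\<^sup>2"
  proof -
   have "(LINT z|cyl t2 T. (J (m z) - J (m (z - (h, 0))))\<^sup>2) = (LINT z|cyl t2 T. (J (m z) - J (m' z))\<^sup>2)"
    by (rule Bochner_Integration.integral_cong) (use mm in auto)
   also have "... = (LINT z|cyl 0 T. indicator {t2<..<T} (fst z) * (J (m z) - J (m' z))\<^sup>2)"
    by (rule integral_cyl_subset) (use t2 in auto)
   also have "... <= (LINT z|cyl 0 T. (J (m z) - J (m' z))\<^sup>2)"
    by (rule cyl_mono_integral[OF integrable_cyl_bounded_mult[OF me(1), where B=1] me(1)]) (auto simp: indicator_def)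
   finally have "c / 2 * (LINT z|cyl t2 T. (J (m z) - J (m (z - (h, 0))))\<^sup>2) <= c / 2 * (LINT z|cyl 0 T. (J (m z) - J (m' z))\<^sup>2)"
    using c by (intro mult_left_mono) auto
   also have "... <= C2 * h\<^sup>2 + C1 * h\<^sup>2" using me(2) mv(4) C1(3)[OF h(1) hh(1)] by linarith
   finally show ?thesis using c by (simp add: field_simps)
  qed
  ultimately show ?thesis using i by blast
 qed
 then show ?thesis using h0 by blast
qed

lemma difference_estimate:
 assumes t1: "0 < t1" "t1 < T" and e: "e \<in> Basis"
 shows "\<exists>C. \<exists>h0>0. \<forall>h. 0 < h \<and> h <= h0 --> integrable (cyl t1 T) (%z. (J (m z) - J (m (z - h *\<^sub>R e)))\<^sup>2) \<and>
  (LINT z|cyl t1 T. (J (m z) - J (m (z - h *\<^sub>R e)))\<^sup>2) <= C * h\<^sup>2"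
proof -
 from e consider "e = (1, 0)" | i where "e = (0, axis i 1)" by (auto simp: Basis_prod_def Basis_vec_def)
 then show ?thesis
 proof cases
  case 1
  then show ?thesis using time_estimate[OF t1] by simp
 next
  case 2
  obtain C where C: "!!\<delta>. integrable (cyl t1 T) (%z. (J (m z) - J (m (z - (0, \<delta> *\<^sub>R axis i 1))))\<^sup>2)"
   "!!\<delta>. (LINT z|cyl t1 T. (J (m z) - J (m (z - (0, \<delta> *\<^sub>R axis i 1))))\<^sup>2) <= C * \<delta>\<^sup>2"
   using space_estimate[OF t1, of i] by blast
  show ?thesis unfolding 2 by (rule exI[of _ C], rule exI[of _ 1]) (use C in simp)
 qed
qed

text \<open>Comparison with density 0 in the midpoint inequality bounds the square of
  \<open>J (m z) - J 0\<close> by a multiple of \<open>G (m z) + G 0\<close>.\<close>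

lemma J_square_integrable: "integrable (cyl 0 T) (%z. (J (m z))\<^sup>2)"
proof -
 have "integrable (cyl 0 T) (%z. 4 / c * (G (m z) + G 0) + 2 * (J 0)\<^sup>2)"
  by (intro Bochner_Integration.integrable_add integrable_mult_right int_G integrable_cyl_one)
 then show ?thesis
 proof (rule Bochner_Integration.integrable_bound)
  show "AE z in cyl 0 T. norm ((J (m z))\<^sup>2) <= norm (4 / c * (G (m z) + G 0) + 2 * (J 0)\<^sup>2)"
  proof (rule AE_I2)
   fix z
   have "c / 4 * (J (m z) - J 0)\<^sup>2 <= 1/2 * (G (m z) + G 0)"
    using G_J[OF wsD(5)[of z], of 0] G_nonneg[of "(m z + 0) / 2"] wsD(5)[of z] by simp
   then have "(J (m z) - J 0)\<^sup>2 <= 2 / c * (G (m z) + G 0)" using c by (simp add: field_simps)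
   moreover have "(J (m z))\<^sup>2 <= 2 * (J (m z) - J 0)\<^sup>2 + 2 * (J 0)\<^sup>2"
    using zero_le_power2[of "J (m z) - 2 * J 0"] by (simp add: power2_eq_square algebra_simps)
   ultimately have "(J (m z))\<^sup>2 <= 2 * (2 / c * (G (m z) + G 0)) + 2 * (J 0)\<^sup>2" by linarith
   then show "norm ((J (m z))\<^sup>2) <= norm (4 / c * (G (m z) + G 0) + 2 * (J 0)\<^sup>2)" by simp
  qed
 qed measurable
qed

end

section \<open>Weak limits in L2 as elements of least norm\<close>

inductive_set dyadic_hull :: "(nat => 'a => real) => nat => ('a => real) set" for w :: "nat => 'a => real" and n :: nat where
 base: "n <= k ==> w k \<in> dyadic_hull w n"
| mid: "f \<in> dyadic_hull w n ==> g \<in> dyadic_hull w n ==> (%x. (f x + g x) / 2) \<in> dyadic_hull w n"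

lemma dyadic_hull_mono: "f \<in> dyadic_hull w m ==> n <= m ==> f \<in> dyadic_hull w n"
 by (induction rule: dyadic_hull.induct) (auto intro: dyadic_hull.intros)

lemma square_integrable_mult:
 fixes f g :: "'a => real"
 assumes [measurable]: "f \<in> borel_measurable M" "g \<in> borel_measurable M"
  and i: "integrable M (%x. (f x)\<^sup>2)" "integrable M (%x. (g x)\<^sup>2)"
 shows "integrable M (%x. f x * g x)"
proof (rule Bochner_Integration.integrable_bound)
 show "integrable M (%x. (f x)\<^sup>2 + (g x)\<^sup>2)" using i by auto
 have "\<bar>a * b\<bar> <= \<bar>a\<^sup>2 + b\<^sup>2\<bar>" for a b :: real
 proof -
  have "0 <= (\<bar>a\<bar> - \<bar>b\<bar>)\<^sup>2" by simp
  then have "2 * (\<bar>a\<bar> * \<bar>b\<bar>) <= a\<^sup>2 + b\<^sup>2" by (simp add: power2_diff)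
  moreover have "0 <= \<bar>a\<bar> * \<bar>b\<bar>" by simp
  ultimately show ?thesis unfolding abs_mult by linarith
 qed
 then show "AE x in M. norm (f x * g x) <= norm ((f x)\<^sup>2 + (g x)\<^sup>2)" by auto
qed measurable

text \<open>Nearly minimal elements of the midpoint hulls of the tails are Cauchy in L2 by the
  parallelogram law, for which closure under midpoints is all the convexity required;
  \<open>W\<close> is the limit of a subsequence of them. If the pairings of \<open>w n\<close> with
  \<phi> converge, those of elements of later and later hulls have the same limit.\<close>

lemma L2_weak_cluster:
 fixes w :: "nat => 'a => real"
 assumes "finite_measure M" and wm: "!!n. w n \<in> borel_measurable M"
  and wi: "!!n. integrable M (%x. (w n x)\<^sup>2)" and wC: "!!n. (LINT x|M. (w n x)\<^sup>2) <= C"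
 shows "\<exists>W. W \<in> borel_measurable M \<and> integrable M (%x. (W x)\<^sup>2) \<and>
  (\<forall>\<phi> l. \<phi> \<in> borel_measurable M --> integrable M (%x. (\<phi> x)\<^sup>2) --> (%n. \<integral>x. w n x * \<phi> x \<partial>M) \<longlonglongrightarrow> l -->
    (LINT x|M. W x * \<phi> x) = l)"
proof -
 interpret finite_measure M by fact
 let ?K = "dyadic_hull w"
 define N where "N f = (LINT x|M. (f x)\<^sup>2)" for f :: "'a => real"
 have KP: "f \<in> borel_measurable M \<and> integrable M (%x. (f x)\<^sup>2)" if "f \<in> ?K n" for f n
  using that
 proof (induction rule: dyadic_hull.induct)
  case (mid f g)
  then have [measurable]: "f \<in> borel_measurable M" "g \<in> borel_measurable M" by auto
  have "integrable M (%x. (f x)\<^sup>2 / 4 + (g x)\<^sup>2 / 4 + (f x * g x) / 2)" using mid square_integrable_mult[of f M g] by auto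
  moreover have "((f x + g x) / 2)\<^sup>2 = (f x)\<^sup>2 / 4 + (g x)\<^sup>2 / 4 + (f x * g x) / 2" for x
   by (simp add: power2_eq_square field_simps)
  ultimately show ?case by simp
 qed (use wm wi in auto)
 have N0: "0 <= N f" for f unfolding N_def by simp
 \<comment> \<open>The hulls shrink with \<open>n\<close>, so their minimal squared norms increase,
   and \<open>C\<close> bounds them; the Cauchy estimate is expressed by the distance of
   \<open>d n\<close> to the limit \<open>D\<close>.\<close>
 define d where "d n = Inf (N ` ?K n)" for n
 have bdd: "bdd_below (N ` ?K n)" for n by (rule bdd_belowI[of _ 0]) (use N0 in auto)
 have ne: "w n \<in> ?K n" for n by (rule dyadic_hull.base) simp
 have dl: "d n <= N f" if "f \<in> ?K n" for f n unfolding d_def by (rule cInf_lower[OF _ bdd]) (use that in auto)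
 have dC: "d n <= C" for n using dl[OF ne[of n]] wC[of n] by (simp add: N_def)
 have dinc: "incseq d"
 proof (rule incseq_SucI)
  fix n
  show "d n <= d (Suc n)" unfolding d_def[of "Suc n"]
   by (rule cInf_greatest) (use ne[of "Suc n"] dl dyadic_hull_mono[of _ w "Suc n" n] in auto)
 qed
 obtain D where D: "d \<longlonglongrightarrow> D" "!!n. d n <= D" using incseq_convergent[OF dinc] dC by blast
 have "\<exists>f. f \<in> ?K n \<and> N f < d n + inverse (real (Suc n))" for n
 proof -
  have "\<exists>y\<in>N ` ?K n. y < d n + inverse (real (Suc n))" unfolding d_def
   by (rule cInf_lessD) (use ne[of n] in auto)
  then show ?thesis by auto
 qed
 then obtain x where x: "!!n. x n \<in> ?K n" "!!n. N (x n) < d n + inverse (real (Suc n))" by metis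
 have par: "N (%y. f y - g y) = 2 * N f + 2 * N g - 4 * N (%y. (f y + g y) / 2)"
  if "f \<in> ?K n" "g \<in> ?K n" for f g n
 proof -
  note f = KP[OF that(1)] and g = KP[OF that(2)] and h = KP[OF dyadic_hull.mid[OF that]]
  have "N (%y. f y - g y) = (LINT y|M. 2 * (f y)\<^sup>2 + 2 * (g y)\<^sup>2 - 4 * ((f y + g y) / 2)\<^sup>2)"
   unfolding N_def by (intro Bochner_Integration.integral_cong) (auto simp: power2_eq_square field_simps)
  also have "... = 2 * N f + 2 * N g - 4 * N (%y. (f y + g y) / 2)"
   unfolding N_def using f g h by simp
  finally show ?thesis .
 qed
 have cau: "N (%y. x m y - x n y) <= 4 * (D - d n) + 4 * inverse (real (Suc n))" if "n <= m" for m n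
 proof -
  have xm: "x m \<in> ?K n" by (rule dyadic_hull_mono[OF x(1) that])
  have "N (%y. x m y - x n y) = 2 * N (x m) + 2 * N (x n) - 4 * N (%y. (x m y + x n y) / 2)" by (rule par[OF xm x(1)])
  moreover have "d n <= N (%y. (x m y + x n y) / 2)" by (rule dl[OF dyadic_hull.mid[OF xm x(1)]])
  moreover have "inverse (real (Suc m)) <= inverse (real (Suc n))" using that by simp
  moreover have "a = 2 * b + 2 * c - 4 * e ==> dn <= e ==> im <= in' ==> b < dm + im ==> c < dn + in' ==> dm <= D ==> dn <= D
   ==> a <= 4 * (D - dn) + 4 * in'" for a b c e dn dm im in' :: real by argo
  ultimately show ?thesis using x(2)[of m] x(2)[of n] D(2)[of m] D(2)[of n] by blast
 qed
 have "\<exists>n. \<forall>m\<ge>n. N (%y. x m y - x n y) <= (1/4) ^ j" for j :: nat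
 proof -
  have "(%n. 4 * (D - d n) + 4 * inverse (real (Suc n))) \<longlonglongrightarrow> 4 * (D - D) + 4 * 0"
   by (intro tendsto_intros D(1) LIMSEQ_inverse_real_of_nat)
  then have "eventually (%n. 4 * (D - d n) + 4 * inverse (real (Suc n)) < (1/4) ^ j) sequentially"
   by (rule order_tendstoD(2)) simp
  then obtain n where "4 * (D - d n) + 4 * inverse (real (Suc n)) < (1/4) ^ j" by (auto simp: eventually_sequentially)
  then show ?thesis using cau[of n] by (intro exI[of _ n] allI impI) (metis less_imp_le order_trans)
 qed
 then obtain s0 where s0: "!!j m. s0 j <= m ==> N (%y. x m y - x (s0 j) y) <= (1/4) ^ j" by metis
 \<comment> \<open>\<open>s\<close> dominates \<open>s0\<close>, is nondecreasing and is at least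
   the identity; the last property puts \<open>y j\<close> into ever later hulls.\<close>
 define s where "s j = j + (\<Sum>k\<le>j. s0 k)" for j
 have s_ge: "s0 j <= s j" "j <= s j" for j
  using member_le_sum[of j "{..j}" s0] by (auto simp: s_def)
 have s_mono: "s j <= s k" if "j <= k" for j k
  unfolding s_def using that by (intro add_mono sum_mono2) auto
 define y where "y j = x (s j)" for j
 have yK: "y j \<in> ?K (s j)" for j by (simp add: y_def x)
 have ym [measurable]: "y j \<in> borel_measurable M" for j using KP[OF yK] by blast
 have yi: "integrable M (%x. (y j x)\<^sup>2)" for j using KP[OF yK] by blast
 have dif_i: "integrable M (%x. (f x - g x)\<^sup>2)"
  if [measurable]: "f \<in> borel_measurable M" "g \<in> borel_measurable M" and "integrable M (%x. (f x)\<^sup>2)" "integrable M (%x. (g x)\<^sup>2)" for f g :: "'a => real"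
 proof -
  have "integrable M (%x. (f x)\<^sup>2 + (g x)\<^sup>2 - 2 * (f x * g x))" using that square_integrable_mult[of f M g] by auto
  then show ?thesis by (simp add: power2_diff mult.assoc)
 qed
 have yd: "N (%z. y k z - y j z) <= 4 * (1/4) ^ j" if "j <= k" for j k
 proof -
  let ?a = "x (s0 j)"
  have am: "?a \<in> borel_measurable M" "integrable M (%z. (?a z)\<^sup>2)" using KP[OF x(1)] by blast+
  have 1: "N (%z. y k z - ?a z) <= (1/4) ^ j" unfolding y_def by (rule s0) (use s_ge(1)[of j] s_mono[OF that] in simp)
  have 2: "N (%z. y j z - ?a z) <= (1/4) ^ j" unfolding y_def by (rule s0) (rule s_ge)
  have "N (%z. y k z - y j z) <= (LINT z|M. 2 * (y k z - ?a z)\<^sup>2 + 2 * (y j z - ?a z)\<^sup>2)"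
   unfolding N_def
  proof (rule integral_mono)
   show "(y k z - y j z)\<^sup>2 <= 2 * (y k z - ?a z)\<^sup>2 + 2 * (y j z - ?a z)\<^sup>2" for z
    using zero_le_power2[of "y k z + y j z - 2 * ?a z"] by (simp add: power2_eq_square algebra_simps)
  qed (use dif_i[OF ym am(1) yi am(2)] dif_i[OF ym ym yi yi] in auto)
  also have "... = 2 * N (%z. y k z - ?a z) + 2 * N (%z. y j z - ?a z)"
   unfolding N_def using dif_i[OF ym am(1) yi am(2)] by simp
  finally show ?thesis using 1 2 by linarith
 qed
 \<comment> \<open>The squared L2 distances are of order \<open>(1/4)^j\<close>. By
   \<open>a <= 2^j * a^2 + (1/2)^j\<close> the L1 norms of the increments are then summable on a
   finite measure space, which gives convergence almost everywhere.\<close>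
 have AEs: "AE z in M. summable (%j. \<bar>y (Suc j) z - y j z\<bar>)"
 proof -
  have b: "(\<integral>\<^sup>+z. ennreal \<bar>y (Suc j) z - y j z\<bar> \<partial>M) <= ennreal ((4 + measure M (space M)) * (1/2) ^ j)" for j
  proof -
   have "(\<integral>\<^sup>+z. ennreal \<bar>y (Suc j) z - y j z\<bar> \<partial>M) <= (\<integral>\<^sup>+z. ennreal (2 ^ j * (y (Suc j) z - y j z)\<^sup>2 + (1/2) ^ j) \<partial>M)"
   proof (intro nn_integral_mono ennreal_leI)
    fix z
    define a where "a = \<bar>y (Suc j) z - y j z\<bar>"
    have "a <= 2 ^ j * a\<^sup>2 + (1/2) ^ j"
    proof -
     have "0 <= 2 ^ j * (a - (1/2) ^ j)\<^sup>2" by simp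
     also have "... = 2 ^ j * a\<^sup>2 - 2 * a * (2 ^ j * (1/2) ^ j) + (2 ^ j * (1/2) ^ j) * (1/2) ^ j"
      by (simp add: power2_eq_square algebra_simps)
     also have "(2::real) ^ j * (1/2) ^ j = 1" by (simp add: power_mult_distrib[symmetric])
     finally have "0 <= 2 ^ j * a\<^sup>2 - 2 * a + (1/2) ^ j" by simp
     moreover have "0 <= a" by (simp add: a_def)
     ultimately show ?thesis by argo
    qed
    then show "\<bar>y (Suc j) z - y j z\<bar> <= 2 ^ j * (y (Suc j) z - y j z)\<^sup>2 + (1/2) ^ j" by (simp add: a_def)
   qed
   also have "... = ennreal (LINT z|M. 2 ^ j * (y (Suc j) z - y j z)\<^sup>2 + (1/2) ^ j)"
    by (rule nn_integral_eq_integral) (use dif_i[OF ym ym yi yi] in auto)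
   also have "(LINT z|M. 2 ^ j * (y (Suc j) z - y j z)\<^sup>2 + (1/2) ^ j) = 2 ^ j * N (%z. y (Suc j) z - y j z) + (1/2) ^ j * measure M (space M)"
    unfolding N_def using dif_i[OF ym ym yi yi] by simp
   also have "... <= (4 + measure M (space M)) * (1/2) ^ j"
   proof -
    have "2 ^ j * N (%z. y (Suc j) z - y j z) <= 2 ^ j * (4 * (1/4) ^ j)" by (intro mult_left_mono yd) auto
    also have "... = 4 * (1/2) ^ j" by (simp add: power_mult_distrib[symmetric])
    finally show ?thesis by (simp add: algebra_simps)
   qed
   finally show ?thesis by (simp add: ennreal_leI)
  qed
  have "(\<integral>\<^sup>+z. (\<Sum>j. ennreal \<bar>y (Suc j) z - y j z\<bar>) \<partial>M) = (\<Sum>j. \<integral>\<^sup>+z. ennreal \<bar>y (Suc j) z - y j z\<bar> \<partial>M)"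
   by (rule nn_integral_suminf) measurable
  also have "... <= (\<Sum>j. ennreal ((4 + measure M (space M)) * (1/2) ^ j))"
   by (intro suminf_le b) auto
  also have "... = ennreal (\<Sum>j. (4 + measure M (space M)) * (1/2) ^ j)"
   by (rule suminf_ennreal2) (auto intro!: summable_mult summable_geometric)
  finally have "(\<integral>\<^sup>+z. (\<Sum>j. ennreal \<bar>y (Suc j) z - y j z\<bar>) \<partial>M) \<noteq> \<infinity>" by (auto simp: top_unique)
  then have "AE z in M. (\<Sum>j. ennreal \<bar>y (Suc j) z - y j z\<bar>) \<noteq> \<infinity>" by (intro nn_integral_PInf_AE) auto
  then show ?thesis by eventually_elim (auto intro!: summable_suminf_not_top)
 qed
 define W where "W z = lim (%j. y j z)" for z
 have [measurable]: "W \<in> borel_measurable M" unfolding W_def[abs_def] by measurable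
 have AEl: "AE z in M. (%j. y j z) \<longlonglongrightarrow> W z"
  using AEs
 proof eventually_elim
  case (elim z)
  then have "summable (%j. y (Suc j) z - y j z)" by (rule summable_rabs_cancel)
  then have "convergent (%n. \<Sum>j<n. y (Suc j) z - y j z)" by (simp add: summable_iff_convergent)
  then have "convergent (%n. y n z - y 0 z)" by (simp only: sum_lessThan_telescope[of "%j. y j z"])
  then have "convergent (%n. (y n z - y 0 z) + y 0 z)" by (intro convergent_add convergent_const)
  then show ?case unfolding W_def by (simp add: convergent_LIMSEQ_iff)
 qed
 \<comment> \<open>Fatou's lemma turns the pointwise limit into an L2 limit with the same
   rate.\<close>
 have Wy: "(\<integral>\<^sup>+z. ennreal ((W z - y j z)\<^sup>2) \<partial>M) <= ennreal (4 * (1/4) ^ j)" for j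
 proof -
  have "(\<integral>\<^sup>+z. ennreal ((W z - y j z)\<^sup>2) \<partial>M) = (\<integral>\<^sup>+z. liminf (%k. ennreal ((y k z - y j z)\<^sup>2)) \<partial>M)"
  proof (rule nn_integral_cong_AE)
   show "AE z in M. ennreal ((W z - y j z)\<^sup>2) = liminf (%k. ennreal ((y k z - y j z)\<^sup>2))"
    using AEl
   proof eventually_elim
    case (elim z)
    then have "(%k. ennreal ((y k z - y j z)\<^sup>2)) \<longlonglongrightarrow> ennreal ((W z - y j z)\<^sup>2)" by (intro tendsto_intros)
    then show ?case by (intro lim_imp_Liminf[symmetric]) auto
   qed
  qed
  also have "... <= liminf (%k. \<integral>\<^sup>+z. ennreal ((y k z - y j z)\<^sup>2) \<partial>M)" by (rule nn_integral_liminf) measurable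
  also have "... <= limsup (%k. \<integral>\<^sup>+z. ennreal ((y k z - y j z)\<^sup>2) \<partial>M)" by (rule Liminf_le_Limsup) simp
  also have "... <= ennreal (4 * (1/4) ^ j)"
  proof (rule Limsup_bounded)
   show "eventually (%k. (\<integral>\<^sup>+z. ennreal ((y k z - y j z)\<^sup>2) \<partial>M) <= ennreal (4 * (1/4) ^ j)) sequentially"
    unfolding eventually_sequentially
   proof (intro exI allI impI)
    fix k assume "j <= k"
    have "(\<integral>\<^sup>+z. ennreal ((y k z - y j z)\<^sup>2) \<partial>M) = ennreal (N (%z. y k z - y j z))"
     unfolding N_def by (rule nn_integral_eq_integral) (use dif_i[OF ym ym yi yi] in auto)
    then show "(\<integral>\<^sup>+z. ennreal ((y k z - y j z)\<^sup>2) \<partial>M) <= ennreal (4 * (1/4) ^ j)"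
     using yd[OF \<open>j <= k\<close>] by (simp add: ennreal_leI)
   qed
  qed
  finally show ?thesis .
 qed
 have Wyi: "integrable M (%z. (W z - y j z)\<^sup>2)" for j
  using Wy[of j] by (intro integrableI_bounded) (auto simp: less_top[symmetric] top_unique)
 have WyN: "N (%z. W z - y j z) <= 4 * (1/4) ^ j" for j
  using Wy[of j] unfolding N_def by (subst (asm) nn_integral_eq_integral[OF Wyi]) auto
 have Wi: "integrable M (%z. (W z)\<^sup>2)"
 proof -
  have "integrable M (%z. ((W z - y 0 z) - (- y 0 z))\<^sup>2)" by (rule dif_i) (use Wyi[of 0] yi in auto)
  then show ?thesis by simp
 qed
 have "(LINT z|M. W z * \<phi> z) = l"
  if [measurable]: "\<phi> \<in> borel_measurable M" and \<phi>: "integrable M (%x. (\<phi> x)\<^sup>2)" and l: "(%n. \<integral>x. w n x * \<phi> x \<partial>M) \<longlonglongrightarrow> l" for \<phi> l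
 proof -
  \<comment> \<open>Averaging two numbers within \<epsilon> of \<open>l\<close> gives another one,
    so the bound for the tail passes to its hull by induction.\<close>
  have hull: "\<bar>(LINT z|M. f z * \<phi> z) - l\<bar> <= \<epsilon>" if "f \<in> ?K n" "!!k. n <= k ==> \<bar>(LINT z|M. w k z * \<phi> z) - l\<bar> <= \<epsilon>" for f n \<epsilon>
   using that(1)
  proof (induction rule: dyadic_hull.induct)
   case (mid f g)
   have i: "integrable M (%z. f z * \<phi> z)" "integrable M (%z. g z * \<phi> z)"
    using KP[OF mid.hyps(1)] KP[OF mid.hyps(2)] \<phi> by (auto intro!: square_integrable_mult)
   have "(LINT z|M. (f z + g z) / 2 * \<phi> z) = (LINT z|M. 1/2 * (f z * \<phi> z) + 1/2 * (g z * \<phi> z))"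
    by (intro Bochner_Integration.integral_cong) (auto simp: field_simps)
   also have "... = 1/2 * (LINT z|M. f z * \<phi> z) + 1/2 * (LINT z|M. g z * \<phi> z)" using i by simp
   finally show ?case using mid.IH by (simp add: field_simps) arith?
  qed (use that(2) in auto)
  have "(%j. \<integral>z. y j z * \<phi> z \<partial>M) \<longlonglongrightarrow> l"
  proof (rule LIMSEQ_I)
   fix r :: real assume r: "0 < r"
   obtain n0 where n0: "!!k. n0 <= k ==> \<bar>(LINT z|M. w k z * \<phi> z) - l\<bar> < r / 2"
    using LIMSEQ_D[OF l, of "r / 2"] r by auto
   have "norm ((LINT z|M. y j z * \<phi> z) - l) < r" if "n0 <= j" for j
   proof -
    have "\<bar>(LINT z|M. y j z * \<phi> z) - l\<bar> <= r / 2"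
     by (rule hull[OF yK]) (use n0 s_ge(2)[of j] that in \<open>auto intro: less_imp_le\<close>)
    then show ?thesis using r by simp
   qed
   then show "\<exists>no. \<forall>n\<ge>no. norm ((LINT z|M. y n z * \<phi> z) - l) < r" by blast
  qed
  moreover have "(%j. \<integral>z. y j z * \<phi> z \<partial>M) \<longlonglongrightarrow> (LINT z|M. W z * \<phi> z)"
  proof (rule LIM_zero_cancel, rule Lim_null_comparison)
   have le: "\<bar>(LINT z|M. y j z * \<phi> z) - (LINT z|M. W z * \<phi> z)\<bar> <= (4 + N \<phi>) * (1/2) ^ j" for j
   proof -
    have i: "integrable M (%z. y j z * \<phi> z)" "integrable M (%z. W z * \<phi> z)"
     using yi Wi \<phi> by (auto intro!: square_integrable_mult)
    have "\<bar>(LINT z|M. y j z * \<phi> z) - (LINT z|M. W z * \<phi> z)\<bar> = \<bar>\<integral>z. y j z * \<phi> z - W z * \<phi> z \<partial>M\<bar>" using i by simp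
    also have "... <= (LINT z|M. \<bar>y j z * \<phi> z - W z * \<phi> z\<bar>)" by (rule integral_abs_bound)
    also have "... <= (LINT z|M. 2 ^ j * (W z - y j z)\<^sup>2 + (1/2) ^ j * (\<phi> z)\<^sup>2)"
    proof (rule integral_mono)
     fix z
     define a b where "a = \<bar>W z - y j z\<bar>" and "b = \<bar>\<phi> z\<bar>"
     have ab: "0 <= a * b" by (simp add: a_def b_def)
     have "0 <= 2 ^ j * (a - (1/2) ^ j * b)\<^sup>2" by simp
     also have "... = 2 ^ j * a\<^sup>2 - 2 * (a * b) * (2 ^ j * (1/2) ^ j) + (2 ^ j * (1/2) ^ j) * (1/2) ^ j * b\<^sup>2"
      by (simp add: power2_eq_square algebra_simps)
     also have "(2::real) ^ j * (1/2) ^ j = 1" by (simp add: power_mult_distrib[symmetric])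
     finally have "a * b <= 2 ^ j * a\<^sup>2 + (1/2) ^ j * b\<^sup>2" using ab by simp
     then show "\<bar>y j z * \<phi> z - W z * \<phi> z\<bar> <= 2 ^ j * (W z - y j z)\<^sup>2 + (1/2) ^ j * (\<phi> z)\<^sup>2"
      by (simp add: a_def b_def left_diff_distrib[symmetric] abs_mult abs_minus_commute)
    qed (use i Wyi[of j] \<phi> in auto)
    also have "... = 2 ^ j * N (%z. W z - y j z) + (1/2) ^ j * N \<phi>" unfolding N_def using Wyi[of j] \<phi> by simp
    also have "... <= 2 ^ j * (4 * (1/4) ^ j) + (1/2) ^ j * N \<phi>" using mult_left_mono[OF WyN[of j], of "2 ^ j"] by simp
    also have "2 ^ j * (4 * (1/4) ^ j) = 4 * (1/2::real) ^ j" by (simp add: power_mult_distrib[symmetric])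
    finally show ?thesis by (simp add: algebra_simps)
   qed
   then show "eventually (%j. norm ((LINT z|M. y j z * \<phi> z) - (LINT z|M. W z * \<phi> z)) <= (4 + N \<phi>) * (1/2) ^ j) sequentially" by simp
   have "(%j. (4 + N \<phi>) * (1/2) ^ j) \<longlonglongrightarrow> (4 + N \<phi>) * 0" by (intro tendsto_intros LIMSEQ_power_zero) simp
   then show "(%j. (4 + N \<phi>) * (1/2) ^ j) \<longlonglongrightarrow> 0" by simp
  qed
  ultimately show ?thesis using LIMSEQ_unique by blast
 qed
 then show ?thesis using Wi by (intro exI[of _ W]) auto
qed

section \<open>Weak derivatives from difference quotients\<close>

lemma integral_cong_parts:
 fixes f g :: "'a => real"
 assumes m: "f \<in> borel_measurable M" "g \<in> borel_measurable M"
  and 1: "(\<integral>\<^sup>+z. ennreal (f z) \<partial>M) = (\<integral>\<^sup>+z. ennreal (g z) \<partial>M)"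
  and 2: "(\<integral>\<^sup>+z. ennreal (- f z) \<partial>M) = (\<integral>\<^sup>+z. ennreal (- g z) \<partial>M)"
 shows "integrable M f \<longleftrightarrow> integrable M g" "(LINT z|M. f z) = (LINT z|M. g z)"
proof -
 show I: "integrable M f \<longleftrightarrow> integrable M g" unfolding real_integrable_def 1 2 using m by simp
 show "(LINT z|M. f z) = (LINT z|M. g z)"
 proof (cases "integrable M f")
  case True
  then show ?thesis using I by (simp add: real_lebesgue_integral_def 1 2)
 next
  case False
  then show ?thesis using I by (simp add: not_integrable_integral_eq)
 qed
qed

text \<open>In a space direction periodicity takes care of the cell boundary. In time,
  \<open>f\<close> has to vanish where the translate would enter or leave the interval.\<close>

lemma nn_integral_cyl_translate:
 fixes f :: "real \<times> (real^'n) => ennreal"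
 assumes [measurable]: "f \<in> borel_fun" and per: "tperiodic f"
  and e: "e \<in> Basis" and h: "0 < h" "h <= 1" and supp: "!!z. e = (1, 0) ==> fst z <= a \<or> b - h <= fst z ==> f z = 0"
 shows "(\<integral>\<^sup>+z. f (z - h *\<^sub>R e) \<partial>cyl a b) = (\<integral>\<^sup>+z. f z \<partial>cyl a b)"
proof -
 from e consider "e = (1, 0)" | i where "e = (0, axis i 1)" by (auto simp: Basis_prod_def Basis_vec_def)
 then show ?thesis
 proof cases
  case 1
  have "(\<integral>\<^sup>+z. f (z - h *\<^sub>R e) \<partial>cyl a b) = (\<integral>\<^sup>+t. (%t. (\<integral>\<^sup>+x. f (t, x) * indicator cell x \<partial>lborel) * indicator {a<..<b} (t + h)) (t + - h) \<partial>lborel)"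
   by (subst nn_integral_cyl) (auto simp: 1)
  also have "... = (\<integral>\<^sup>+t. (\<integral>\<^sup>+x. f (t, x) * indicator cell x \<partial>lborel) * indicator {a<..<b} (t + h) \<partial>lborel)"
   by (rule lborel_nn_integral_translate) measurable
  also have "... = (\<integral>\<^sup>+t. (\<integral>\<^sup>+x. f (t, x) * indicator cell x \<partial>lborel) * indicator {a<..<b} t \<partial>lborel)"
  proof (intro nn_integral_cong)
   fix t
   show "(\<integral>\<^sup>+x. f (t, x) * indicator cell x \<partial>lborel) * indicator {a<..<b} (t + h) = (\<integral>\<^sup>+x. f (t, x) * indicator cell x \<partial>lborel) * indicator {a<..<b} t"
   proof (cases "t <= a \<or> b - h <= t")
    case True
    then have "f (t, x) = 0" for x using supp[of "(t, x)"] 1 by simp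
    then show ?thesis by simp
   next
    case False
    then show ?thesis using h by (auto simp: indicator_def)
   qed
  qed
  also have "... = (\<integral>\<^sup>+z. f z \<partial>cyl a b)" by (rule nn_integral_cyl[symmetric]) measurable
  finally show ?thesis .
 next
  case 2
  have "(\<integral>\<^sup>+x. f (t, x - h *\<^sub>R axis i 1) * indicator cell x \<partial>lborel) = (\<integral>\<^sup>+x. f (t, x) * indicator cell x \<partial>lborel)" for t
  proof -
   let ?g = "%x. f (t, x - h *\<^sub>R axis i 1)"
   have "?g (x + axis i 1) = ?g x" for x
    using tperiodicD[OF per axis_in_lattice, of t "x - h *\<^sub>R axis i 1" i] by (simp add: algebra_simps)
   then have "(\<integral>\<^sup>+x. ?g (x + h *\<^sub>R axis i 1) * indicator cell x \<partial>lborel) = (\<integral>\<^sup>+x. ?g x * indicator cell x \<partial>lborel)"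
    by (intro nn_integral_cell_translate) (use h in auto)
   then show ?thesis by simp
  qed
  then show ?thesis by (subst (1 2) nn_integral_cyl) (auto simp: 2)
 qed
qed

text \<open>Backward differences of \<open>u\<close> never look at times beyond \<open>b\<close>.
  Their quotients are bounded in L2; summation by parts moves the difference to \<phi>, where
  dominated convergence applies, and \<open>L2_weak_cluster\<close> supplies the derivative.\<close>

lemma weak_derivative_of_differences:
 fixes u :: "real \<times> (real^'n) => real"
 assumes [measurable]: "u \<in> borel_fun" and per: "tperiodic u"
  and ab: "a < b" and u2: "integrable (cyl a b) (%z. (u z)\<^sup>2)" and e: "e \<in> Basis" and h0: "0 < h0"
  and est: "!!h. 0 < h ==> h <= h0 ==> integrable (cyl a b) (%z. (u z - u (z - h *\<^sub>R e))\<^sup>2) \<and>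
   (LINT z|cyl a b. (u z - u (z - h *\<^sub>R e))\<^sup>2) <= C * h\<^sup>2"
 shows "\<exists>W. W \<in> borel_measurable (cyl a b) \<and> integrable (cyl a b) (%z. (W z)\<^sup>2) \<and>
  (\<forall>\<phi> D \<alpha> \<beta>. C1per \<phi> D --> a < \<alpha> --> \<beta> < b --> (\<forall>t x. t \<notin> {\<alpha>..\<beta>} --> \<phi> (t, x) = 0) -->
   (LINT z|cyl a b. u z * D z e) = - (LINT z|cyl a b. W z * \<phi> z))"
proof -
 define h where "h n = h0 * inverse (real (Suc n))" for n
 have h: "0 < h n" "h n <= h0" for n
  using h0 by (auto simp: h_def mult_le_cancel_left1 inverse_le_1_iff)
 have hlim: "h \<longlonglongrightarrow> 0" unfolding h_def[abs_def] using tendsto_mult[OF tendsto_const LIMSEQ_inverse_real_of_nat, of h0] by simp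
 define w where "w n z = (u z - u (z - h n *\<^sub>R e)) / h n" for n z
 have tr [measurable]: "(%z. u (z - r *\<^sub>R e)) \<in> borel_fun" for r
  by (rule measurable_compose[of "%z. z - r *\<^sub>R e" borel borel u]) auto
 have wm [measurable]: "w n \<in> borel_fun" for n unfolding w_def[abs_def] by measurable
 have w2: "(w n z)\<^sup>2 = (1 / (h n)\<^sup>2) * (u z - u (z - h n *\<^sub>R e))\<^sup>2" for n z
  by (simp add: w_def power_divide)
 have wi: "integrable (cyl a b) (%z. (w n z)\<^sup>2)" for n unfolding w2 using est[OF h] by auto
 have wC: "(LINT z|cyl a b. (w n z)\<^sup>2) <= C" for n
  unfolding w2 using est[OF h, of n] h(1)[of n] by (simp add: divide_le_eq)
 interpret fm: finite_measure "cyl a b :: (real \<times> (real^'n)) measure" by (rule finite_measure_cyl)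
 have ui: "integrable (cyl a b) u"
  using square_integrable_mult[of u "cyl a b" "%_. 1"] u2 by simp
 obtain W where W0: "W \<in> borel_measurable (cyl a b) \<and> integrable (cyl a b) (%z. (W z)\<^sup>2) \<and>
  (\<forall>\<phi> l. \<phi> \<in> borel_measurable (cyl a b) --> integrable (cyl a b) (%x. (\<phi> x)\<^sup>2) --> (%n. \<integral>x. w n x * \<phi> x \<partial>cyl a b) \<longlonglongrightarrow> l -->
    (LINT x|cyl a b. W x * \<phi> x) = l)"
  using L2_weak_cluster[of "cyl a b" w C, OF finite_measure_cyl borel_measurable_cyl[OF wm] wi wC] by (elim exE)
 note W = W0[THEN conjunct1] W0[THEN conjunct2, THEN conjunct1] W0[THEN conjunct2, THEN conjunct2, rule_format]
 have "(LINT z|cyl a b. u z * D z e) = - (LINT z|cyl a b. W z * \<phi> z)"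
  if \<phi>: "C1per \<phi> D" and \<alpha>\<beta>: "a < \<alpha>" "\<beta> < b" and supp: "!!t x. t \<notin> {\<alpha>..\<beta>} ==> \<phi> (t, x) = 0" for \<phi> D \<alpha> \<beta>
 proof -
  note [measurable] = C1per_borel[OF \<phi>]
  obtain B where B: "!!t x. t \<in> {\<alpha> - 1..\<beta> + 1} ==> \<bar>\<phi> (t, x)\<bar> <= B" using continuous_cbox_bound[OF C1perD(4,3)[OF \<phi>]] by blast
  have \<phi>b: "\<bar>\<phi> z\<bar> <= \<bar>B\<bar>" for z
   using B[of "fst z" "snd z"] supp[of "fst z" "snd z"] by (cases "fst z \<in> {\<alpha>..\<beta>}") auto
  have \<phi>2: "integrable (cyl a b) (%z. (\<phi> z)\<^sup>2)"
   by (rule fm.integrable_const_bound[of _ "\<bar>B\<bar>\<^sup>2"]) (use \<phi>b in \<open>auto simp: abs_le_square_iff[symmetric] intro!: AE_I2\<close>)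
  obtain BD where BD: "!!t x. t \<in> {\<alpha> - 1..\<beta> + 1} ==> \<bar>D (t, x) e\<bar> <= BD"
   using continuous_cbox_bound[OF C1perD(2)[OF \<phi>] tperiodic_comp[OF C1per_per[OF \<phi>]]] by blast
  have Db: "\<bar>D z e\<bar> <= \<bar>BD\<bar>" for z
  proof (cases "fst z \<in> {\<alpha> - 1..\<beta> + 1}")
   case True then show ?thesis using BD[of "fst z" "snd z"] by simp
  next
   case False
   have "(\<phi> has_derivative (%_. 0)) (at z)"
   proof (rule has_derivative_transform_within_open[of "%_. 0" _ _ _ "{z. fst z < \<alpha>} \<union> {z. \<beta> < fst z}"])
    show "open ({z :: real \<times> (real^'n). fst z < \<alpha>} \<union> {z. \<beta> < fst z})"
     by (intro open_Un open_Collect_less continuous_intros)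
    show "0 = \<phi> x" if "x \<in> {z. fst z < \<alpha>} \<union> {z. \<beta> < fst z}" for x
     using supp[of "fst x" "snd x"] that by auto
   qed (use False in auto)
   then have "D z = (%_. 0)" using has_derivative_unique C1perD(1)[OF \<phi>] by blast
   then show ?thesis by simp
  qed
  have line: "((%s. \<phi> (z + s *\<^sub>R e)) has_real_derivative D (z + s *\<^sub>R e) e) (at s)" for z s
  proof -
   have "((%s. \<phi> (z + s *\<^sub>R e)) has_derivative (%r. D (z + s *\<^sub>R e) (r *\<^sub>R e))) (at s)"
    by (rule has_derivative_compose[where g=\<phi> and f="%s. z + s *\<^sub>R e", OF _ C1perD(1)[OF \<phi>]]) (auto intro!: derivative_eq_intros)
   moreover have "D (z + s *\<^sub>R e) (r *\<^sub>R e) = D (z + s *\<^sub>R e) e * r" for r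
    using linear_scale[OF C1perD(5)[OF \<phi>], of "z + s *\<^sub>R e" r e] by (simp add: mult.commute)
   ultimately show ?thesis by (simp add: has_field_derivative_def)
  qed
  have lip: "\<bar>\<phi> (z + r *\<^sub>R e) - \<phi> z\<bar> <= \<bar>BD\<bar> * r" if r: "0 < r" for z r
  proof -
   obtain s where "\<phi> (z + r *\<^sub>R e) - \<phi> (z + 0 *\<^sub>R e) = (r - 0) * D (z + s *\<^sub>R e) e"
    using MVT2[OF r, of "%s. \<phi> (z + s *\<^sub>R e)" "%s. D (z + s *\<^sub>R e) e"] line by blast
   then show ?thesis using mult_left_mono[OF Db[of "z + s *\<^sub>R e"], of r] r by (simp add: abs_mult mult.commute)
  qed
  have tr\<phi> [measurable]: "(%z. \<phi> (z + r *\<^sub>R e)) \<in> borel_fun" for r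
   by (rule measurable_compose[of "%z. z + r *\<^sub>R e" borel borel \<phi>]) auto
  \<comment> \<open>The step must be shorter than the distance from the support of \<phi> to the
    ends of the interval, so that translation crosses no time boundary, and at most 1 for the
    translation within the cell.\<close>
  have "eventually (%n. h n < min (\<alpha> - a) (min 1 (b - \<beta>))) sequentially"
   by (rule order_tendstoD(2)[OF hlim]) (use \<alpha>\<beta> in auto)
  then have ev: "eventually (%n. (LINT z|cyl a b. w n z * \<phi> z) = - (LINT z|cyl a b. u z * ((\<phi> (z + h n *\<^sub>R e) - \<phi> z) / h n))) sequentially"
  proof eventually_elim
   case (elim n)
   then have hn: "h n < \<alpha> - a" "h n <= 1" by auto
   define k where "k = h n"
   have k: "0 < k" "k < \<alpha> - a" "k <= 1" using h(1)[of n] hn by (auto simp: k_def)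
   define f where "f z = u z * \<phi> (z + k *\<^sub>R e)" for z
   have [measurable]: "f \<in> borel_fun" unfolding f_def[abs_def] by measurable
   have fs: "(%z. f (z - k *\<^sub>R e)) \<in> borel_fun"
    by (rule measurable_compose[of "%z. z - k *\<^sub>R e" borel borel f]) auto
   have fper: "tperiodic f"
    unfolding tperiodic_def
   proof (intro allI impI)
    fix t x l assume l: "(l::real^'n) \<in> lattice"
    have "(t, x + l) + k *\<^sub>R e = (t + fst (k *\<^sub>R e), (x + snd (k *\<^sub>R e)) + l)" "(t, x) + k *\<^sub>R e = (t + fst (k *\<^sub>R e), x + snd (k *\<^sub>R e))"
     by (simp_all add: plus_prod_def)
    then show "f (t, x + l) = f (t, x)"
     unfolding f_def using tperiodicD[OF per l] tperiodicD[OF C1perD(3)[OF \<phi>] l] by simp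
   qed
   \<comment> \<open>Instantiated with the identity and with negation, this treats the positive and
     the negative part of \<open>f\<close>.\<close>
   have eq: "(\<integral>\<^sup>+z. ennreal (H (f (z - k *\<^sub>R e))) \<partial>cyl a b) = (\<integral>\<^sup>+z. ennreal (H (f z)) \<partial>cyl a b)"
    if [measurable]: "H \<in> borel_fun" and H0: "H 0 = (0::real)" for H
   proof (rule nn_integral_cyl_translate[where f="%z. ennreal (H (f z))", OF _ tperiodic_comp[OF fper] e k(1,3)])
    fix z :: "real \<times> (real^'n)" assume "e = (1, 0)" "fst z <= a \<or> b - k <= fst z"
    then have "fst (z + k *\<^sub>R e) \<notin> {\<alpha>..\<beta>}" using k \<alpha>\<beta> by auto
    then have "\<phi> (z + k *\<^sub>R e) = 0" using supp[of "fst (z + k *\<^sub>R e)" "snd (z + k *\<^sub>R e)"] unfolding prod.collapse by blast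
    then show "ennreal (H (f z)) = 0" by (simp add: f_def H0)
   qed measurable
   have p1: "(\<integral>\<^sup>+z. ennreal (f (z - k *\<^sub>R e)) \<partial>cyl a b) = (\<integral>\<^sup>+z. ennreal (f z) \<partial>cyl a b)"
    using eq[of "%x. x"] by simp
   have p2: "(\<integral>\<^sup>+z. ennreal (- f (z - k *\<^sub>R e)) \<partial>cyl a b) = (\<integral>\<^sup>+z. ennreal (- f z) \<partial>cyl a b)"
    using eq[of uminus] by simp
   note parts = integral_cong_parts[OF borel_measurable_cyl[OF fs] borel_measurable_cyl[OF \<open>f \<in> borel_fun\<close>] p1 p2]
   have if': "integrable (cyl a b) f"
   proof -
    have "integrable (cyl a b) (%z. \<phi> (z + k *\<^sub>R e) * u z)"
     by (rule integrable_cyl_bounded_mult[OF ui tr\<phi>, where B="\<bar>B\<bar>"]) (rule \<phi>b)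
    then show ?thesis by (simp add: f_def[abs_def] mult.commute)
   qed
   have iu: "integrable (cyl a b) (%z. u z * \<phi> z)"
   proof -
    have "integrable (cyl a b) (%z. \<phi> z * u z)"
     by (rule integrable_cyl_bounded_mult[OF ui _, where B="\<bar>B\<bar>"]) (auto intro: \<phi>b)
    then show ?thesis by (simp add: mult.commute)
   qed
   have "(LINT z|cyl a b. w n z * \<phi> z) = (LINT z|cyl a b. (1 / k) * (u z * \<phi> z - f (z - k *\<^sub>R e)))"
    by (intro Bochner_Integration.integral_cong) (auto simp: w_def f_def k_def[symmetric] diff_divide_distrib left_diff_distrib)
   also have "... = (1 / k) * ((LINT z|cyl a b. u z * \<phi> z) - (LINT z|cyl a b. f z))"
    using iu if' parts by simp
   also have "... = (LINT z|cyl a b. (1 / k) * (u z * \<phi> z - f z))" using iu if' by simp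
   also have "... = (LINT z|cyl a b. - (u z * ((\<phi> (z + k *\<^sub>R e) - \<phi> z) / k)))"
    by (intro Bochner_Integration.integral_cong) (auto simp: f_def diff_divide_distrib right_diff_distrib)
   finally show ?case by (simp add: k_def)
  qed
  have "(%n. \<integral>z. u z * ((\<phi> (z + h n *\<^sub>R e) - \<phi> z) / h n) \<partial>cyl a b) \<longlonglongrightarrow> (LINT z|cyl a b. u z * D z e)"
  proof (rule integral_dominated_convergence[where w="%z. \<bar>BD\<bar> * \<bar>u z\<bar>"])
   have hat: "filterlim h (at 0) sequentially"
    by (rule filterlim_atI[OF hlim]) (use h(1) in \<open>auto intro!: always_eventually simp: less_imp_neq[symmetric]\<close>)
   show "AE z in cyl a b. (%n. u z * ((\<phi> (z + h n *\<^sub>R e) - \<phi> z) / h n)) \<longlonglongrightarrow> u z * D z e"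
   proof (intro AE_I2 tendsto_mult tendsto_const)
    fix z
    have "((%r. (\<phi> (z + (0 + r) *\<^sub>R e) - \<phi> (z + 0 *\<^sub>R e)) / r) \<longlongrightarrow> D (z + 0 *\<^sub>R e) e) (at 0)"
     using line[of z 0] unfolding DERIV_def .
    from filterlim_compose[OF this hat] show "(%n. (\<phi> (z + h n *\<^sub>R e) - \<phi> z) / h n) \<longlonglongrightarrow> D z e" by simp
   qed
   show "AE z in cyl a b. norm (u z * ((\<phi> (z + h n *\<^sub>R e) - \<phi> z) / h n)) <= \<bar>BD\<bar> * \<bar>u z\<bar>" for n
   proof (rule AE_I2)
    fix z
    have "\<bar>\<phi> (z + h n *\<^sub>R e) - \<phi> z\<bar> / h n <= \<bar>BD\<bar>" using lip[OF h(1)[of n], of z] h(1)[of n] by (simp add: divide_le_eq)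
    from mult_left_mono[OF this, of "\<bar>u z\<bar>"] show "norm (u z * ((\<phi> (z + h n *\<^sub>R e) - \<phi> z) / h n)) <= \<bar>BD\<bar> * \<bar>u z\<bar>"
     using h(1)[of n] by (simp add: abs_mult mult.commute)
   qed
   show "(%z. u z * D z e) \<in> borel_measurable (cyl a b)"
    by (intro borel_measurable_cyl borel_measurable_times borel_measurable_continuous_onI[OF C1perD(2)[OF \<phi>]]) simp
   show "(%z. u z * ((\<phi> (z + h n *\<^sub>R e) - \<phi> z) / h n)) \<in> borel_measurable (cyl a b)" for n
    by (intro borel_measurable_cyl borel_measurable_times borel_measurable_divide borel_measurable_diff tr\<phi>) auto
  qed (use ui in auto)
  then have "(%n. - (LINT z|cyl a b. u z * ((\<phi> (z + h n *\<^sub>R e) - \<phi> z) / h n))) \<longlonglongrightarrow> - (LINT z|cyl a b. u z * D z e)"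
   by (rule tendsto_minus)
  then have "(%n. \<integral>z. w n z * \<phi> z \<partial>cyl a b) \<longlonglongrightarrow> - (LINT z|cyl a b. u z * D z e)"
   by (subst tendsto_cong[OF ev])
  from W(3)[OF _ \<phi>2 this] show ?thesis by simp
 qed
 then show ?thesis using W by (intro exI[of _ W]) auto
qed

section \<open>Weak compactness of probability measures on the torus\<close>

text \<open>
 The digits of \<open>code x\<close> in base 4 record all rational comparisons of coordinates. This embeds the cell into a
 bounded interval with continuous inverse, and Helly's theorem on the line applies.
\<close>

definition code_bit :: "nat => real^'n => real" where
 "code_bit k x = (let d = from_nat_into (UNIV :: (rat \<times> 'n) set) k in indicator {x. x $ snd d < of_rat (fst d)} x)"

definition code :: "real^'n => real" where
 "code x = (\<Sum>k. (1/4) ^ k * code_bit k x)"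

lemma code_bit_cases: "code_bit k x = 0 \<or> code_bit k x = 1"
 by (auto simp: code_bit_def Let_def indicator_def)

lemma code_bit_measurable [measurable]: "code_bit k \<in> borel_fun"
 unfolding code_bit_def[abs_def] Let_def by measurable

lemma code_summable: "summable (%k. (1/4) ^ k * code_bit k x)"
proof (rule summable_comparison_test')
 show "summable (%k. (1/4::real) ^ k)" by (rule summable_geometric) simp
 show "norm ((1/4) ^ k * code_bit k x) <= (1/4) ^ k" for k using code_bit_cases[of k x] by auto
qed

lemma code_measurable [measurable]: "code \<in> borel_fun"
 unfolding code_def[abs_def] by measurable

lemma code_range: "0 <= code x" "code x <= 4/3"
proof -
 show "0 <= code x" unfolding code_def
  by (rule suminf_nonneg[OF code_summable]) (use code_bit_cases[of _ x] in \<open>metis mult_zero_right mult.right_neutral zero_le_power order_refl zero_le_divide_1_iff zero_le_numeral\<close>)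
 have "code x <= (\<Sum>k. (1/4) ^ k)" unfolding code_def
 proof (rule suminf_le)
  show "(1/4) ^ k * code_bit k x <= (1/4) ^ k" for k using code_bit_cases[of k x] by auto
 qed (auto intro!: code_summable summable_geometric)
 also have "... = 4/3" by (simp add: suminf_geometric)
 finally show "code x <= 4/3" .
qed

text \<open>At the first digit \<open>j\<close> that differs the codes part by
  \<open>(1/4)^j\<close>, and all later digits together can undo at most a third of that; the
  remaining two thirds exceed the assumed bound.\<close>

lemma code_separates:
 assumes "\<bar>code x - code y\<bar> < 1/2 * (1/4) ^ N" "k <= N"
 shows "code_bit k x = code_bit k y"
proof (rule ccontr)
 assume neq: "\<not> ?thesis"
 then have ex: "\<exists>k. code_bit k x \<noteq> code_bit k y" by blast
 define j where "j = (LEAST k. code_bit k x \<noteq> code_bit k y)"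
 have j: "code_bit j x \<noteq> code_bit j y" unfolding j_def using ex by (rule LeastI_ex)
 have below: "code_bit i x = code_bit i y" if "i < j" for i using not_less_Least[of i] that unfolding j_def by blast
 have "j <= k" unfolding j_def by (rule Least_le) (use neq in simp)
 then have jN: "j <= N" using assms(2) by simp
 define a where "a k = (1/4) ^ k * code_bit k x - (1/4) ^ k * code_bit k y" for k
 have sa: "summable a" unfolding a_def[abs_def] by (intro summable_diff code_summable)
 have "code x - code y = suminf a" unfolding code_def a_def[abs_def] by (rule suminf_diff) (rule code_summable)+
 also have "... = (\<Sum>k. a (k + Suc j)) + (\<Sum>k<Suc j. a k)" by (rule suminf_split_initial_segment[OF sa])
 also have "(\<Sum>k<Suc j. a k) = a j" using below by (simp add: a_def)
 finally have e: "code x - code y = (\<Sum>k. a (k + Suc j)) + a j" .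
 have aj: "\<bar>a j\<bar> = (1/4) ^ j"
  using j code_bit_cases[of j x] code_bit_cases[of j y] by (auto simp: a_def)
 have ab: "norm (a k) <= (1/4) ^ k" for k using code_bit_cases[of k x] code_bit_cases[of k y] by (auto simp: a_def)
 have sg: "summable (%k. (1/4::real) ^ (k + Suc j))" by (rule summable_ignore_initial_segment) (simp add: summable_geometric)
 have "\<bar>\<Sum>k. a (k + Suc j)\<bar> <= (\<Sum>k. (1/4) ^ (k + Suc j))"
  unfolding real_norm_def[symmetric] by (rule norm_suminf_le[OF ab sg])
 also have "(\<Sum>k. (1/4::real) ^ (k + Suc j)) = (1/4) ^ Suc j * (\<Sum>k. (1/4) ^ k)"
  by (subst suminf_mult[symmetric]) (auto simp: power_add mult.commute summable_geometric)
 also have "... = (1/4) ^ j / 3" by (simp add: suminf_geometric)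
 finally have "(1/4) ^ j - (1/4) ^ j / 3 <= \<bar>code x - code y\<bar>" using e aj by linarith
 moreover have "(1/4::real) ^ N <= (1/4) ^ j" using jN by (intro power_decreasing) auto
 moreover have "0 < (1/4::real) ^ N" by simp
 ultimately show False using assms(1) by linarith
qed

text \<open>Comparison with the grid points \<open>l / M\<close> locates each coordinate to within
  \<open>1 / M\<close>. Only finitely many digits record these comparisons, and sufficiently close
  codes agree on all of them.\<close>

lemma code_inverse_uniform:
 fixes \<epsilon> :: real
 assumes "0 < \<epsilon>"
 shows "\<exists>\<delta>>0. \<forall>x\<in>(cell :: (real^'n) set). \<forall>y\<in>cell. \<bar>code x - code y\<bar> < \<delta> --> norm (x - y) < \<epsilon>"
proof -
 define n where "n = real CARD('n)"
 have n: "0 < n" by (simp add: n_def)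
 obtain M :: nat where M: "n / \<epsilon> < real M" using reals_Archimedean2 by blast
 have M0: "0 < real M" using M n assms by (meson divide_pos_pos less_trans)
 define idx where "idx l i = (SOME k. from_nat_into (UNIV :: (rat \<times> 'n) set) k = (of_nat l / of_nat M, i))" for l :: nat and i :: 'n
 have cnt: "countable (UNIV :: (rat \<times> 'n) set)"
 proof -
  have "countable ((UNIV :: rat set) \<times> (UNIV :: 'n set))" by (intro countable_SIGMA) (auto intro: countable_finite)
  then show ?thesis by simp
 qed
 have idx: "from_nat_into (UNIV :: (rat \<times> 'n) set) (idx l i) = (of_nat l / of_nat M, i)" for l i
 proof -
  have "(of_nat l / of_nat M, i) \<in> range (from_nat_into (UNIV :: (rat \<times> 'n) set))"
   using range_from_nat_into[OF _ cnt] by simp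
  then have "\<exists>k. from_nat_into (UNIV :: (rat \<times> 'n) set) k = (of_nat l / of_nat M, i)" by (metis imageE)
  then show ?thesis unfolding idx_def by (rule someI_ex)
 qed
 define N where "N = Max ((%(l, i). idx l i) ` ({..M} \<times> UNIV))"
 have N: "idx l i <= N" if "l <= M" for l i unfolding N_def by (rule Max_ge) (use that in force)+
 have bit: "code_bit (idx l i) x = (if x $ i < real l / real M then 1 else 0)" for l i and x :: "real^'n"
  unfolding code_bit_def Let_def idx by (simp add: indicator_def of_rat_divide)
 have "norm (x - y) < \<epsilon>" if xy: "x \<in> cell" "y \<in> cell" "\<bar>code x - code y\<bar> < 1/2 * (1/4) ^ N" for x y :: "real^'n"
 proof -
  have agree: "x $ i < real l / real M \<longleftrightarrow> y $ i < real l / real M" if "l <= M" for l i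
   using code_separates[OF xy(3) N[OF that, of i]] unfolding bit by (auto split: if_splits)
  have "\<bar>x $ i - y $ i\<bar> <= 1 / real M" for i
  proof -
   define l where "l = nat \<lfloor>real M * x $ i\<rfloor>"
   have xi: "0 <= x $ i" "x $ i < 1" using xy(1) by (auto simp: cell_def)
   have l: "real l <= real M * x $ i" "real M * x $ i < real l + 1"
    using xi M0 by (auto simp: l_def)
   have "real l < real M"
   proof -
    have "real M * x $ i < real M * 1" using xi M0 by (intro mult_strict_left_mono) auto
    then show ?thesis using l(1) by linarith
   qed
   then have lM: "Suc l <= M" by simp
   have 1: "real l / real M <= x $ i" "x $ i < real (Suc l) / real M"
    using l M0 by (auto simp: divide_le_eq less_divide_eq mult.commute)
   have 2: "real l / real M <= y $ i" using agree[of l i] 1 lM by (auto simp: not_less[symmetric])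
   have 3: "y $ i < real (Suc l) / real M" using agree[OF lM, of i] 1 by simp
   have "real (Suc l) / real M = real l / real M + 1 / real M" by (simp add: add_divide_distrib)
   then show ?thesis using 1 2 3 by linarith
  qed
  then have "norm (x - y) <= (\<Sum>i\<in>(UNIV::'n set). 1 / real M)"
   by (intro order_trans[OF norm_le_l1_cart] sum_mono) simp
  also have "... = n / real M" by (simp add: n_def)
  also have "... < \<epsilon>" using M M0 assms by (simp add: divide_less_eq mult.commute)
  finally show ?thesis .
 qed
 then show ?thesis by (intro exI[of _ "1/2 * (1/4) ^ N"]) auto
qed

text \<open>The inverse of \<open>code\<close> is uniformly continuous on the range of codes; it
  extends to the closure of that range, and from there to the line by Dugundji's theorem. A
  continuous left inverse on the whole line is what lets weak convergence of image measures be
  pulled back.\<close>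

lemma code_section:
 "\<exists>\<gamma> :: real => real^'n. continuous_on UNIV \<gamma> \<and> (\<forall>x\<in>cell. \<gamma> (code x) = x)"
proof -
 have inj: "inj_on code (cell :: (real^'n) set)"
 proof (rule inj_onI)
  fix x y :: "real^'n" assume xy: "x \<in> cell" "y \<in> cell" "code x = code y"
  have "norm (x - y) <= \<epsilon>" if "0 < \<epsilon>" for \<epsilon> using code_inverse_uniform[OF that] xy by (force simp: less_imp_le)
  then have "norm (x - y) <= 0" using field_le_epsilon[of "norm (x - y)" 0] by simp
  then show "x = y" by simp
 qed
 define f where "f = inv_into (cell :: (real^'n) set) code"
 have f: "f (code x) = x" if "x \<in> cell" for x unfolding f_def using inj that by simp
 have "uniformly_continuous_on (code ` (cell :: (real^'n) set)) f"
  unfolding uniformly_continuous_on_def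
 proof (intro allI impI)
  fix \<epsilon> :: real assume "0 < \<epsilon>"
  from code_inverse_uniform[OF this, where 'n='n] obtain \<delta> where \<delta>: "0 < \<delta>"
   "!!x y :: real^'n. x \<in> cell ==> y \<in> cell ==> \<bar>code x - code y\<bar> < \<delta> ==> norm (x - y) < \<epsilon>" by blast
  have "dist (f u') (f u) < \<epsilon>" if u: "u \<in> code ` (cell :: (real^'n) set)" "u' \<in> code ` (cell :: (real^'n) set)" "dist u' u < \<delta>" for u u'
  proof -
   obtain x x' :: "real^'n" where x: "x \<in> cell" "u = code x" "x' \<in> cell" "u' = code x'" using u by blast
   then have "norm (x' - x) < \<epsilon>" using \<delta>(2)[of x' x] u(3) by (simp add: dist_norm)
   then show ?thesis unfolding x(2,4) f[OF x(1)] f[OF x(3)] dist_norm .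
  qed
  then show "\<exists>d>0. \<forall>x\<in>code ` (cell :: (real^'n) set). \<forall>x'\<in>code ` (cell :: (real^'n) set). dist x' x < d --> dist (f x') (f x) < \<epsilon>"
   using \<delta>(1) by blast
 qed
 note uc = this
 obtain g where g: "uniformly_continuous_on (closure (code ` (cell :: (real^'n) set))) g"
  "!!u. u \<in> code ` (cell :: (real^'n) set) ==> f u = g u"
 proof (rule uniformly_continuous_on_extension_on_closure[OF uc])
  fix g assume "uniformly_continuous_on (closure (code ` (cell :: (real^'n) set))) g"
   "!!u. u \<in> code ` (cell :: (real^'n) set) ==> f u = g u"
  then show thesis by (rule that)
 qed
 have "continuous_on (closure (code ` (cell :: (real^'n) set))) g" by (rule uniformly_continuous_imp_continuous[OF g(1)])
 note gc = this
 obtain \<gamma> where \<gamma>: "continuous_on UNIV \<gamma>" "!!u. u \<in> closure (code ` (cell :: (real^'n) set)) ==> \<gamma> u = g u"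
 proof (rule Dugundji[of "UNIV :: (real^'n) set" UNIV "closure (code ` (cell :: (real^'n) set))" g])
  show "convex (UNIV :: (real^'n) set)" "(UNIV :: (real^'n) set) \<noteq> {}" by simp_all
  show "closedin (top_of_set UNIV) (closure (code ` (cell :: (real^'n) set)))" by simp
  show "continuous_on (closure (code ` (cell :: (real^'n) set))) g" by (rule gc)
  show "g ` closure (code ` (cell :: (real^'n) set)) \<subseteq> UNIV" by (rule subset_UNIV)
  fix h assume "continuous_on UNIV h" "!!u. u \<in> closure (code ` (cell :: (real^'n) set)) ==> h u = g u"
  then show thesis by (rule that)
 qed
 have cl: "code x \<in> closure (code ` (cell :: (real^'n) set))" if "x \<in> cell" for x :: "real^'n"
  by (rule subsetD[OF closure_subset imageI[OF that]])
 have "\<gamma> (code x) = x" if "x \<in> cell" for x using \<gamma>(2)[OF cl[OF that]] g(2)[OF imageI[OF that]] f[OF that] by simp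
 then show ?thesis using \<gamma>(1) by blast
qed

section \<open>Weakly convergent subsequences of measures on the cell\<close>

lemma torus_probD:
 assumes "torus_prob \<mu>"
 shows "prob_space \<mu>" "sets \<mu> = sets torus_borel" "space \<mu> = cell" "f \<in> borel_fun ==> f \<in> borel_measurable \<mu>"
proof -
 show 1: "prob_space \<mu>" and 2: "sets \<mu> = sets torus_borel" using assms by (auto simp: torus_prob_def)
 show "space \<mu> = cell" using sets_eq_imp_space_eq[OF 2] by (simp add: space_restrict_space)
 show "f \<in> borel_fun ==> f \<in> borel_measurable \<mu>"
  by (subst measurable_cong_sets[OF 2 refl]) (rule measurable_restrict_space1)
qed

lemma periodic_continuous_bounded:
 fixes \<psi> :: "real^'n => real"
 assumes "continuous_on UNIV \<psi>" "periodic \<psi>"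
 shows "\<exists>B. \<forall>x. \<bar>\<psi> x\<bar> <= B"
proof -
 have "continuous_on UNIV (%z :: real \<times> (real^'n). \<psi> (snd z))"
  by (rule continuous_on_compose2[OF assms(1)]) (auto intro!: continuous_intros)
 moreover have "tperiodic (%z :: real \<times> (real^'n). \<psi> (snd z))" using assms(2) by (auto simp: tperiodic_def periodic_def)
 ultimately show ?thesis using continuous_cbox_bound[of "%z. \<psi> (snd z)" 0 0] by auto
qed

text \<open>The image measures under \<open>code\<close> are tight, and \<open>\<gamma>\<close>
  carries a limit law back. That law may charge numbers that are not codes, where
  \<open>\<gamma>\<close> can leave the cell; \<open>wrap\<close> returns it to the cell, a change
  that periodic \<psi> do not notice.\<close>

lemma torus_weakly_compact:
 fixes \<mu> :: "nat => (real^'n) measure"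
 assumes \<mu>: "!!n. torus_prob (\<mu> n)"
 shows "\<exists>\<nu> s. torus_prob \<nu> \<and> strict_mono (s :: nat => nat) \<and>
  (\<forall>\<psi> :: real^'n => real. continuous_on UNIV \<psi> --> periodic \<psi> --> (%k. \<integral>x. \<psi> x \<partial>\<mu> (s k)) \<longlonglongrightarrow> (LINT x|\<nu>. \<psi> x))"
proof -
 obtain \<gamma> :: "real => real^'n" where \<gamma>: "continuous_on UNIV \<gamma>" "!!x. x \<in> cell ==> \<gamma> (code x) = x"
  using code_section by blast
 define \<kappa> where "\<kappa> n = distr (\<mu> n) borel code" for n
 have cm: "code \<in> \<mu> n \<rightarrow>\<^sub>M borel" for n by (rule torus_probD(4)[OF \<mu>]) measurable
 have rd: "real_distribution (\<kappa> n)" for n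
  unfolding \<kappa>_def by (rule prob_space.real_distribution_distr[OF torus_probD(1)[OF \<mu>] cm])
 have "tight \<kappa>" unfolding tight_def
 proof (intro conjI allI impI rd)
  fix \<epsilon> :: real assume "0 < \<epsilon>"
  have "measure (\<kappa> n) {-1<..2} = 1" for n
  proof -
   have "measure (\<kappa> n) {-1<..2} = measure (\<mu> n) (code -` {-1<..2} \<inter> space (\<mu> n))"
    unfolding \<kappa>_def by (rule measure_distr[OF cm]) simp
   also have "code -` {-1<..2} \<inter> space (\<mu> n) = space (\<mu> n)"
   proof -
    have "-1 < code x" "code x <= 2" for x :: "real^'n" using code_range[of x] by linarith+
    then show ?thesis by auto
   qed
   finally show ?thesis using prob_space.prob_space[OF torus_probD(1)[OF \<mu>]] by simp
  qed
  then show "\<exists>a b. a < b \<and> (\<forall>n. 1 - \<epsilon> < measure (\<kappa> n) {a<..b})"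
   using \<open>0 < \<epsilon>\<close> by (intro exI[of _ "-1"] exI[of _ 2]) auto
 qed
 from tight_imp_convergent_subsubsequence[OF this strict_mono_id] obtain s M where
  sM: "strict_mono (s :: nat => nat)" "real_distribution M" "weak_conv_m (\<kappa> \<circ> s) M" by (auto simp: comp_assoc)
 interpret M: real_distribution M by fact
 have [measurable]: "\<gamma> \<in> borel_fun" by (rule borel_measurable_continuous_onI[OF \<gamma>(1)])
 have wm: "(%u. wrap (\<gamma> u)) \<in> M \<rightarrow>\<^sub>M torus_borel"
  by (rule measurable_restrict_space2) auto
 define \<nu> where "\<nu> = distr M torus_borel (%u. wrap (\<gamma> u))"
 have "torus_prob \<nu>" unfolding torus_prob_def \<nu>_def using M.prob_space_distr[OF wm] by simp
 moreover have "(%k. \<integral>x. \<psi> x \<partial>\<mu> (s k)) \<longlonglongrightarrow> (LINT x|\<nu>. \<psi> x)" if \<psi>: "continuous_on UNIV \<psi>" "periodic \<psi>" for \<psi> :: "real^'n => real"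
 proof -
  obtain B where B: "!!x. \<bar>\<psi> x\<bar> <= B" using periodic_continuous_bounded[OF \<psi>] by blast
  have [measurable]: "\<psi> \<in> borel_fun" by (rule borel_measurable_continuous_onI[OF \<psi>(1)])
  have "continuous_on UNIV (%u. \<psi> (\<gamma> u))" by (rule continuous_on_compose2[OF \<psi>(1) \<gamma>(1)]) simp
  then have "isCont (%u. \<psi> (\<gamma> u)) u" for u by (simp add: continuous_on_eq_continuous_at)
  then have "(%k. \<integral>u. \<psi> (\<gamma> u) \<partial>(\<kappa> \<circ> s) k) \<longlonglongrightarrow> (LINT u|M. \<psi> (\<gamma> u))"
   by (intro weak_conv_imp_integral_bdd_continuous_conv[where B=B] sM(2,3)) (use rd B in auto)
  moreover have "(LINT u|M. \<psi> (\<gamma> u)) = (LINT x|\<nu>. \<psi> x)"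
   unfolding \<nu>_def by (subst integral_distr[OF wm]) (auto simp: periodic_wrap[OF \<psi>(2)] intro!: measurable_restrict_space1)
  moreover have "(LINT u|(\<kappa> \<circ> s) k. \<psi> (\<gamma> u)) = (LINT x|\<mu> (s k). \<psi> x)" for k
  proof -
   have "(LINT u|(\<kappa> \<circ> s) k. \<psi> (\<gamma> u)) = (LINT x|\<mu> (s k). \<psi> (\<gamma> (code x)))"
    unfolding \<kappa>_def comp_def by (rule integral_distr[OF cm]) measurable
   also have "... = (LINT x|\<mu> (s k). \<psi> x)"
    by (intro Bochner_Integration.integral_cong) (auto simp: torus_probD(3)[OF \<mu>] \<gamma>(2))
   finally show ?thesis .
  qed
  ultimately show ?thesis by simp
 qed
 ultimately show ?thesis using sM(1) by blast
qed

section \<open>The distance on the torus\<close>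

lemma zero_lattice: "0 \<in> lattice" and lattice_uminus: "k \<in> lattice ==> - k \<in> lattice"
 and lattice_add: "k \<in> lattice ==> l \<in> lattice ==> k + l \<in> lattice"
 by (auto simp: lattice_def)

lemma torus_dist_bdd: "bdd_below ((%k. norm (x - y + k)) ` lattice)"
 by (rule bdd_belowI[of _ 0]) auto

lemma torus_dist_le: "k \<in> lattice ==> torus_dist x y <= norm (x - y + k)"
 unfolding torus_dist_def by (rule cINF_lower[OF torus_dist_bdd])

lemma torus_dist_nonneg: "0 <= torus_dist x y"
 unfolding torus_dist_def by (rule cINF_greatest) (use zero_lattice in auto)

lemma torus_dist_ge: "(!!k. k \<in> lattice ==> a <= norm (x - y + k)) ==> a <= torus_dist x y"
 unfolding torus_dist_def by (rule cINF_greatest) (use zero_lattice in auto)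

lemma torus_dist_continuous: "continuous_on UNIV (%p :: (real^'n) \<times> (real^'n). torus_dist (fst p) (snd p))"
proof -
 have "torus_dist x y <= torus_dist x' y' + (norm (x - x') + norm (y - y'))" for x y x' y' :: "real^'n"
 proof -
  have "torus_dist x y - (norm (x - x') + norm (y - y')) <= torus_dist x' y'"
  proof (rule torus_dist_ge)
   fix k :: "real^'n" assume "k \<in> lattice"
   then have "torus_dist x y <= norm (x - y + k)" by (rule torus_dist_le)
   also have "x - y + k = (x' - y' + k) + (x - x') - (y - y')" by simp
   also have "norm ... <= norm (x' - y' + k) + norm (x - x') + norm (y - y')"
    by (rule order_trans[OF norm_triangle_ineq4]) (intro add_right_mono norm_triangle_ineq)
   finally show "torus_dist x y - (norm (x - x') + norm (y - y')) <= norm (x' - y' + k)" by linarith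
  qed
  then show ?thesis by linarith
 qed
 note lip = this
 have "dist (torus_dist (fst p) (snd p)) (torus_dist (fst p') (snd p')) <= 2 * dist p p'" for p p' :: "(real^'n) \<times> (real^'n)"
 proof -
  have "norm (fst p - fst p') <= dist p p'" "norm (snd p - snd p') <= dist p p'"
   using dist_fst_le[of p p'] dist_snd_le[of p p'] by (auto simp: dist_norm)
  then show ?thesis
   using lip[of "fst p" "snd p" "fst p'" "snd p'"] lip[of "fst p'" "snd p'" "fst p" "snd p"]
   by (simp add: dist_real_def abs_le_iff norm_minus_commute)
 qed
 then have "2-lipschitz_on UNIV (%p :: (real^'n) \<times> (real^'n). torus_dist (fst p) (snd p))" by (intro lipschitz_onI) auto
 then show ?thesis by (rule lipschitz_on_continuous_on)
qed

lemma cell_diff_norm: "x \<in> cell ==> y \<in> cell ==> norm (x - y) <= real CARD('n)" for x y :: "real^'n"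
proof -
 assume "x \<in> cell" "y \<in> cell"
 then have "\<bar>(x - y) $ i\<bar> <= 1" for i by (auto simp: cell_def abs_le_iff) (smt (verit))+
 then have "norm (x - y) <= (\<Sum>i\<in>(UNIV::'n set). 1)" by (intro order_trans[OF norm_le_l1_cart] sum_mono) auto
 then show ?thesis by simp
qed

lemma torus_dist_cell: "x \<in> cell ==> y \<in> cell ==> torus_dist x y <= real CARD('n)" for x y :: "real^'n"
 using torus_dist_le[OF zero_lattice, of x y] cell_diff_norm[of x y] by simp

section \<open>Couplings from partitions of unity\<close>

lemma C1per_sum:
 assumes "finite Z" "!!z. z \<in> Z ==> C1per (r z) (D z)"
 shows "C1per (%x. \<Sum>z\<in>Z. r z x) (%x w. \<Sum>z\<in>Z. D z x w)"
 using assms by (induction Z rule: finite_induct) (auto intro!: C1per_add simp: C1per_const)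

lemma C1per_inverse:
 assumes r: "C1per r D" and pos: "!!z. r z \<noteq> 0"
 shows "C1per (%z. inverse (r z)) (%z w. - (inverse (r z) * D z w * inverse (r z)))"
 unfolding C1per_def
proof (intro conjI allI)
 show "((%z. inverse (r z)) has_derivative (%w. - (inverse (r z) * D z w * inverse (r z)))) (at z)" for z
  by (rule has_derivative_compose[OF C1perD(1)[OF r] has_derivative_inverse'[OF pos]])
 show "continuous_on UNIV (%z. - (inverse (r z) * D z w * inverse (r z)))" for w
  by (intro continuous_intros C1perD[OF r]) (use pos in auto)
 show "tperiodic (%z. inverse (r z))" using C1perD(3)[OF r] by (rule tperiodic_comp)
qed

lemma C1per_possq:
 assumes r: "C1per r D"
 shows "C1per (%z. possq (r z)) (%z w. 2 * max 0 (r z) * D z w)"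
 unfolding C1per_def
proof (intro conjI allI)
 show "((%z. possq (r z)) has_derivative (%w. 2 * max 0 (r z) * D z w)) (at z)" for z
  by (rule has_derivative_compose[OF C1perD(1)[OF r]]) (use possq_der[of "r z"] in \<open>simp add: has_field_derivative_def\<close>)
 show "continuous_on UNIV (%z. 2 * max 0 (r z) * D z w)" for w
  by (intro continuous_intros C1perD[OF r])
 show "tperiodic (%z. possq (r z))" using C1perD(3)[OF r] by (rule tperiodic_comp)
qed

text \<open>For small \<open>\<kappa>\<close>, a periodic function of \<open>x\<close> that is
  positive only near the lattice translates of \<open>y\<close>; the cosines make it smooth without
  a choice of representatives.\<close>

definition bump_arg :: "real => real^'n => real^'n => real" where
 "bump_arg \<kappa> y x = \<kappa> - (\<Sum>i\<in>UNIV. 1 - cos (2 * pi * (x $ i - y $ i)))"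

lemma C1per_bump_arg: "\<exists>D. C1per (%z. bump_arg \<kappa> y (snd z)) D"
proof -
 let ?D = "%(z :: real \<times> (real^'a)) w. - (\<Sum>i\<in>UNIV. sin (2 * pi * (snd z $ i - y $ i)) * (2 * pi * (snd w $ i)))"
 have "C1per (%z. bump_arg \<kappa> y (snd z)) ?D"
  unfolding C1per_def
 proof (intro conjI allI)
  fix z w :: "real \<times> (real^'a)"
  have c: "((%z. 1 - cos (2 * pi * (snd z $ i - y $ i))) has_derivative (%w. sin (2 * pi * (snd z $ i - y $ i)) * (2 * pi * (snd w $ i)))) (at z)" for i
  proof -
   have l: "((%z :: real \<times> (real^'a). 2 * pi * (snd z $ i - y $ i)) has_derivative (%w. 2 * pi * (snd w $ i))) (at z)"
   proof -
    have "((%z :: real \<times> (real^'a). snd z $ i) has_derivative (%w. snd w $ i)) (at z)"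
     by (rule bounded_linear_imp_has_derivative)
       (rule bounded_linear_compose[OF bounded_linear_vec_nth bounded_linear_snd])
    then show ?thesis by (auto intro!: derivative_eq_intros)
   qed
   have "((%u. 1 - cos u) has_derivative (%h. sin u * h)) (at u)" for u :: real
    by (auto intro!: derivative_eq_intros simp: mult.commute)
   from has_derivative_compose[OF l this] show ?thesis .
  qed
  show "((%z. bump_arg \<kappa> y (snd z)) has_derivative ?D z) (at z)"
   using has_derivative_diff[OF has_derivative_const has_derivative_sum[OF c]]
   unfolding bump_arg_def by simp
  show "continuous_on UNIV (%z. ?D z w)" by (intro continuous_intros)
 next
  show "tperiodic (%z. bump_arg \<kappa> y (snd z))"
   unfolding tperiodic_def
  proof (intro allI impI)
   fix t x k assume k: "(k :: real^'a) \<in> lattice"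
   have "cos (2 * pi * ((x + k) $ i - y $ i)) = cos (2 * pi * (x $ i - y $ i))" for i
   proof -
    obtain n where n: "k $ i = of_int n" using k by (auto simp: lattice_def elim: Ints_cases)
    have e: "2 * pi * ((x + k) $ i - y $ i) = 2 * pi * (x $ i - y $ i) + 2 * pi * of_int n"
     by (simp add: n algebra_simps)
    show ?thesis unfolding e by (simp add: cos_add)
   qed
   then show "bump_arg \<kappa> y (snd (t, x + k)) = bump_arg \<kappa> y (snd (t, x))" by (simp add: bump_arg_def)
  qed
 qed
 then show ?thesis by blast
qed

text \<open>Let \<open>k\<close> be the coordinatewise nearest lattice point to
  \<open>x - y\<close>. If one coordinate were off by more than \<open>\<eta>\<close>, its cosine
  term alone would exhaust \<open>1 - cos (2 * pi * \<eta>)\<close>.\<close>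

lemma bump_arg_near:
 fixes x y :: "real^'n"
 assumes \<eta>: "0 < \<eta>" "\<eta> < 1/2" and pos: "0 < bump_arg (1 - cos (2 * pi * \<eta>)) y x"
 shows "\<exists>k\<in>lattice. norm (x - y - k) <= real CARD('n) * \<eta>"
proof -
 define k where "k = ((\<chi> i. of_int (round (x $ i - y $ i))) :: real^'n)"
 have k: "k \<in> lattice" by (simp add: k_def lattice_def)
 have "\<bar>(x - y - k) $ i\<bar> <= \<eta>" for i
 proof (rule ccontr)
  define u where "u = (x - y - k) $ i"
  assume "\<not> \<bar>(x - y - k) $ i\<bar> <= \<eta>"
  then have u: "\<eta> < \<bar>u\<bar>" by (simp add: u_def)
  have u2: "\<bar>u\<bar> <= 1/2" using of_int_round_abs_le[of "x $ i - y $ i"] by (simp add: u_def k_def abs_minus_commute)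
  have "cos (2 * pi * (x $ i - y $ i)) = cos (2 * pi * u)"
  proof -
   have e: "2 * pi * (x $ i - y $ i) = 2 * pi * u + 2 * pi * of_int (round (x $ i - y $ i))"
    by (simp add: u_def k_def algebra_simps)
   show ?thesis unfolding e by (simp add: cos_add)
  qed
  also have "... = cos (2 * pi * \<bar>u\<bar>)" by (cases "0 <= u") (auto simp: abs_if)
  also have "... <= cos (2 * pi * \<eta>)" using u u2 \<eta> by (intro cos_monotone_0_pi_le) auto
  finally have "1 - cos (2 * pi * \<eta>) <= 1 - cos (2 * pi * (x $ i - y $ i))" by simp
  also have "... <= (\<Sum>i\<in>UNIV. 1 - cos (2 * pi * (x $ i - y $ i)))"
   by (rule member_le_sum) auto
  finally show False using pos by (simp add: bump_arg_def)
 qed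
 then have "norm (x - y - k) <= (\<Sum>i\<in>(UNIV :: 'n set). \<eta>)"
  by (intro order_trans[OF norm_le_l1_cart] sum_mono) auto
 then show ?thesis using k by auto
qed

text \<open>The functions are C1 and periodic so that their averages evolve by the weak equation,
  and their supports are small so that these averages control \<open>W2\<close>.\<close>

lemma partition_of_unity:
 fixes \<epsilon> :: real
 assumes \<epsilon>: "0 < \<epsilon>"
 shows "\<exists>(Z :: (real^'n) set) (f :: real^'n => real^'n => real). finite Z \<and> (\<forall>y\<in>Z. \<exists>D. C1per (%z. f y (snd z)) D) \<and>
  (\<forall>y\<in>Z. \<forall>x. 0 <= f y x) \<and> (\<forall>x. (\<Sum>y\<in>Z. f y x) = 1) \<and>
  (\<forall>y\<in>Z. \<forall>x x'. 0 < f y x --> 0 < f y x' --> torus_dist x x' <= \<epsilon>)"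
proof -
 define n where "n = real CARD('n)"
 have n: "1 <= n" by (simp add: n_def Suc_le_eq)
 \<comment> \<open>Two points of one bump are within \<open>2 * n * \<eta>\<close> of each other
   modulo the lattice; the bound 1/4 keeps \<open>2 * pi * \<eta>\<close> where the cosine is
   decreasing.\<close>
 define \<eta> where "\<eta> = min (1/4) (\<epsilon> / (2 * n))"
 have \<eta>: "0 < \<eta>" "\<eta> < 1/2" using \<epsilon> n by (auto simp: \<eta>_def)
 define \<kappa> where "\<kappa> = 1 - cos (2 * pi * \<eta>)"
 have \<kappa>: "0 < \<kappa>"
 proof -
  have "cos (2 * pi * \<eta>) < cos 0" using \<eta> by (intro cos_monotone_0_pi) auto
  then show ?thesis by (simp add: \<kappa>_def)
 qed
 define b where "b y x = possq (bump_arg \<kappa> y x)" for y x :: "real^'n"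
 have bC: "\<exists>D. C1per (%z. b y (snd z)) D" for y
  using C1per_bump_arg[of \<kappa> y] C1per_possq unfolding b_def by blast
 have b0: "0 <= b y x" for y x by (simp add: b_def possq_def)
 have bpos: "0 < b y x \<longleftrightarrow> 0 < bump_arg \<kappa> y x" for y x by (auto simp: b_def possq_def max_def)
 have byy: "0 < b y y" for y using \<kappa> by (simp add: bpos bump_arg_def)
 have bcont: "continuous_on UNIV (b y)" for y
 proof -
  obtain D where "C1per (%z. b y (snd z)) D" using bC by blast
  from continuous_on_compose2[OF C1perD(4)[OF this, of UNIV] continuous_on_Pair[OF continuous_on_const continuous_on_id]]
  show ?thesis by simp
 qed
 have bper: "periodic (b y)" for y
 proof -
  obtain D where "C1per (%z. b y (snd z)) D" using bC by blast
  from C1perD(3)[OF this] show ?thesis by (auto simp: tperiodic_def periodic_def)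
 qed
 have bo: "open {x. 0 < b y x}" for y using bcont by (auto intro!: open_Collect_less)
 have "cbox 0 (1 :: real^'n) \<subseteq> (\<Union>y\<in>cbox 0 1. {x. 0 < b y x})" using byy by blast
 then obtain Z where Z: "Z \<subseteq> cbox 0 (1 :: real^'n)" "finite Z" "cbox 0 (1 :: real^'n) \<subseteq> (\<Union>y\<in>Z. {x. 0 < b y x})"
  by (rule compactE_image[OF compact_cbox bo])
 define B where "B x = (\<Sum>y\<in>Z. b y x)" for x
 have Bpos: "0 < B x" for x
 proof -
  have "wrap x \<in> cbox 0 1" using wrap_cell[of x] by (auto simp: cell_def mem_box_cart less_imp_le)
  then obtain y where y: "y \<in> Z" "0 < b y (wrap x)" using Z(3) by blast
  then have "0 < b y x" using periodic_wrap[OF bper, of y x] by simp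
  also have "... <= B x" unfolding B_def by (rule member_le_sum) (use y b0 Z in auto)
  finally show ?thesis .
 qed
 have BC: "\<exists>D. C1per (%z. B (snd z)) D"
 proof -
  obtain D where "!!y. C1per (%z. b y (snd z)) (D y)" using bC by metis
  then show ?thesis unfolding B_def using C1per_sum[OF Z(2), of "%y z. b y (snd z)" D] by blast
 qed
 define f where "f y x = b y x * inverse (B x)" for y x
 have "\<exists>D. C1per (%z. f y (snd z)) D" for y
 proof -
  obtain D1 where 1: "C1per (%z. b y (snd z)) D1" using bC by blast
  obtain D2 where 2: "C1per (%z. B (snd z)) D2" using BC by blast
  have "B (snd z) \<noteq> 0" for z :: "real \<times> (real^'n)" using Bpos[of "snd z"] by simp
  from C1per_mult[OF 1 C1per_inverse[OF 2 this]] show ?thesis unfolding f_def by blast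
 qed
 moreover have "0 <= f y x" for y x using b0[of y x] Bpos[of x] by (simp add: f_def less_imp_le)
 moreover have "(\<Sum>y\<in>Z. f y x) = 1" for x
  using Bpos[of x] by (simp add: f_def sum_distrib_right[symmetric] B_def[symmetric])
 moreover have "torus_dist x x' <= \<epsilon>" if "0 < f y x" "0 < f y x'" for x x' y
 proof -
  have "0 < b y x" "0 < b y x'" using that Bpos[of x] Bpos[of x'] by (auto simp: f_def zero_less_mult_iff)
  then have p: "0 < bump_arg (1 - cos (2 * pi * \<eta>)) y x" "0 < bump_arg (1 - cos (2 * pi * \<eta>)) y x'"
   by (simp_all add: bpos \<kappa>_def)
  obtain k where k: "k \<in> lattice" "norm (x - y - k) <= n * \<eta>" using bump_arg_near[OF \<eta> p(1)] by (auto simp: n_def)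
  obtain l where l: "l \<in> lattice" "norm (x' - y - l) <= n * \<eta>" using bump_arg_near[OF \<eta> p(2)] by (auto simp: n_def)
  have "torus_dist x x' <= norm (x - x' + (- k + l))"
   by (rule torus_dist_le) (use k l lattice_add lattice_uminus in blast)
  also have "x - x' + (- k + l) = (x - y - k) - (x' - y - l)" by simp
  also have "norm ... <= n * \<eta> + n * \<eta>" by (rule order_trans[OF norm_triangle_ineq4]) (use k l in linarith)
  also have "... <= \<epsilon>"
  proof -
   have "2 * n * \<eta> <= 2 * n * (\<epsilon> / (2 * n))" using n by (intro mult_left_mono) (auto simp: \<eta>_def)
   also have "... = \<epsilon>" using n by simp
   finally show ?thesis by linarith
  qed
  finally show ?thesis .
 qed
 ultimately show ?thesis using Z(2) by (intro exI[of _ Z] exI[of _ f] conjI) simp_all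
qed

text \<open>
 The common part \<open>min (a y) (b y)\<close> of the masses of each cell \<open>f y\<close> is coupled within that cell. The factor
 \<open>1 - \<delta>\<close> keeps the mass of the remainder positive, so that one may divide by it.
\<close>

lemma coupling_exists:
 fixes \<mu> \<nu> :: "(real^'n) measure" and f :: "'z => real^'n => real"
 assumes \<mu>: "torus_prob \<mu>" and \<nu>: "torus_prob \<nu>" and Z: "finite Z"
  and fm: "!!y. y \<in> Z ==> f y \<in> borel_fun" and f0: "!!y x. y \<in> Z ==> 0 <= f y x"
  and f1: "!!x. (\<Sum>y\<in>Z. f y x) = 1"
  and near: "!!y x x'. y \<in> Z ==> 0 < f y x ==> 0 < f y x' ==> torus_dist x x' <= \<epsilon>"
  and \<epsilon>: "0 <= \<epsilon>" and \<delta>: "0 < \<delta>" "\<delta> < 1"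
 shows "\<exists>\<pi>\<in>couplings \<mu> \<nu>. (\<integral>\<^sup>+p. ennreal ((torus_dist (fst p) (snd p))\<^sup>2) \<partial>\<pi>)
  <= ennreal (\<epsilon>\<^sup>2 + (real CARD('n))\<^sup>2 * (\<delta> + (\<Sum>y\<in>Z. \<bar>(LINT x|\<mu>. f y x) - (LINT x|\<nu>. f y x)\<bar>)))"
proof -
 interpret M: prob_space \<mu> by (rule torus_probD(1)[OF \<mu>])
 interpret N: prob_space \<nu> by (rule torus_probD(1)[OF \<nu>])
 interpret MN: pair_prob_space \<mu> \<nu> ..
 note sM = torus_probD(2)[OF \<mu>] and sN = torus_probD(2)[OF \<nu>]
 have fle: "f y x <= 1" if "y \<in> Z" for y x
  using member_le_sum[of y Z "%y. f y x"] that f0 f1[of x] Z by auto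
 have fM: "f y \<in> borel_measurable \<mu>" "integrable \<mu> (f y)" if "y \<in> Z" for y
  using torus_probD(4)[OF \<mu> fm[OF that]] f0[OF that] fle[OF that] by (auto intro!: M.integrable_const_bound[of _ 1])
 have fN: "f y \<in> borel_measurable \<nu>" "integrable \<nu> (f y)" if "y \<in> Z" for y
  using torus_probD(4)[OF \<nu> fm[OF that]] f0[OF that] fle[OF that] by (auto intro!: N.integrable_const_bound[of _ 1])
 define a b where "a y = (LINT x|\<mu>. f y x)" and "b y = (LINT x|\<nu>. f y x)" for y
 have ab0: "0 <= a y" "0 <= b y" if "y \<in> Z" for y using f0[OF that] by (auto simp: a_def b_def)
 have suma: "(\<Sum>y\<in>Z. a y) = 1" "(\<Sum>y\<in>Z. b y) = 1"
 proof -
  have "(\<Sum>y\<in>Z. a y) = (LINT x|\<mu>. (\<Sum>y\<in>Z. f y x))" unfolding a_def using fM by (intro Bochner_Integration.integral_sum[symmetric]) auto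
  then show "(\<Sum>y\<in>Z. a y) = 1" by (simp add: f1 M.prob_space)
  have "(\<Sum>y\<in>Z. b y) = (LINT x|\<nu>. (\<Sum>y\<in>Z. f y x))" unfolding b_def using fN by (intro Bochner_Integration.integral_sum[symmetric]) auto
  then show "(\<Sum>y\<in>Z. b y) = 1" by (simp add: f1 N.prob_space)
 qed
 define \<theta> where "\<theta> = 1 - \<delta>"
 have \<theta>: "0 < \<theta>" "\<theta> < 1" using \<delta> by (auto simp: \<theta>_def)
 define c where "c y = \<theta> * min (a y) (b y)" for y
 have c0: "0 <= c y" "c y <= a y" "c y <= b y" if "y \<in> Z" for y
 proof -
  have m: "0 <= min (a y) (b y)" using ab0[OF that] by simp
  then show "0 <= c y" using \<theta> by (simp add: c_def)
  have "c y <= 1 * min (a y) (b y)" unfolding c_def using m \<theta> by (intro mult_right_mono) auto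
  then show "c y <= a y" "c y <= b y" by auto
 qed
 define R where "R = 1 - (\<Sum>y\<in>Z. c y)"
 have minle: "(\<Sum>y\<in>Z. min (a y) (b y)) <= 1" using sum_mono[of Z "%y. min (a y) (b y)" a] suma by simp
 have R: "0 < R" "R <= \<delta> + (\<Sum>y\<in>Z. \<bar>a y - b y\<bar>)"
 proof -
  have s: "(\<Sum>y\<in>Z. c y) = \<theta> * (\<Sum>y\<in>Z. min (a y) (b y))" by (simp add: c_def sum_distrib_left)
  have "\<theta> * (\<Sum>y\<in>Z. min (a y) (b y)) <= \<theta> * 1" using minle \<theta> by (intro mult_left_mono) auto
  then show "0 < R" unfolding R_def s using \<theta> by linarith
  have "0 <= (\<Sum>y\<in>Z. min (a y) (b y))" using ab0 by (intro sum_nonneg) auto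
  have "1 - (\<Sum>y\<in>Z. min (a y) (b y)) = (\<Sum>y\<in>Z. a y - min (a y) (b y))" by (simp add: sum_subtractf suma)
  also have "... <= (\<Sum>y\<in>Z. \<bar>a y - b y\<bar>)" by (intro sum_mono) auto
  finally have "1 - (\<Sum>y\<in>Z. min (a y) (b y)) <= (\<Sum>y\<in>Z. \<bar>a y - b y\<bar>)" .
  moreover have "R = (1 - (\<Sum>y\<in>Z. min (a y) (b y))) + \<delta> * (\<Sum>y\<in>Z. min (a y) (b y))"
   unfolding R_def s \<theta>_def by (simp add: algebra_simps)
  moreover have "\<delta> * (\<Sum>y\<in>Z. min (a y) (b y)) <= \<delta> * 1" using minle \<delta> by (intro mult_left_mono) auto
  ultimately show "R <= \<delta> + (\<Sum>y\<in>Z. \<bar>a y - b y\<bar>)" by linarith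
 qed
 \<comment> \<open>\<open>w y\<close> rescales the product of the two pieces, of mass
   \<open>a y * b y\<close>, to mass \<open>c y\<close>. If \<open>a y\<close> or \<open>b y\<close>
   is 0 then so is \<open>c y\<close>, and division by zero returns the right value 0.\<close>
 define w where "w y = c y / (a y * b y)" for y
 have w: "w y * b y = c y / a y" "w y * a y = c y / b y" "0 <= w y" "a y * (c y / a y) = c y" "b y * (c y / b y) = c y" if "y \<in> Z" for y
 proof -
  have "a y = 0 ==> c y = 0" "b y = 0 ==> c y = 0" using c0[OF that] by auto
  then show "w y * b y = c y / a y" "w y * a y = c y / b y" "a y * (c y / a y) = c y" "b y * (c y / b y) = c y"
   by (auto simp: w_def)
  show "0 <= w y" using c0[OF that] ab0[OF that] by (simp add: w_def)
 qed
 have ca: "c y / a y <= 1" "c y / b y <= 1" if "y \<in> Z" for y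
  using c0[OF that] ab0[OF that] by (auto simp: divide_le_eq_1)
 \<comment> \<open>\<open>r\<close> and \<open>s\<close> are what is left of either measure. Both
   have mass \<open>R\<close>, and \<open>F2\<close> couples them independently.\<close>
 define r where "r x = (\<Sum>y\<in>Z. (1 - c y / a y) * f y x)" for x
 define s where "s x = (\<Sum>y\<in>Z. (1 - c y / b y) * f y x)" for x
 have r0: "0 <= r x" "0 <= s x" for x using ca f0 by (auto simp: r_def s_def intro!: sum_nonneg mult_nonneg_nonneg)
 have rR: "(LINT x|\<mu>. r x) = R" "(LINT x|\<nu>. s x) = R"
 proof -
  have "(LINT x|\<mu>. r x) = (\<Sum>y\<in>Z. (1 - c y / a y) * a y)"
   unfolding r_def a_def using fM by (subst Bochner_Integration.integral_sum) auto
  also have "... = (\<Sum>y\<in>Z. a y - c y)"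
  proof (intro sum.cong refl)
   fix y assume "y \<in> Z"
   from w(4)[OF this] show "(1 - c y / a y) * a y = a y - c y" by (simp only: left_diff_distrib mult_1 mult.commute[of "c y / _"])
  qed
  finally show "(LINT x|\<mu>. r x) = R" by (simp add: sum_subtractf suma R_def)
  have "(LINT x|\<nu>. s x) = (\<Sum>y\<in>Z. (1 - c y / b y) * b y)"
   unfolding s_def b_def using fN by (subst Bochner_Integration.integral_sum) auto
  also have "... = (\<Sum>y\<in>Z. b y - c y)"
  proof (intro sum.cong refl)
   fix y assume "y \<in> Z"
   from w(5)[OF this] show "(1 - c y / b y) * b y = b y - c y" by (simp only: left_diff_distrib mult_1 mult.commute[of "c y / _"])
  qed
  finally show "(LINT x|\<nu>. s x) = R" by (simp add: sum_subtractf suma R_def)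
 qed
 have rM: "r \<in> borel_measurable \<mu>" "integrable \<mu> r" "s \<in> borel_measurable \<nu>" "integrable \<nu> s"
  unfolding r_def[abs_def] s_def[abs_def] using fM fN by auto
 define F1 where "F1 p = (\<Sum>y\<in>Z. w y * f y (fst p) * f y (snd p))" for p
 define F2 where "F2 p = r (fst p) * s (snd p) / R" for p
 have F0: "0 <= F1 p" "0 <= F2 p" for p
  unfolding F1_def F2_def using w(3) f0 r0 R by (auto intro!: sum_nonneg mult_nonneg_nonneg divide_nonneg_pos)
 have Fm [measurable]: "F1 \<in> borel_measurable (\<mu> \<Otimes>\<^sub>M \<nu>)" "F2 \<in> borel_measurable (\<mu> \<Otimes>\<^sub>M \<nu>)"
 proof -
  have fst': "(%p. g (fst p)) \<in> borel_measurable (\<mu> \<Otimes>\<^sub>M \<nu>)" if "g \<in> borel_measurable \<mu>" for g :: "real^'n => real"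
   by (rule measurable_compose[OF measurable_fst that])
  have snd': "(%p. g (snd p)) \<in> borel_measurable (\<mu> \<Otimes>\<^sub>M \<nu>)" if "g \<in> borel_measurable \<nu>" for g :: "real^'n => real"
   by (rule measurable_compose[OF measurable_snd that])
  show "F1 \<in> borel_measurable (\<mu> \<Otimes>\<^sub>M \<nu>)" unfolding F1_def[abs_def]
   by (intro borel_measurable_sum borel_measurable_times borel_measurable_const fst'[OF fM(1)] snd'[OF fN(1)])
  show "F2 \<in> borel_measurable (\<mu> \<Otimes>\<^sub>M \<nu>)" unfolding F2_def[abs_def]
   by (intro borel_measurable_divide borel_measurable_times borel_measurable_const fst'[OF rM(1)] snd'[OF rM(3)])
 qed
 define \<pi> where "\<pi> = density (\<mu> \<Otimes>\<^sub>M \<nu>) (%p. ennreal (F1 p + F2 p))"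
 \<comment> \<open>For every \<open>x\<close> the weights coming from \<open>F1\<close> and the
   remainder \<open>r\<close> add up to the partition of unity, so the first marginal has density 1
   with respect to \<open>\<mu>\<close>.\<close>
 have inner1: "(\<integral>\<^sup>+y. ennreal (F1 (x, y) + F2 (x, y)) \<partial>\<nu>) = 1" for x
 proof -
  have i: "integrable \<nu> (%y. F1 (x, y))" "integrable \<nu> (%y. F2 (x, y))"
   unfolding F1_def F2_def using fN rM by auto
  have "(\<integral>\<^sup>+y. ennreal (F1 (x, y) + F2 (x, y)) \<partial>\<nu>) = ennreal (LINT y|\<nu>. F1 (x, y) + F2 (x, y))"
   by (rule nn_integral_eq_integral) (use i F0 in auto)
  also have "(LINT y|\<nu>. F1 (x, y) + F2 (x, y)) = (\<Sum>y\<in>Z. w y * f y x * b y) + r x * R / R"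
   using i fN rM rR by (simp add: F1_def F2_def b_def)
  also have "(\<Sum>y\<in>Z. w y * f y x * b y) = (\<Sum>y\<in>Z. (c y / a y) * f y x)"
   by (intro sum.cong refl) (simp add: w(1)[symmetric])
  also have "... + r x * R / R = 1" using R by (simp add: r_def sum.distrib[symmetric] left_diff_distrib f1)
  finally show ?thesis by simp
 qed
 have inner2: "(\<integral>\<^sup>+x. ennreal (F1 (x, y) + F2 (x, y)) \<partial>\<mu>) = 1" for y
 proof -
  have i: "integrable \<mu> (%x. F1 (x, y))" "integrable \<mu> (%x. F2 (x, y))"
   unfolding F1_def F2_def using fM rM by auto
  have "(\<integral>\<^sup>+x. ennreal (F1 (x, y) + F2 (x, y)) \<partial>\<mu>) = ennreal (LINT x|\<mu>. F1 (x, y) + F2 (x, y))"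
   by (rule nn_integral_eq_integral) (use i F0 in auto)
  also have "(LINT x|\<mu>. F1 (x, y) + F2 (x, y)) = (\<Sum>z\<in>Z. w z * a z * f z y) + R * s y / R"
   using i fM rM rR by (simp add: F1_def F2_def a_def)
  also have "(\<Sum>z\<in>Z. w z * a z * f z y) = (\<Sum>z\<in>Z. (c z / b z) * f z y)"
   by (intro sum.cong refl) (simp add: w(2)[symmetric])
  also have "... + R * s y / R = 1" using R by (simp add: s_def sum.distrib[symmetric] left_diff_distrib f1)
  finally show ?thesis by simp
 qed
 have sets\<pi>: "sets \<pi> = sets (torus_borel \<Otimes>\<^sub>M torus_borel)"
  unfolding \<pi>_def sets_density by (rule sets_pair_measure_cong[OF sM sN])
 have m1: "distr \<pi> torus_borel fst = \<mu>"
 proof (rule measure_eqI)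
  show "sets (distr \<pi> torus_borel fst) = sets \<mu>" by (simp add: sM)
  fix A assume "A \<in> sets (distr \<pi> torus_borel fst)"
  then have A: "A \<in> sets \<mu>" by (simp add: sM)
  have mf: "fst \<in> \<pi> \<rightarrow>\<^sub>M torus_borel"
   by (subst measurable_cong_sets[OF sets\<pi> refl]) (rule measurable_fst)
  have "emeasure (distr \<pi> torus_borel fst) A = (\<integral>\<^sup>+p. indicator A (fst p) \<partial>\<pi>)"
   by (subst nn_integral_distr[OF mf, symmetric]) (use A sM in auto)
  also have "... = (\<integral>\<^sup>+p. ennreal (F1 p + F2 p) * indicator A (fst p) \<partial>(\<mu> \<Otimes>\<^sub>M \<nu>))"
   unfolding \<pi>_def by (rule nn_integral_density) (use A in auto)
  also have "... = (\<integral>\<^sup>+x. (\<integral>\<^sup>+y. ennreal (F1 (x, y) + F2 (x, y)) * indicator A x \<partial>\<nu>) \<partial>\<mu>)"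
   by (subst N.nn_integral_fst[symmetric]) (use A in auto)
  also have "... = (\<integral>\<^sup>+x. indicator A x \<partial>\<mu>)"
  proof (intro nn_integral_cong)
   fix x assume "x \<in> space \<mu>"
   then have "(%y. ennreal (F1 (x, y) + F2 (x, y))) \<in> borel_measurable \<nu>" by measurable
   from nn_integral_multc[OF this, of "indicator A x"]
   show "(\<integral>\<^sup>+y. ennreal (F1 (x, y) + F2 (x, y)) * indicator A x \<partial>\<nu>) = indicator A x" unfolding inner1 by simp
  qed
  finally show "emeasure (distr \<pi> torus_borel fst) A = emeasure \<mu> A" using A by simp
 qed
 have m2: "distr \<pi> torus_borel snd = \<nu>"
 proof (rule measure_eqI)
  show "sets (distr \<pi> torus_borel snd) = sets \<nu>" by (simp add: sN)
  fix A assume "A \<in> sets (distr \<pi> torus_borel snd)"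
  then have A: "A \<in> sets \<nu>" by (simp add: sN)
  have mf: "snd \<in> \<pi> \<rightarrow>\<^sub>M torus_borel"
   by (subst measurable_cong_sets[OF sets\<pi> refl]) (rule measurable_snd)
  have "emeasure (distr \<pi> torus_borel snd) A = (\<integral>\<^sup>+p. indicator A (snd p) \<partial>\<pi>)"
   by (subst nn_integral_distr[OF mf, symmetric]) (use A sN in auto)
  also have "... = (\<integral>\<^sup>+p. ennreal (F1 p + F2 p) * indicator A (snd p) \<partial>(\<mu> \<Otimes>\<^sub>M \<nu>))"
   unfolding \<pi>_def by (rule nn_integral_density) (use A in auto)
  also have "... = (\<integral>\<^sup>+y. (\<integral>\<^sup>+x. ennreal (F1 (x, y) + F2 (x, y)) * indicator A y \<partial>\<mu>) \<partial>\<nu>)"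
   by (subst MN.nn_integral_snd[symmetric]) (use A in auto)
  also have "... = (\<integral>\<^sup>+y. indicator A y \<partial>\<nu>)"
  proof (intro nn_integral_cong)
   fix y assume "y \<in> space \<nu>"
   then have "(%x. ennreal (F1 (x, y) + F2 (x, y))) \<in> borel_measurable \<mu>" by measurable
   from nn_integral_multc[OF this, of "indicator A y"]
   show "(\<integral>\<^sup>+x. ennreal (F1 (x, y) + F2 (x, y)) * indicator A y \<partial>\<mu>) = indicator A y" unfolding inner2 by simp
  qed
  finally show "emeasure (distr \<pi> torus_borel snd) A = emeasure \<nu> A" using A by simp
 qed
 let ?D = "real CARD('n)"
 have "(\<integral>\<^sup>+p. ennreal ((torus_dist (fst p) (snd p))\<^sup>2) \<partial>\<pi>)
   = (\<integral>\<^sup>+p. ennreal (F1 p + F2 p) * ennreal ((torus_dist (fst p) (snd p))\<^sup>2) \<partial>(\<mu> \<Otimes>\<^sub>M \<nu>))"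
 proof -
  have "(%p :: (real^'n) \<times> (real^'n). torus_dist (fst p) (snd p)) \<in> borel_measurable (borel \<Otimes>\<^sub>M borel)"
   unfolding borel_prod by (rule borel_measurable_continuous_onI[OF torus_dist_continuous])
  moreover have "(%x. x) \<in> \<mu> \<rightarrow>\<^sub>M borel" "(%x. x) \<in> \<nu> \<rightarrow>\<^sub>M borel"
   unfolding measurable_cong_sets[OF sM refl] measurable_cong_sets[OF sN refl]
   by (auto intro: measurable_restrict_space1)
  then have "(%p. (fst p, snd p)) \<in> \<mu> \<Otimes>\<^sub>M \<nu> \<rightarrow>\<^sub>M borel \<Otimes>\<^sub>M borel"
   by (intro measurable_Pair measurable_compose[OF measurable_fst] measurable_compose[OF measurable_snd])
  ultimately have "(%p. torus_dist (fst p) (snd p)) \<in> borel_measurable (\<mu> \<Otimes>\<^sub>M \<nu>)"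
   using measurable_compose[of "%p. (fst p, snd p)" "\<mu> \<Otimes>\<^sub>M \<nu>"] by fastforce
  then show ?thesis unfolding \<pi>_def by (intro nn_integral_density) auto
 qed
 \<comment> \<open>Under \<open>F1\<close> the two points share a piece and are \<epsilon> close;
   under \<open>F2\<close> the diameter bound \<open>?D\<close> is paid, but only on mass
   \<open>R\<close>.\<close>
 also have "... <= (\<integral>\<^sup>+p. ennreal (\<epsilon>\<^sup>2) * ennreal (F1 p + F2 p) + ennreal (?D\<^sup>2) * ennreal (F2 p) \<partial>(\<mu> \<Otimes>\<^sub>M \<nu>))"
 proof (rule nn_integral_mono)
  fix p assume "p \<in> space (\<mu> \<Otimes>\<^sub>M \<nu>)"
  then have pc: "fst p \<in> cell" "snd p \<in> cell" by (auto simp: space_pair_measure torus_probD(3)[OF \<mu>] torus_probD(3)[OF \<nu>])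
  define d where "d = torus_dist (fst p) (snd p)"
  have d: "0 <= d" "d <= ?D" unfolding d_def using torus_dist_nonneg torus_dist_cell[OF pc] by auto
  have "F1 p * d\<^sup>2 <= F1 p * \<epsilon>\<^sup>2"
  proof (cases "\<exists>y\<in>Z. 0 < f y (fst p) \<and> 0 < f y (snd p)")
   case True
   then have "d <= \<epsilon>" unfolding d_def using near by blast
   then show ?thesis using d F0 by (intro mult_left_mono power_mono) auto
  next
   case False
   then have "w y * f y (fst p) * f y (snd p) = 0" if "y \<in> Z" for y
    using f0[OF that, of "fst p"] f0[OF that, of "snd p"] that by fastforce
   then have "F1 p = 0" unfolding F1_def by (intro sum.neutral) auto
   then show ?thesis by simp
  qed
  moreover have "F2 p * d\<^sup>2 <= F2 p * ?D\<^sup>2" using d F0 by (intro mult_left_mono power_mono) auto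
  moreover have "0 <= \<epsilon>\<^sup>2 * F2 p" using F0 by simp
  ultimately have "(F1 p + F2 p) * d\<^sup>2 <= \<epsilon>\<^sup>2 * (F1 p + F2 p) + ?D\<^sup>2 * F2 p" by (simp add: algebra_simps)
  then show "ennreal (F1 p + F2 p) * ennreal ((torus_dist (fst p) (snd p))\<^sup>2) <= ennreal (\<epsilon>\<^sup>2) * ennreal (F1 p + F2 p) + ennreal (?D\<^sup>2) * ennreal (F2 p)"
   using F0 by (simp add: d_def[symmetric] ennreal_mult[symmetric] ennreal_plus[symmetric] ennreal_leI del: ennreal_plus)
 qed
 also have "... = ennreal (\<epsilon>\<^sup>2) * (\<integral>\<^sup>+p. ennreal (F1 p + F2 p) \<partial>(\<mu> \<Otimes>\<^sub>M \<nu>)) + ennreal (?D\<^sup>2) * (\<integral>\<^sup>+p. ennreal (F2 p) \<partial>(\<mu> \<Otimes>\<^sub>M \<nu>))"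
  by (subst nn_integral_add) (auto simp: nn_integral_cmult)
 also have "(\<integral>\<^sup>+p. ennreal (F1 p + F2 p) \<partial>(\<mu> \<Otimes>\<^sub>M \<nu>)) = 1"
  by (subst N.nn_integral_fst[symmetric]) (auto simp: inner1 M.emeasure_space_1)
 also have "(\<integral>\<^sup>+p. ennreal (F2 p) \<partial>(\<mu> \<Otimes>\<^sub>M \<nu>)) = ennreal R"
 proof -
  have "(\<integral>\<^sup>+y. ennreal (F2 (x, y)) \<partial>\<nu>) = ennreal (r x)" for x
  proof -
   have "(\<integral>\<^sup>+y. ennreal (F2 (x, y)) \<partial>\<nu>) = ennreal (LINT y|\<nu>. F2 (x, y))"
    by (rule nn_integral_eq_integral) (use rM F0 in \<open>auto simp: F2_def\<close>)
   also have "(LINT y|\<nu>. F2 (x, y)) = r x" using rM rR R by (simp add: F2_def)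
   finally show ?thesis .
  qed
  then have "(\<integral>\<^sup>+p. ennreal (F2 p) \<partial>(\<mu> \<Otimes>\<^sub>M \<nu>)) = (\<integral>\<^sup>+x. ennreal (r x) \<partial>\<mu>)"
   by (subst N.nn_integral_fst[symmetric]) auto
  also have "... = ennreal R" unfolding rR(1)[symmetric] by (rule nn_integral_eq_integral) (use rM r0 in auto)
  finally show ?thesis .
 qed
 also have "ennreal (\<epsilon>\<^sup>2) * 1 + ennreal (?D\<^sup>2) * ennreal R = ennreal (\<epsilon>\<^sup>2 + ?D\<^sup>2 * R)"
  using R by (simp add: ennreal_mult[symmetric] ennreal_plus[symmetric] del: ennreal_plus)
 also have "... <= ennreal (\<epsilon>\<^sup>2 + ?D\<^sup>2 * (\<delta> + (\<Sum>y\<in>Z. \<bar>a y - b y\<bar>)))"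
  using R by (intro ennreal_leI add_left_mono mult_left_mono) auto
 finally show ?thesis unfolding a_def b_def using sets\<pi> m1 m2 by (intro bexI[of _ \<pi>]) (auto simp: couplings_def)
qed

section \<open>The measure at the final time\<close>

lemma coupling_D:
 fixes \<mu> \<nu> :: "(real^'n) measure"
 assumes \<mu>: "torus_prob \<mu>" and \<pi>: "\<pi> \<in> couplings \<mu> \<nu>"
 shows "prob_space \<pi>" "fst \<in> \<pi> \<rightarrow>\<^sub>M torus_borel" "snd \<in> \<pi> \<rightarrow>\<^sub>M torus_borel"
  "(%p. torus_dist (fst p) (snd p)) \<in> borel_measurable \<pi>"
proof -
 have s: "sets \<pi> = sets (torus_borel \<Otimes>\<^sub>M torus_borel)" and d: "distr \<pi> torus_borel fst = \<mu>"
  using \<pi> by (auto simp: couplings_def)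
 show f: "fst \<in> \<pi> \<rightarrow>\<^sub>M torus_borel" by (subst measurable_cong_sets[OF s refl]) (rule measurable_fst)
 show g: "snd \<in> \<pi> \<rightarrow>\<^sub>M torus_borel" by (subst measurable_cong_sets[OF s refl]) (rule measurable_snd)
 show "prob_space \<pi>" by (rule prob_space_distrD[OF f]) (use torus_probD(1)[OF \<mu>] d in simp)
 have "(%x. x) \<in> torus_borel \<rightarrow>\<^sub>M (borel :: (real^'n) measure)" by (rule measurable_restrict_space1) auto
 then have "(%p. (fst p, snd p)) \<in> \<pi> \<rightarrow>\<^sub>M borel \<Otimes>\<^sub>M borel"
  by (intro measurable_Pair measurable_compose[OF f] measurable_compose[OF g])
 moreover have "(%p :: (real^'n) \<times> (real^'n). torus_dist (fst p) (snd p)) \<in> borel_measurable (borel \<Otimes>\<^sub>M borel)"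
  unfolding borel_prod by (rule borel_measurable_continuous_onI[OF torus_dist_continuous])
 ultimately show "(%p. torus_dist (fst p) (snd p)) \<in> borel_measurable \<pi>"
  using measurable_compose[of "%p. (fst p, snd p)" \<pi>] by fastforce
qed

section \<open>The Wasserstein distance and averages of functions\<close>

lemma W2_nonneg: "0 <= W2 \<mu> \<nu>" and W2_square: "(W2 \<mu> \<nu>)\<^sup>2 = enn2real
   (INF \<pi>\<in>couplings \<mu> \<nu>. \<integral>\<^sup>+ p. ennreal ((torus_dist (fst p) (snd p))\<^sup>2) \<partial>\<pi>)"
 by (simp_all add: W2_def)

lemma W2_le_averages:
 fixes \<mu> \<nu> :: "(real^'n) measure" and f :: "'z => real^'n => real"
 assumes \<mu>: "torus_prob \<mu>" and \<nu>: "torus_prob \<nu>" and Z: "finite Z"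
  and fm: "!!y. y \<in> Z ==> f y \<in> borel_fun" and f0: "!!y x. y \<in> Z ==> 0 <= f y x"
  and f1: "!!x. (\<Sum>y\<in>Z. f y x) = 1"
  and near: "!!y x x'. y \<in> Z ==> 0 < f y x ==> 0 < f y x' ==> torus_dist x x' <= \<epsilon>"
  and \<epsilon>: "0 <= \<epsilon>" and \<delta>: "0 < \<delta>" "\<delta> < 1"
 shows "(W2 \<mu> \<nu>)\<^sup>2 <= \<epsilon>\<^sup>2 + (real CARD('n))\<^sup>2 * (\<delta> + (\<Sum>y\<in>Z. \<bar>(LINT x|\<mu>. f y x) - (LINT x|\<nu>. f y x)\<bar>))" (is "_ <= ?K")
proof -
 obtain \<pi> where p: "\<pi> \<in> couplings \<mu> \<nu>" "(\<integral>\<^sup>+p. ennreal ((torus_dist (fst p) (snd p))\<^sup>2) \<partial>\<pi>) <= ennreal ?K"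
 proof -
  have "\<exists>\<pi>\<in>couplings \<mu> \<nu>. (\<integral>\<^sup>+p. ennreal ((torus_dist (fst p) (snd p))\<^sup>2) \<partial>\<pi>) <= ennreal ?K"
   by (rule coupling_exists[OF \<mu> \<nu> Z fm f0 f1 _ \<epsilon> \<delta>]) (assumption | erule (2) near)+
  from this that show ?thesis by (rule bexE)
 qed
 have "(INF \<pi>\<in>couplings \<mu> \<nu>. \<integral>\<^sup>+ p. ennreal ((torus_dist (fst p) (snd p))\<^sup>2) \<partial>\<pi>) <= ennreal ?K"
  by (rule INF_lower2[OF p(1)]) (rule p(2))
 moreover have "0 <= ?K" using \<delta> by (intro add_nonneg_nonneg mult_nonneg_nonneg sum_nonneg) auto
 ultimately show ?thesis unfolding W2_square by (intro enn2real_leI)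
qed

text \<open>Since \<open>enn2real\<close> maps infinity to 0, \<open>W2\<close> determines the
  infimum of the costs only once some coupling has finite cost; one built from a partition of unity
  at scale 1 does.\<close>

lemma W2_cost_finite:
 fixes \<mu> \<nu> :: "(real^'n) measure"
 assumes \<mu>: "torus_prob \<mu>" and \<nu>: "torus_prob \<nu>"
 shows "(INF \<pi>\<in>couplings \<mu> \<nu>. \<integral>\<^sup>+ p. ennreal ((torus_dist (fst p) (snd p))\<^sup>2) \<partial>\<pi>) = ennreal ((W2 \<mu> \<nu>)\<^sup>2)"
proof -
 obtain Z :: "(real^'n) set" and f :: "real^'n => real^'n => real" where Z: "finite Z" "\<forall>y\<in>Z. \<exists>D. C1per (%z :: real \<times> (real^'n). f y (snd z)) D"
  "\<forall>y\<in>Z. \<forall>x. 0 <= f y x" "\<forall>x. (\<Sum>y\<in>Z. f y x) = 1" "\<forall>y\<in>Z. \<forall>x x'. 0 < f y x --> 0 < f y x' --> torus_dist x x' <= 1"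
  using partition_of_unity[OF zero_less_one, where 'n='n] by (elim exE conjE) (rule that)
 have m: "f y \<in> borel_fun" if y: "y \<in> Z" for y
 proof -
  obtain D where "C1per (%z :: real \<times> (real^'n). f y (snd z)) D" using Z(2) y by blast
  from measurable_Pair_slice[OF C1per_borel[OF this], of 0] show ?thesis by simp
 qed
 let ?K = "1\<^sup>2 + (real CARD('n))\<^sup>2 * (1/2 + (\<Sum>y\<in>Z. \<bar>(LINT x|\<mu>. f y x) - (LINT x|\<nu>. f y x)\<bar>))"
 obtain \<pi> where p: "\<pi> \<in> couplings \<mu> \<nu>" "(\<integral>\<^sup>+p. ennreal ((torus_dist (fst p) (snd p))\<^sup>2) \<partial>\<pi>) <= ennreal ?K"
 proof -
  have "\<exists>\<pi>\<in>couplings \<mu> \<nu>. (\<integral>\<^sup>+p. ennreal ((torus_dist (fst p) (snd p))\<^sup>2) \<partial>\<pi>) <= ennreal ?K"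
  proof (rule coupling_exists[OF \<mu> \<nu> Z(1) m])
   show "!!y x x'. y \<in> Z ==> 0 < f y x ==> 0 < f y x' ==> torus_dist x x' <= 1" using Z(5) by blast
  qed (use Z(3,4) in auto)
  from this that show ?thesis by (rule bexE)
 qed
 have "(INF \<pi>\<in>couplings \<mu> \<nu>. \<integral>\<^sup>+ p. ennreal ((torus_dist (fst p) (snd p))\<^sup>2) \<partial>\<pi>) <= ennreal ?K"
  by (rule INF_lower2[OF p(1)]) (rule p(2))
 then have "(INF \<pi>\<in>couplings \<mu> \<nu>. \<integral>\<^sup>+ p. ennreal ((torus_dist (fst p) (snd p))\<^sup>2) \<partial>\<pi>) < top"
  using le_less_trans ennreal_less_top by blast
 then show ?thesis unfolding W2_square by simp
qed

text \<open>A nearly optimal coupling is enough. The pointwise bound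
  \<open>d <= \<eta> + d^2 / \<eta>\<close> leads from the squared cost to the Lipschitz
  estimate.\<close>

lemma W2_lipschitz_integral:
 fixes \<mu> \<nu> :: "(real^'n) measure" and \<psi> :: "real^'n => real"
 assumes \<mu>: "torus_prob \<mu>" and \<nu>: "torus_prob \<nu>" and \<psi>: "\<psi> \<in> borel_fun" "!!x. \<bar>\<psi> x\<bar> <= B"
  and lip: "!!x y. \<bar>\<psi> x - \<psi> y\<bar> <= L * torus_dist x y" and L: "0 <= L" and \<eta>: "0 < \<eta>"
 shows "\<bar>(LINT x|\<mu>. \<psi> x) - (LINT x|\<nu>. \<psi> x)\<bar> <= L * (2 * \<eta> + (W2 \<mu> \<nu>)\<^sup>2 / \<eta>)"
proof -
 have "(INF \<pi>\<in>couplings \<mu> \<nu>. \<integral>\<^sup>+ p. ennreal ((torus_dist (fst p) (snd p))\<^sup>2) \<partial>\<pi>) < ennreal ((W2 \<mu> \<nu>)\<^sup>2 + \<eta>\<^sup>2)"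
  unfolding W2_cost_finite[OF \<mu> \<nu>] using \<eta> by (intro ennreal_lessI add_nonneg_pos) auto
 then obtain \<pi> where \<pi>: "\<pi> \<in> couplings \<mu> \<nu>"
  and cost: "(\<integral>\<^sup>+ p. ennreal ((torus_dist (fst p) (snd p))\<^sup>2) \<partial>\<pi>) < ennreal ((W2 \<mu> \<nu>)\<^sup>2 + \<eta>\<^sup>2)"
  unfolding INF_less_iff by blast
 note c = coupling_D[OF \<mu> \<pi>]
 interpret P: prob_space \<pi> by (rule c(1))
 let ?d = "%p :: (real^'n) \<times> (real^'n). torus_dist (fst p) (snd p)"
 have d: "distr \<pi> torus_borel fst = \<mu>" "distr \<pi> torus_borel snd = \<nu>" using \<pi> by (auto simp: couplings_def)
 have \<psi>m: "\<psi> \<in> borel_measurable torus_borel" using \<psi>(1) by (rule measurable_restrict_space1)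
 have e: "(LINT x|\<mu>. \<psi> x) = (LINT p|\<pi>. \<psi> (fst p))" "(LINT x|\<nu>. \<psi> x) = (LINT p|\<pi>. \<psi> (snd p))"
  using integral_distr[OF c(2) \<psi>m] integral_distr[OF c(3) \<psi>m] d by simp_all
 have i: "integrable \<pi> (%p. \<psi> (fst p))" "integrable \<pi> (%p. \<psi> (snd p))"
  using \<psi>(2) by (auto intro!: P.integrable_const_bound[of _ B] measurable_compose[OF c(2) \<psi>m] measurable_compose[OF c(3) \<psi>m])
 have d2: "integrable \<pi> (%p. (?d p)\<^sup>2)"
 proof (rule integrableI_nonneg)
  show "(%p. (?d p)\<^sup>2) \<in> borel_measurable \<pi>" using c(4) by simp
  show "(\<integral>\<^sup>+ p. ennreal ((?d p)\<^sup>2) \<partial>\<pi>) < \<infinity>" using cost by (rule less_le_trans) simp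
 qed simp
 have d2v: "(LINT p|\<pi>. (?d p)\<^sup>2) <= (W2 \<mu> \<nu>)\<^sup>2 + \<eta>\<^sup>2"
 proof -
  have "ennreal (LINT p|\<pi>. (?d p)\<^sup>2) = (\<integral>\<^sup>+ p. ennreal ((?d p)\<^sup>2) \<partial>\<pi>)"
   by (rule nn_integral_eq_integral[symmetric, OF d2]) simp
  then have "ennreal (LINT p|\<pi>. (?d p)\<^sup>2) <= ennreal ((W2 \<mu> \<nu>)\<^sup>2 + \<eta>\<^sup>2)" using cost by simp
  then show ?thesis by (subst (asm) ennreal_le_iff) auto
 qed
 have "\<bar>(LINT x|\<mu>. \<psi> x) - (LINT x|\<nu>. \<psi> x)\<bar> = \<bar>\<integral>p. \<psi> (fst p) - \<psi> (snd p) \<partial>\<pi>\<bar>" using e i by simp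
 also have "... <= (LINT p|\<pi>. \<bar>\<psi> (fst p) - \<psi> (snd p)\<bar>)" by (rule integral_abs_bound)
 also have "... <= (LINT p|\<pi>. L * (\<eta> + (?d p)\<^sup>2 / \<eta>))"
 proof (rule integral_mono)
  show "integrable \<pi> (%p. \<bar>\<psi> (fst p) - \<psi> (snd p)\<bar>)" using i by (intro integrable_abs Bochner_Integration.integrable_diff)
  show "integrable \<pi> (%p. L * (\<eta> + (?d p)\<^sup>2 / \<eta>))" using d2 by simp
  fix p :: "(real^'n) \<times> (real^'n)"
  have "0 <= (?d p - \<eta>)\<^sup>2" by simp
  then have "?d p * \<eta> <= \<eta>\<^sup>2 + (?d p)\<^sup>2"
   using mult_nonneg_nonneg[OF torus_dist_nonneg[of "fst p" "snd p"] less_imp_le[OF \<eta>]] unfolding power2_diff by linarith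
  then have "?d p <= \<eta> + (?d p)\<^sup>2 / \<eta>" using \<eta> by (simp add: field_simps power2_eq_square)
  then have "L * ?d p <= L * (\<eta> + (?d p)\<^sup>2 / \<eta>)" using L by (rule mult_left_mono)
  then show "\<bar>\<psi> (fst p) - \<psi> (snd p)\<bar> <= L * (\<eta> + (?d p)\<^sup>2 / \<eta>)" using lip[of "fst p" "snd p"] by linarith
 qed
 also have "... = L * (\<eta> + (LINT p|\<pi>. (?d p)\<^sup>2) / \<eta>)" using d2 by (simp add: P.prob_space)
 also have "... <= L * (\<eta> + ((W2 \<mu> \<nu>)\<^sup>2 + \<eta>\<^sup>2) / \<eta>)"
  using d2v L \<eta> by (intro mult_left_mono add_left_mono divide_right_mono) auto
 also have "... = L * (2 * \<eta> + (W2 \<mu> \<nu>)\<^sup>2 / \<eta>)" using \<eta> by (simp add: field_simps power2_eq_square)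
 finally show ?thesis .
qed

lemma W2_tendsto_lipschitz_integral:
 fixes \<mu> :: "nat => (real^'n) measure" and \<psi> :: "real^'n => real"
 assumes \<mu>: "!!n. torus_prob (\<mu> n)" and \<nu>: "torus_prob \<nu>" and \<psi>: "\<psi> \<in> borel_fun" "!!x. \<bar>\<psi> x\<bar> <= B"
  and lip: "!!x y. \<bar>\<psi> x - \<psi> y\<bar> <= L * torus_dist x y" and L: "0 <= L"
  and W: "(%n. W2 (\<mu> n) \<nu>) \<longlonglongrightarrow> 0"
 shows "(%n. \<integral>x. \<psi> x \<partial>\<mu> n) \<longlonglongrightarrow> (LINT x|\<nu>. \<psi> x)"
proof (rule LIMSEQ_I)
 fix r :: real assume r: "0 < r"
 define \<eta> where "\<eta> = r / (4 * (L + 1))"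
 have \<eta>: "0 < \<eta>" using r L by (simp add: \<eta>_def)
 have "L * (2 * \<eta>) <= (L + 1) * (2 * \<eta>)" using \<eta> by (intro mult_right_mono) auto
 also have "... = r / 2" using L by (simp add: \<eta>_def field_simps)
 finally have l: "L * (2 * \<eta>) <= r / 2" .
 have "(%n. L * (2 * \<eta> + (W2 (\<mu> n) \<nu>)\<^sup>2 / \<eta>)) \<longlonglongrightarrow> L * (2 * \<eta> + 0\<^sup>2 / \<eta>)"
  by (intro tendsto_intros W) (use \<eta> in auto)
 moreover have "L * (2 * \<eta> + 0\<^sup>2 / \<eta>) < r" using l r by simp
 ultimately have "eventually (%n. L * (2 * \<eta> + (W2 (\<mu> n) \<nu>)\<^sup>2 / \<eta>) < r) sequentially" by (rule order_tendstoD)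
 then obtain N where N: "!!n. N <= n ==> L * (2 * \<eta> + (W2 (\<mu> n) \<nu>)\<^sup>2 / \<eta>) < r" by (auto simp: eventually_sequentially)
 have "norm ((LINT x|\<mu> n. \<psi> x) - (LINT x|\<nu>. \<psi> x)) < r" if "N <= n" for n
  using le_less_trans[OF W2_lipschitz_integral[OF \<mu> \<nu> \<psi> lip L \<eta>] N[OF that]] by simp
 then show "\<exists>N. \<forall>n\<ge>N. norm ((LINT x|\<mu> n. \<psi> x) - (LINT x|\<nu>. \<psi> x)) < r" by blast
qed

section \<open>Lipschitz functions determine measures on the cell\<close>

lemma closed_frac_le:
 assumes "0 <= a" shows "closed {u :: real. frac u <= a}"
proof (cases "a < 1")
 case True
 have "- {u :: real. frac u <= a} = (\<Union>n::int. {of_int n + a <..< of_int n + 1})"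
 proof (intro equalityI subsetI)
  fix u assume "u \<in> - {u :: real. frac u <= a}"
  then show "u \<in> (\<Union>n::int. {of_int n + a <..< of_int n + 1})"
   using frac_lt_1[of u] by (intro UN_I[of "\<lfloor>u\<rfloor>"]) (auto simp: frac_def)
 next
  fix u assume "u \<in> (\<Union>n::int. {of_int n + a <..< of_int n + 1})"
  then obtain n :: int where n: "of_int n + a < u" "u < of_int n + 1" by auto
  then have "\<lfloor>u\<rfloor> = n" using assms by (simp add: floor_eq_iff)
  then show "u \<in> - {u :: real. frac u <= a}" using n by (simp add: frac_def)
 qed
 then show ?thesis unfolding closed_def by (simp add: open_UN)
next
 case False
 have "frac u <= a" for u :: real using frac_lt_1[of u] False by linarith
 then have "{u :: real. frac u <= a} = UNIV" by blast
 then show ?thesis by simp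
qed

text \<open>The indicator of a closed set is a limit of truncated Lipschitz functions of the
  distance to it. The sets \<open>A\<close> are closed and periodic and meet the cell in a lower
  orthant, so that these functions are Lipschitz for \<open>torus_dist\<close>; lower orthants
  generate the Borel sets.\<close>

lemma torus_prob_eqI:
 fixes \<mu> \<nu> :: "(real^'n) measure"
 assumes \<mu>: "torus_prob \<mu>" and \<nu>: "torus_prob \<nu>"
  and eq: "!!\<psi> B L. \<psi> \<in> borel_fun ==> (!!x. \<bar>\<psi> x\<bar> <= B) ==> (!!x y. \<bar>\<psi> x - \<psi> y\<bar> <= L * torus_dist x y) ==> 0 <= L ==>
    (LINT x|\<mu>. \<psi> x) = (LINT x|\<nu>. \<psi> x)"
 shows "\<mu> = \<nu>"
proof -
 note sM = torus_probD(2)[OF \<mu>] and sN = torus_probD(2)[OF \<nu>]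
 interpret M: prob_space \<mu> by (rule torus_probD(1)[OF \<mu>])
 interpret N: prob_space \<nu> by (rule torus_probD(1)[OF \<nu>])
 have cellb: "(cell :: (real^'n) set) \<in> sets borel" using sets_cell by simp
 have idm: "(%x. x) \<in> \<mu> \<rightarrow>\<^sub>M borel" "(%x. x) \<in> \<nu> \<rightarrow>\<^sub>M borel"
  unfolding measurable_cong_sets[OF sM refl] measurable_cong_sets[OF sN refl] by (auto intro: measurable_restrict_space1)
 have box: "emeasure \<mu> ({..a} \<inter> cell) = emeasure \<nu> ({..a} \<inter> cell)" for a :: "real^'n"
 proof -
  define A where "A = {x :: real^'n. \<forall>i. frac (x $ i) <= a $ i}"
  show ?thesis
  proof (cases "A = {}")
   case True
   have "{..a} \<inter> cell \<subseteq> A" by (auto simp: A_def less_eq_vec_def cell_def frac_eq)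
   then show ?thesis using True by simp
  next
   case False
   have a0: "0 <= a $ i" for i using False frac_ge_0 order_trans unfolding A_def by blast
   have cl: "closed A"
   proof -
    have A: "A = (\<Inter>i. (%x. x $ i) -` {u. frac u <= a $ i})" by (auto simp: A_def)
    have "closed ((%x :: real^'n. x $ i) -` {u. frac u <= a $ i})" for i
     by (rule closed_vimage[OF closed_frac_le[OF a0]]) (intro continuous_intros)
    then show ?thesis unfolding A by (intro closed_INT ballI)
   qed
   have Ak: "x + k \<in> A \<longleftrightarrow> x \<in> A" if "k \<in> lattice" for x k
   proof -
    have "frac ((x + k) $ i) = frac (x $ i)" for i
    proof -
     obtain n where "k $ i = of_int n" using \<open>k \<in> lattice\<close> by (auto simp: lattice_def elim: Ints_cases)
     then show ?thesis by (simp add: frac_def)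
    qed
    then show ?thesis by (simp add: A_def)
   qed
   have ik: "infdist (x + k) A <= infdist x A" if "k \<in> lattice" for x k
   proof -
    have "infdist (x + k) A <= dist x b" if "b \<in> A" for b
     using infdist_le[of "b + k" A "x + k"] Ak[OF \<open>k \<in> lattice\<close>] that by (simp add: dist_norm)
    then show ?thesis unfolding infdist_notempty[OF False, of x] by (intro cINF_greatest False)
   qed
   have lip: "\<bar>infdist x A - infdist y A\<bar> <= torus_dist x y" for x y
   proof (rule torus_dist_ge)
    fix k :: "real^'n" assume k: "k \<in> lattice"
    have "infdist (x + k) A = infdist x A"
     using ik[OF k, of x] ik[OF lattice_uminus[OF k], of "x + k"] by simp
    then show "\<bar>infdist x A - infdist y A\<bar> <= norm (x - y + k)"
     using infdist_triangle_abs[of "x + k" A y] by (simp add: dist_norm algebra_simps)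
   qed
   define \<psi> where "\<psi> n x = max 0 (1 - real n * infdist x A)" for n x
   have \<psi>01: "0 <= \<psi> n x" "\<psi> n x <= 1" "\<bar>\<psi> n x\<bar> <= 1" for n x using infdist_nonneg[of x A] by (auto simp: \<psi>_def)
   have \<psi>b: "\<psi> n \<in> borel_fun" for n
    unfolding \<psi>_def[abs_def] by (intro borel_measurable_continuous_onI continuous_intros)
   have \<psi>lip: "\<bar>\<psi> n x - \<psi> n y\<bar> <= real n * torus_dist x y" for n x y
   proof -
    have "\<bar>\<psi> n x - \<psi> n y\<bar> <= \<bar>real n * infdist x A - real n * infdist y A\<bar>" by (auto simp: \<psi>_def max_def)
    also have "... = real n * \<bar>infdist x A - infdist y A\<bar>" by (simp add: abs_mult right_diff_distrib[symmetric])
    also have "... <= real n * torus_dist x y" using lip by (intro mult_left_mono) auto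
    finally show ?thesis .
   qed
   have lim: "(%n. \<psi> n x) \<longlonglongrightarrow> indicator ({..a} \<inter> cell) x" if x: "x \<in> cell" for x
   proof -
    have xA: "x \<in> A \<longleftrightarrow> x \<in> {..a}" using x by (auto simp: A_def less_eq_vec_def cell_def frac_eq)
    show ?thesis
    proof (cases "x \<in> A")
     case True
     then have "\<psi> n x = 1" for n by (simp add: \<psi>_def)
     then show ?thesis using True xA x by simp
    next
     case nA: False
     then have "0 < infdist x A" using in_closed_iff_infdist_zero[OF cl False] infdist_nonneg[of x A] by (simp add: less_le)
     then obtain N :: nat where N: "1 < real N * infdist x A" using reals_Archimedean3 by blast
     have "\<psi> n x = 0" if "N <= n" for n
     proof -
      have "real N * infdist x A <= real n * infdist x A" using that infdist_nonneg by (intro mult_right_mono) auto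
      then show ?thesis using N by (simp add: \<psi>_def)
     qed
     then have "eventually (%n. \<psi> n x = 0) sequentially" by (auto simp: eventually_sequentially)
     then have "(%n. \<psi> n x) \<longlonglongrightarrow> 0" by (rule tendsto_eventually)
     then show ?thesis using nA xA by simp
    qed
   qed
   have dct: "(%n. \<integral>x. \<psi> n x \<partial>\<sigma>) \<longlonglongrightarrow> measure \<sigma> ({..a} \<inter> cell)" if \<sigma>: "torus_prob \<sigma>" for \<sigma>
   proof -
    interpret S: prob_space \<sigma> by (rule torus_probD(1)[OF \<sigma>])
    have st: "{..a} \<inter> cell \<in> sets \<sigma>"
     unfolding torus_probD(2)[OF \<sigma>] using sets_restrict_space_iff[of "cell :: (real^'n) set" borel "{..a} \<inter> cell"] cellb by auto
    have "(%n. \<integral>x. \<psi> n x \<partial>\<sigma>) \<longlonglongrightarrow> (LINT x|\<sigma>. indicator ({..a} \<inter> cell) x)"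
    proof (rule integral_dominated_convergence[where w="%_. 1"])
     show "(%x. indicator ({..a} \<inter> cell) x :: real) \<in> borel_measurable \<sigma>" using st by simp
     show "\<psi> n \<in> borel_measurable \<sigma>" for n using torus_probD(4)[OF \<sigma> \<psi>b] .
     show "AE x in \<sigma>. (%n. \<psi> n x) \<longlonglongrightarrow> indicator ({..a} \<inter> cell) x"
      using lim torus_probD(3)[OF \<sigma>] by (intro AE_I2) auto
    qed (use \<psi>01 in auto)
    then show ?thesis using st by (simp add: sets.Int_space_eq2)
   qed
   have "measure \<mu> ({..a} \<inter> cell) = measure \<nu> ({..a} \<inter> cell)"
   proof (rule LIMSEQ_unique[OF dct[OF \<mu>]])
    have "(LINT x|\<mu>. \<psi> n x) = (LINT x|\<nu>. \<psi> n x)" for n by (rule eq[OF \<psi>b \<psi>01(3) \<psi>lip]) simp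
    then show "(%n. \<integral>x. \<psi> n x \<partial>\<mu>) \<longlonglongrightarrow> measure \<nu> ({..a} \<inter> cell)" using dct[OF \<nu>] by simp
   qed
   then show ?thesis by (simp add: M.emeasure_eq_measure N.emeasure_eq_measure)
  qed
 qed
 have d: "distr \<mu> borel (%x. x) = distr \<nu> borel (%x. x)"
 proof (rule measure_eqI_generator_eq[where E="range (%a :: real^'n. {..a})" and \<Omega>=UNIV and A="%n. {..(\<chi> i. real n)}"])
  show "Int_stable (range (%a :: real^'n. {..a}))"
  proof (rule Int_stableI)
   fix X Y assume "X \<in> range (%a :: real^'n. {..a})" "Y \<in> range (%a :: real^'n. {..a})"
   then obtain a b where "X = {..a}" "Y = {..b}" by auto
   then have "X \<inter> Y = {..(\<chi> i. min (a $ i) (b $ i))}" by (auto simp: less_eq_vec_def)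
   then show "X \<inter> Y \<in> range (%a :: real^'n. {..a})" by blast
  qed
  show "emeasure (distr \<mu> borel (%x. x)) X = emeasure (distr \<nu> borel (%x. x)) X" if "X \<in> range (%a :: real^'n. {..a})" for X
   using that box by (auto simp: emeasure_distr idm torus_probD(3)[OF \<mu>] torus_probD(3)[OF \<nu>])
  show "sets (distr \<mu> borel (%x. x)) = sigma_sets UNIV (range (%a :: real^'n. {..a}))"
   "sets (distr \<nu> borel (%x. x)) = sigma_sets UNIV (range (%a :: real^'n. {..a}))"
   by (simp_all add: borel_eq_atMost)
  show "(\<Union>n. {..(\<chi> i. real n)}) = (UNIV :: (real^'n) set)"
  proof (intro equalityI subsetI UNIV_I)
   fix x :: "real^'n"
   obtain n where "norm x <= real n" using real_arch_simple by blast
   then have "x $ i <= real n" for i using component_le_norm_cart[of x i] by linarith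
   then show "x \<in> (\<Union>n. {..(\<chi> i. real n)})" by (auto simp: less_eq_vec_def)
  qed
  show "emeasure (distr \<mu> borel (%x. x)) {..(\<chi> i. real n)} \<noteq> \<infinity>" for n
   by (simp add: emeasure_distr idm)
 qed auto
 show ?thesis
 proof (rule measure_eqI)
  show "sets \<mu> = sets \<nu>" using sM sN by simp
  fix X assume X: "X \<in> sets \<mu>"
  then have b: "X \<in> sets borel" "X \<subseteq> cell"
   using sets_restrict_space_iff[of "cell :: (real^'n) set" borel X] cellb unfolding sM by auto
  have "emeasure (distr \<mu> borel (%x. x)) X = emeasure \<mu> X" "emeasure (distr \<nu> borel (%x. x)) X = emeasure \<nu> X"
   using b by (auto simp: emeasure_distr idm torus_probD(3)[OF \<mu>] torus_probD(3)[OF \<nu>] Int_absorb2)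
  then show "emeasure \<mu> X = emeasure \<nu> X" using d by simp
 qed
qed

section \<open>The continuous curve of measures\<close>

lemma AE_lebesgue_on_iff:
 fixes S :: "'a::euclidean_space set"
 assumes "S \<in> sets borel"
 shows "(AE x in lebesgue_on S. P x) \<longleftrightarrow> (AE x in lborel. x \<in> S --> P x)"
 using assms by (subst AE_restrict_space_iff) (auto simp: AE_completion_iff)

text \<open>Both curves have the prescribed density at almost every time; along such times tending
  to \<open>T\<close> the averages of Lipschitz functions converge to those of either final
  measure.\<close>

lemma W2_representative_unique:
 fixes m :: "real \<times> (real^'n) => real"
 assumes T: "0 < T" and r: "W2_representative T m \<mu>" "W2_representative T m \<mu>'"
 shows "\<mu> T = \<mu>' T"
proof -
 have p: "torus_prob (\<mu> t)" "torus_prob (\<mu>' t)" if "t \<in> {0..T}" for t using r that by (auto simp: W2_representative_def)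
 have "AE t in lborel. t \<in> {0<..<T} --> \<mu> t = \<mu>' t"
 proof -
  have "AE t in lborel. t \<in> {0<..<T} --> (\<forall>A\<in>sets torus_borel. emeasure (\<mu> t) A = (\<integral>\<^sup>+x\<in>A. ennreal (m (t, x)) \<partial>lebesgue_on cell))"
   "AE t in lborel. t \<in> {0<..<T} --> (\<forall>A\<in>sets torus_borel. emeasure (\<mu>' t) A = (\<integral>\<^sup>+x\<in>A. ennreal (m (t, x)) \<partial>lebesgue_on cell))"
   using r unfolding W2_representative_def by (simp_all add: AE_lebesgue_on_iff)
  then show ?thesis
  proof eventually_elim
   fix t assume *: "t \<in> {0<..<T} --> (\<forall>A\<in>sets torus_borel. emeasure (\<mu> t) A = (\<integral>\<^sup>+x\<in>A. ennreal (m (t, x)) \<partial>lebesgue_on cell))"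
    "t \<in> {0<..<T} --> (\<forall>A\<in>sets torus_borel. emeasure (\<mu>' t) A = (\<integral>\<^sup>+x\<in>A. ennreal (m (t, x)) \<partial>lebesgue_on cell))"
   show "t \<in> {0<..<T} --> \<mu> t = \<mu>' t"
   proof
    assume t: "t \<in> {0<..<T}"
    then have "torus_prob (\<mu> t)" "torus_prob (\<mu>' t)" using p by auto
    then show "\<mu> t = \<mu>' t" using * t by (intro measure_eqI) (auto simp: torus_probD(2))
   qed
  qed
 qed
 then obtain s where s: "!!n :: nat. s n \<in> {0<..<T} \<and> \<mu> (s n) = \<mu>' (s n)" "s \<longlonglongrightarrow> T"
  using AE_dense_sequence[of T "%t. \<mu> t = \<mu>' t" T] T by auto
 have W: "(%n. W2 (\<mu> (s n)) (\<mu> T)) \<longlonglongrightarrow> 0" "(%n. W2 (\<mu>' (s n)) (\<mu>' T)) \<longlonglongrightarrow> 0"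
 proof -
  have "((%s. W2 (\<mu> s) (\<mu> T)) \<longlongrightarrow> 0) (at T within {0..T})" "((%s. W2 (\<mu>' s) (\<mu>' T)) \<longlongrightarrow> 0) (at T within {0..T})"
   using r T by (auto simp: W2_representative_def)
  moreover have "\<forall>i. s i \<in> {0..T} - {T}" using s(1) by (auto simp: less_imp_le)
  ultimately show "(%n. W2 (\<mu> (s n)) (\<mu> T)) \<longlonglongrightarrow> 0" "(%n. W2 (\<mu>' (s n)) (\<mu>' T)) \<longlonglongrightarrow> 0"
   using s(2) unfolding tendsto_at_iff_sequentially by (auto simp: comp_def)
 qed
 have sp: "torus_prob (\<mu> (s n))" "torus_prob (\<mu>' (s n))" "torus_prob (\<mu> T)" "torus_prob (\<mu>' T)" for n
  using p[of "s n"] p[of T] s(1)[of n] T by auto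
 show ?thesis
 proof (rule torus_prob_eqI[OF sp(3,4)])
  fix \<psi> :: "real^'n => real" and B L
  assume \<psi>: "\<psi> \<in> borel_fun" "!!x. \<bar>\<psi> x\<bar> <= B" "!!x y. \<bar>\<psi> x - \<psi> y\<bar> <= L * torus_dist x y" "0 <= L"
  have "(%n. \<integral>x. \<psi> x \<partial>\<mu> (s n)) \<longlonglongrightarrow> (LINT x|\<mu> T. \<psi> x)" by (rule W2_tendsto_lipschitz_integral[OF sp(1,3) \<psi> W(1)])
  moreover have "(%n. \<integral>x. \<psi> x \<partial>\<mu>' (s n)) \<longlonglongrightarrow> (LINT x|\<mu>' T. \<psi> x)" by (rule W2_tendsto_lipschitz_integral[OF sp(2,4) \<psi> W(2)])
  ultimately show "(LINT x|\<mu> T. \<psi> x) = (LINT x|\<mu>' T. \<psi> x)" using s(1) by (simp add: LIMSEQ_unique)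
 qed
qed

lemma final_measure_eq:
 fixes m :: "real \<times> (real^'n) => real"
 assumes "0 < T" "W2_representative T m \<mu>"
 shows "final_measure T m = \<mu> T"
 unfolding final_measure_def using assms W2_representative_unique by (intro the_equality) blast+

lemma slice_density:
 fixes m :: "real \<times> (real^'n) => real"
 assumes m: "m \<in> borel_fun" "!!z. 0 <= m z"
  and int: "integrable lborel (%x. indicator cell x * m (t, x))" and one: "slice m t = 1"
 defines "\<mu> \<equiv> density (restrict_space lborel cell) (%x. ennreal (m (t, x)))"
 shows "torus_prob \<mu>"
  "\<psi> \<in> borel_fun ==> (LINT x|\<mu>. \<psi> x) = slice (%z. \<psi> (snd z) * m z) t"
  "A \<in> sets torus_borel ==> emeasure \<mu> A = (\<integral>\<^sup>+x\<in>A. ennreal (m (t, x)) \<partial>lebesgue_on cell)"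
proof -
 have mt: "(%x. m (t, x)) \<in> borel_fun" using m(1) by measurable
 have mr: "f \<in> borel_fun ==> f \<in> borel_measurable (restrict_space lborel cell)" for f :: "real^'n => real"
  by (rule measurable_restrict_space1) simp
 have s: "sets \<mu> = sets torus_borel" unfolding \<mu>_def sets_density by (rule sets_restrict_space_cong) simp
 have cb: "(cell :: (real^'n) set) \<inter> space lborel \<in> sets lborel" "(cell :: (real^'n) set) \<inter> space lebesgue \<in> sets lebesgue" by simp_all
 show "A \<in> sets torus_borel ==> emeasure \<mu> A = (\<integral>\<^sup>+x\<in>A. ennreal (m (t, x)) \<partial>lebesgue_on cell)"
 proof -
  assume "A \<in> sets torus_borel"
  then have A: "A \<in> sets (restrict_space lborel cell)" using s by (simp add: \<mu>_def)
  have "emeasure \<mu> A = (\<integral>\<^sup>+x. ennreal (m (t, x)) * indicator A x \<partial>restrict_space lborel cell)"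
   unfolding \<mu>_def by (rule emeasure_density[OF _ A]) (use mr[OF mt] in simp)
  then show ?thesis by (simp only: nn_integral_restrict_space[OF cb(1)] nn_integral_restrict_space[OF cb(2)] nn_integral_completion)
 qed
 show i: "\<psi> \<in> borel_fun ==> (LINT x|\<mu>. \<psi> x) = slice (%z. \<psi> (snd z) * m z) t" for \<psi>
 proof -
  assume \<psi>: "\<psi> \<in> borel_fun"
  have "(LINT x|\<mu>. \<psi> x) = (LINT x|restrict_space lborel cell. m (t, x) *\<^sub>R \<psi> x)"
   unfolding \<mu>_def by (rule integral_density[OF mr[OF \<psi>] mr[OF mt]]) (simp add: m(2))
  then show ?thesis unfolding integral_restrict_space[OF cb(1)] slice_def by (simp add: ac_simps)
 qed
 have "prob_space \<mu>"
 proof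
  let ?R = "restrict_space lborel cell :: (real^'n) measure"
  have "emeasure \<mu> (space ?R) = (\<integral>\<^sup>+x. ennreal (m (t, x)) * indicator (space ?R) x \<partial>?R)"
   unfolding \<mu>_def by (rule emeasure_density[OF _ sets.top]) (use mr[OF mt] in simp)
  also have "... = (\<integral>\<^sup>+x. ennreal (m (t, x)) \<partial>?R)" by (intro nn_integral_cong) simp
  finally have "emeasure \<mu> (space \<mu>) = (\<integral>\<^sup>+x. ennreal (m (t, x)) \<partial>?R)" by (simp add: \<mu>_def)
  also have "... = (\<integral>\<^sup>+x. ennreal (indicator cell x * m (t, x)) \<partial>lborel)"
   unfolding nn_integral_restrict_space[OF cb(1)] by (intro nn_integral_cong) (auto simp: indicator_def)
  also have "... = ennreal (slice m t)"
   unfolding slice_def by (rule nn_integral_eq_integral[OF int]) (simp add: m(2))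
  finally show "emeasure \<mu> (space \<mu>) = 1" by (simp add: one)
 qed
 then show "torus_prob \<mu>" using s by (simp add: torus_prob_def)
qed

text \<open>At almost every time the density serves. At the other times, notably at
  \<open>T\<close>, a weak limit along good times is taken; any choice will do, because its averages
  over the countable family \<open>\<F>\<close> are forced to be \<open>evol\<close>, and these
  averages alone yield continuity in \<open>W2\<close>.\<close>

lemma W2_representative_exists:
 fixes m :: "real \<times> (real^'n) => real"
 assumes ws: "weak_sol T \<rho> m v" and T: "0 < T" and \<rho>: "(LINT x|lebesgue_on cell. \<rho> x) = 1"
  and \<Psi>: "C1per (%z. \<Psi> (snd z)) D\<Psi>"
 shows "\<exists>\<mu>. W2_representative T m \<mu> \<and> (LINT x|\<mu> T. \<Psi> x) = evol \<rho> m v (%z. \<Psi> (snd z)) D\<Psi> T"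
proof -
 have "\<exists>(Z :: (real^'n) set) (f :: real^'n => real^'n => real). finite Z \<and> (\<forall>y\<in>Z. \<exists>D. C1per (%z. f y (snd z)) D) \<and>
  (\<forall>y\<in>Z. \<forall>x. 0 <= f y x) \<and> (\<forall>x. (\<Sum>y\<in>Z. f y x) = 1) \<and>
  (\<forall>y\<in>Z. \<forall>x x'. 0 < f y x --> 0 < f y x' --> torus_dist x x' <= 1 / real (Suc N))" for N
  by (rule partition_of_unity) simp
 then obtain Z :: "nat => (real^'n) set" and f :: "nat => real^'n => real^'n => real" where
  Z: "!!N. finite (Z N)" "!!N y. y \<in> Z N ==> \<exists>D. C1per (%z. f N y (snd z)) D"
  "!!N y x. y \<in> Z N ==> 0 <= f N y x" "!!N x. (\<Sum>y\<in>Z N. f N y x) = 1"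
  "!!N y x x'. y \<in> Z N ==> 0 < f N y x ==> 0 < f N y x' ==> torus_dist x x' <= 1 / real (Suc N)"
  by metis
 \<comment> \<open>The partition functions of all scales are countably many, so that a single null
   set of times can be excluded; \<open>\<Psi>\<close> is added for the final cost.\<close>
 define \<F> where "\<F> = insert \<Psi> (\<Union>N. f N ` Z N)"
 have c\<F>: "countable \<F>" unfolding \<F>_def by (intro countable_insert countable_UN[OF countableI_type] countable_finite finite_imageI Z(1))
 have "\<exists>D. \<psi> \<in> \<F> --> C1per (%z. \<psi> (snd z)) D \<and> (\<psi> = \<Psi> --> D = D\<Psi>)" for \<psi>
  using \<Psi> Z(2) unfolding \<F>_def by (cases "\<psi> = \<Psi>") auto
 then obtain D where D: "!!\<psi>. \<psi> \<in> \<F> ==> C1per (%z. \<psi> (snd z)) (D \<psi>)" "\<Psi> \<in> \<F> ==> D \<Psi> = D\<Psi>" by metis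
 define E where "E \<psi> t = evol \<rho> m v (%z. \<psi> (snd z)) (D \<psi>) t" for \<psi> t
 have cont: "continuous_on UNIV \<psi>" "periodic \<psi>" "\<psi> \<in> borel_fun" if "\<psi> \<in> \<F>" for \<psi>
 proof -
  show c: "continuous_on UNIV \<psi>"
   using continuous_on_compose2[OF C1perD(4)[OF D(1)[OF that], of UNIV] continuous_on_Pair[OF continuous_on_const continuous_on_id]] by simp
  then show "\<psi> \<in> borel_fun" by (rule borel_measurable_continuous_onI)
  show "periodic \<psi>" using C1perD(3)[OF D(1)[OF that]] by (auto simp: tperiodic_def periodic_def)
 qed
 define good where "good t \<longleftrightarrow> integrable lborel (%x. indicator cell x * m (t, x)) \<and> slice m t = 1 \<and>
  (\<forall>\<psi>\<in>\<F>. slice (%z. \<psi> (snd z) * m z) t = E \<psi> t)" for t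
 have good: "AE t in lborel. t \<in> {0<..<T} --> good t"
 proof -
  have "AE t in lborel. \<forall>\<psi>\<in>\<F>. t \<in> {0<..<T} --> slice (%z. \<psi> (snd z) * m z) t = E \<psi> t"
   unfolding E_def by (intro AE_ball_countable' c\<F> weak_sol_slice[OF ws D(1) T])
  with integrable_slice(3)[OF weak_solD(6)[OF ws]] weak_sol_mass[OF ws T \<rho>] show ?thesis
   by eventually_elim (simp add: good_def)
 qed
 define dens where "dens t = density (restrict_space lborel cell) (%x. ennreal (m (t, x)))" for t
 have dens: "torus_prob (dens t)" "\<psi> \<in> \<F> ==> (LINT x|dens t. \<psi> x) = E \<psi> t"
  "A \<in> sets torus_borel ==> emeasure (dens t) A = (\<integral>\<^sup>+x\<in>A. ennreal (m (t, x)) \<partial>lebesgue_on cell)" if "good t" for t \<psi> A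
  using that slice_density[OF weak_solD(1,5)[OF ws], of t] cont(3) unfolding dens_def good_def by auto
 have "\<exists>\<nu>. t \<in> {0..T} --> torus_prob \<nu> \<and> (\<forall>\<psi>\<in>\<F>. (LINT x|\<nu>. \<psi> x) = E \<psi> t) \<and> (good t --> \<nu> = dens t)" for t
 proof (cases "good t \<or> t \<notin> {0..T}")
  case True
  then show ?thesis using dens by (intro exI[of _ "dens t"]) auto
 next
  case False
  then obtain s where s: "!!n::nat. s n \<in> {0<..<T} \<and> good (s n)" "s \<longlonglongrightarrow> t"
   using AE_dense_sequence[OF good T] by blast
  obtain \<nu> r where \<nu>: "torus_prob \<nu>" "strict_mono (r :: nat => nat)"
   "!!\<psi> :: real^'n => real. continuous_on UNIV \<psi> ==> periodic \<psi> ==> (%k. \<integral>x. \<psi> x \<partial>dens (s (r k))) \<longlonglongrightarrow> (LINT x|\<nu>. \<psi> x)"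
   using torus_weakly_compact[of "%n. dens (s n)"] dens(1) s(1) by blast
  have "(LINT x|\<nu>. \<psi> x) = E \<psi> t" if \<psi>: "\<psi> \<in> \<F>" for \<psi>
  proof (rule LIMSEQ_unique)
   show "(%k. \<integral>x. \<psi> x \<partial>dens (s (r k))) \<longlonglongrightarrow> (LINT x|\<nu>. \<psi> x)" using \<nu>(3) cont \<psi> by blast
   have "(%n. E \<psi> (s n)) \<longlonglongrightarrow> E \<psi> t"
    unfolding E_def by (rule evol_tendsto[OF ws D(1)[OF \<psi>] _ s(2)]) (use s(1) False in \<open>auto simp: less_imp_le\<close>)
   from LIMSEQ_subseq_LIMSEQ[OF this \<nu>(2)]
   show "(%k. \<integral>x. \<psi> x \<partial>dens (s (r k))) \<longlonglongrightarrow> E \<psi> t" using dens(2) s(1) \<psi> by (simp add: comp_def)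
  qed
  then show ?thesis using \<nu>(1) False by blast
 qed
 then obtain \<mu> where \<mu>: "!!t. t \<in> {0..T} ==> torus_prob (\<mu> t)" "!!t \<psi>. t \<in> {0..T} ==> \<psi> \<in> \<F> ==> (LINT x|\<mu> t. \<psi> x) = E \<psi> t"
  "!!t. t \<in> {0..T} ==> good t ==> \<mu> t = dens t" by metis
 have "((%s. W2 (\<mu> s) (\<mu> t)) \<longlongrightarrow> 0) (at t within {0..T})" if t: "t \<in> {0..T}" for t
  unfolding tendsto_at_iff_sequentially
 proof (intro allI impI)
  fix X assume X: "\<forall>i. X i \<in> {0..T} - {t}" "X \<longlonglongrightarrow> t"
  let ?n = "real CARD('n)"
  show "((%s. W2 (\<mu> s) (\<mu> t)) \<circ> X) \<longlonglongrightarrow> 0"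
  proof (rule LIMSEQ_I)
   fix e :: real assume e: "0 < e"
   \<comment> \<open>The scale of the partition, the mass held back in the coupling and the
     difference of averages contribute at most a quarter of \<open>e^2\<close> each.\<close>
   define \<delta> where "\<delta> = min (1/2) (e\<^sup>2 / (4 * ?n\<^sup>2))"
   have \<delta>: "0 < \<delta>" "\<delta> < 1" using e by (auto simp: \<delta>_def)
   have "?n\<^sup>2 * \<delta> <= ?n\<^sup>2 * (e\<^sup>2 / (4 * ?n\<^sup>2))" by (intro mult_left_mono) (auto simp: \<delta>_def)
   then have \<delta>2: "?n\<^sup>2 * \<delta> <= e\<^sup>2 / 4" by simp
   obtain N where N: "1 / real (Suc N) < e / 2" using nat_approx_posE[of "e/2"] e by auto
   have N2: "(1 / real (Suc N))\<^sup>2 <= e\<^sup>2 / 4" using power_mono[OF less_imp_le[OF N], of 2] by (simp add: power_divide)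
   have "(%n. ?n\<^sup>2 * (\<Sum>y\<in>Z N. \<bar>E (f N y) (X n) - E (f N y) t\<bar>)) \<longlonglongrightarrow> ?n\<^sup>2 * (\<Sum>y\<in>Z N. \<bar>E (f N y) t - E (f N y) t\<bar>)"
   proof (intro tendsto_intros)
    fix y assume "y \<in> Z N"
    then have "f N y \<in> \<F>" by (auto simp: \<F>_def)
    then show "(%n. E (f N y) (X n)) \<longlonglongrightarrow> E (f N y) t"
     unfolding E_def by (intro evol_tendsto[OF ws D(1) _ X(2) t]) (use X(1) in auto)
   qed
   moreover have "?n\<^sup>2 * (\<Sum>y\<in>Z N. \<bar>E (f N y) t - E (f N y) t\<bar>) < e\<^sup>2 / 4" using e by simp
   ultimately have "eventually (%n. ?n\<^sup>2 * (\<Sum>y\<in>Z N. \<bar>E (f N y) (X n) - E (f N y) t\<bar>) < e\<^sup>2 / 4) sequentially"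
    by (rule order_tendstoD)
   then obtain M where M: "!!n. M <= n ==> ?n\<^sup>2 * (\<Sum>y\<in>Z N. \<bar>E (f N y) (X n) - E (f N y) t\<bar>) < e\<^sup>2 / 4"
    by (auto simp: eventually_sequentially)
   have "norm (W2 (\<mu> (X n)) (\<mu> t) - 0) < e" if n: "M <= n" for n
   proof -
    have Xn: "X n \<in> {0..T}" using X(1) by auto
    have F: "f N y \<in> \<F>" if "y \<in> Z N" for y using that by (auto simp: \<F>_def)
    have "(W2 (\<mu> (X n)) (\<mu> t))\<^sup>2 <= (1 / real (Suc N))\<^sup>2 + ?n\<^sup>2 * (\<delta> + (\<Sum>y\<in>Z N. \<bar>(LINT x|\<mu> (X n). f N y x) - (LINT x|\<mu> t. f N y x)\<bar>))"
     by (rule W2_le_averages[OF \<mu>(1)[OF Xn] \<mu>(1)[OF t] Z(1) cont(3)[OF F] Z(3,4,5) _ \<delta>]) auto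
    also have "(\<Sum>y\<in>Z N. \<bar>(LINT x|\<mu> (X n). f N y x) - (LINT x|\<mu> t. f N y x)\<bar>) = (\<Sum>y\<in>Z N. \<bar>E (f N y) (X n) - E (f N y) t\<bar>)"
     by (intro sum.cong refl) (simp add: \<mu>(2)[OF Xn F] \<mu>(2)[OF t F])
    finally have "(W2 (\<mu> (X n)) (\<mu> t))\<^sup>2 <= (1 / real (Suc N))\<^sup>2 + (?n\<^sup>2 * \<delta> + ?n\<^sup>2 * (\<Sum>y\<in>Z N. \<bar>E (f N y) (X n) - E (f N y) t\<bar>))"
     by (simp only: distrib_left)
    also have "... < e\<^sup>2" using N2 \<delta>2 M[OF n] e zero_less_power[OF e, of 2] by linarith
    finally show ?thesis using e W2_nonneg[of "\<mu> (X n)" "\<mu> t"] by (simp add: power_less_imp_less_base)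
   qed
   then show "\<exists>M. \<forall>n\<ge>M. norm (((%s. W2 (\<mu> s) (\<mu> t)) \<circ> X) n - 0) < e" by auto
  qed
 qed
 moreover have "AE t in lebesgue_on {0<..<T}. \<forall>A\<in>sets torus_borel. emeasure (\<mu> t) A = (\<integral>\<^sup>+x\<in>A. ennreal (m (t, x)) \<partial>lebesgue_on cell)"
  unfolding AE_lebesgue_on_iff[OF borel_open[OF open_greaterThanLessThan]] using good
  by eventually_elim (auto simp: \<mu>(3) dens(3))
 moreover have "(LINT x|\<mu> T. \<Psi> x) = evol \<rho> m v (%z. \<Psi> (snd z)) D\<Psi> T"
  using \<mu>(2)[of T \<Psi>] T D(2) by (simp add: E_def \<F>_def)
 ultimately show ?thesis using \<mu>(1) unfolding W2_representative_def by blast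
qed

section \<open>Almost everywhere equal representatives\<close>

lemma measurable_lebesgue_AE_eq:
 assumes "f' \<in> borel_measurable lebesgue" "AE x in lebesgue. f x = f' x"
 shows "f \<in> borel_measurable lebesgue"
proof (rule measurableI)
 fix A :: "'b set" assume A: "A \<in> sets borel"
 show "f -` A \<inter> space lebesgue \<in> sets lebesgue"
 proof (rule completion.in_sets_AE)
  show "f' -` A \<inter> space lebesgue \<in> sets lebesgue" using assms(1) A by (rule measurable_sets)
  show "AE x in lebesgue. x \<in> f' -` A \<inter> space lebesgue \<longleftrightarrow> x \<in> f -` A \<inter> space lebesgue"
   using assms(2) by eventually_elim simp
 qed simp
qed simp

lemma AE_cyl_iff:
 "(AE z in cyl a b. P z) \<longleftrightarrow> (AE z in lborel. z \<in> {a<..<b} \<times> (cell :: (real^'n) set) --> P z)"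
 unfolding cyl_def by (rule AE_restrict_space_iff) simp

lemma AE_cylinder_iff: "(AE z in cylinder a b. P z) \<longleftrightarrow> (AE z in cyl a b. P (z :: real \<times> (real^'n)))"
 by (simp only: AE_lebesgue_on_iff[OF sets_cylinder_set] AE_cyl_iff)

text \<open>The bridge between the completed measure of the definitions and the Borel measure of the
  proof; a change of the function on a null set is made in the same step.\<close>

lemma cylinder_AE_eq:
 fixes f h :: "real \<times> (real^'n) => 'b::{banach, second_countable_topology}"
 assumes h: "h \<in> borel_measurable (cyl a b)" and eq: "AE z in cyl a b. f z = h z"
 shows "f \<in> borel_measurable (cylinder a b)"
  "integrable (cylinder a b) f \<longleftrightarrow> integrable (cyl a b) h"
  "(LINT z|cylinder a b. f z) = (LINT z|cyl a b. h z)"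
proof -
 let ?S = "{a<..<b} \<times> (cell :: (real^'n) set)"
 have s: "?S \<inter> space lebesgue \<in> sets lebesgue" "?S \<inter> space lborel \<in> sets lborel" by simp_all
 have hb: "(%z. indicator ?S z *\<^sub>R h z) \<in> borel_measurable lborel"
  using h unfolding cyl_def by (subst (asm) borel_measurable_restrict_space_iff[OF s(2)]) simp
 then have hl: "(%z. indicator ?S z *\<^sub>R h z) \<in> borel_measurable lebesgue" by (rule measurable_completion)
 have e: "AE z in lebesgue. indicator ?S z *\<^sub>R f z = indicator ?S z *\<^sub>R h z"
  unfolding AE_completion_iff using eq unfolding AE_cyl_iff by eventually_elim (auto simp: indicator_def)
 have fl: "(%z. indicator ?S z *\<^sub>R f z) \<in> borel_measurable lebesgue" by (rule measurable_lebesgue_AE_eq[OF hl e])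
 show "f \<in> borel_measurable (cylinder a b)" using fl borel_measurable_restrict_space_iff[OF s(1)] by blast
 show "integrable (cylinder a b) f \<longleftrightarrow> integrable (cyl a b) h"
  unfolding integrable_restrict_space[OF s(1)] cyl_def integrable_restrict_space[OF s(2)]
  using integrable_cong_AE[OF fl hl e] integrable_completion[OF hb] by simp
 show "(LINT z|cylinder a b. f z) = (LINT z|cyl a b. h z)"
  unfolding integral_restrict_space[OF s(1)] cyl_def integral_restrict_space[OF s(2)]
  using integral_cong_AE[OF fl hl e] integral_completion[OF hb] by simp
qed

lemma nn_integral_cylinder: "(\<integral>\<^sup>+z. f z \<partial>cylinder a b) = (\<integral>\<^sup>+z. f z \<partial>(cyl a b :: (real \<times> (real^'n)) measure))"
proof -
 let ?S = "{a<..<b} \<times> (cell :: (real^'n) set)"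
 have s: "?S \<inter> space lebesgue \<in> sets lebesgue" "?S \<inter> space lborel \<in> sets lborel" by simp_all
 show ?thesis unfolding nn_integral_restrict_space[OF s(1)] cyl_def nn_integral_restrict_space[OF s(2)] nn_integral_completion ..
qed

text \<open>Composition with \<open>wrap\<close> makes a Borel version periodic and changes nothing
  inside the cell.\<close>

lemma cylinder_borel_version:
 fixes f :: "real \<times> (real^'n) => real"
 assumes "f \<in> borel_measurable (cylinder a b)"
 shows "\<exists>f'. f' \<in> borel_fun \<and> tperiodic f' \<and> (AE z in cyl a b. f z = f' z)"
proof -
 let ?S = "{a<..<b} \<times> (cell :: (real^'n) set)"
 have s: "?S \<inter> space lebesgue \<in> sets lebesgue" by simp
 have "(%z. indicator ?S z *\<^sub>R f z) \<in> borel_measurable lebesgue" using assms borel_measurable_restrict_space_iff[OF s] by blast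
 then obtain g where g: "g \<in> borel_measurable lborel" "AE z in lborel. indicator ?S z *\<^sub>R f z = g z"
  using completion_ex_borel_measurable_real by blast
 define f' where "f' z = g (fst z, wrap (snd z))" for z
 have [measurable]: "g \<in> borel_fun" using g(1) by simp
 have "(%z :: real \<times> (real^'n). (fst z, wrap (snd z))) \<in> borel \<rightarrow>\<^sub>M borel \<Otimes>\<^sub>M borel" by measurable
 then have m: "(%z :: real \<times> (real^'n). (fst z, wrap (snd z))) \<in> borel \<rightarrow>\<^sub>M borel" by (simp only: borel_prod)
 have "f' \<in> borel_fun" unfolding f'_def[abs_def] by (rule measurable_compose[OF m]) measurable
 moreover have "tperiodic f'" by (simp add: tperiodic_def f'_def wrap_add_lattice)
 moreover have "AE z in cyl a b. f z = f' z"
  unfolding AE_cyl_iff using g(2) by eventually_elim (auto simp: f'_def wrap_id)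
 ultimately show ?thesis by blast
qed

section \<open>Test functions and the weak formulation\<close>

lemma continuous_on_of_basis:
 fixes D :: "'a::topological_space => 'b::euclidean_space => real"
 assumes lin: "!!z. z \<in> S ==> linear (D z)" and cont: "!!b. b \<in> Basis ==> continuous_on S (%z. D z b)"
 shows "continuous_on S (%z. D z e)"
proof (rule continuous_on_eq)
 show "continuous_on S (%z. \<Sum>b\<in>Basis. (e \<bullet> b) * D z b)" by (intro continuous_intros cont)
 fix z assume "z \<in> S"
 then interpret l: linear "D z" by (rule lin)
 have "D z e = D z (\<Sum>b\<in>Basis. (e \<bullet> b) *\<^sub>R b)" by (simp only: euclidean_representation)
 then show "(\<Sum>b\<in>Basis. (e \<bullet> b) * D z b) = D z e" by (simp add: l.sum l.scale)
qed

lemma test_fun_test_pair: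
 fixes \<phi> :: "real \<times> (real^'n) => real"
 assumes "test_fun 1 {0..<T} \<phi>" "0 < T"
 shows "\<exists>D. test_pair T \<phi> D"
proof -
 let ?S = "{0..<T} \<times> (UNIV :: (real^'n) set)"
 have ck: "Ck_on (Suc 0) ?S \<phi>" and per: "\<forall>t\<in>{0..<T}. periodic (%x. \<phi> (t, x))"
  and "\<exists>K. compact K \<and> K \<subseteq> {0..<T} \<and> (\<forall>t\<in>{0..<T} - K. \<forall>x. \<phi> (t, x) = 0)"
  using assms by (auto simp: test_fun_def)
 then obtain K where K: "compact K" "K \<subseteq> {0..<T}" "\<forall>t\<in>{0..<T} - K. \<forall>x. \<phi> (t, x) = 0" by blast
 obtain D where D: "\<forall>z\<in>?S. (\<phi> has_derivative D z) (at z within ?S)" "\<forall>e\<in>Basis. continuous_on ?S (%z. D z e)"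
  using ck by auto
 have "continuous_on ?S (%z. D z e)" for e
  by (rule continuous_on_of_basis) (use D has_derivative_linear in blast)+
 moreover have "\<exists>a<T. \<forall>t\<in>{0..<T}. a < t --> (\<forall>x. \<phi> (t, x) = 0)"
 proof (cases "K = {}")
  case True
  then show ?thesis using K(3) assms(2) by blast
 next
  case False
  obtain a where a: "a \<in> K" "\<forall>t\<in>K. t <= a" using compact_attains_sup[OF K(1) False] by blast
  then have "\<forall>t\<in>{0..<T}. a < t --> (\<forall>x. \<phi> (t, x) = 0)" using K(3) by fastforce
  moreover have "a < T" using a(1) K(2) by auto
  ultimately show ?thesis by blast
 qed
 ultimately show ?thesis using D(1) per unfolding test_pair_def by blast
qed

lemma test_pair_test_fun:
 fixes \<phi> :: "real \<times> (real^'n) => real"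
 assumes tp: "test_pair T \<phi> D" and T: "0 < T"
 shows "test_fun 1 {0..<T} \<phi>"
proof -
 obtain a where a: "a < T" "\<forall>t\<in>{0..<T}. a < t --> (\<forall>x. \<phi> (t, x) = 0)" using test_pairD(4)[OF tp] by blast
 have "compact {0..max 0 a} \<and> {0..max 0 a} \<subseteq> {0..<T} \<and> (\<forall>t\<in>{0..<T} - {0..max 0 a}. \<forall>x. \<phi> (t, x) = 0)"
  using a T by auto
 then have "\<exists>K. compact K \<and> K \<subseteq> {0..<T} \<and> (\<forall>t\<in>{0..<T} - K. \<forall>x. \<phi> (t, x) = 0)" by blast
 moreover have "Ck_on (Suc 0) ({0..<T} \<times> UNIV) \<phi>" unfolding Ck_on.simps using test_pairD(1,2)[OF tp] by blast
 moreover have "\<forall>t\<in>{0..<T}. periodic (%x. \<phi> (t, x))" using tp unfolding test_pair_def by blast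
 ultimately show ?thesis unfolding test_fun_def by simp
qed

lemma test_pair_integrand:
 fixes \<phi> :: "real \<times> (real^'n) => real"
 assumes tp: "test_pair T \<phi> D" and z: "z \<in> {0<..<T} \<times> cell"
 shows "(r :: real) * time_deriv \<phi> z + (r *\<^sub>R u) \<bullet> space_grad \<phi> z = r * D z (1, u)"
proof -
 have f: "0 < fst z" "fst z < T" using z by auto
 have d: "frechet_derivative \<phi> (at z) = D z" by (rule frechet_derivative_at[OF test_pair_interior[OF tp f], symmetric])
 have "linear (D z)" by (rule test_pair_linear[OF tp]) (use f in auto)
 from linear_pair_expand[OF this, of 1 u] show ?thesis
  by (simp add: time_deriv_def space_grad_def d inner_vec_def algebra_simps sum_distrib_left)
qed

lemma test_pair_measurable:
 fixes m :: "real \<times> (real^'n) => real"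
 assumes tp: "test_pair T \<phi> D" and [measurable]: "m \<in> borel_fun" "v \<in> borel_fun"
 shows "(%z. m z * D z (1, v z)) \<in> borel_measurable (cyl 0 T)"
proof -
 have [measurable]: "(%z. strip_ext T D z (1, v z)) \<in> borel_fun"
 proof (rule strip_ext_measurable)
  show "continuous_on ({0<..<T} \<times> UNIV) (%z. D z w)" for w by (rule continuous_on_subset[OF test_pairD(2)[OF tp]]) auto
  show "linear (D z)" if "z \<in> {0<..<T} \<times> UNIV" for z by (rule test_pair_linear[OF tp]) (use that in auto)
 qed auto
 have "(%z. m z * strip_ext T D z (1, v z)) \<in> borel_measurable (cyl 0 T)" by (rule borel_measurable_cyl) measurable
 then show ?thesis by (rule measurable_cong[THEN iffD1, rotated]) (auto simp: strip_ext_def)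
qed

lemma admissible_weak_sol:
 fixes m :: "real \<times> (real^'n) => real"
 assumes adm: "(m, v) \<in> admissible T \<rho>" and T: "0 < T" and kin: "(\<integral>\<^sup>+z. ennreal (m z * (norm (v z))\<^sup>2) \<partial>cylinder 0 T) \<noteq> \<infinity>"
 shows "\<exists>m' v'. weak_sol T \<rho> m' v' \<and> (AE z in cyl 0 T. m z = m' z \<and> v z = v' z)"
proof -
 have im: "integrable (cylinder 0 T) m" and m0: "AE z in cylinder 0 T. 0 <= m z" and vm: "v \<in> borel_measurable (cylinder 0 T)"
  and eq: "!!\<phi>. test_fun 1 {0..<T} \<phi> ==> (LINT z|cylinder 0 T. m z * time_deriv \<phi> z + (m z *\<^sub>R v z) \<bullet> space_grad \<phi> z)
    + (LINT x|lebesgue_on cell. \<phi> (0, x) * \<rho> x) = 0"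
  using adm[unfolded admissible_def mem_Collect_eq prod.case]
  by - (elim conjE, assumption, elim conjE, assumption, elim conjE, assumption, elim conjE allE impE, assumption, assumption)
 obtain f where f: "f \<in> borel_fun" "tperiodic f" "AE z in cyl 0 T. m z = f z"
  using cylinder_borel_version[of m 0 T] im by blast
 have "(%z. v z $ i) \<in> borel_measurable (cylinder 0 T)" for i using vm by (rule borel_measurable_vec_nth)
 then have "\<exists>g. g \<in> borel_fun \<and> tperiodic g \<and> (AE z in cyl 0 T. v z $ i = g z)" for i
  by (rule cylinder_borel_version)
 then obtain g where g: "!!i. g i \<in> borel_fun" "!!i. tperiodic (g i)" "!!i. AE z in cyl 0 T. v z $ i = g i z" by metis
 \<comment> \<open>The truncation makes the density nonnegative everywhere instead of almost
   everywhere.\<close>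
 define m' where "m' z = max 0 (f z)" for z
 define v' where "v' z = (\<chi> i. g i z)" for z
 have meas: "m' \<in> borel_fun" "v' \<in> borel_fun"
  unfolding m'_def[abs_def] v'_def[abs_def] by (intro measurable_vec_lambda g borel_measurable_max borel_measurable_const f)+
 have per: "tperiodic m'" "tperiodic v'" using f(2) g(2) by (auto simp: tperiodic_def m'_def v'_def)
 have ae: "AE z in cyl 0 T. m z = m' z \<and> v z = v' z"
 proof -
  have "AE z in cyl 0 T. \<forall>i. v z $ i = g i z" using g(3) by (simp add: AE_all_countable)
  with f(3) m0[unfolded AE_cylinder_iff] show ?thesis by eventually_elim (auto simp: m'_def v'_def vec_eq_iff)
 qed
 have "weak_sol T \<rho> m' v'"
  unfolding weak_sol_def
 proof (intro conjI allI impI meas per)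
  show "0 <= m' z" for z by (simp add: m'_def)
  have "AE z in cyl 0 T. m z = m' z" using ae by eventually_elim simp
  then show i: "integrable (cyl 0 T) m'" using cylinder_AE_eq(2)[OF borel_measurable_cyl[OF meas(1)]] im by blast
  show "integrable (cyl 0 T) (%z. m' z * (norm (v' z))\<^sup>2)"
  proof (rule integrableI_nonneg)
   show "(%z. m' z * (norm (v' z))\<^sup>2) \<in> borel_measurable (cyl 0 T)" by (rule borel_measurable_cyl) (use meas in measurable)
   have "(\<integral>\<^sup>+z. ennreal (m' z * (norm (v' z))\<^sup>2) \<partial>cyl 0 T) = (\<integral>\<^sup>+z. ennreal (m z * (norm (v z))\<^sup>2) \<partial>cyl 0 T)"
    by (rule nn_integral_cong_AE) (use ae in eventually_elim, simp)
   then show "(\<integral>\<^sup>+z. ennreal (m' z * (norm (v' z))\<^sup>2) \<partial>cyl 0 T) < \<infinity>" using kin unfolding nn_integral_cylinder by (simp add: less_top)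
  qed (simp add: m'_def)
  fix \<phi> :: "real \<times> (real^'n) => real" and D assume tp: "test_pair T \<phi> D"
  have "(LINT z|cylinder 0 T. m z * time_deriv \<phi> z + (m z *\<^sub>R v z) \<bullet> space_grad \<phi> z) = (LINT z|cyl 0 T. m' z * D z (1, v' z))"
  proof (rule cylinder_AE_eq(3)[OF test_pair_measurable[OF tp meas]])
   show "AE z in cyl 0 T. m z * time_deriv \<phi> z + (m z *\<^sub>R v z) \<bullet> space_grad \<phi> z = m' z * D z (1, v' z)"
    using ae AE_space by eventually_elim (simp only: space_cyl test_pair_integrand[OF tp])
  qed
  with eq[OF test_pair_test_fun[OF tp T]]
  show "(LINT z|cyl 0 T. m' z * D z (1, v' z)) + (LINT x|lebesgue_on cell. \<phi> (0, x) * \<rho> x) = 0" by simp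
 qed
 with ae show ?thesis by blast
qed

lemma integral_lebesgue_on_cell:
 fixes h :: "real^'n => real"
 assumes "h \<in> borel_fun"
 shows "(LINT x|lebesgue_on cell. h x) = (LINT x|lborel. indicator cell x * h x)"
proof -
 have s: "(cell :: (real^'n) set) \<inter> space lebesgue \<in> sets lebesgue" by simp
 have "(%x. indicator cell x *\<^sub>R h x) \<in> borel_measurable lborel" using assms by simp
 then show ?thesis unfolding integral_restrict_space[OF s] by (simp add: integral_completion)
qed

text \<open>Needed for the competitors. That almost every slice has mass 1 is not part of
  \<open>weak_sol\<close>; it follows from the balance law for the constant function 1.\<close>

lemma weak_sol_admissible:
 fixes m :: "real \<times> (real^'n) => real"
 assumes ws: "weak_sol T \<rho> m v" and T: "0 < T" and \<rho>: "(LINT x|lebesgue_on cell. \<rho> x) = 1"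
 shows "(m, v) \<in> admissible T \<rho>"
 unfolding admissible_def mem_Collect_eq prod.case
proof (intro conjI allI impI)
 note wd = weak_solD[OF ws]
 note [measurable] = wd(1,2)
 have refl: "AE z in cyl 0 T. h z = h z" for h :: "real \<times> (real^'n) => 'x" by simp
 show "integrable (cylinder 0 T) m" using cylinder_AE_eq(2)[OF borel_measurable_cyl[OF wd(1)] refl] wd(6) by blast
 show "AE z in cylinder 0 T. 0 <= m z" using wd(5) by simp
 have "(%x. m (t, x)) \<in> borel_fun" for t using wd(1) by measurable
 then have sl: "(LINT x|lebesgue_on cell. m (t, x)) = slice m t" for t by (simp add: integral_lebesgue_on_cell slice_def)
 show "AE t in lebesgue_on {0<..<T}. (LINT x|lebesgue_on cell. m (t, x)) = 1"
  unfolding sl AE_lebesgue_on_iff[OF borel_open[OF open_greaterThanLessThan]] by (rule weak_sol_mass[OF ws T \<rho>])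
 show "v \<in> borel_measurable (cylinder 0 T)" by (rule cylinder_AE_eq(1)[OF borel_measurable_cyl[OF wd(2)] refl])
 have mm: "(%z. m z *\<^sub>R v z) \<in> borel_measurable (cyl 0 T)" by (rule borel_measurable_cyl) measurable
 have "integrable (cyl 0 T) (%z. m z *\<^sub>R v z)"
  by (rule Bochner_Integration.integrable_bound[OF weak_sol_integrable_v[OF ws] mm]) (simp add: wd(5))
 then show "integrable (cylinder 0 T) (%z. m z *\<^sub>R v z)" using cylinder_AE_eq(2)[OF mm refl] by blast
 fix \<phi> :: "real \<times> (real^'n) => real" assume "test_fun 1 {0..<T} \<phi>"
 then obtain D where tp: "test_pair T \<phi> D" using test_fun_test_pair T by blast
 have "(LINT z|cylinder 0 T. m z * time_deriv \<phi> z + (m z *\<^sub>R v z) \<bullet> space_grad \<phi> z) = (LINT z|cyl 0 T. m z * D z (1, v z))"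
  by (rule cylinder_AE_eq(3)[OF test_pair_measurable[OF tp wd(1,2)]], rule AE_I2) (simp only: space_cyl test_pair_integrand[OF tp])
 then show "(LINT z|cylinder 0 T. m z * time_deriv \<phi> z + (m z *\<^sub>R v z) \<bullet> space_grad \<phi> z) + (LINT x|lebesgue_on cell. \<phi> (0, x) * \<rho> x) = 0"
  using wd(8)[OF tp] by simp
qed

section \<open>The energy in terms of Borel representatives\<close>

lemma W2_representative_AE_eq:
 fixes m m' :: "real \<times> (real^'n) => real"
 assumes "AE z in cyl 0 T. m z = m' z" "W2_representative T m \<mu>"
 shows "W2_representative T m' \<mu>"
proof -
 have "AE z in lborel \<Otimes>\<^sub>M lborel. z \<in> {0<..<T} \<times> (cell :: (real^'n) set) --> m z = m' z"
  using assms(1) unfolding AE_cyl_iff lborel_prod .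
 from lborel_pair.AE_pair[OF this] have "AE t in lborel. AE x in lborel. t \<in> {0<..<T} \<and> x \<in> cell --> m (t, x) = m' (t, x)" by simp
 moreover have "AE t in lborel. t \<in> {0<..<T} --> (\<forall>A\<in>sets torus_borel. emeasure (\<mu> t) A = (\<integral>\<^sup>+x\<in>A. ennreal (m (t, x)) \<partial>lebesgue_on cell))"
  using assms(2) unfolding W2_representative_def by (simp add: AE_lebesgue_on_iff)
 ultimately have "AE t in lborel. t \<in> {0<..<T} --> (\<forall>A\<in>sets torus_borel. emeasure (\<mu> t) A = (\<integral>\<^sup>+x\<in>A. ennreal (m' (t, x)) \<partial>lebesgue_on cell))"
 proof eventually_elim
  case (elim t)
  show ?case
  proof (intro impI ballI)
   fix A assume t: "t \<in> {0<..<T}" and A: "A \<in> sets (torus_borel :: (real^'n) measure)"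
   have ae: "AE x in lebesgue_on cell. m (t, x) = m' (t, x)"
    unfolding AE_lebesgue_on_iff[OF sets_cell] using elim(1) t by simp
   have "(\<integral>\<^sup>+x\<in>A. ennreal (m (t, x)) \<partial>lebesgue_on cell) = (\<integral>\<^sup>+x\<in>A. ennreal (m' (t, x)) \<partial>lebesgue_on cell)"
    by (rule nn_integral_cong_AE) (use ae in eventually_elim, simp)
   then show "emeasure (\<mu> t) A = (\<integral>\<^sup>+x\<in>A. ennreal (m' (t, x)) \<partial>lebesgue_on cell)" using elim(2) t A by simp
  qed
 qed
 then show ?thesis using assms(2) unfolding W2_representative_def by (simp add: AE_lebesgue_on_iff)
qed

lemma energy_AE_eq:
 fixes m m' :: "real \<times> (real^'n) => real"
 assumes ae: "AE z in cyl 0 T. m z = m' z \<and> v z = v' z"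
 shows "energy T G \<Psi> m v = energy T G \<Psi> m' v'"
proof -
 have "W2_representative T m = W2_representative T m'"
 proof (rule ext)
  have "AE z in cyl 0 T. m z = m' z" "AE z in cyl 0 T. m' z = m z" using ae by (eventually_elim, simp)+
  then show "W2_representative T m \<mu> = W2_representative T m' \<mu>" for \<mu> using W2_representative_AE_eq by blast
 qed
 then have "final_measure T m = final_measure T m'" by (simp add: final_measure_def)
 moreover have "(\<integral>\<^sup>+z. ennreal (m z * (norm (v z))\<^sup>2) \<partial>cyl 0 T) = (\<integral>\<^sup>+z. ennreal (m' z * (norm (v' z))\<^sup>2) \<partial>cyl 0 T)"
  "(\<integral>\<^sup>+z. ennreal (1/2 * m z * (norm (v z))\<^sup>2) + G (m z) \<partial>cyl 0 T) = (\<integral>\<^sup>+z. ennreal (1/2 * m' z * (norm (v' z))\<^sup>2) + G (m' z) \<partial>cyl 0 T)"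
  by (rule nn_integral_cong_AE, use ae in eventually_elim, simp)+
 ultimately show ?thesis unfolding energy_def nn_integral_cylinder by simp
qed

lemma weak_sol_kinetic_finite:
 assumes "weak_sol T \<rho> m v"
 shows "(\<integral>\<^sup>+z. ennreal (m z * (norm (v z))\<^sup>2) \<partial>cylinder 0 T) \<noteq> \<infinity>"
 using weak_solD(7)[OF assms] unfolding nn_integral_cylinder by (auto simp: integrable_iff_bounded weak_solD(5)[OF assms])

text \<open>The final average of \<open>\<Psi>\<close> is \<open>evol\<close> at \<open>T\<close>:
  the initial average, which does not depend on the competitor, plus the bulk integral contained in
  \<open>lagr\<close>.\<close>

lemma energy_weak_sol:
 fixes m :: "real \<times> (real^'n) => real"
 assumes ws: "weak_sol T \<rho> m v" and T: "0 < T" and \<rho>: "(LINT x|lebesgue_on cell. \<rho> x) = 1"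
  and G: "!!s. 0 <= s ==> G s = ennreal (H s)" "!!s. 0 <= s ==> 0 <= H s"
  and iH: "integrable (cyl 0 T) (%z. H (m z))"
  and \<Psi>: "periodic \<Psi>" "!!x. (\<Psi> has_derivative (%h. h \<bullet> p x)) (at x)" and p: "continuous_on UNIV p"
 shows "energy T G \<Psi> m v = ereal ((LINT z|cyl 0 T. lagr H p m v z) + (LINT x|lebesgue_on cell. \<Psi> x * \<rho> x))"
proof -
 have C: "C1per (%z. \<Psi> (snd z)) (%z w. snd w \<bullet> p (snd z))"
  unfolding C1per_def
 proof (intro conjI allI)
  show "((%z. \<Psi> (snd z)) has_derivative (%w. snd w \<bullet> p (snd z))) (at z)" for z :: "real \<times> (real^'n)"
   by (rule has_derivative_compose[OF bounded_linear_imp_has_derivative[OF bounded_linear_snd] \<Psi>(2)])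
  show "continuous_on UNIV (%z :: real \<times> (real^'n). snd w \<bullet> p (snd z))" for w :: "real \<times> (real^'n)"
   by (intro continuous_intros continuous_on_compose2[OF p]) auto
  show "tperiodic (%z. \<Psi> (snd z))" using \<Psi>(1) by (auto simp: tperiodic_def periodic_def)
 qed
 obtain \<mu> where \<mu>: "W2_representative T m \<mu>" "(LINT x|\<mu> T. \<Psi> x) = evol \<rho> m v (%z. \<Psi> (snd z)) (%z w. snd w \<bullet> p (snd z)) T"
  using W2_representative_exists[OF ws T \<rho> C] by blast
 have fin: "(LINT x|final_measure T m. \<Psi> x) = (LINT x|lebesgue_on cell. \<Psi> x * \<rho> x) + (LINT z|cyl 0 T. m z * (v z \<bullet> p (snd z)))"
  unfolding final_measure_eq[OF T \<mu>(1)] \<mu>(2) by (simp add: evol_def)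
 have ip: "integrable (cyl 0 T) (%z. m z * (v z \<bullet> p (snd z)))" using weak_sol_integrable_D(1)[OF ws C] by simp
 note m0 = weak_solD(5)[OF ws]
 have ik: "integrable (cyl 0 T) (%z. 1/2 * m z * (norm (v z))\<^sup>2 + H (m z))"
  using weak_solD(7)[OF ws] iH by (simp add: mult.assoc)
 have "(\<integral>\<^sup>+z. ennreal (1/2 * m z * (norm (v z))\<^sup>2) + G (m z) \<partial>cyl 0 T) = (\<integral>\<^sup>+z. ennreal (1/2 * m z * (norm (v z))\<^sup>2 + H (m z)) \<partial>cyl 0 T)"
  using m0 G by (intro nn_integral_cong) (simp add: ennreal_plus)
 also have "... = ennreal (LINT z|cyl 0 T. 1/2 * m z * (norm (v z))\<^sup>2 + H (m z))"
  by (rule nn_integral_eq_integral[OF ik]) (use m0 G(2) in auto)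
 finally have "enn2ereal (\<integral>\<^sup>+z. ennreal (1/2 * m z * (norm (v z))\<^sup>2) + G (m z) \<partial>cyl 0 T)
   = ereal (LINT z|cyl 0 T. 1/2 * m z * (norm (v z))\<^sup>2 + H (m z))"
  using m0 G(2) by (simp add: integral_nonneg_AE)
 then have "energy T G \<Psi> m v = ereal (LINT z|cyl 0 T. 1/2 * m z * (norm (v z))\<^sup>2 + H (m z)) + ereal (LINT x|final_measure T m. \<Psi> x)"
  using weak_sol_kinetic_finite[OF ws] unfolding energy_def nn_integral_cylinder by simp
 moreover have "(LINT z|cyl 0 T. lagr H p m v z) = (LINT z|cyl 0 T. 1/2 * m z * (norm (v z))\<^sup>2 + H (m z)) + (LINT z|cyl 0 T. m z * (v z \<bullet> p (snd z)))"
  unfolding lagr_def by (rule Bochner_Integration.integral_add[OF ik ip])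
 ultimately show ?thesis using fin by simp
qed

text \<open>\<open>test_fun\<close> leaves the values outside the interval open, so the function is
  extended by 0. The open strip and the open set of times outside the compact \<open>K\<close> cover
  everything, and the derivative is glued from the two.\<close>

lemma test_fun_C1per:
 fixes \<phi> :: "real \<times> (real^'n) => real"
 assumes tf: "test_fun 1 {a<..<b} \<phi>" and ab: "a < b"
 shows "\<exists>\<phi>' D \<alpha> \<beta>. C1per \<phi>' D \<and> a < \<alpha> \<and> \<beta> < b \<and> (\<forall>t x. t \<notin> {\<alpha>..\<beta>} --> \<phi>' (t, x) = 0) \<and>
  (\<forall>z e. fst z \<in> {a<..<b} --> \<phi>' z = \<phi> z \<and> D z e = frechet_derivative \<phi> (at z) e)"
proof -
 let ?S = "{a<..<b} \<times> (UNIV :: (real^'n) set)"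
 have oS: "open ?S" by (intro open_Times) auto
 have ck: "Ck_on (Suc 0) ?S \<phi>" and per: "\<forall>t\<in>{a<..<b}. periodic (%x. \<phi> (t, x))"
  and "\<exists>K. compact K \<and> K \<subseteq> {a<..<b} \<and> (\<forall>t\<in>{a<..<b} - K. \<forall>x. \<phi> (t, x) = 0)"
  using assms by (auto simp: test_fun_def)
 then obtain K where K: "compact K" "K \<subseteq> {a<..<b}" "\<forall>t\<in>{a<..<b} - K. \<forall>x. \<phi> (t, x) = 0" by blast
 obtain D where D: "\<forall>z\<in>?S. (\<phi> has_derivative D z) (at z within ?S)" "\<forall>e\<in>Basis. continuous_on ?S (%z. D z e)"
  using ck by auto
 have D1: "(\<phi> has_derivative D z) (at z)" if "z \<in> ?S" for z using D(1) that at_within_open[OF that oS] by metis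
 have D2: "continuous_on ?S (%z. D z e)" for e
  by (rule continuous_on_of_basis) (use D D1 has_derivative_linear in blast)+
 define N where "N = {z :: real \<times> (real^'n). fst z \<notin> K}"
 have "N = (- K) \<times> UNIV" by (auto simp: N_def)
 then have oN: "open N" using K(1) by (auto intro!: open_Times simp: compact_imp_closed open_Compl)
 define \<phi>' where "\<phi>' z = (if z \<in> ?S then \<phi> z else 0)" for z
 define D' where "D' z = (if z \<in> ?S then D z else (%_. 0))" for z
 have NS: "N \<union> ?S = UNIV" using K(2) by (auto simp: N_def)
 have \<phi>N: "\<phi>' z = 0" if "z \<in> N" for z using that K(3) by (cases z) (auto simp: \<phi>'_def N_def)
 have dS: "(\<phi>' has_derivative D z) (at z)" if "z \<in> ?S" for z
  by (rule has_derivative_transform_within_open[OF D1[OF that] oS that]) (simp add: \<phi>'_def)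
 have dN: "(\<phi>' has_derivative (%_. 0)) (at z)" if "z \<in> N" for z
  by (rule has_derivative_transform_within_open[OF has_derivative_const oN that]) (simp add: \<phi>N)
 have D'N: "D' z e = 0" if "z \<in> N" for z e
  using has_derivative_unique[OF dS dN[OF that]] by (auto simp: D'_def)
 have "C1per \<phi>' D'"
  unfolding C1per_def
 proof (intro conjI allI)
  show "(\<phi>' has_derivative D' z) (at z)" for z
  proof (cases "z \<in> ?S")
   case False
   then have "z \<in> N" using NS by blast
   then show ?thesis using dN False by (simp add: D'_def)
  qed (use dS in \<open>simp add: D'_def\<close>)
  show "continuous_on UNIV (%z. D' z e)" for e
   unfolding NS[symmetric]
  proof (rule continuous_on_open_Un[OF oN oS])
   show "continuous_on N (%z. D' z e)" by (rule continuous_on_eq[OF continuous_on_const]) (simp add: D'N)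
   show "continuous_on ?S (%z. D' z e)" by (rule continuous_on_eq[OF D2]) (simp add: D'_def)
  qed
  show "tperiodic \<phi>'" using per by (auto simp: tperiodic_def \<phi>'_def periodic_def)
 qed
 moreover have "\<exists>\<alpha> \<beta>. a < \<alpha> \<and> \<beta> < b \<and> K \<subseteq> {\<alpha>..\<beta>}"
 proof (cases "K = {}")
  case True
  then show ?thesis using ab dense[OF ab] by blast
 next
  case False
  obtain \<alpha> where "\<alpha> \<in> K" "\<forall>t\<in>K. \<alpha> <= t" using compact_attains_inf[OF K(1) False] by blast
  moreover obtain \<beta> where "\<beta> \<in> K" "\<forall>t\<in>K. t <= \<beta>" using compact_attains_sup[OF K(1) False] by blast
  ultimately show ?thesis using K(2) by (intro exI[of _ \<alpha>] exI[of _ \<beta>]) auto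
 qed
 then obtain \<alpha> \<beta> where ab': "a < \<alpha>" "\<beta> < b" "K \<subseteq> {\<alpha>..\<beta>}" by blast
 moreover have "\<phi>' (t, x) = 0" if "t \<notin> {\<alpha>..\<beta>}" for t x
 proof -
  have "t \<notin> K" using ab'(3) that by blast
  then show ?thesis by (simp add: \<phi>N N_def)
 qed
 moreover have "\<phi>' z = \<phi> z \<and> D' z e = frechet_derivative \<phi> (at z) e" if "fst z \<in> {a<..<b}" for z e
 proof -
  have "z \<in> ?S" using that by (cases z) auto
  then show ?thesis using frechet_derivative_at[OF D1] by (simp add: \<phi>'_def D'_def)
 qed
 ultimately show ?thesis by blast
qed

section \<open>The running cost and the main theorem\<close>

lemma upward_closed_borel:
 fixes U :: "real set"
 assumes up: "!!x y. x \<in> U ==> x <= y ==> y \<in> U"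
 shows "U \<in> sets borel"
proof (cases "bdd_below U \<and> U \<noteq> {}")
 case True
 have eq: "U = {Inf U<..} \<union> (U \<inter> {Inf U})"
 proof (intro equalityI subsetI)
  fix x assume "x \<in> U"
  then show "x \<in> {Inf U<..} \<union> (U \<inter> {Inf U})" using cInf_lower[of x U] True by (auto simp: le_less)
 next
  fix x assume "x \<in> {Inf U<..} \<union> (U \<inter> {Inf U})"
  then show "x \<in> U" using cInf_less_iff[of U x] True up by (auto intro: less_imp_le)
 qed
 have "U \<inter> {Inf U} \<in> sets borel" by (rule borel_closed[OF finite_imp_closed]) simp
 then show ?thesis by (subst eq) (rule sets.Un, simp_all)
next
 case False
 then have "U = {} \<or> U = UNIV" unfolding bdd_below_def using up by (metis UNIV_eq_I linear)
 then show ?thesis by auto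
qed

text \<open>Monotonicity of \<open>g\<close> makes its real version \<open>\<gamma>\<close> a
  subgradient of the primitive. It is finite because \<open>g s\<close> is at most the increase of
  \<open>G\<close> over the next unit interval. The extension of \<open>g\<close> to the negative
  axis is monotone, hence Borel on the whole line.\<close>

lemma primitive_real:
 fixes g G :: "real => ennreal"
 assumes g: "mono_on {0..} g" and G: "!!s. 0 <= s ==> G s = (\<integral>\<^sup>+r\<in>{0..s}. g r \<partial>lborel)"
  and fin: "!!s. 0 <= s ==> G s < \<infinity>"
 shows "\<exists>H \<gamma> :: real => real. (\<forall>s\<ge>0. G s = ennreal (H s) \<and> 0 <= H s \<and> 0 <= \<gamma> s) \<and> H 0 = 0 \<and>
  (\<forall>s\<ge>0. \<forall>t\<ge>s. \<gamma> s * (t - s) <= H t - H s \<and> H t - H s <= \<gamma> t * (t - s))"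
proof -
 define g' where "g' r = g (max 0 r)" for r
 have mono: "g' r <= g' r'" if "r <= r'" for r r' unfolding g'_def by (rule mono_onD[OF g]) (use that in auto)
 have [measurable]: "g' \<in> borel_fun"
 proof (rule borel_measurableI_greater)
  fix y show "{x \<in> space borel. y < g' x} \<in> sets borel"
   by (rule upward_closed_borel) (use less_le_trans[OF _ mono] in simp)
 qed
 have G': "G s = (\<integral>\<^sup>+r\<in>{0..s}. g' r \<partial>lborel)" if "0 <= s" for s
  unfolding G[OF that] by (intro nn_integral_cong) (auto simp: g'_def indicator_def)
 have split: "G t = G s + (\<integral>\<^sup>+r\<in>{s<..t}. g' r \<partial>lborel)" if "0 <= s" "s <= t" for s t
 proof -
  have "G t = (\<integral>\<^sup>+r. g' r * indicator {0..s} r + g' r * indicator {s<..t} r \<partial>lborel)"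
   using that by (subst G') (auto intro!: nn_integral_cong simp: indicator_def)
  then show ?thesis using that by (simp add: nn_integral_add G')
 qed
 have low: "g' s * ennreal (t - s) <= (\<integral>\<^sup>+r\<in>{s<..t}. g' r \<partial>lborel)" if "s <= t" for s t
 proof -
  have "(\<integral>\<^sup>+r. g' s * indicator {s<..t} r \<partial>lborel) <= (\<integral>\<^sup>+r\<in>{s<..t}. g' r \<partial>lborel)"
   by (intro nn_integral_mono) (auto simp: indicator_def intro: mono)
  then show ?thesis using that by (simp add: nn_integral_cmult_indicator)
 qed
 have upp: "(\<integral>\<^sup>+r\<in>{s<..t}. g' r \<partial>lborel) <= g' t * ennreal (t - s)" if "s <= t" for s t
 proof -
  have "(\<integral>\<^sup>+r\<in>{s<..t}. g' r \<partial>lborel) <= (\<integral>\<^sup>+r. g' t * indicator {s<..t} r \<partial>lborel)"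
   by (intro nn_integral_mono) (auto simp: indicator_def intro: mono)
  then show ?thesis using that by (simp add: nn_integral_cmult_indicator)
 qed
 have gfin: "g' s < top" if "0 <= s" for s
 proof -
  have "g' s * ennreal (s + 1 - s) <= G (s + 1)"
   using split[of s "s + 1"] low[of s "s + 1"] that by (simp add: add_increasing)
  then have "g' s <= G (s + 1)" by simp
  also have "... < top" using fin[of "s + 1"] that by simp
  finally show ?thesis .
 qed
 define H where "H s = enn2real (G s)" for s
 define \<gamma> where "\<gamma> s = enn2real (g' s)" for s
 have H: "G s = ennreal (H s)" "0 <= H s" "0 <= \<gamma> s" "g' s = ennreal (\<gamma> s)" if "0 <= s" for s
  using fin[OF that] gfin[OF that] by (auto simp: H_def \<gamma>_def)
 have "H 0 = 0"
 proof -
  have "(\<integral>\<^sup>+r\<in>{0..0}. g' r \<partial>lborel) = (\<integral>\<^sup>+r\<in>{0::real}. g' 0 \<partial>lborel)" by (intro nn_integral_cong) (auto simp: indicator_def)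
  then show ?thesis by (simp add: H_def G' nn_integral_cmult_indicator)
 qed
 moreover have "\<gamma> s * (t - s) <= H t - H s \<and> H t - H s <= \<gamma> t * (t - s)" if "0 <= s" "s <= t" for s t
 proof -
  have st: "0 <= t" using that by simp
  have "ennreal (H s + \<gamma> s * (t - s)) <= ennreal (H t)"
   using split[OF that] low[OF that(2)] that H[OF that(1)] H(1)[OF st]
   by (simp add: ennreal_mult[symmetric] ennreal_plus[symmetric] add_left_mono del: ennreal_plus)
     (metis add_left_mono ennreal_plus diff_ge_0_iff_ge mult_nonneg_nonneg)
  moreover have "ennreal (H t) <= ennreal (H s + \<gamma> t * (t - s))"
  proof -
   have "G t <= G s + g' t * ennreal (t - s)" unfolding split[OF that] by (intro add_left_mono upp that)
   then show ?thesis using H[OF that(1)] H[OF st] that by (simp add: ennreal_mult[symmetric] ennreal_plus[symmetric] del: ennreal_plus)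
  qed
  moreover have "0 <= \<gamma> t * (t - s)" using H(3)[OF st] that by simp
  ultimately have "H s + \<gamma> s * (t - s) <= H t" "H t <= H s + \<gamma> t * (t - s)"
   using H(2)[OF that(1)] H(2)[OF st] by (simp_all only: ennreal_le_iff add_nonneg_nonneg)
  then show ?thesis by linarith
 qed
 ultimately show ?thesis using H by (intro exI[of _ H] exI[of _ \<gamma>]) auto
qed

text \<open>One finite value spreads: the growth condition with a fixed \<open>a\<close> carries
  finiteness to the points \<open>(1 + a) ^ n * s0\<close>, and monotonicity fills in the
  rest.\<close>

lemma growth_finite:
 fixes G :: "real => ennreal"
 assumes mono: "!!s t. 0 <= s ==> s <= t ==> G s <= G t" and a0: "0 < a0"
  and growth: "!!s a. 0 < s ==> 0 < a ==> a < a0 ==> G ((1 + a) * s) <= ennreal (1 + C0 * a) * G s + ennreal C0"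
  and s0: "0 < s0" "G s0 < \<infinity>" and s: "0 <= s"
 shows "G s < \<infinity>"
proof -
 define a where "a = a0 / 2"
 have a: "0 < a" "a < a0" using a0 by (auto simp: a_def)
 have f: "G ((1 + a) ^ n * s0) < \<infinity>" for n
 proof (induction n)
  case (Suc n)
  have "G ((1 + a) * ((1 + a) ^ n * s0)) <= ennreal (1 + C0 * a) * G ((1 + a) ^ n * s0) + ennreal C0"
   by (rule growth) (use a s0 in auto)
  also have "... < \<infinity>" using Suc by (simp add: ennreal_mult_less_top)
  finally show ?case by (simp add: mult.assoc)
 qed (use s0 in simp)
 obtain n where "s / s0 < (1 + a) ^ n" using real_arch_pow[of "1 + a" "s / s0"] a by auto
 then have "s <= (1 + a) ^ n * s0" using s0 by (simp add: divide_less_eq less_imp_le)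
 then show ?thesis using mono[OF s] f[of n] le_less_trans by blast
qed

text \<open>With \<open>w\<close> the midpoint, the subgradient inequality bounds the conjugate at
  \<open>\<gamma> w\<close> by \<open>w * \<gamma> w - H w\<close>. In the sum of the instances for
  \<open>s\<close> and \<open>t\<close> the linear terms cancel; passing from \<open>J s\<close> to
  \<open>J t\<close> through \<open>Jstar (\<gamma> w)\<close> accounts for the factor in
  \<open>c / 4\<close>.\<close>

lemma convexity_gap:
 fixes H \<gamma> J Jstar :: "real => real"
 assumes G: "!!s. 0 <= s ==> G s = ennreal (H s)" "!!s. 0 <= s ==> 0 <= H s" "!!s. s < 0 ==> G s = \<infinity>"
  and sub: "!!s t. 0 <= s ==> 0 <= t ==> H t + \<gamma> t * (s - t) <= H s"
  and J: "!!s q. enn2ereal (G s) + conjugate_fun G q \<ge> ereal (s * q + c * \<bar>J s - Jstar q\<bar>\<^sup>2)" and c: "0 < c"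
  and s: "0 <= s" "0 <= t"
 shows "c / 4 * (J s - J t)\<^sup>2 <= H s / 2 + H t / 2 - H ((s + t) / 2)"
proof -
 define w where "w = (s + t) / 2"
 have w: "0 <= w" using s by (simp add: w_def)
 have conj: "conjugate_fun G (\<gamma> w) <= ereal (w * \<gamma> w - H w)"
  unfolding conjugate_fun_def
 proof (rule SUP_least)
  fix x :: real
  show "ereal (x * \<gamma> w) - enn2ereal (G x) <= ereal (w * \<gamma> w - H w)"
  proof (cases "0 <= x")
   case True
   then show ?thesis using G sub[OF True w] by (simp add: algebra_simps)
  qed (use G(3) in simp)
 qed
 have k: "c * (J x - Jstar (\<gamma> w))\<^sup>2 <= H x - H w - \<gamma> w * (x - w)" if x: "0 <= x" for x
 proof -
  have "ereal (x * \<gamma> w + c * \<bar>J x - Jstar (\<gamma> w)\<bar>\<^sup>2) <= enn2ereal (G x) + conjugate_fun G (\<gamma> w)" by (rule J)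
  also have "... <= enn2ereal (G x) + ereal (w * \<gamma> w - H w)" by (intro add_left_mono conj)
  finally show ?thesis using G x by (simp add: algebra_simps)
 qed
 have "(J s - J t)\<^sup>2 <= 2 * (J s - Jstar (\<gamma> w))\<^sup>2 + 2 * (J t - Jstar (\<gamma> w))\<^sup>2"
  using zero_le_power2[of "(J s - Jstar (\<gamma> w)) + (J t - Jstar (\<gamma> w))"] by (simp add: power2_eq_square algebra_simps)
 then have "c * (J s - J t)\<^sup>2 <= c * (2 * (J s - Jstar (\<gamma> w))\<^sup>2 + 2 * (J t - Jstar (\<gamma> w))\<^sup>2)" using c by (intro mult_left_mono) auto
 moreover have "\<gamma> w * (s - w) + \<gamma> w * (t - w) = 0" by (simp add: w_def field_simps)
 ultimately show ?thesis using k[OF s(1)] k[OF s(2)] unfolding w_def[symmetric] distrib_left by linarith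
qed

text \<open>For arguments in \<open>{0..K}\<close> the gap is at most
  \<open>\<gamma> K * (t - s)\<close>, so \<open>J\<close> is locally Hoelder continuous with
  exponent 1/2 on nonnegative arguments. This supplies the measurability of
  \<open>J\<close>.\<close>

lemma convexity_gap_continuous:
 fixes H \<gamma> J :: "real => real"
 assumes c: "0 < c" and gap: "!!s t. 0 <= s ==> 0 <= t ==> c / 4 * (J s - J t)\<^sup>2 <= H s / 2 + H t / 2 - H ((s + t) / 2)"
  and H: "!!s t. 0 <= s ==> s <= t ==> \<gamma> s * (t - s) <= H t - H s \<and> H t - H s <= \<gamma> t * (t - s)"
  and \<gamma>: "!!s. 0 <= s ==> 0 <= \<gamma> s"
 shows "continuous_on UNIV (%s. J (max 0 s))"
proof -
 have \<gamma>m: "\<gamma> s <= \<gamma> t" if "0 <= s" "s <= t" for s t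
 proof (cases "s = t")
  case False
  then have "\<gamma> s * (t - s) <= \<gamma> t * (t - s)" using H[OF that] by linarith
  then show ?thesis using False that by simp
 qed simp
 have est: "c / 4 * (J s - J t)\<^sup>2 <= \<gamma> K * (t - s)" if "0 <= s" "s <= t" "t <= K" for s t K
 proof -
  let ?w = "(s + t) / 2"
  have w: "0 <= ?w" "s <= ?w" "?w <= t" using that by auto
  have "H s <= H ?w" using H[OF that(1) w(2)] mult_nonneg_nonneg[OF \<gamma>[OF that(1)], of "?w - s"] w(2) by simp
  moreover have "H t - H ?w <= \<gamma> t * (t - ?w)" using H[OF w(1,3)] by simp
  moreover have "\<gamma> t * (t - ?w) <= \<gamma> K * (t - s)"
   using \<gamma>m[of t K] \<gamma>[of t] that w by (intro mult_mono) auto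
  moreover have "0 <= \<gamma> t * (t - ?w)" using \<gamma>[of t] that w by (intro mult_nonneg_nonneg) auto
  moreover have "c / 4 * (J s - J t)\<^sup>2 <= H s / 2 + H t / 2 - H ?w" by (rule gap) (use that in auto)
  ultimately show ?thesis by linarith
 qed
 have "((%y. J (max 0 y)) \<longlongrightarrow> J (max 0 x)) (at x)" for x
 proof -
  let ?M = "4 / c * \<gamma> (\<bar>x\<bar> + 1)"
  have M: "(J (max 0 y) - J (max 0 x))\<^sup>2 <= ?M * \<bar>y - x\<bar>" if y: "\<bar>y - x\<bar> < 1" for y
  proof -
   have "c / 4 * (J (max 0 y) - J (max 0 x))\<^sup>2 <= \<gamma> (\<bar>x\<bar> + 1) * \<bar>max 0 y - max 0 x\<bar>"
   proof (cases "max 0 y <= max 0 x")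
    case True
    with est[of "max 0 y" "max 0 x" "\<bar>x\<bar> + 1"] show ?thesis by auto
   next
    case False
    then have k: "max 0 x <= max 0 y" "max 0 y <= \<bar>x\<bar> + 1" using y by auto
    then have "\<bar>max 0 y - max 0 x\<bar> = max 0 y - max 0 x" by simp
    then show ?thesis using est[OF _ k] by (simp add: power2_commute)
   qed
   also have "... <= \<gamma> (\<bar>x\<bar> + 1) * \<bar>y - x\<bar>" by (intro mult_left_mono \<gamma>) auto
   finally have "4 / c * (c / 4 * (J (max 0 y) - J (max 0 x))\<^sup>2) <= 4 / c * (\<gamma> (\<bar>x\<bar> + 1) * \<bar>y - x\<bar>)"
    using c by (intro mult_left_mono) auto
   then show ?thesis using c by (simp add: mult.assoc)
  qed
  have "((%y. sqrt (?M * \<bar>y - x\<bar>)) \<longlongrightarrow> sqrt (?M * \<bar>x - x\<bar>)) (at x)" by (intro tendsto_intros)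
  then have l: "((%y. sqrt (?M * \<bar>y - x\<bar>)) \<longlongrightarrow> 0) (at x)" by simp
  have "((%y. J (max 0 y) - J (max 0 x)) \<longlongrightarrow> 0) (at x)"
  proof (rule Lim_null_comparison[OF _ l])
   show "\<forall>\<^sub>F y in at x. norm (J (max 0 y) - J (max 0 x)) <= sqrt (?M * \<bar>y - x\<bar>)"
    unfolding eventually_at using M by (intro exI[of _ 1]) (auto simp: dist_real_def intro!: real_le_rsqrt)
  qed
  then show ?thesis by (simp add: LIM_zero_iff)
 qed
 then show ?thesis by (auto simp: continuous_on_def)
qed

text \<open>The additive constant of the growth condition does not shrink with \<open>a\<close>.
  Interpolating by convexity between \<open>s\<close> and \<open>(1 + b) * s\<close>, with weight
  \<open>l = a / b\<close>, turns it into \<open>C0 * a / b\<close>; hence the constant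
  \<open>C0 + C0 / b\<close>.\<close>

lemma linear_growth:
 fixes H \<gamma> :: "real => real"
 assumes sub: "!!s t. 0 <= s ==> 0 <= t ==> H t + \<gamma> t * (s - t) <= H s" and H: "H 0 = 0" "!!s. 0 <= s ==> 0 <= H s"
  and b: "0 < b" and C0: "0 < C0" and gr: "!!s. 0 < s ==> H ((1 + b) * s) <= (1 + C0 * b) * H s + C0"
  and s: "0 <= s" and a: "0 <= a" "a <= b"
 shows "H ((1 + a) * s) <= H s + (C0 + C0 / b) * a * (H s + 1)"
proof (cases "s = 0")
 case True
 then show ?thesis using H b C0 a by simp
next
 case False
 define l where "l = a / b"
 have l: "0 <= l" "l <= 1" using a b by (auto simp: l_def)
 define u where "u = (1 + a) * s"
 have u: "0 <= u" "0 <= (1 + b) * s" using a b s by (auto simp: u_def)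
 have "(1 - l) * (H u + \<gamma> u * (s - u)) + l * (H u + \<gamma> u * ((1 + b) * s - u)) <= (1 - l) * H s + l * H ((1 + b) * s)"
  by (intro add_mono mult_left_mono sub u s) (use l in auto)
 moreover have "(1 - l) * (H u + \<gamma> u * (s - u)) + l * (H u + \<gamma> u * ((1 + b) * s - u)) = H u"
 proof -
  have "l * b = a" using b by (simp add: l_def)
  have "(1 - l) * (H u + \<gamma> u * (s - u)) + l * (H u + \<gamma> u * ((1 + b) * s - u)) = H u + \<gamma> u * (s + (l * b) * s - u)"
   by (simp add: algebra_simps)
  then show ?thesis unfolding \<open>l * b = a\<close> by (simp add: u_def algebra_simps)
 qed
 ultimately have "H u <= (1 - l) * H s + l * H ((1 + b) * s)" by linarith
 also have "... <= (1 - l) * H s + l * ((1 + C0 * b) * H s + C0)"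
  using gr[of s] s False l by (intro add_left_mono mult_left_mono) auto
 also have "... = H s + a * C0 * H s + a * (C0 / b)" using b by (simp add: l_def field_simps)
 also have "... <= H s + (C0 + C0 / b) * a * (H s + 1)"
 proof -
  have "0 <= a * C0" "0 <= a * (C0 / b) * H s" using a b C0 H(2)[OF s] by auto
  then show ?thesis by (simp add: algebra_simps add_divide_distrib)
 qed
 finally show ?thesis by (simp add: u_def)
qed

theorem theorem5p6:
  fixes T c :: real
    and g G :: "real \<Rightarrow> ennreal"
    and \<Psi> \<rho>0 :: "real ^ 'n \<Rightarrow> real"
    and J Jstar :: "real \<Rightarrow> real"
    and m :: "real \<times> (real ^ 'n) \<Rightarrow> real"
    and v :: "real \<times> (real ^ 'n) \<Rightarrow> real ^ 'n"
  assumes "0 < T"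
    and "mono_on {0..} g"
    and "\<And>s. 0 \<le> s \<Longrightarrow> G s = (\<integral>\<^sup>+r\<in>{0..s}. g r \<partial>lborel)"
    and "\<And>s. s < 0 \<Longrightarrow> G s = \<infinity>"
    and superlinear: "((\<lambda>s. G s / ennreal s) \<longlongrightarrow> \<infinity>) at_top"
    and growth: "\<exists>C0>0. \<exists>a0>0. \<forall>s>0. \<forall>a. 0 < a \<and> a < a0 \<longrightarrow>
        G ((1 + a) * s) \<le> ennreal (1 + C0 * a) * G s + ennreal C0"
    and "torus_density \<rho>0"
    and "torus_C11 \<Psi>"
    and "0 < c"
    and "\<And>s q. enn2ereal (G s) + conjugate_fun G q
                  \<ge> ereal (s * q + c * \<bar>J s - Jstar q\<bar>\<^sup>2)"
    and "is_solution T G \<Psi> \<rho>0 m v"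
  shows "\<forall>t1. 0 < t1 \<and> t1 < T \<longrightarrow> H1_cylinder t1 T (\<lambda>z. J (m z))"
proof -
 note T = assms(1) and gm = assms(2) and Gint = assms(3) and Gneg = assms(4) and c = assms(9) and Jineq = assms(10)
 have \<rho>: "(LINT x|lebesgue_on cell. \<rho>0 x) = 1" using assms(7) by (simp add: torus_density_def)
 obtain p L where \<Psi>: "periodic \<Psi>" and p: "!!x. GDERIV \<Psi> x :> p x" "L-lipschitz_on UNIV p"
  using assms(8) by (auto simp: torus_C11_def)
 have \<Psi>d: "(\<Psi> has_derivative (%h. h \<bullet> p x)) (at x)" for x using p(1) by (simp add: gderiv_def)
 have pc: "continuous_on UNIV p" by (rule lipschitz_on_continuous_on[OF p(2)])
 have adm: "(m, v) \<in> admissible T \<rho>0" and en: "energy T G \<Psi> m v < \<infinity>"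
  and min: "!!m' v'. (m', v') \<in> admissible T \<rho>0 ==> energy T G \<Psi> m v <= energy T G \<Psi> m' v'"
  using assms(11) by (auto simp: is_solution_def)
 have "(\<integral>\<^sup>+z. ennreal (m z * (norm (v z))\<^sup>2) \<partial>cylinder 0 T) \<noteq> \<infinity>" using en by (auto simp: energy_def)
 from admissible_weak_sol[OF adm T this] obtain m' v' where ws: "weak_sol T \<rho>0 m' v'"
  and ae: "AE z in cyl 0 T. m z = m' z \<and> v z = v' z" by blast
 have en': "energy T G \<Psi> m' v' = energy T G \<Psi> m v" by (rule energy_AE_eq[OF ae, symmetric])
 note wd = weak_solD[OF ws]
 define X where "X = (\<integral>\<^sup>+z. ennreal (1/2 * m' z * (norm (v' z))\<^sup>2) + G (m' z) \<partial>cyl 0 T)"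
 have X: "X < \<infinity>"
 proof (rule ccontr)
  assume "\<not> X < \<infinity>"
  then have "X = \<infinity>" by (simp add: not_less top_unique)
  then have "energy T G \<Psi> m' v' = \<infinity>" unfolding energy_def nn_integral_cylinder X_def by simp
  then show False using en en' by simp
 qed
 have Gmono: "G s <= G t" if "0 <= s" "s <= t" for s t
  using that by (simp add: Gint) (intro nn_integral_mono, auto simp: indicator_def)
 \<comment> \<open>If \<open>G\<close> were infinite at all positive densities, finite energy would
   force \<open>m'\<close> to vanish almost everywhere, against mass 1.\<close>
 have "\<exists>s0>0. G s0 < \<infinity>"
 proof (rule ccontr)
  assume "\<not> (\<exists>s0>0. G s0 < \<infinity>)"
  have inf: "G s = \<infinity>" if s: "0 < s" for s
  proof (rule ccontr)
   assume "G s \<noteq> \<infinity>"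
   then have "G s < \<infinity>" by (simp add: less_top)
   then show False using \<open>\<not> (\<exists>s0>0. G s0 < \<infinity>)\<close> s by blast
  qed
  let ?A = "{z. 0 < m' z} \<inter> {0<..<T} \<times> cell"
  have A: "?A \<in> sets (cyl 0 T)"
   unfolding cyl_def using wd(1) by (subst sets_restrict_space_iff) auto
  have "\<infinity> * emeasure (cyl 0 T) ?A = (\<integral>\<^sup>+z. \<infinity> * indicator ?A z \<partial>cyl 0 T)"
   by (rule nn_integral_cmult_indicator[OF A, symmetric])
  also have "... <= X" unfolding X_def by (intro nn_integral_mono) (auto simp: indicator_def inf)
  finally have "emeasure (cyl 0 T) ?A = 0" using X by (cases "emeasure (cyl 0 T) ?A = 0") (auto simp: ennreal_top_mult)
  then have "?A \<in> null_sets (cyl 0 T)" by (rule null_setsI[OF _ A])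
  from AE_not_in[OF this] have "AE z in cyl 0 T. m' z = 0"
   using AE_space by eventually_elim (use wd(5) in \<open>auto simp: less_le\<close>)
  then have "(LINT z|cyl 0 T. m' z) = 0" by (rule integral_eq_zero_AE)
  moreover have "(LINT z|cyl 0 T. m' z) = (LINT t|lborel. indicator {0<..<T} t)"
   unfolding integrable_slice(2)[OF wd(6)]
  proof (rule integral_cong_AE)
   show "(%t. indicator {0<..<T} t * slice m' t) \<in> borel_measurable lborel" using integrable_slice(1)[OF wd(6)] by blast
   show "AE t in lborel. indicator {0<..<T} t * slice m' t = indicator {0<..<T} t"
    using weak_sol_mass[OF ws T \<rho>] by eventually_elim (auto simp: indicator_def)
  qed simp
  ultimately show False using T by simp
 qed
 then obtain s0 where s0: "0 < s0" "G s0 < \<infinity>" by blast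
 obtain C0 a0 where C0: "0 < C0" and a0: "0 < a0" and gr: "!!s a. 0 < s ==> 0 < a ==> a < a0 ==>
   G ((1 + a) * s) <= ennreal (1 + C0 * a) * G s + ennreal C0"
  using growth by blast
 have fin: "G s < \<infinity>" if "0 <= s" for s by (rule growth_finite[OF Gmono a0 gr s0 that])
 obtain H \<gamma> where "\<forall>s\<ge>0. G s = ennreal (H s) \<and> 0 <= H s \<and> 0 <= \<gamma> s" and H0: "H 0 = 0"
  and "\<forall>s\<ge>0. \<forall>t\<ge>s. \<gamma> s * (t - s) <= H t - H s \<and> H t - H s <= \<gamma> t * (t - s)"
  using primitive_real[OF gm Gint fin] by blast
 then have H: "!!s. 0 <= s ==> G s = ennreal (H s)" "!!s. 0 <= s ==> 0 <= H s" "!!s. 0 <= s ==> 0 <= \<gamma> s"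
  and H\<gamma>: "!!s t. 0 <= s ==> s <= t ==> \<gamma> s * (t - s) <= H t - H s \<and> H t - H s <= \<gamma> t * (t - s)" by auto
 have sub: "H t + \<gamma> t * (s - t) <= H s" if "0 <= s" "0 <= t" for s t
 proof (cases "s <= t")
  case True
  then show ?thesis using H\<gamma>[OF that(1) True] by (simp add: right_diff_distrib)
 next
  case False
  then show ?thesis using H\<gamma>[OF that(2), of s] by simp
 qed
 have gap: "c / 4 * (J s - J t)\<^sup>2 <= H s / 2 + H t / 2 - H ((s + t) / 2)" if "0 <= s" "0 <= t" for s t
  by (rule convexity_gap[OF H(1,2) Gneg sub Jineq c that])
 have Hm: "H s <= H t" if "0 <= s" "s <= t" for s t
  using H\<gamma>[OF that] mult_nonneg_nonneg[OF H(3)[OF that(1)], of "t - s"] that by simp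
 \<comment> \<open>The growth condition is strict in \<open>a < a0\<close>, while the locale
   includes its upper bound.\<close>
 define b where "b = a0 / 2"
 have b: "0 < b" "b < a0" using a0 by (auto simp: b_def)
 have grH: "H ((1 + b) * s) <= (1 + C0 * b) * H s + C0" if s: "0 < s" for s
 proof -
  have "ennreal (H ((1 + b) * s)) <= ennreal (1 + C0 * b) * ennreal (H s) + ennreal C0"
   using gr[OF s b] H(1)[of s] H(1)[of "(1 + b) * s"] s b by simp
  also have "... = ennreal ((1 + C0 * b) * H s + C0)"
   using H(2)[of s] s b C0 by (simp add: ennreal_mult ennreal_plus)
  finally show ?thesis using H(2)[of s] s b C0 by (subst (asm) ennreal_le_iff) auto
 qed
 \<comment> \<open>Functions on the whole line with the right values at nonnegative densities;
   freezing \<open>J\<close> on the negative axis makes \<open>J'\<close> continuous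
   everywhere.\<close>
 define H' where "H' s = H (max 0 s)" for s
 define J' where "J' s = J (max 0 s)" for s
 have H'e: "H' s = H s" "J' s = J s" if "0 <= s" for s using that by (auto simp: H'_def J'_def)
 have H'm [measurable]: "H' \<in> borel_fun"
  by (rule borel_measurable_mono) (auto intro!: monoI Hm simp: H'_def)
 have iH: "integrable (cyl 0 T) (%z. H' (m' z))"
 proof (rule integrableI_nonneg)
  show "(%z. H' (m' z)) \<in> borel_measurable (cyl 0 T)" by (rule borel_measurable_cyl) (use wd(1) in measurable)
  show "AE z in cyl 0 T. 0 <= H' (m' z)" using H(2) wd(5) by (simp add: H'e)
  have "(\<integral>\<^sup>+z. ennreal (H' (m' z)) \<partial>cyl 0 T) <= X"
   unfolding X_def by (intro nn_integral_mono) (simp add: H'e wd(5) H(1) add_increasing)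
  then show "(\<integral>\<^sup>+z. ennreal (H' (m' z)) \<partial>cyl 0 T) < \<infinity>" using X by (rule le_less_trans)
 qed
 have GH': "G s = ennreal (H' s)" "0 <= H' s" if "0 <= s" for s using H that by (simp_all add: H'e)
 have Len: "energy T G \<Psi> n w = ereal ((LINT z|cyl 0 T. lagr H' p n w z) + (LINT x|lebesgue_on cell. \<Psi> x * \<rho>0 x))"
  if "weak_sol T \<rho>0 n w" "integrable (cyl 0 T) (%z. H' (n z))" for n w
  by (rule energy_weak_sol[OF that(1) T \<rho> GH' that(2) \<Psi> \<Psi>d pc])
 interpret minimizer T c L \<rho>0 \<Psi> p H' J' m' v' "C0 + C0 / b" b
 proof
  show "norm (p x - p y) <= L * norm (x - y)" for x y using lipschitz_onD[OF p(2), of x y] by (simp add: dist_norm)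
  show "0 <= L" using p(2) by (rule lipschitz_on_nonneg)
  show "H' s <= H' t" if "0 <= s" "s <= t" for s t using Hm[OF that] that by (simp add: H'e)
  show "continuous_on UNIV J'" unfolding J'_def[abs_def] by (rule convexity_gap_continuous[OF c gap H\<gamma> H(3)])
  show "c / 4 * (J' s - J' t)\<^sup>2 <= H' s / 2 + H' t / 2 - H' ((s + t) / 2)" if "0 <= s" "0 <= t" for s t
   using gap[OF that] that by (simp add: H'e)
  show "0 <= C0 + C0 / b" using C0 b by simp
  show "H' ((1 + a) * s) <= H' s + (C0 + C0 / b) * a * (H' s + 1)" if "0 <= s" "0 <= a" "a <= b" for s a
   using linear_growth[OF sub H0 H(2) b(1) C0 grH that] that by (simp add: H'e)
  \<comment> \<open>Both energies contain the same initial cost, so comparing energies amounts to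
    comparing the bulk integrals.\<close>
  fix n w assume n: "weak_sol T \<rho>0 n w" "integrable (cyl 0 T) (%z. H' (n z))"
  have "energy T G \<Psi> m' v' <= energy T G \<Psi> n w" unfolding en' by (rule min[OF weak_sol_admissible[OF n(1) T \<rho>]])
  then show "(LINT z|cyl 0 T. lagr H' p m' v' z) <= (LINT z|cyl 0 T. lagr H' p n w z)"
   unfolding Len[OF ws iH] Len[OF n] by simp
 qed (fact T c \<rho> \<Psi> \<Psi>d H'm GH'(2) b(1) ws iH)+
 show ?thesis
 proof (intro allI impI)
  fix t1 assume t1: "0 < t1 \<and> t1 < T"
  let ?u = "%z. J' (m' z)"
  have ub: "?u \<in> borel_fun" using J_meas wd(1) by measurable
  have up: "tperiodic ?u" using wd(3) by (rule tperiodic_comp)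
  have aeu: "AE z in cyl t1 T. J (m z) = ?u z"
  proof -
   have "AE z in lborel. z \<in> {t1<..<T} \<times> (cell :: (real^'n) set) --> J (m z) = ?u z"
    using ae unfolding AE_cyl_iff by eventually_elim (use t1 wd(5) in \<open>auto simp: H'e\<close>)
   then show ?thesis unfolding AE_cyl_iff .
  qed
  have u2: "integrable (cyl t1 T) (%z. (?u z)\<^sup>2)"
   by (rule integrable_cyl_subset[OF J_square_integrable]) (use t1 in auto)
  have L2u: "L2_fun (cylinder t1 T) (%z. J (m z))"
   unfolding L2_fun_def
  proof
   show "(%z. J (m z)) \<in> borel_measurable (cylinder t1 T)" by (rule cylinder_AE_eq(1)[OF borel_measurable_cyl[OF ub] aeu])
   have "AE z in cyl t1 T. (J (m z))\<^sup>2 = (?u z)\<^sup>2" using aeu by eventually_elim simp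
   from cylinder_AE_eq(2)[OF _ this] u2 show "integrable (cylinder t1 T) (%z. (J (m z))\<^sup>2)" by blast
  qed
  show "H1_cylinder t1 T (%z. J (m z))"
   unfolding H1_cylinder_def
  proof (intro conjI L2u ballI)
   fix e :: "real \<times> (real^'n)" assume e: "e \<in> Basis"
   obtain C h0 where h0: "0 < h0" and est: "!!h. 0 < h ==> h <= h0 ==> integrable (cyl t1 T) (%z. (?u z - ?u (z - h *\<^sub>R e))\<^sup>2) \<and>
     (LINT z|cyl t1 T. (?u z - ?u (z - h *\<^sub>R e))\<^sup>2) <= C * h\<^sup>2"
    using difference_estimate[OF conjunct1[OF t1] conjunct2[OF t1] e] by blast
   obtain W where W: "W \<in> borel_measurable (cyl t1 T)" "integrable (cyl t1 T) (%z. (W z)\<^sup>2)"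
    and weak: "!!\<phi> D \<alpha> \<beta>. C1per \<phi> D ==> t1 < \<alpha> ==> \<beta> < T ==> (\<forall>t x. t \<notin> {\<alpha>..\<beta>} --> \<phi> (t, x) = 0) ==>
     (LINT z|cyl t1 T. ?u z * D z e) = - (LINT z|cyl t1 T. W z * \<phi> z)"
    using weak_derivative_of_differences[OF ub up conjunct2[OF t1] u2 e h0 est] by blast
   have refl: "AE z in cyl t1 T. f z = f z" for f :: "real \<times> (real^'n) => real" by simp
   have L2W: "L2_fun (cylinder t1 T) W"
    unfolding L2_fun_def using cylinder_AE_eq(1)[OF W(1) refl] cylinder_AE_eq(2)[OF _ refl, of "%z. (W z)\<^sup>2"] W by blast
   show "\<exists>w. L2_fun (cylinder t1 T) w \<and> (\<forall>\<phi>. (\<forall>k. test_fun k {t1<..<T} \<phi>) -->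
      (LINT z|cylinder t1 T. J (m z) * frechet_derivative \<phi> (at z) e) = - (LINT z|cylinder t1 T. w z * \<phi> z))"
   proof (intro exI[of _ W] conjI L2W allI impI)
    fix \<phi> :: "real \<times> (real^'n) => real" assume "\<forall>k. test_fun k {t1<..<T} \<phi>"
    then have "test_fun 1 {t1<..<T} \<phi>" by blast
    from test_fun_C1per[OF this conjunct2[OF t1]] obtain \<phi>' D \<alpha> \<beta> where \<phi>': "C1per \<phi>' D" "t1 < \<alpha>" "\<beta> < T"
     "\<forall>t x. t \<notin> {\<alpha>..\<beta>} --> \<phi>' (t, x) = 0"
     "!!z e. fst z \<in> {t1<..<T} ==> \<phi>' z = \<phi> z \<and> D z e = frechet_derivative \<phi> (at z) e" by blast
    have Db: "(%z. D z e) \<in> borel_fun" by (rule borel_measurable_continuous_onI[OF C1perD(2)[OF \<phi>'(1)]])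
    have "(LINT z|cylinder t1 T. J (m z) * frechet_derivative \<phi> (at z) e) = (LINT z|cyl t1 T. ?u z * D z e)"
    proof (rule cylinder_AE_eq(3))
     show "(%z. ?u z * D z e) \<in> borel_measurable (cyl t1 T)" by (rule borel_measurable_cyl) (use ub Db in measurable)
     show "AE z in cyl t1 T. J (m z) * frechet_derivative \<phi> (at z) e = ?u z * D z e"
      using aeu AE_space by eventually_elim (use \<phi>'(5)[of _ e] in auto)
    qed
    also have "... = - (LINT z|cyl t1 T. W z * \<phi>' z)" by (rule weak[OF \<phi>'(1-4)])
    also have "(LINT z|cyl t1 T. W z * \<phi>' z) = (LINT z|cylinder t1 T. W z * \<phi> z)"
    proof (rule cylinder_AE_eq(3)[symmetric])
     show "(%z. W z * \<phi>' z) \<in> borel_measurable (cyl t1 T)"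
      by (intro borel_measurable_times W(1) borel_measurable_cyl C1per_borel[OF \<phi>'(1)])
     show "AE z in cyl t1 T. W z * \<phi> z = W z * \<phi>' z"
      by (rule AE_I2) (use \<phi>'(5) in auto)
    qed
    finally show "(LINT z|cylinder t1 T. J (m z) * frechet_derivative \<phi> (at z) e) = - (LINT z|cylinder t1 T. W z * \<phi> z)" .
   qed
  qed
 qed
qed

end
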